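(* Assume that $\sigma$ is a $C^1$ function on $\mathbb{R}$ and that $\Omega\times\Omega_{\mathrm{TJ}}$ supports the 2-Poincaré–Wirtinger inequality with constant $C_P>0$. Let $f_0\in L^2(\Omega\times\Omega_{\mathrm{TJ}},e^{E/D}\,d\theta\,da)$ be a probability density function. Then, for any $t_0>0$, there exists a constant $C>0$ such that the associated solution $f$ of the Fokker–Planck problem with initial datum $f_0$ satisfies $$\iint_{\Omega\times\Omega_{\mathrm{TJ}}}|f_t(\theta,a,t)|^2\exp\Bigl(\frac{E(\theta,a)}{D}\Bigr)\,d\theta\,da\le C\,e^{-\frac{2\min\{3\gamma,\eta\}D}{C_W}t}$$ for all $t>t_0$, where $C_W=\dfrac{\sup e^{-E/D}}{\inf e^{-E/D}}\,C_P$ (sup and inf over $\Omega\times\Omega_{\mathrm{TJ}}$).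
   Context: $\gamma,\eta,\beta_\theta,\beta_a>0$ are constants satisfying $\frac{6\gamma}{\beta_\theta^2}=\frac{2\eta}{\beta_a^2}$, and $D:=\frac{\beta_\theta^2}{6\gamma}=\frac{\beta_a^2}{2\eta}$. $\theta=(\theta_1,\theta_2,\theta_3)$ (the misorientations) ranges over $\Omega=\{\theta\in(-\frac{\pi}{4},\frac{\pi}{4})^3:\theta_1+\theta_2+\theta_3=0\}\subset\mathbb{R}^3$, with $d\theta$ the 2-dimensional measure on this plane; $a$ (the triple junction) ranges over a bounded domain $\Omega_{\mathrm{TJ}}\subset\mathbb{R}^2$ with $C^2$ boundary. $\nabla^\Omega_\theta,\ \nabla^\Omega_\theta\cdot,\ \Delta^\Omega_\theta$ are the tangential gradient, divergence, Laplacian on the plane of $\Omega$ ($\nabla^\Omega_\theta\phi=(I-\frac13J)(\partial_{\theta_k}\phi)_{k}$, $J$ the all-ones matrix); $\nabla_a,\Delta_a$ are the standard ones; $\nu_\theta,\nu_a$ are outer unit normals to $\partial\Omega$ and $\partial\Omega_{\mathrm{TJ}}$. $E(\theta,a)=\sum_{j=1}^3\sigma(\theta_j)|a-x^{(j)}|$ with $x^{(1)},x^{(2)},x^{(3)}\in\mathbb{R}^2$ fixed. Fokker–Planck problem: $f_t+\nabla^\Omega_\theta\cdot(v_\theta f)+\nabla_a\cdot(v_af)=\frac{\beta_\theta^2}{2}\Delta^\Omega_\theta f+\frac{\beta_a^2}{2}\Delta_af$ in $\Omega\times\Omega_{\mathrm{TJ}}$, $t>0$, with $v_\theta=-3\gamma\nabla^\Omega_\theta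 E$, $v_a=-\eta\nabla_aE$, no-flux conditions $(\frac{\beta_\theta^2}{2}\nabla^\Omega_\theta f-v_\theta f)\cdot\nu_\theta=0$ on $\partial\Omega\times\Omega_{\mathrm{TJ}}$ and $(\frac{\beta_a^2}{2}\nabla_af-v_af)\cdot\nu_a=0$ on $\Omega\times\partial\Omega_{\mathrm{TJ}}$, and $f(\cdot,\cdot,0)=f_0$. The associated solution is $f=g\,e^{-E/D}$, where, with $dm=e^{-E/D}d\theta\,da$, $g$ is the unique function in $C([0,\infty);L^2(dm))\cap C^1((0,\infty);L^2(dm))\cap C((0,\infty);H^2(dm))$ with $g_t=Lg$ for $t>0$, $g(0)=f_0e^{E/D}$; here $Lg=3\gamma D\Delta^\Omega_\theta g+\eta D\Delta_ag-3\gamma\nabla^\Omega_\theta E\cdot\nabla^\Omega_\theta g-\eta\nabla_aE\cdot\nabla_ag$ with domain the $g\in H^2(\Omega\times\Omega_{\mathrm{TJ}},dm)$ with Neumann conditions $\nabla^\Omega_\theta g\cdot\nu_\theta=0$ on $\partial\Omega\times\Omega_{\mathrm{TJ}}$, $\nabla_ag\cdot\nu_a=0$ on $\Omega\times\partial\Omega_{\mathrm{TJ}}$. Probability density: $f_0$ is positive with $\iint f_0\,d\theta\,da=1$. The 2-Poincaré–Wirtinger inequality with constant $C_P$: for all $g\in C^\infty(\Omega\times\Omega_{\mathrm{TJ}})$, $\iint|g-\bar g|^2d\theta\,da\le C_P\iint(|\nabla^\Omega_\theta g|^2+|\nabla_ag|^2)d\theta\,da$, where $\bar g$ is the mean of $g$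 over $\Omega\times\Omega_{\mathrm{TJ}}$ with respect to $d\theta\,da$. *)

theory Defs
  imports "HOL-Analysis.Analysis"
begin

section \<open>Classical derivatives\<close>

fun Ck_on :: "nat \<Rightarrow> 'a::euclidean_space set \<Rightarrow> ('a \<Rightarrow> 'b::real_normed_vector) \<Rightarrow> bool" where
  "Ck_on 0 S f \<longleftrightarrow> continuous_on S f"
| "Ck_on (Suc k) S f \<longleftrightarrow>
     (\<forall>x\<in>S. f differentiable (at x)) \<and>
     (\<forall>b\<in>Basis. Ck_on k S (\<lambda>x. frechet_derivative f (at x) b))"

text \<open>\<open>Ck_on\<close> and \<open>smooth_on\<close> are meant for open sets \<open>S\<close>.\<close>

definition smooth_on :: "'a::euclidean_space set \<Rightarrow> ('a \<Rightarrow> 'b::real_normed_vector) \<Rightarrow> bool" where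
  "smooth_on S f \<longleftrightarrow> (\<forall>k. Ck_on k S f)"


section \<open>Domains, measures and boundaries\<close>

type_synonym state = "(real^3) \<times> (real^2)"

definition mis_plane :: "(real^3) set" where
  "mis_plane = {\<theta>. \<theta>$1 + \<theta>$2 + \<theta>$3 = 0}"

definition mis :: "(real^3) set" where
  "mis = {\<theta>. (\<forall>k. - (pi/4) < \<theta>$k \<and> \<theta>$k < pi/4) \<and> \<theta>$1 + \<theta>$2 + \<theta>$3 = 0}"

text \<open>The boundary is locally, in suitable orthonormal coordinates, the graph of a \<open>C\<^sup>2\<close> function
  with the domain on one side of it.\<close>

definition C2_boundary :: "(real^2) set \<Rightarrow> bool" where
  "C2_boundary S \<longleftrightarrow>
     (\<forall>p\<in>frontier S. \<exists>r>0. \<exists>u n. \<exists>c :: real \<Rightarrow> real.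
        norm u = 1 \<and> norm n = 1 \<and> u \<bullet> n = 0 \<and> Ck_on 2 UNIV c \<and>
        (\<forall>z\<in>ball p r. z \<in> S \<longleftrightarrow> n \<bullet> (z - p) > c (u \<bullet> (z - p))))"

text \<open>The two-dimensional measure on the plane is the image of planar Lebesgue measure under an
  isometric parametrisation.\<close>

definition plane_measure :: "(real^3) measure" where
  "plane_measure =
     distr lborel borel
       (\<lambda>s::real^2. (s$1 / sqrt 2) *\<^sub>R vector [1, -1, 0] + (s$2 / sqrt 6) *\<^sub>R vector [1, 1, -2])"

definition vol :: "(real^2) set \<Rightarrow> state measure" where
  "vol TJ = restrict_space (plane_measure \<Otimes>\<^sub>M lborel) (mis \<times> TJ)"

definition expvol :: "(real^2) set \<Rightarrow> (state \<Rightarrow> real) \<Rightarrow> state measure" where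
  "expvol TJ w = density (vol TJ) (\<lambda>z. ennreal (exp (w z)))"

text \<open>One-dimensional Hausdorff measure, used on the boundary curves.\<close>

definition hausdorff1_outer :: "'a::metric_space set \<Rightarrow> ennreal" where
  "hausdorff1_outer A =
     (SUP \<delta>\<in>{0<..}.
        INF U\<in>{U :: nat \<Rightarrow> 'a set. A \<subseteq> (\<Union>i. U i) \<and> (\<forall>i. bounded (U i) \<and> diameter (U i) \<le> \<delta>)}.
          (\<Sum>i. ennreal (diameter (U i))))"

definition hausdorff1 :: "'a::metric_space measure" where
  "hausdorff1 = measure_of UNIV (sets borel) hausdorff1_outer"

text \<open>Outer unit normal of \<open>S\<close>, an open subset of the linear subspace \<open>V\<close>, at a boundary point
  \<open>p\<close>: the blow-up of \<open>S\<close> at \<open>p\<close> is the half space \<open>{h \<in> V. h \<bullet> \<nu> < 0}\<close>. It is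
  unique where it exists; at the six corners of the hexagon \<open>mis\<close>, which form a null set of its
  boundary, it does not exist.\<close>

definition is_outer_normal :: "'a::euclidean_space set \<Rightarrow> 'a set \<Rightarrow> 'a \<Rightarrow> 'a \<Rightarrow> bool" where
  "is_outer_normal V S p \<nu> \<longleftrightarrow>
     \<nu> \<in> V \<and> norm \<nu> = 1 \<and>
     (\<forall>\<epsilon>>0. \<exists>r>0. \<forall>h\<in>V. norm h < r \<longrightarrow>
        (h \<bullet> \<nu> < - \<epsilon> * norm h \<longrightarrow> p + h \<in> S) \<and> (h \<bullet> \<nu> > \<epsilon> * norm h \<longrightarrow> p + h \<notin> S))"

definition outer_normal :: "'a::euclidean_space set \<Rightarrow> 'a set \<Rightarrow> 'a \<Rightarrow> 'a" where
  "outer_normal V S p = (THE \<nu>. is_outer_normal V S p \<nu>)"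


section \<open>Tangential gradients\<close>

text \<open>Functions on \<open>mis \<times> TJ\<close> are represented by functions on the ambient space. On
  \<open>mis \<times> TJ\<close>, the tangential derivatives below depend only on the restriction to
  \<open>mis_plane \<times> UNIV\<close>.\<close>

definition tproj :: "real^3^3" where
  "tproj = mat 1 - (1/3) *\<^sub>R (\<chi> i j. 1)"

definition grad_th :: "(state \<Rightarrow> real) \<Rightarrow> state \<Rightarrow> real^3" where
  "grad_th \<phi> z = tproj *v (\<chi> k. frechet_derivative \<phi> (at z) (axis k 1, 0))"

definition grad_a :: "(state \<Rightarrow> real) \<Rightarrow> state \<Rightarrow> real^2" where
  "grad_a \<phi> z = (\<chi> i. frechet_derivative \<phi> (at z) (0, axis i 1))"

text \<open>As \<open>tproj\<close> is symmetric, the \<open>k\<close>-th component of \<open>grad_th \<phi>\<close> is the directional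
  derivative of \<open>\<phi>\<close> along \<open>dir_th k\<close>.\<close>

definition dir_th :: "3 \<Rightarrow> state" where
  "dir_th k = (tproj *v axis k 1, 0)"

definition dir_a :: "2 \<Rightarrow> state" where
  "dir_a i = (0, axis i 1)"

definition dirs :: "state set" where
  "dirs = range dir_th \<union> range dir_a"


section \<open>Weighted Lebesgue and Sobolev spaces\<close>

text \<open>Elements of \<open>L\<^sup>2\<close> are represented by functions; equality is equality almost everywhere.\<close>

definition L2 :: "'a measure \<Rightarrow> ('a \<Rightarrow> real) set" where
  "L2 M = {f \<in> borel_measurable M. integrable M (\<lambda>z. (f z)\<^sup>2)}"

definition L2norm :: "'a measure \<Rightarrow> ('a \<Rightarrow> real) \<Rightarrow> real" where
  "L2norm M f = sqrt (\<integral>z. (f z)\<^sup>2 \<partial>M)"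

definition loc_integrable :: "(real^2) set \<Rightarrow> (state \<Rightarrow> real) \<Rightarrow> bool" where
  "loc_integrable TJ g \<longleftrightarrow>
     g \<in> borel_measurable (vol TJ) \<and>
     (\<forall>K. compact K \<and> K \<subseteq> mis \<times> TJ \<longrightarrow> set_integrable (vol TJ) K g)"

text \<open>The restrictions of these functions to \<open>mis \<times> TJ\<close> are exactly the functions in
  \<open>C\<^sub>c\<^sup>\<infinity>(mis \<times> TJ)\<close> (extend constantly in the direction normal to the plane).\<close>

definition test_function :: "(real^2) set \<Rightarrow> (state \<Rightarrow> real) \<Rightarrow> bool" where
  "test_function TJ \<phi> \<longleftrightarrow>
     smooth_on UNIV \<phi> \<and>
     (\<exists>K. compact K \<and> K \<subseteq> mis \<times> TJ \<and> (\<forall>z \<in> mis \<times> TJ - K. \<phi> z = 0))"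

text \<open>Weak directional derivative along a direction \<open>v\<close> tangent to \<open>mis \<times> TJ\<close>.\<close>

definition has_weak_deriv :: "(real^2) set \<Rightarrow> state \<Rightarrow> (state \<Rightarrow> real) \<Rightarrow> (state \<Rightarrow> real) \<Rightarrow> bool" where
  "has_weak_deriv TJ v g h \<longleftrightarrow>
     loc_integrable TJ g \<and> loc_integrable TJ h \<and>
     (\<forall>\<phi>. test_function TJ \<phi> \<longrightarrow>
        (\<integral>z. g z * frechet_derivative \<phi> (at z) v \<partial>vol TJ) = - (\<integral>z. h z * \<phi> z \<partial>vol TJ))"

definition weak_deriv :: "(real^2) set \<Rightarrow> state \<Rightarrow> (state \<Rightarrow> real) \<Rightarrow> state \<Rightarrow> real" where
  "weak_deriv TJ v g = (SOME h. has_weak_deriv TJ v g h)"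

text \<open>\<open>M\<close> is \<open>vol TJ\<close> with a weight; weak derivatives are always taken with respect to
  \<open>vol TJ\<close>.\<close>

definition H2 :: "state measure \<Rightarrow> (real^2) set \<Rightarrow> (state \<Rightarrow> real) set" where
  "H2 M TJ =
     {g \<in> L2 M. \<forall>v\<in>dirs. \<exists>h\<in>L2 M. has_weak_deriv TJ v g h \<and>
                  (\<forall>w\<in>dirs. \<exists>k\<in>L2 M. has_weak_deriv TJ w h k)}"

definition H2norm :: "state measure \<Rightarrow> (real^2) set \<Rightarrow> (state \<Rightarrow> real) \<Rightarrow> real" where
  "H2norm M TJ g =
     sqrt ((L2norm M g)\<^sup>2 + (\<Sum>v\<in>dirs. (L2norm M (weak_deriv TJ v g))\<^sup>2)
           + (\<Sum>v\<in>dirs. \<Sum>w\<in>dirs. (L2norm M (weak_deriv TJ w (weak_deriv TJ v g)))\<^sup>2))"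

definition wgrad_th :: "(real^2) set \<Rightarrow> (state \<Rightarrow> real) \<Rightarrow> state \<Rightarrow> real^3" where
  "wgrad_th TJ g z = (\<chi> k. weak_deriv TJ (dir_th k) g z)"

definition wgrad_a :: "(real^2) set \<Rightarrow> (state \<Rightarrow> real) \<Rightarrow> state \<Rightarrow> real^2" where
  "wgrad_a TJ g z = (\<chi> i. weak_deriv TJ (dir_a i) g z)"

definition wlap_th :: "(real^2) set \<Rightarrow> (state \<Rightarrow> real) \<Rightarrow> state \<Rightarrow> real" where
  "wlap_th TJ g z = (\<Sum>k\<in>UNIV. weak_deriv TJ (dir_th k) (weak_deriv TJ (dir_th k) g) z)"

definition wlap_a :: "(real^2) set \<Rightarrow> (state \<Rightarrow> real) \<Rightarrow> state \<Rightarrow> real" where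
  "wlap_a TJ g z = (\<Sum>i\<in>UNIV. weak_deriv TJ (dir_a i) (weak_deriv TJ (dir_a i) g) z)"


section \<open>Normal derivatives on the boundary in the sense of traces\<close>

text \<open>\<open>\<tau>\<close> is the trace of \<open>\<nabla>g \<bullet> \<nu>\<close>, i.e. the value at \<open>g\<close> of the continuous extension to
  \<open>H\<^sup>2\<close> of the map \<open>\<phi> \<mapsto> \<nabla>\<phi> \<bullet> \<nu>\<close>, which is defined for functions \<open>\<phi>\<close> smooth up to the
  boundary and takes values in \<open>L\<^sup>2\<close> of the respective part of the boundary.\<close>

definition has_normal_trace_th ::
  "state measure \<Rightarrow> (real^2) set \<Rightarrow> (state \<Rightarrow> real) \<Rightarrow> (state \<Rightarrow> real) \<Rightarrow> bool" where
  "has_normal_trace_th M TJ g \<tau> \<longleftrightarrow>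
     (\<exists>\<phi> :: nat \<Rightarrow> state \<Rightarrow> real.
        (\<forall>n. smooth_on UNIV (\<phi> n)) \<and>
        (\<lambda>n. H2norm M TJ (\<lambda>z. \<phi> n z - g z)) \<longlonglongrightarrow> 0 \<and>
        (\<lambda>n. \<integral>\<^sup>+a\<in>TJ. (\<integral>\<^sup>+\<theta>\<in>rel_frontier mis.
               ennreal ((grad_th (\<phi> n) (\<theta>, a) \<bullet> outer_normal mis_plane mis \<theta> - \<tau> (\<theta>, a))\<^sup>2)
             \<partial>hausdorff1) \<partial>lborel) \<longlonglongrightarrow> 0)"

definition has_normal_trace_a ::
  "state measure \<Rightarrow> (real^2) set \<Rightarrow> (state \<Rightarrow> real) \<Rightarrow> (state \<Rightarrow> real) \<Rightarrow> bool" where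
  "has_normal_trace_a M TJ g \<tau> \<longleftrightarrow>
     (\<exists>\<phi> :: nat \<Rightarrow> state \<Rightarrow> real.
        (\<forall>n. smooth_on UNIV (\<phi> n)) \<and>
        (\<lambda>n. H2norm M TJ (\<lambda>z. \<phi> n z - g z)) \<longlonglongrightarrow> 0 \<and>
        (\<lambda>n. \<integral>\<^sup>+\<theta>\<in>mis. (\<integral>\<^sup>+a\<in>frontier TJ.
               ennreal ((grad_a (\<phi> n) (\<theta>, a) \<bullet> outer_normal UNIV TJ a - \<tau> (\<theta>, a))\<^sup>2)
             \<partial>hausdorff1) \<partial>plane_measure) \<longlonglongrightarrow> 0)"


section \<open>The evolution problem\<close>

definition energy :: "(real \<Rightarrow> real) \<Rightarrow> (3 \<Rightarrow> real^2) \<Rightarrow> state \<Rightarrow> real" where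
  "energy \<sigma> x = (\<lambda>(\<theta>, a). \<Sum>j\<in>UNIV. \<sigma> (\<theta>$j) * norm (a - x j))"

text \<open>The gradients of \<open>E = energy \<sigma> x\<close> exist classically except where \<open>a\<close> is one of the three
  points \<open>x j\<close>, which is a null set.\<close>

definition generator ::
  "real \<Rightarrow> real \<Rightarrow> real \<Rightarrow> (state \<Rightarrow> real) \<Rightarrow> (real^2) set \<Rightarrow> (state \<Rightarrow> real) \<Rightarrow> state \<Rightarrow> real" where
  "generator \<gamma> \<eta> D E TJ g z =
     3 * \<gamma> * D * wlap_th TJ g z + \<eta> * D * wlap_a TJ g z
     - 3 * \<gamma> * (grad_th E z \<bullet> wgrad_th TJ g z) - \<eta> * (grad_a E z \<bullet> wgrad_a TJ g z)"

definition generator_dom :: "state measure \<Rightarrow> (real^2) set \<Rightarrow> (state \<Rightarrow> real) set" where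
  "generator_dom M TJ =
     {g \<in> H2 M TJ. has_normal_trace_th M TJ g (\<lambda>_. 0) \<and> has_normal_trace_a M TJ g (\<lambda>_. 0)}"

definition cont_L2_on :: "real set \<Rightarrow> 'a measure \<Rightarrow> (real \<Rightarrow> 'a \<Rightarrow> real) \<Rightarrow> bool" where
  "cont_L2_on T M g \<longleftrightarrow>
     (\<forall>t\<in>T. g t \<in> L2 M \<and> ((\<lambda>s. L2norm M (\<lambda>z. g s z - g t z)) \<longlongrightarrow> 0) (at t within T))"

definition cont_H2_on :: "real set \<Rightarrow> state measure \<Rightarrow> (real^2) set \<Rightarrow> (real \<Rightarrow> state \<Rightarrow> real) \<Rightarrow> bool" where
  "cont_H2_on T M TJ g \<longleftrightarrow>
     (\<forall>t\<in>T. g t \<in> H2 M TJ \<and> ((\<lambda>s. H2norm M TJ (\<lambda>z. g s z - g t z)) \<longlongrightarrow> 0) (at t within T))"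

text \<open>\<open>h\<close> is the time derivative at \<open>t\<close> of the curve \<open>g\<close> in \<open>L\<^sup>2(M)\<close>.\<close>

definition has_L2_deriv :: "'a measure \<Rightarrow> (real \<Rightarrow> 'a \<Rightarrow> real) \<Rightarrow> ('a \<Rightarrow> real) \<Rightarrow> real \<Rightarrow> bool" where
  "has_L2_deriv M g h t \<longleftrightarrow>
     h \<in> L2 M \<and> g t \<in> L2 M \<and> (\<forall>\<^sub>F s in at t. g s \<in> L2 M) \<and>
     ((\<lambda>s. L2norm M (\<lambda>z. (g s z - g t z) / (s - t) - h z)) \<longlongrightarrow> 0) (at t)"

text \<open>\<open>f = g exp (- E / D)\<close>, where \<open>g\<close> solves the Cauchy problem for the generator with initial
  datum \<open>f\<^sub>0 exp (E / D)\<close>.\<close>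

definition associated_solution ::
  "real \<Rightarrow> real \<Rightarrow> real \<Rightarrow> (state \<Rightarrow> real) \<Rightarrow> (real^2) set \<Rightarrow> (state \<Rightarrow> real) \<Rightarrow> (real \<Rightarrow> state \<Rightarrow> real) \<Rightarrow> bool" where
  "associated_solution \<gamma> \<eta> D E TJ f\<^sub>0 f \<longleftrightarrow>
     (let dm = expvol TJ (\<lambda>z. - E z / D) in
      \<exists>g g'. cont_L2_on {0..} dm g \<and>
        (\<forall>t>0. has_L2_deriv dm g (g' t) t) \<and> cont_L2_on {0<..} dm g' \<and>
        cont_H2_on {0<..} dm TJ g \<and>
        (\<forall>t>0. g t \<in> generator_dom dm TJ \<and> (AE z in dm. g' t z = generator \<gamma> \<eta> D E TJ (g t) z)) \<and>
        (AE z in dm. g 0 z = f\<^sub>0 z * exp (E z / D)) \<and>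
        (\<forall>t\<ge>0. \<forall>z \<in> mis \<times> TJ. f t z = g t z * exp (- E z / D)))"


section \<open>The Poincare--Wirtinger inequality\<close>

text \<open>A smooth function on \<open>mis \<times> TJ\<close> is one that extends smoothly to an ambient open
  neighbourhood; integrability makes the mean value meaningful, and both sides of the inequality
  may be infinite.\<close>

definition mean :: "(real^2) set \<Rightarrow> (state \<Rightarrow> real) \<Rightarrow> real" where
  "mean TJ g = (\<integral>z. g z \<partial>vol TJ) / measure (vol TJ) (mis \<times> TJ)"

definition poincare_wirtinger :: "(real^2) set \<Rightarrow> real \<Rightarrow> bool" where
  "poincare_wirtinger TJ C \<longleftrightarrow>
     (\<forall>W g. open W \<and> mis \<times> TJ \<subseteq> W \<and> smooth_on W g \<and> integrable (vol TJ) g \<longrightarrow>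
        (\<integral>\<^sup>+z. ennreal ((g z - mean TJ g)\<^sup>2) \<partial>vol TJ)
          \<le> ennreal C * (\<integral>\<^sup>+z. ennreal ((norm (grad_th g z))\<^sup>2 + (norm (grad_a g z))\<^sup>2) \<partial>vol TJ))"

end

theory Submission
  imports Defs
begin

text \<open>Put \<open>w = exp (- E / D)\<close> and \<open>dm = w dvol\<close>, so that the solution is \<open>f = g w\<close> with \<open>g' = L g\<close>, and
  \<open>L\<close> is symmetric and dissipative in \<open>L\<^sup>2(dm)\<close>: integrating by parts with the Neumann conditions gives
  \<open>\<integral> \<psi> L g dm = - D (3 \<gamma> \<integral> \<nabla>\<^sub>\<theta>g \<bullet> \<nabla>\<^sub>\<theta>\<psi> dm + \<eta> \<integral> \<nabla>\<^sub>ag \<bullet> \<nabla>\<^sub>a\<psi> dm)\<close>.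
  With \<open>\<psi> = 1\<close> the mean of \<open>g\<close> is constant in time. Hence \<open>u = g(s) - g(t)\<close> has mean zero, and the
  Poincare--Wirtinger inequality, transferred to \<open>dm\<close> at the cost of the factor \<open>sup w / inf w\<close>, yields
  \<open>\<integral> u L u dm \<le> - r \<integral> u\<^sup>2 dm\<close> with \<open>r = min (3 \<gamma>) \<eta> D / C\<^sub>W\<close>. So \<open>exp (2 r t) \<integral> (g(t + h) - g(t))\<^sup>2 dm\<close> is
  nonincreasing in \<open>t\<close>; dividing by \<open>h\<^sup>2\<close> and letting \<open>h\<close> tend to \<open>0\<close>, so is \<open>exp (2 r t) \<integral> (g')\<^sup>2 dm\<close>.

  The Neumann conditions are given through smooth \<open>\<phi> n\<close> that converge to \<open>g\<close> in \<open>H\<^sup>2\<close> and whose normal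
  derivatives tend to \<open>0\<close> in \<open>L\<^sup>2\<close> of the boundary for \<open>\<H>\<^sup>1\<close>. It therefore suffices to bound
  \<open>(\<integral> div (w \<psi> \<nabla>\<phi>) dvol)\<^sup>2\<close> by a multiple of \<open>\<integral> (\<nabla>\<phi> \<bullet> \<nu>)\<^sup>2 d\<H>\<^sup>1\<close> for smooth \<open>\<phi>\<close>. This needs the divergence
  theorem only with the coordinate parameters of the boundary curves, and \<open>\<H>\<^sup>1\<close> dominates Lebesgue
  measure of the parameter because orthogonal projections do not increase diameters; the area formula
  is not needed.\<close>

section \<open>Smooth functions and bump functions\<close>

text \<open>Increments \<open>g(s) - g(t)\<close> stand in for \<open>g'\<close> because only
  \<open>g\<close> is known to lie in the generator domain and to be differentiable in time;
  \<open>g'\<close> is merely continuous in \<open>L2\<close>. The two Neumann conditions come with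
  separate approximating sequences, so the angular and the spatial integration by parts are carried
  out independently and meet only in the limit. The weight is the other obstacle: \<open>E\<close>
  contains \<open>norm (a - x j)\<close>, so \<open>w\<close> may have kinks at the points
  \<open>x j\<close>, and the planar divergence theorem has to admit a multiplier whose gradient is
  locally bounded but undefined on a finite set. The weight is kept in the multiplier
  \<open>w * \<psi>\<close> and not in the vector field, so that the boundary integral contains
  nothing but the normal derivative of \<open>\<phi>\<close>. Finally, \<open>hausdorff1\<close> is
  built by \<open>measure_of\<close>, which yields the zero measure unless the set function is
  countably additive on the Borel sets; hence the Caratheodory argument.\<close>

abbreviation ddir :: "'a::euclidean_space \<Rightarrow> ('a \<Rightarrow> 'b::real_normed_vector) \<Rightarrow> 'a \<Rightarrow> 'b" where
  "ddir v f \<equiv> (\<lambda>z. frechet_derivative f (at z) v)"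

lemma ddir_eq: "(f has_derivative f') (at z) \<Longrightarrow> ddir v f z = f' v"
  using frechet_derivative_at by metis

text \<open>\<open>Ck_on (Suc k)\<close> does not mention \<open>Ck_on k\<close>; the two levels
  meet only at the bottom of the recursion, where differentiability gives continuity.\<close>

lemma Ck_on_Suc_imp: "Ck_on (Suc k) S f \<Longrightarrow> Ck_on k S f"
proof (induction k arbitrary: f)
  case 0
  then show ?case by (auto intro!: continuous_at_imp_continuous_on differentiable_imp_continuous_within)
next
  case (Suc k)
  then show ?case by (metis Ck_on.simps(2))
qed

lemma Ck_on_const: "Ck_on k UNIV (\<lambda>_. c)"
proof (induction k arbitrary: c)
  case (Suc k)
  have "frechet_derivative (\<lambda>_. c) (at x) b = 0" for x b :: 'a
    by (simp add: frechet_derivative_const)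
  then show ?case using Suc by simp
qed auto

lemma Ck_on_add:
  "Ck_on k UNIV f \<Longrightarrow> Ck_on k UNIV g \<Longrightarrow> Ck_on k UNIV (\<lambda>x. f x + g x)"
proof (induction k arbitrary: f g)
  case (Suc k)
  have "ddir b (\<lambda>x. f x + g x) = (\<lambda>z. ddir b f z + ddir b g z)" for b
    using Suc.prems by (auto intro!: ext ddir_eq derivative_intros simp: frechet_derivative_works)
  then show ?case using Suc by simp
qed (auto intro: continuous_intros)

lemma Ck_on_bounded_linear:
  assumes "bounded_linear L"
  shows "Ck_on k UNIV f \<Longrightarrow> Ck_on k UNIV (\<lambda>x. L (f x))"
proof (induction k arbitrary: f)
  case 0
  then show ?case using bounded_linear.continuous_on[OF assms] by auto
next
  case (Suc k)
  have *: "((\<lambda>x. L (f x)) has_derivative (\<lambda>h. L (frechet_derivative f (at z) h))) (at z)" for z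
    using Suc.prems bounded_linear.has_derivative[OF assms] by (auto simp: frechet_derivative_works)
  have "ddir b (\<lambda>x. L (f x)) = (\<lambda>z. L (ddir b f z))" for b
    by (rule ext, rule ddir_eq[OF *])
  then show ?case using Suc * by (auto simp: differentiable_def)
qed

lemma Ck_on_mult:
  fixes f g :: "'a::euclidean_space \<Rightarrow> real"
  shows "Ck_on k UNIV f \<Longrightarrow> Ck_on k UNIV g \<Longrightarrow> Ck_on k UNIV (\<lambda>x. f x * g x)"
proof (induction k arbitrary: f g)
  case (Suc k)
  have *: "((\<lambda>x. f x * g x) has_derivative
      (\<lambda>h. f z * frechet_derivative g (at z) h + frechet_derivative f (at z) h * g z)) (at z)" for z
    using Suc.prems by (auto intro!: derivative_intros simp: frechet_derivative_works)
  have "ddir b (\<lambda>x. f x * g x) = (\<lambda>z. f z * ddir b g z + ddir b f z * g z)" for b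
    by (rule ext, rule ddir_eq[OF *])
  moreover have "(\<lambda>x. f x * g x) differentiable at z" for z
    using * differentiable_def by blast
  moreover have "Ck_on k UNIV (\<lambda>z. f z * ddir b g z + ddir b f z * g z)" if "b \<in> Basis" for b
    using Suc that Ck_on_Suc_imp[OF Suc.prems(1)] Ck_on_Suc_imp[OF Suc.prems(2)]
    by (intro Ck_on_add Suc.IH) auto
  ultimately show ?case by simp
qed (auto intro: continuous_intros)

text \<open>The bump functions are products of one-variable profiles composed with linear
  functionals. The derivative along \<open>i\<close> is again such a composition, times the constant
  \<open>i \<bullet> b\<close>, which closes the induction.\<close>

lemma Ck_on_inner:
  fixes f :: "real \<Rightarrow> real"
  shows "Ck_on k UNIV f \<Longrightarrow> Ck_on k UNIV (\<lambda>x. f (x \<bullet> b))"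
proof (induction k arbitrary: f)
  case 0
  then show ?case
    by (auto intro!: continuous_on_compose2[of UNIV f] continuous_intros)
next
  case (Suc k)
  have "(f has_derivative frechet_derivative f (at t)) (at t)" for t
    using Suc.prems by (auto simp: frechet_derivative_works)
  then have *: "((\<lambda>x. f (x \<bullet> b)) has_derivative (\<lambda>h. frechet_derivative f (at (z \<bullet> b)) (h \<bullet> b))) (at z)" for z
    by (rule has_derivative_compose[rotated]) (auto intro!: derivative_eq_intros)
  have lin: "frechet_derivative f (at t) r = r * frechet_derivative f (at t) 1" for t r
    using Suc.prems linear_cmul[OF linear_frechet_derivative[of f "at t"], of r 1] by simp
  have "ddir i (\<lambda>x. f (x \<bullet> b)) = (\<lambda>z. (i \<bullet> b) * ddir 1 f (z \<bullet> b))" for i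
    by (rule ext, subst ddir_eq[OF *], rule lin)
  moreover have "\<exists>D. ((\<lambda>x. f (x \<bullet> b)) has_derivative D) (at z)" for z using * by blast
  moreover have "Ck_on k UNIV (\<lambda>z. (i \<bullet> b) * ddir 1 f (z \<bullet> b))" for i
    by (rule Ck_on_bounded_linear[OF bounded_linear_mult_right Suc.IH]) (use Suc.prems in auto)
  ultimately show ?case by (simp add: differentiable_def)
qed

lemma Ck_on_sum:
  "finite I \<Longrightarrow> (\<And>i. i \<in> I \<Longrightarrow> Ck_on k UNIV (f i)) \<Longrightarrow> Ck_on k UNIV (\<lambda>x. \<Sum>i\<in>I. f i x)"
  by (induction I rule: finite_induct) (auto intro!: Ck_on_add Ck_on_const)

lemma Ck_on_prod:
  fixes f :: "'i \<Rightarrow> 'a::euclidean_space \<Rightarrow> real"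
  shows "finite I \<Longrightarrow> (\<And>i. i \<in> I \<Longrightarrow> Ck_on k UNIV (f i)) \<Longrightarrow> Ck_on k UNIV (\<lambda>x. \<Prod>i\<in>I. f i x)"
  by (induction I rule: finite_induct) (auto intro!: Ck_on_mult Ck_on_const)

lemma Ck_on_affine_real:
  fixes f :: "real \<Rightarrow> real"
  shows "Ck_on k UNIV f \<Longrightarrow> Ck_on k UNIV (\<lambda>x. f (m * x + c))"
proof (induction k arbitrary: f)
  case 0
  then show ?case
    by (auto intro!: continuous_on_compose2[of UNIV f] continuous_intros)
next
  case (Suc k)
  have "(f has_derivative frechet_derivative f (at t)) (at t)" for t
    using Suc.prems by (auto simp: frechet_derivative_works)
  then have *: "((\<lambda>x. f (m * x + c)) has_derivative (\<lambda>h. frechet_derivative f (at (m * z + c)) (m * h))) (at z)" for z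
    by (rule has_derivative_compose[rotated]) (auto intro!: derivative_eq_intros)
  have lin: "frechet_derivative f (at t) r = r * frechet_derivative f (at t) 1" for t r
    using Suc.prems linear_cmul[OF linear_frechet_derivative[of f "at t"], of r 1] by simp
  have "ddir 1 (\<lambda>x. f (m * x + c)) = (\<lambda>z. m * ddir 1 f (m * z + c))"
    by (rule ext, subst ddir_eq[OF *], subst lin) simp
  moreover have "\<exists>D. ((\<lambda>x. f (m * x + c)) has_derivative D) (at z)" for z using * by blast
  moreover have "Ck_on k UNIV (\<lambda>z. m * ddir 1 f (m * z + c))"
    by (rule Ck_on_bounded_linear[OF bounded_linear_mult_right Suc.IH]) (use Suc.prems in auto)
  ultimately show ?case by (simp add: differentiable_def)
qed

lemma smooth_const: "smooth_on UNIV (\<lambda>_. c)"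
  by (simp add: smooth_on_def Ck_on_const)

lemma smooth_diff: "smooth_on UNIV f \<Longrightarrow> smooth_on UNIV g \<Longrightarrow> smooth_on UNIV (\<lambda>x. f x - g x)"
  using Ck_on_add[of _ f "\<lambda>x. - g x"] Ck_on_bounded_linear[OF bounded_linear_minus[OF bounded_linear_ident], of _ g]
  by (simp add: smooth_on_def)

lemma smooth_continuous: "smooth_on UNIV f \<Longrightarrow> continuous_on UNIV f"
  unfolding smooth_on_def using Ck_on.simps(1) by blast

lemma smooth_has_derivative:
  "smooth_on UNIV f \<Longrightarrow> (f has_derivative (\<lambda>h. ddir h f z)) (at z)"
  unfolding smooth_on_def by (drule spec[of _ 1]) (auto simp: frechet_derivative_works)

lemma ddir_expand:
  fixes f :: "'a::euclidean_space \<Rightarrow> 'b::real_normed_vector"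
  assumes "f differentiable at z"
  shows "ddir v f z = (\<Sum>b\<in>Basis. (v \<bullet> b) *\<^sub>R ddir b f z)"
proof -
  have "linear (frechet_derivative f (at z))"
    by (rule linear_frechet_derivative[OF assms])
  then show ?thesis
    using linear_sum[of "frechet_derivative f (at z)" "\<lambda>b. (v \<bullet> b) *\<^sub>R b" Basis]
    by (simp add: euclidean_representation linear_cmul)
qed

text \<open>\<open>Ck_on\<close> speaks of derivatives along \<open>Basis\<close> only, whereas the
  tangential directions \<open>dir_th k\<close> are not basis vectors; linearity writes any
  directional derivative as a combination of partial ones.\<close>

lemma smooth_ddir:
  assumes "smooth_on UNIV f"
  shows "smooth_on UNIV (ddir v f)"
proof -
  have d: "f differentiable at z" for z
    using smooth_has_derivative[OF assms] differentiable_def by blast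
  have "ddir v f = (\<lambda>z. \<Sum>b\<in>Basis. (v \<bullet> b) *\<^sub>R ddir b f z)"
    by (rule ext, rule ddir_expand[OF d])
  moreover have "Ck_on k UNIV (ddir b f)" if "b \<in> Basis" for b k
    using assms that unfolding smooth_on_def by (metis Ck_on.simps(2))
  ultimately show ?thesis unfolding smooth_on_def
    by (auto intro!: Ck_on_sum Ck_on_bounded_linear[OF bounded_linear_scaleR_right])
qed

section \<open>A flat function and smooth bumps supported in boxes\<close>

definition expbump :: "real \<Rightarrow> real" where
  "expbump x = (if x > 0 then exp (- 1 / x) else 0)"

text \<open>With \<open>y = 1 / x\<close> this is the fact that the exponential outgrows every
  polynomial at infinity.\<close>

lemma expbump_poly_limit:
  fixes p :: "real poly"
  shows "((\<lambda>x. poly p (1 / x) * exp (- 1 / x)) \<longlongrightarrow> 0) (at_right 0)"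
proof -
  have "((\<lambda>y. poly p y * exp (- y)) \<longlongrightarrow> 0) at_top"
  proof -
    have "((\<lambda>y. \<Sum>i\<le>degree p. coeff p i * (y ^ i / exp y)) \<longlongrightarrow> (\<Sum>i\<le>degree p. coeff p i * 0)) at_top"
      by (intro tendsto_sum tendsto_mult tendsto_const tendsto_power_div_exp_0)
    moreover have "(\<Sum>i\<le>degree p. coeff p i * (y ^ i / exp y)) = poly p y * exp (- y)" for y
      by (simp only: poly_altdef sum_distrib_right exp_minus divide_inverse mult.assoc)
    ultimately show ?thesis by simp
  qed
  moreover have "filterlim (\<lambda>x::real. 1 / x) at_top (at_right 0)"
    using filterlim_inverse_at_top_right by (simp add: inverse_eq_divide)
  ultimately have "((\<lambda>x. poly p (1 / x) * exp (- (1 / x))) \<longlongrightarrow> 0) (at_right 0)"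
    by (rule filterlim_compose)
  then show ?thesis by simp
qed

text \<open>The functions \<open>p(1/x) exp(-1/x)\<close>, extended by zero, are closed under
  differentiation, which yields all derivatives of \<open>expbump\<close> at once. Differentiating
  \<open>p(1/x)\<close> produces \<open>- p'(1/x) / x^2\<close> and differentiating the exponential
  produces the factor \<open>1 / x^2\<close>, hence
  \<open>q(y) = y^2 (p(y) - p'(y))\<close>.\<close>

lemma expbump_poly_deriv:
  fixes p :: "real poly"
  defines "q \<equiv> monom 1 2 * (p - pderiv p)"
  shows "((\<lambda>x. poly p (1 / x) * expbump x) has_derivative (\<lambda>h. h * (poly q (1 / x) * expbump x))) (at x)"
proof -
  have "((\<lambda>x. poly p (1 / x) * expbump x) has_field_derivative (poly q (1 / x) * expbump x)) (at x)"
  proof (cases "x = 0")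
    case False
    show ?thesis
    proof (cases "x > 0")
      case True
      have "((\<lambda>x. poly p (1 / x) * exp (- 1 / x)) has_field_derivative (poly q (1 / x) * exp (- 1/x))) (at x)"
        using True unfolding q_def
        by (auto intro!: derivative_eq_intros DERIV_chain2[OF poly_DERIV] simp: poly_monom field_simps power2_eq_square)
      then have "((\<lambda>x. poly p (1 / x) * expbump x) has_field_derivative (poly q (1 / x) * exp (- 1/x))) (at x)"
        by (rule has_field_derivative_transform_within_open[of _ _ _ "{0<..}"])
          (use True in \<open>auto simp: expbump_def\<close>)
      then show ?thesis using True by (simp add: expbump_def)
    next
      case f: False
      have "((\<lambda>x. 0) has_field_derivative 0) (at x)" by simp
      then have "((\<lambda>x. poly p (1 / x) * expbump x) has_field_derivative 0) (at x)"
        by (rule has_field_derivative_transform_within_open[of _ _ _ "{..<0}"])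
          (use f False in \<open>auto simp: expbump_def\<close>)
      then show ?thesis using f False by (simp add: expbump_def)
    qed
  next
    case True
    have r: "((\<lambda>y. (poly p (1 / y) * expbump y) / y) \<longlongrightarrow> 0) (at_right 0)"
    proof -
      \<comment> \<open>Division by the variable multiplies the polynomial in its reciprocal by one
        more factor, so the right-hand difference quotient at zero is again of the form covered by
        the limit lemma.\<close>
      have "((\<lambda>x. poly (monom 1 1 * p) (1 / x) * exp (- 1 / x)) \<longlongrightarrow> 0) (at_right 0)"
        by (rule expbump_poly_limit)
      then show ?thesis
        by (rule Lim_transform_eventually)
          (auto simp: eventually_at_right_field poly_monom expbump_def intro!: exI[of _ 1])
    qed
    have l: "((\<lambda>y. (poly p (1 / y) * expbump y) / y) \<longlongrightarrow> 0) (at_left 0)"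
      by (rule Lim_transform_eventually[OF tendsto_const])
        (auto simp: eventually_at_left_field expbump_def intro!: exI[of _ "-1"])
    have "((\<lambda>y. (poly p (1 / y) * expbump y) / y) \<longlongrightarrow> 0) (at 0)"
      using l r by (simp add: filterlim_split_at)
    then show ?thesis using True
      by (simp add: has_field_derivative_iff expbump_def)
  qed
  then show ?thesis by (simp add: has_field_derivative_def mult.commute[of _ "poly _ _ * _"])
qed

lemma expbump_poly_Ck: "Ck_on k UNIV (\<lambda>x. poly p (1 / x) * expbump x)"
proof (induction k arbitrary: p)
  case 0
  show ?case
    using has_derivative_continuous[OF expbump_poly_deriv[of p]] by (simp add: continuous_at_imp_continuous_on)
next
  case (Suc k)
  have "ddir 1 (\<lambda>x. poly p (1 / x) * expbump x) =
     (\<lambda>x. poly (monom 1 2 * (p - pderiv p)) (1 / x) * expbump x)"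
    by (rule ext, subst ddir_eq[OF expbump_poly_deriv]) simp
  moreover have "(\<lambda>x. poly p (1 / x) * expbump x) differentiable at x" for x
    using expbump_poly_deriv differentiable_def by blast
  ultimately show ?case
    using Suc[of "monom 1 2 * (p - pderiv p)"] by (simp del: poly_mult poly_diff)
qed

lemma expbump_Ck: "Ck_on k UNIV expbump"
  using expbump_poly_Ck[of k 1] by simp

lemma expbump_bounds: "0 \<le> expbump x" "expbump x \<le> 1"
  by (auto simp: expbump_def)

lemma expbump_tendsto: "(\<lambda>n. expbump (real n * x)) \<longlonglongrightarrow> (if x > 0 then 1 else 0)"
proof (cases "x > 0")
  case True
  have "(\<lambda>n. exp (- (1 / x) * (1 / real n))) \<longlonglongrightarrow> exp (- (1 / x) * 0)"
    by (intro tendsto_intros lim_1_over_n)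
  then have "(\<lambda>n. expbump (real n * x)) \<longlonglongrightarrow> exp (- (1 / x) * 0)"
    by (rule Lim_transform_eventually)
      (use True in \<open>auto simp: expbump_def mult.commute intro!: eventually_mono[OF eventually_gt_at_top[of 0]]\<close>)
  then show ?thesis using True by simp
next
  case False
  then have "expbump (real n * x) = 0" for n
    by (auto simp: expbump_def zero_less_mult_iff)
  then show ?thesis using False by simp
qed

text \<open>Scaling the argument by \<open>n\<close> sharpens \<open>expbump\<close> to a step, so
  these smooth functions lie between zero and the indicator of the open box and converge to it
  pointwise. Dominated convergence then replaces test functions by indicators of boxes.\<close>

definition boxbump :: "nat \<Rightarrow> 'a::euclidean_space \<Rightarrow> 'a \<Rightarrow> 'a \<Rightarrow> real" where
  "boxbump n l u z =
     (\<Prod>b\<in>Basis. expbump (real n * (z \<bullet> b - l \<bullet> b)) * expbump (real n * (u \<bullet> b - z \<bullet> b)))"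

lemma boxbump_smooth: "smooth_on UNIV (boxbump n l u)"
proof -
  have "Ck_on k UNIV (\<lambda>z. expbump (real n * (z \<bullet> b - l \<bullet> b)) * expbump (real n * (u \<bullet> b - z \<bullet> b)))"
    for k and b :: 'a
  proof -
    have "Ck_on k UNIV (\<lambda>x. expbump (real n * x + (- real n * (l \<bullet> b))) * expbump ((- real n) * x + real n * (u \<bullet> b)))"
      by (intro Ck_on_mult Ck_on_affine_real expbump_Ck)
    then have "Ck_on k UNIV (\<lambda>x. expbump (real n * (x - l \<bullet> b)) * expbump (real n * (u \<bullet> b - x)))"
      by (simp add: algebra_simps)
    then show ?thesis by (rule Ck_on_inner)
  qed
  then show ?thesis unfolding smooth_on_def boxbump_def[abs_def] by (auto intro!: Ck_on_prod)
qed

lemma boxbump_bounds: "0 \<le> boxbump n l u z" "boxbump n l u z \<le> 1"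
  unfolding boxbump_def
  by (auto intro!: prod_nonneg prod_le_1 mult_nonneg_nonneg mult_le_one expbump_bounds)

lemma boxbump_zero: "z \<notin> box l u \<Longrightarrow> boxbump n l u z = 0"
proof -
  assume "z \<notin> box l u"
  then obtain b where "b \<in> Basis" "z \<bullet> b \<le> l \<bullet> b \<or> u \<bullet> b \<le> z \<bullet> b"
    by (auto simp: mem_box not_less)
  then show ?thesis
    unfolding boxbump_def
    by (intro prod_zero bexI[of _ b]) (auto simp: expbump_def zero_less_mult_iff)
qed

lemma boxbump_tendsto: "(\<lambda>n. boxbump n l u z) \<longlonglongrightarrow> indicator (box l u) z"
proof -
  have "(\<lambda>n. boxbump n l u z) \<longlonglongrightarrow>
    (\<Prod>b\<in>Basis. (if z \<bullet> b - l \<bullet> b > 0 then 1 else 0) * (if u \<bullet> b - z \<bullet> b > 0 then 1 else 0))"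
    unfolding boxbump_def by (intro tendsto_prod tendsto_mult expbump_tendsto)
  also have "(\<Prod>b\<in>Basis. (if z \<bullet> b - l \<bullet> b > 0 then 1 else 0) * (if u \<bullet> b - z \<bullet> b > 0 then 1 else 0)) = (indicator (box l u) z :: real)"
    by (auto simp: indicator_def mem_box intro!: prod.neutral)
  finally show ?thesis .
qed

section \<open>Coordinates on the state space\<close>

declare borel_prod [simp]

lemma sets_borel_prod [simp]:
  "sets (borel \<Otimes>\<^sub>M borel) = sets (borel :: ('a::second_countable_topology \<times> 'b::second_countable_topology) measure)"
  by (simp only: borel_prod)

lemma Basis_2: "(Basis :: (real^2) set) = {axis 1 1, axis 2 1}"
  by (auto simp: Basis_vec_def UNIV_2)

lemma axis_2_neq: "(axis 1 1 :: real^2) \<noteq> axis 2 1"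
  by (simp add: axis_eq_axis)

lemma linear_2_measurable [measurable]: "(\<lambda>(s, y). p + s *\<^sub>R u + y *\<^sub>R v) \<in> borel_measurable borel"
  for u :: "'a::euclidean_space"
  by (intro borel_measurable_continuous_onI) (auto intro!: continuous_intros simp: case_prod_unfold)

text \<open>Connects Lebesgue measure on vectors with Lebesgue measure on pairs, where iterated
  integration takes place.\<close>

lemma lborel_vec2: "(lborel :: (real^2) measure) = distr lborel borel (\<lambda>(s, y). s *\<^sub>R axis 1 1 + y *\<^sub>R axis 2 1)"
proof (rule lborel_eqI)
  fix l u :: "real^2"
  assume lu: "\<And>b. b \<in> Basis \<Longrightarrow> l \<bullet> b \<le> u \<bullet> b"
  have [measurable]: "(\<lambda>(s, y). s *\<^sub>R axis 1 1 + y *\<^sub>R axis 2 1 :: real^2) \<in> borel_measurable borel"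
    using linear_2_measurable[of 0] by simp
  have "(\<lambda>(s, y). s *\<^sub>R axis 1 1 + y *\<^sub>R axis 2 1) -` box l u = box (l$1, l$2) (u$1, u$2)"
    by (auto simp: mem_box Basis_2 Basis_prod_def inner_axis) (auto simp: axis_def)
  moreover have "l$1 \<le> u$1" "l$2 \<le> u$2"
    using lu[of "axis 1 1"] lu[of "axis 2 1"] by (auto simp: Basis_2 inner_axis)
  ultimately show "emeasure (distr lborel borel (\<lambda>(s, y). s *\<^sub>R axis 1 1 + y *\<^sub>R axis 2 1)) (box l u) =
      ennreal (\<Prod>b\<in>Basis. (u - l) \<bullet> b)"
    apply (subst emeasure_distr)
    by (auto simp: Basis_2 inner_axis axis_2_neq emeasure_lborel_box_eq Basis_prod_def ennreal_mult'' mult.commute)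
qed simp

text \<open>The planar change of variables with Jacobian \<open>\<delta>\<close>; on boxes it is the
  determinant formula for linear images. It is applied with \<open>\<delta> = sqrt 3\<close> to the
  skew coordinates of the misorientation plane and with \<open>\<delta> = 1\<close> to orthonormal
  frames.\<close>

lemma lborel_lin_param:
  fixes u v p :: "real^2"
  assumes d: "\<delta> = \<bar>u$1 * v$2 - u$2 * v$1\<bar>" "\<delta> \<noteq> 0"
  shows "(lborel :: (real^2) measure) = distr (density lborel (\<lambda>_. ennreal \<delta>)) borel (\<lambda>(s, y). p + s *\<^sub>R u + y *\<^sub>R v)"
    (is "_ = distr ?D borel ?T")
proof (rule lborel_eqI)
  define f where "f = (\<lambda>z::real^2. z$1 *\<^sub>R u + z$2 *\<^sub>R v)"
  have lin: "linear f"
    unfolding f_def by (auto intro!: linearI simp: algebra_simps)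
  have det: "\<bar>det (matrix f)\<bar> = \<delta>"
    by (simp add: det_2 matrix_def f_def axis_def d algebra_simps)
  have inj: "inj f"
    using det_nz_iff_inj[OF lin] det d by auto
  have surj: "surj f" using inj lin linear_injective_imp_surjective by blast
  fix a b :: "real^2"
  assume ab: "\<And>i. i \<in> Basis \<Longrightarrow> a \<bullet> i \<le> b \<bullet> i"
  have [measurable]: "(\<lambda>(s, y). s *\<^sub>R axis 1 1 + y *\<^sub>R axis 2 1 :: real^2) \<in> borel_measurable borel"
    using linear_2_measurable[of 0] by simp
  define A where "A = box (a - p) (b - p)"
  have A: "A \<in> sets borel" "bounded A" by (auto simp: A_def bounded_box)
  have contf: "continuous_on UNIV f" using lin linear_continuous_on linear_conv_bounded_linear by blast
  have op: "open (f -` A)"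
    using continuous_open_vimage[of A f] contf by (auto simp: A_def continuous_on_eq_continuous_at)
  obtain B where B: "B > 0" "\<And>x. norm x \<le> B * norm (f x)"
    using linear_inj_bounded_below_pos[OF lin inj]
    by (metis (no_types) divide_inverse_commute inverse_positive_iff_positive mult.commute pos_le_divide_eq inverse_inverse_eq)
  \<comment> \<open>An injective linear map is bounded below, so preimages of bounded sets are
    bounded. This gives the finite measure that the determinant formula demands.\<close>
  have bd: "bounded (f -` A)"
  proof -
    obtain K where "\<And>x. x \<in> A \<Longrightarrow> norm x \<le> K" using A bounded_iff by blast
    then show ?thesis
      by (intro boundedI[of _ "B * K"]) (metis B mult_left_mono order_trans less_imp_le vimage_eq)
  qed
  have lm: "f -` A \<in> lmeasurable" using op bd lmeasurable_open by blast
  have "measure lebesgue A = \<delta> * measure lebesgue (f -` A)"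
    using measure_linear_image[OF lin lm] det surj by (simp add: surj_image_vimage_eq)
  then have m: "measure lborel A = \<delta> * measure lborel (f -` A)"
    using A op by simp
  have "?T -` box a b = (\<lambda>(s, y). s *\<^sub>R axis 1 1 + y *\<^sub>R axis 2 1) -` (f -` A)"
    by (auto simp: A_def f_def mem_box algebra_simps axis_def less_diff_eq)
  then have "emeasure (distr ?D borel ?T) (box a b) = \<delta> * emeasure lborel ((\<lambda>(s, y). s *\<^sub>R axis 1 1 + y *\<^sub>R axis 2 1) -` (f -` A))"
    apply (subst emeasure_distr)
      apply simp
     apply simp
    apply simp
    apply (subst emeasure_density_const)
    using measurable_sets_borel[OF \<open>_ \<in> borel_measurable borel\<close>, of "f -` A"] op by auto
  also have "\<dots> = \<delta> * emeasure lborel (f -` A)"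
    using op emeasure_distr[of "\<lambda>(s, y). s *\<^sub>R axis 1 1 + y *\<^sub>R axis 2 1" lborel borel "f -` A"]
    by (simp flip: lborel_vec2)
  also have "\<dots> = \<delta> * ennreal (measure lborel (f -` A))"
    using emeasure_eq_ennreal_measure[of lborel "f -` A"] emeasure_bounded_finite[OF bd]
    by (simp add: less_top)
  also have "\<dots> = ennreal (measure lborel A)"
    using m d by (simp add: ennreal_mult)
  also have "\<dots> = ennreal (\<Prod>i\<in>Basis. (b - a) \<bullet> i)"
    using ab by (simp add: A_def measure_lborel_box_eq algebra_simps)
  finally show "emeasure (distr ?D borel ?T) (box a b) = ennreal (\<Prod>i\<in>Basis. (b - a) \<bullet> i)" .
qed simp

section \<open>Linear charts of the misorientation plane and of the state space\<close>

definition hexpar :: "real \<times> real \<Rightarrow> real^3" where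
  "hexpar = (\<lambda>(p, q). vector [p, q, - p - q])"

lemma hexpar_nth [simp]:
  "hexpar z $ 1 = fst z" "hexpar z $ 2 = snd z" "hexpar z $ 3 = - fst z - snd z"
  by (auto simp: hexpar_def case_prod_unfold)

lemma hexpar_linear: "bounded_linear hexpar"
  by (rule linear_conv_bounded_linear[THEN iffD1], rule linearI)
    (auto simp: vec_eq_iff forall_3 algebra_simps)

lemma hexpar_measurable [measurable]: "hexpar \<in> borel_measurable borel"
  using hexpar_linear by (intro borel_measurable_continuous_onI linear_continuous_on)

text \<open>\<open>hexpar\<close> uses the first two angles as coordinates: it is not isometric, but
  in it the six sides of the hexagon become lines on which \<open>p\<close>, \<open>q\<close> or
  \<open>p + q\<close> is constant. The price is the constant density \<open>sqrt 3\<close>, the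
  area of the parallelogram spanned by \<open>(1, 0, -1)\<close> and
  \<open>(0, 1, -1)\<close>.\<close>

lemma plane_measure_hexpar:
  "plane_measure = distr (density lborel (\<lambda>_. ennreal (sqrt 3))) borel hexpar"
proof -
  \<comment> \<open>The vectors \<open>(1, 0, -1)\<close> and \<open>(0, 1, -1)\<close> expressed in
    the orthonormal frame that defines \<open>plane_measure\<close>; the frame map sends
    \<open>s u + y v\<close> to \<open>hexpar (s, y)\<close>.\<close>
  define u v :: "real^2" where "u = vector [1 / sqrt 2, 3 / sqrt 6]" and "v = vector [- 1 / sqrt 2, 3 / sqrt 6]"
  have s12: "sqrt 2 * sqrt 6 = 2 * sqrt 3"
    by (simp flip: real_sqrt_mult) (simp add: real_sqrt_mult[of 4 3, simplified])
  have "\<bar>u$1 * v$2 - u$2 * v$1\<bar> = 6 / (sqrt 2 * sqrt 6)"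
    by (simp add: u_def v_def field_simps)
  also have "\<dots> = sqrt 3"
    unfolding s12 by (simp add: field_simps)
  finally have d: "sqrt 3 = \<bar>u$1 * v$2 - u$2 * v$1\<bar>" by simp
  have [measurable]: "(\<lambda>s::real^2. (s$1 / sqrt 2) *\<^sub>R vector [1, -1, 0] + (s$2 / sqrt 6) *\<^sub>R vector [1, 1, -2]::real^3)
     \<in> borel_measurable borel"
    by (intro borel_measurable_continuous_onI continuous_intros) auto
  have [measurable]: "(\<lambda>(s, y). s *\<^sub>R u + y *\<^sub>R v) \<in> borel_measurable borel"
    using linear_2_measurable[of 0 u v] by simp
  have "plane_measure = distr (distr (density lborel (\<lambda>_. ennreal (sqrt 3))) borel (\<lambda>(s, y). 0 + s *\<^sub>R u + y *\<^sub>R v)) borel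
       (\<lambda>s::real^2. (s$1 / sqrt 2) *\<^sub>R vector [1, -1, 0] + (s$2 / sqrt 6) *\<^sub>R vector [1, 1, -2])"
    unfolding plane_measure_def using lborel_lin_param[OF d, of 0] by simp
  also have "\<dots> = distr (density lborel (\<lambda>_. ennreal (sqrt 3))) borel
     ((\<lambda>s::real^2. (s$1 / sqrt 2) *\<^sub>R vector [1, -1, 0] + (s$2 / sqrt 6) *\<^sub>R vector [1, 1, -2]) \<circ> (\<lambda>(s, y). 0 + s *\<^sub>R u + y *\<^sub>R v))"
    by (rule distr_distr) simp_all
  also have "((\<lambda>s::real^2. (s$1 / sqrt 2) *\<^sub>R vector [1, -1, 0] + (s$2 / sqrt 6) *\<^sub>R vector [1, 1, -2]) \<circ> (\<lambda>(s, y). 0 + s *\<^sub>R u + y *\<^sub>R v)) = hexpar"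
    by (rule ext) (auto simp: hexpar_def u_def v_def vec_eq_iff forall_3 field_simps)
  finally show ?thesis .
qed

lemma sets_plane_measure [measurable_cong, simp]: "sets plane_measure = sets borel"
  by (simp add: plane_measure_def)

lemma space_plane_measure [simp]: "space plane_measure = UNIV"
  by (simp add: plane_measure_def)

lemma emeasure_plane_bounded:
  assumes "bounded A"
  shows "emeasure plane_measure A < \<infinity>"
proof (cases "A \<in> sets borel")
  case True
  obtain K where K: "\<And>x. x \<in> A \<Longrightarrow> norm x \<le> K" using assms bounded_iff by blast
  have "hexpar -` A \<subseteq> cbox (- K, - K) (K, K)"
  proof
    fix z assume "z \<in> hexpar -` A"
    then have "norm (hexpar z) \<le> K" using K by auto
    then have "\<bar>hexpar z $ 1\<bar> \<le> K" "\<bar>hexpar z $ 2\<bar> \<le> K"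
      using component_le_norm_cart order_trans by blast+
    then show "z \<in> cbox (- K, - K) (K, K)"
      by (cases z) (auto simp: mem_box Basis_prod_def)
  qed
  then have "bounded (hexpar -` A)" using bounded_cbox bounded_subset by blast
  moreover have "hexpar -` A \<in> sets borel"
    using True hexpar_measurable measurable_sets_borel by blast
  ultimately show ?thesis
    unfolding plane_measure_hexpar using True
    using emeasure_bounded_finite[of "hexpar -` A"]
    by (simp add: emeasure_distr emeasure_density_const ennreal_mult_less_top)
qed (simp add: emeasure_notin_sets)

lemma sigma_finite_plane: "sigma_finite_measure plane_measure"
proof
  show "\<exists>A. countable A \<and> A \<subseteq> sets plane_measure \<and> \<Union> A = space plane_measure \<and> (\<forall>a\<in>A. emeasure plane_measure a \<noteq> \<infinity>)"
  proof (intro exI conjI)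
    show "countable (range (\<lambda>n. cball (0::real^3) (real n)))" by simp
    show "\<Union> (range (\<lambda>n. cball (0::real^3) (real n))) = space plane_measure"
      using real_arch_simple by (auto simp: dist_norm)
    show "\<forall>a\<in>range (\<lambda>n. cball 0 (real n)). emeasure plane_measure a \<noteq> \<infinity>"
      using emeasure_plane_bounded[OF bounded_cball] by (auto simp: less_top)
  qed auto
qed

text \<open>A global linear chart of \<open>mis_plane \<times> UNIV\<close>: through it, statements
  about \<open>vol TJ\<close> become statements about Lebesgue measure on an open subset of a
  four-dimensional Euclidean space.\<close>

definition statepar :: "(real \<times> real) \<times> (real^2) \<Rightarrow> state" where
  "statepar = (\<lambda>(z, a). (hexpar z, a))"

lemma statepar_linear: "bounded_linear statepar"
proof -
  have "statepar = (\<lambda>w. (hexpar (fst w), snd w))" by (auto simp: statepar_def)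
  then show ?thesis
    using bounded_linear_Pair[OF bounded_linear_compose[OF hexpar_linear bounded_linear_fst] bounded_linear_snd]
    by metis
qed

lemma statepar_measurable [measurable]: "statepar \<in> borel_measurable borel"
  using statepar_linear by (intro borel_measurable_continuous_onI linear_continuous_on)

lemma plane_pair_statepar:
  "plane_measure \<Otimes>\<^sub>M lborel = distr (density lborel (\<lambda>_. ennreal (sqrt 3))) borel statepar"
proof -
  have "plane_measure \<Otimes>\<^sub>M lborel = distr (density lborel (\<lambda>_. ennreal (sqrt 3))) borel hexpar \<Otimes>\<^sub>M distr (lborel::(real^2) measure) borel (\<lambda>x. x)"
    by (simp add: plane_measure_hexpar distr_id2)
  also have "\<dots> = distr (density lborel (\<lambda>_. ennreal (sqrt 3)) \<Otimes>\<^sub>M lborel) (borel \<Otimes>\<^sub>M borel) (\<lambda>(x, y). (hexpar x, y))"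
    by (rule pair_measure_distr) (simp_all add: distr_id2 lborel.sigma_finite_measure_axioms)
  also have "density lborel (\<lambda>_. ennreal (sqrt 3)) \<Otimes>\<^sub>M (lborel::(real^2) measure) = density (lborel \<Otimes>\<^sub>M lborel) (\<lambda>(x, y). ennreal (sqrt 3) * 1)"
    using pair_measure_density[of "\<lambda>_. ennreal (sqrt 3)" lborel "\<lambda>_. 1" "lborel::(real^2) measure"]
    by (simp add: density_1 lborel.sigma_finite_measure_axioms)
  finally show ?thesis
    by (simp add: lborel_prod borel_prod statepar_def case_prod_unfold)
qed

lemma mis_subset_plane: "mis \<subseteq> mis_plane"
  by (auto simp: mis_def mis_plane_def)

lemma hexpar_plane: "\<theta> \<in> mis_plane \<Longrightarrow> hexpar (\<theta>$1, \<theta>$2) = \<theta>"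
  by (auto simp: mis_plane_def vec_eq_iff forall_3)

lemma mis_borel [measurable]: "mis \<in> sets borel"
proof -
  have eq: "mis = {\<theta>. (\<forall>k. - (pi/4) < \<theta>$k \<and> \<theta>$k < pi/4)} \<inter> {\<theta>. \<theta>$1 + \<theta>$2 + \<theta>$3 = 0}"
    by (auto simp: mis_def)
  have op: "open {\<theta>::real^3. \<forall>k. - (pi/4) < \<theta>$k \<and> \<theta>$k < pi/4}"
  proof -
    have "{\<theta>::real^3. \<forall>k. - (pi/4) < \<theta>$k \<and> \<theta>$k < pi/4} = (\<Inter>k. {\<theta>. - (pi/4) < \<theta>$k} \<inter> {\<theta>. \<theta>$k < pi/4})" by auto
    then show ?thesis
      by (simp only:) (intro open_INT open_Int ballI finite open_halfspace_component_lt_cart open_halfspace_component_gt_cart)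
  qed
  have cl: "closed {\<theta>::real^3. \<theta>$1 + \<theta>$2 + \<theta>$3 = 0}"
    by (intro closed_Collect_eq continuous_intros)
  show ?thesis
    unfolding eq by (rule sets.Int[OF borel_open[OF op] borel_closed[OF cl]])
qed

lemma bounded_mis: "bounded mis"
proof (rule boundedI)
  fix \<theta> :: "real^3" assume "\<theta> \<in> mis"
  then have "- (pi/4) < \<theta>$k" "\<theta>$k < pi/4" for k by (auto simp: mis_def)
  then have "\<bar>\<theta>$k\<bar> \<le> pi/4" for k by (metis abs_le_iff less_imp_le minus_le_iff)
  then have "(\<Sum>k\<in>UNIV. \<bar>\<theta>$k\<bar>) \<le> (\<Sum>k\<in>(UNIV::3 set). pi/4)" by (intro sum_mono) auto
  then show "norm \<theta> \<le> 3 * (pi/4)" using norm_le_l1_cart[of \<theta>] by simp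
qed

lemma zero_in_mis: "0 \<in> mis" by (auto simp: mis_def)

lemma state_borel [measurable]: "open (TJ :: (real^2) set) \<Longrightarrow> mis \<times> TJ \<in> sets borel"
  using pair_measureI[of mis "borel :: (real^3) measure" TJ borel] by simp

section \<open>Integration over the state space\<close>

lemma borel_measurable_vol:
  fixes F :: "state \<Rightarrow> real"
  assumes "open TJ"
  shows "F \<in> borel_measurable (vol TJ) \<longleftrightarrow> (\<lambda>z. indicator (mis \<times> TJ) z * F z) \<in> borel_measurable borel"
proof -
  have "borel_measurable (plane_measure \<Otimes>\<^sub>M (lborel :: (real^2) measure)) = (borel_measurable borel :: (state \<Rightarrow> real) set)"
    by (rule measurable_cong_sets) simp_all
  moreover have "F \<in> borel_measurable (restrict_space (plane_measure \<Otimes>\<^sub>M lborel) (mis \<times> TJ)) \<longleftrightarrow>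
      (\<lambda>x. indicator (mis \<times> TJ) x *\<^sub>R F x) \<in> borel_measurable (plane_measure \<Otimes>\<^sub>M lborel)"
    by (rule borel_measurable_restrict_space_iff) (use state_borel[OF assms] in \<open>auto simp: space_pair_measure\<close>)
  ultimately show ?thesis unfolding vol_def by (simp only: real_scaleR_def)
qed

lemma integral_vol:
  fixes F :: "state \<Rightarrow> real"
  assumes "open TJ"
  shows "(\<integral>z. F z \<partial>vol TJ) = (\<integral>z. indicator (mis \<times> TJ) z * F z \<partial>(plane_measure \<Otimes>\<^sub>M lborel))"
  unfolding vol_def
  by (subst integral_restrict_space) (use state_borel[OF assms] in \<open>auto simp: space_pair_measure\<close>)

lemma integral_vol_par:
  fixes F :: "state \<Rightarrow> real"
  assumes "open TJ" "F \<in> borel_measurable (vol TJ)"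
  shows "(\<integral>z. F z \<partial>vol TJ) = sqrt 3 * (\<integral>w. indicator (mis \<times> TJ) (statepar w) * F (statepar w) \<partial>lborel)"
proof -
  have [measurable]: "(\<lambda>z. indicator (mis \<times> TJ) z * F z) \<in> borel_measurable borel"
    using borel_measurable_vol assms by blast
  have [measurable]: "(\<lambda>w. indicator (mis \<times> TJ) (statepar w) * F (statepar w)) \<in> borel_measurable borel"
    using measurable_compose[OF statepar_measurable, of "\<lambda>z. indicator (mis \<times> TJ) z * F z" borel] by simp
  show ?thesis
    unfolding integral_vol[OF assms(1)] plane_pair_statepar
    by (subst integral_distr) (auto simp: integral_density)
qed

lemma AE_vol_par:
  assumes "open TJ" "{z \<in> mis \<times> TJ. P z} \<in> sets borel"
  shows "(AE z in vol TJ. P z) \<longleftrightarrow> (AE w in lborel. statepar w \<in> mis \<times> TJ \<longrightarrow> P (statepar w))"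
proof -
  have "{z. z \<in> mis \<times> TJ \<longrightarrow> P z} = - (mis \<times> TJ) \<union> {z \<in> mis \<times> TJ. P z}" by auto
  then have m: "{z. z \<in> mis \<times> TJ \<longrightarrow> P z} \<in> sets borel"
    using assms state_borel[OF assms(1)] by auto
  show ?thesis
    unfolding vol_def
    unfolding plane_pair_statepar
    apply (subst AE_restrict_space_iff)
    using state_borel[OF assms(1)] apply (simp add: space_pair_measure)
    apply (subst AE_distr_iff)
    using m by (simp_all add: AE_density)
qed

lemma emeasure_vol_finite:
  assumes "open TJ" "bounded TJ"
  shows "finite_measure (vol TJ)"
proof
  have "emeasure (plane_measure \<Otimes>\<^sub>M lborel) (mis \<times> TJ) = emeasure plane_measure mis * emeasure lborel TJ"
    using assms by (simp add: lborel.emeasure_pair_measure_Times)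
  also have "\<dots> < \<infinity>"
    using emeasure_plane_bounded[OF bounded_mis] emeasure_bounded_finite[OF assms(2)]
    by (simp add: ennreal_mult_less_top)
  finally show "emeasure (vol TJ) (space (vol TJ)) \<noteq> \<infinity>"
    using state_borel[OF assms(1)]
    by (simp add: vol_def emeasure_restrict_space space_restrict_space space_pair_measure less_top)
qed

lemma space_vol: "space (vol TJ) = mis \<times> TJ"
  by (simp add: vol_def space_restrict_space space_pair_measure)

lemma integrable_vol_bounded:
  fixes F :: "state \<Rightarrow> real"
  assumes "open TJ" "bounded TJ" "F \<in> borel_measurable (vol TJ)" "\<And>z. z \<in> mis \<times> TJ \<Longrightarrow> \<bar>F z\<bar> \<le> B"
  shows "integrable (vol TJ) F"
  by (rule finite_measure.integrable_const_bound[OF emeasure_vol_finite[OF assms(1,2)], of _ B])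
    (use assms in \<open>auto simp: space_vol\<close>)

lemma integrable_vol_iff:
  fixes F :: "state \<Rightarrow> real"
  assumes "open TJ"
  shows "integrable (vol TJ) F \<longleftrightarrow> integrable (plane_measure \<Otimes>\<^sub>M lborel) (\<lambda>z. indicator (mis \<times> TJ) z * F z)"
  unfolding vol_def
  by (subst integrable_restrict_space) (use state_borel[OF assms] in \<open>auto simp: space_pair_measure\<close>)

text \<open>Both orders are kept because the two boundary parts need different slices: the hexagon
  is treated at fixed \<open>a\<close>, the boundary of \<open>TJ\<close> at fixed
  \<open>\<theta>\<close>. Integrability of the inner integrals is recorded for the Cauchy-Schwarz
  estimate over the slices.\<close>

lemma integral_vol_fubini:
  fixes F :: "state \<Rightarrow> real"
  assumes "open TJ" "integrable (vol TJ) F"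
  shows "(\<integral>z. F z \<partial>vol TJ) = (\<integral>\<theta>. indicator mis \<theta> * (\<integral>a. indicator TJ a * F (\<theta>, a) \<partial>lborel) \<partial>plane_measure)"
    and "(\<integral>z. F z \<partial>vol TJ) = (\<integral>a. indicator TJ a * (\<integral>\<theta>. indicator mis \<theta> * F (\<theta>, a) \<partial>plane_measure) \<partial>lborel)"
    and "integrable plane_measure (\<lambda>\<theta>. indicator mis \<theta> * (\<integral>a. indicator TJ a * F (\<theta>, a) \<partial>lborel))"
    and "integrable lborel (\<lambda>a. indicator TJ a * (\<integral>\<theta>. indicator mis \<theta> * F (\<theta>, a) \<partial>plane_measure))"
proof -
  interpret p: pair_sigma_finite plane_measure "lborel :: (real^2) measure"
    by (intro pair_sigma_finite.intro sigma_finite_plane lborel.sigma_finite_measure_axioms)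
  have i: "integrable (plane_measure \<Otimes>\<^sub>M lborel) (\<lambda>z. indicator (mis \<times> TJ) z * F z)"
    using assms integrable_vol_iff by blast
  have i': "integrable (plane_measure \<Otimes>\<^sub>M lborel) (\<lambda>(\<theta>, a). indicator (mis \<times> TJ) (\<theta>, a) * F (\<theta>, a))"
    using i by (simp add: case_prod_unfold)
  have e: "indicator (mis \<times> TJ) (\<theta>, a) * F (\<theta>, a) = indicator mis \<theta> * (indicator TJ a * F (\<theta>, a))"
    "indicator (mis \<times> TJ) (\<theta>, a) * F (\<theta>, a) = indicator TJ a * (indicator mis \<theta> * F (\<theta>, a))" for \<theta> a
    by (auto simp: indicator_def)
  have e': "(\<integral>z. indicator (mis \<times> TJ) z * F z \<partial>(plane_measure \<Otimes>\<^sub>M lborel)) =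
      (\<integral>(\<theta>, a). indicator TJ a * (indicator mis \<theta> * F (\<theta>, a)) \<partial>(plane_measure \<Otimes>\<^sub>M lborel))"
    by (rule Bochner_Integration.integral_cong) (auto simp: indicator_def)
  show "(\<integral>z. F z \<partial>vol TJ) = (\<integral>\<theta>. indicator mis \<theta> * (\<integral>a. indicator TJ a * F (\<theta>, a) \<partial>lborel) \<partial>plane_measure)"
    unfolding integral_vol[OF assms(1)]
    by (subst p.integral_fst'[OF i, symmetric]) (simp add: e(1))
  show "(\<integral>z. F z \<partial>vol TJ) = (\<integral>a. indicator TJ a * (\<integral>\<theta>. indicator mis \<theta> * F (\<theta>, a) \<partial>plane_measure) \<partial>lborel)"
    unfolding integral_vol[OF assms(1)]
    using p.integral_snd[OF i'] e'
    by (simp only: e(2) integral_mult_right_zero)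
  show "integrable plane_measure (\<lambda>\<theta>. indicator mis \<theta> * (\<integral>a. indicator TJ a * F (\<theta>, a) \<partial>lborel))"
    using p.integrable_fst'[OF i] by (simp add: e(1))
  show "integrable lborel (\<lambda>a. indicator TJ a * (\<integral>\<theta>. indicator mis \<theta> * F (\<theta>, a) \<partial>plane_measure))"
    using p.integrable_snd[OF i'] by (simp only: e(2) integral_mult_right_zero)
qed

section \<open>Testing with smooth functions\<close>

lemma enn2real_eq_imp_eq: "enn2real a = enn2real b \<Longrightarrow> a \<noteq> top \<Longrightarrow> b \<noteq> top \<Longrightarrow> a = b"
  by (metis ennreal_enn2real less_top)

text \<open>The positive and the negative part of \<open>f\<close> are densities of measures that
  agree on the boxes, a generator closed under intersection, hence everywhere. Uniqueness of
  densities equates the two parts almost everywhere, and they can only be equal where both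
  vanish.\<close>

lemma AE_zero_if_box_integrals_zero:
  fixes f :: "'a::euclidean_space \<Rightarrow> real"
  assumes int: "integrable lborel f"
    and z: "\<And>l u. (\<integral>x. indicator (box l u) x * f x \<partial>lborel) = 0"
  shows "AE x in lborel. f x = 0"
proof -
  have [measurable]: "f \<in> borel_measurable borel" using int by auto
  have fin: "(\<integral>\<^sup>+x. ennreal (f x) \<partial>lborel) \<noteq> \<infinity>" "(\<integral>\<^sup>+x. ennreal (- f x) \<partial>lborel) \<noteq> \<infinity>"
    using int by (auto simp: real_integrable_def)
  let ?M = "density lborel (\<lambda>x. ennreal (f x))" and ?N = "density lborel (\<lambda>x. ennreal (- f x))"
  have ind: "ennreal (f x) * indicator A x = ennreal (indicator A x * f x)"
    "ennreal (- f x) * indicator A x = ennreal (- (indicator A x * f x))" for x A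
    by (auto simp: indicator_def)
  have finA: "(\<integral>\<^sup>+x. ennreal (indicator A x * f x) \<partial>lborel) \<noteq> \<infinity>"
    "(\<integral>\<^sup>+x. ennreal (- (indicator A x * f x)) \<partial>lborel) \<noteq> \<infinity>" if "A \<in> sets borel" for A
    using integrable_mult_indicator[OF _ int, of A] that by (auto simp: real_integrable_def)
  have "?M = ?N"
  proof (rule measure_eqI_generator_eq)
    let ?E = "range (\<lambda>(a, b). box a b::'a set)"
    show "Int_stable ?E"
      by (auto simp: Int_stable_def box_Int_box)
    show "?E \<subseteq> Pow UNIV" "sets ?M = sigma_sets UNIV ?E" "sets ?N = sigma_sets UNIV ?E"
      by (simp_all add: borel_eq_box)
    let ?A = "\<lambda>n::nat. box (- (real n *\<^sub>R One)) (real n *\<^sub>R One) :: 'a set"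
    show "range ?A \<subseteq> ?E" "(\<Union>i. ?A i) = UNIV"
      unfolding UN_box_eq_UNIV by auto
    show "emeasure ?M (?A i) \<noteq> \<infinity>" for i
      using finA(1)[of "?A i"] by (simp add: emeasure_density ind)
    show "emeasure ?M X = emeasure ?N X" if "X \<in> ?E" for X
    proof -
      from that obtain l u where X: "X = box l u" by auto
      have "enn2real (\<integral>\<^sup>+x. ennreal (indicator X x * f x) \<partial>lborel) =
          enn2real (\<integral>\<^sup>+x. ennreal (- (indicator X x * f x)) \<partial>lborel)"
        using z[of l u] X real_lebesgue_integral_def[of lborel "\<lambda>x. indicator X x * f x"]
          integrable_mult_indicator[OF _ int, of X] by simp
      then have "(\<integral>\<^sup>+x. ennreal (indicator X x * f x) \<partial>lborel) =
          (\<integral>\<^sup>+x. ennreal (- (indicator X x * f x)) \<partial>lborel)"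
        using finA[of X] unfolding X infinity_ennreal_def
        by (intro enn2real_eq_imp_eq) auto
      then show ?thesis using X by (simp add: emeasure_density ind)
    qed
  qed
  then have "AE x in lborel. ennreal (f x) = ennreal (- f x)"
    by (intro sigma_finite_measure.density_unique[OF lborel.sigma_finite_measure_axioms]) auto
  then show ?thesis
    by eventually_elim (metis ennreal_eq_0_iff ennreal_inj linorder_linear neg_0_equal_iff_equal neg_0_le_iff_le neg_le_0_iff_le order_antisym)
qed

text \<open>A localised form in which \<open>H\<close> need only be integrable on closed boxes
  inside \<open>V\<close>. Lindelof's theorem covers \<open>V\<close> by countably many boxes, and
  on each of them the global statement applies to \<open>H\<close> cut off by the box.\<close>

lemma AE_zero_on_open_if_box_integrals_zero:
  fixes H :: "'a::euclidean_space \<Rightarrow> real"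
  assumes V: "open V"
    and int: "\<And>l u. cbox l u \<subseteq> V \<Longrightarrow> integrable lborel (\<lambda>x. indicator (cbox l u) x * H x)"
    and z: "\<And>l u. cbox l u \<subseteq> V \<Longrightarrow> (\<integral>x. indicator (box l u) x * H x \<partial>lborel) = 0"
  shows "AE x in lborel. x \<in> V \<longrightarrow> H x = 0"
proof -
  let ?F = "{box a b | a b. cbox a b \<subseteq> V}"
  obtain F where F: "F \<subseteq> ?F" "countable F" "\<Union> F = \<Union> ?F"
    using Lindelof[of ?F] by auto
  have "\<Union> ?F = V"
  proof
    show "V \<subseteq> \<Union> ?F"
    proof
      fix x assume "x \<in> V"
      then obtain a b where "cbox a b \<subseteq> V" "x \<in> box a b" using open_contains_cbox[OF V] by metis
      then show "x \<in> \<Union> ?F" by auto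
    qed
    show "\<Union> ?F \<subseteq> V" using box_subset_cbox by blast
  qed
  with F have V_eq: "V = \<Union> F" by simp
  have "AE x in lborel. x \<in> B \<longrightarrow> H x = 0" if "B \<in> F" for B
  proof -
    from that F obtain a b where B: "B = box a b" "cbox a b \<subseteq> V" by blast
    have "integrable lborel (\<lambda>x. indicator B x *\<^sub>R (indicator (cbox a b) x * H x))"
      by (intro integrable_mult_indicator int B) (simp add: B)
    moreover have "indicator B x * (indicator (cbox a b) x * H x) = indicator B x * H x" for x
      using box_subset_cbox[of a b] by (auto simp: B indicator_def)
    ultimately have i: "integrable lborel (\<lambda>x. indicator B x * H x)" by simp
    have "AE x in lborel. indicator B x * H x = 0"
    proof (rule AE_zero_if_box_integrals_zero[OF i])
      fix l u
      obtain a' b' where b': "box l u \<inter> box a b = box a' b'" using box_Int_box by blast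
      have "(\<integral>x. indicator (box l u) x * (indicator B x * H x) \<partial>lborel) = (\<integral>x. indicator (box a' b') x * H x \<partial>lborel)"
        by (simp flip: b' add: indicator_inter_arith B mult.assoc)
      also have "\<dots> = 0"
      \<comment> \<open>If the open box is empty, its integral is zero and nothing is known about
        \<open>cbox a' b'\<close>. Otherwise \<open>cbox a' b'\<close> is the closure of the open
        box and stays inside \<open>cbox a b\<close>, as hypothesis \<open>z\<close>
        requires.\<close>
      proof (cases "box a' b' = {}")
        case False
        then have "cbox a' b' = closure (box a' b')" by (simp add: closure_box)
        also have "\<dots> \<subseteq> cbox a b"
          using b' box_subset_cbox[of a b] by (intro closure_minimal) auto
        finally show ?thesis using z B by blast
      qed simp
      finally show "(\<integral>x. indicator (box l u) x * (indicator B x * H x) \<partial>lborel) = 0" .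
    qed
    then show ?thesis by eventually_elim (auto simp: indicator_def)
  qed
  then have "AE x in lborel. \<forall>B\<in>F. x \<in> B \<longrightarrow> H x = 0"
    by (rule AE_ball_countable'[OF _ F(2)])
  then show ?thesis unfolding V_eq by eventually_elim auto
qed

text \<open>A linear left inverse of \<open>statepar\<close> on the whole ambient space. Composing
  with it extends a function of the chart coordinates smoothly off the plane, as
  \<open>test_function\<close> requires.\<close>

definition stateunpar :: "state \<Rightarrow> (real \<times> real) \<times> (real^2)" where
  "stateunpar z = ((fst z $ 1, fst z $ 2), snd z)"

lemma stateunpar_par [simp]: "stateunpar (statepar w) = w"
  by (cases w) (auto simp: stateunpar_def statepar_def)

lemma statepar_unpar: "fst z \<in> mis_plane \<Longrightarrow> statepar (stateunpar z) = z"
  by (cases z) (simp add: stateunpar_def statepar_def hexpar_plane)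

lemma stateunpar_linear: "bounded_linear stateunpar"
  unfolding stateunpar_def
  by (intro bounded_linear_Pair bounded_linear_compose[OF bounded_linear_vec_nth] bounded_linear_fst bounded_linear_snd)

lemma open_statepar_vimage:
  assumes "open TJ"
  shows "open (statepar -` (mis \<times> TJ))"
proof -
  have "statepar -` (mis \<times> TJ) =
      {z. - (pi/4) < fst z \<and> fst z < pi/4 \<and> - (pi/4) < snd z \<and> snd z < pi/4 \<and> - (pi/4) < - fst z - snd z \<and> - fst z - snd z < pi/4} \<times> TJ"
    by (auto simp: statepar_def mis_def forall_3)
  also have "open \<dots>"
    by (intro open_Times assms open_Collect_conj open_Collect_less continuous_intros)
  finally show ?thesis .
qed

lemma integrable_vol_par:
  fixes F :: "state \<Rightarrow> real"
  assumes "open TJ" "F \<in> borel_measurable (vol TJ)"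
  shows "integrable (vol TJ) F \<longleftrightarrow> integrable lborel (\<lambda>w. indicator (mis \<times> TJ) (statepar w) * F (statepar w))"
proof -
  have [measurable]: "(\<lambda>z. indicator (mis \<times> TJ) z * F z) \<in> borel_measurable borel"
    using borel_measurable_vol assms by blast
  have [measurable]: "(\<lambda>w. indicator (mis \<times> TJ) (statepar w) * F (statepar w)) \<in> borel_measurable borel"
    using measurable_compose[OF statepar_measurable, of "\<lambda>z. indicator (mis \<times> TJ) z * F z" borel] by simp
  show ?thesis
    unfolding integrable_vol_iff[OF assms(1)] plane_pair_statepar
    by (subst integrable_distr_eq) (auto simp: integrable_density)
qed

lemma test_function_boxbump:
  assumes "open TJ" "cbox l u \<subseteq> statepar -` (mis \<times> TJ)"
  shows "test_function TJ (\<lambda>z. boxbump n l u (stateunpar z))"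
  unfolding test_function_def
proof (intro conjI exI[of _ "statepar ` cbox l u"] ballI)
  have lin: "linear stateunpar" using stateunpar_linear bounded_linear.linear by blast
  \<comment> \<open>The adjoint turns each chart coordinate into an inner product with a fixed
    vector, the kind of composition that \<open>Ck_on_inner\<close> covers.\<close>
  have "stateunpar z \<bullet> b = z \<bullet> adjoint stateunpar b" for z b
    by (simp add: adjoint_works[OF lin])
  moreover have "Ck_on k UNIV (\<lambda>z. expbump (real n * (z \<bullet> adjoint stateunpar b - l \<bullet> b)) * expbump (real n * (u \<bullet> b - z \<bullet> adjoint stateunpar b)))" for k b
  proof -
    have "Ck_on k UNIV (\<lambda>x. expbump (real n * x + (- real n * (l \<bullet> b))) * expbump ((- real n) * x + real n * (u \<bullet> b)))"
      by (intro Ck_on_mult Ck_on_affine_real expbump_Ck)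
    then have "Ck_on k UNIV (\<lambda>x. expbump (real n * (x - l \<bullet> b)) * expbump (real n * (u \<bullet> b - x)))"
      by (simp add: algebra_simps)
    then show ?thesis by (rule Ck_on_inner)
  qed
  ultimately show "smooth_on UNIV (\<lambda>z. boxbump n l u (stateunpar z))"
    unfolding smooth_on_def boxbump_def[abs_def] by (auto intro!: Ck_on_prod)
  show "compact (statepar ` cbox l u)"
    by (intro compact_continuous_image linear_continuous_on statepar_linear compact_cbox)
  show "statepar ` cbox l u \<subseteq> mis \<times> TJ" using assms by auto
  fix z assume z: "z \<in> mis \<times> TJ - statepar ` cbox l u"
  then have "statepar (stateunpar z) = z" using mis_subset_plane by (intro statepar_unpar) auto
  then have "stateunpar z \<notin> cbox l u" using z by (metis DiffD2 imageI)
  then show "boxbump n l u (stateunpar z) = 0"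
    using box_subset_cbox by (intro boxbump_zero) blast
qed

lemma test_function_bounded_mult:
  assumes TJ: "open TJ" and h: "loc_integrable TJ h" and \<phi>: "test_function TJ \<phi>"
  shows "integrable (vol TJ) (\<lambda>z. h z * \<phi> z)"
proof -
  obtain K where K: "compact K" "K \<subseteq> mis \<times> TJ" "\<And>z. z \<in> mis \<times> TJ - K \<Longrightarrow> \<phi> z = 0"
    using \<phi> by (auto simp: test_function_def)
  have c: "continuous_on UNIV \<phi>" using \<phi> smooth_continuous by (auto simp: test_function_def)
  obtain B where B: "\<And>z. z \<in> K \<Longrightarrow> \<bar>\<phi> z\<bar> \<le> B"
    using compact_imp_bounded[OF compact_continuous_image[OF continuous_on_subset[OF c] K(1)]]
    by (auto simp: bounded_iff)
  have hm: "h \<in> borel_measurable (vol TJ)" and hi: "integrable (vol TJ) (\<lambda>z. indicator K z *\<^sub>R h z)"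
    using h K by (auto simp: loc_integrable_def set_integrable_def)
  have \<phi>m: "\<phi> \<in> borel_measurable (vol TJ)"
    using TJ borel_measurable_continuous_onI[OF c] state_borel[OF TJ] by (subst borel_measurable_vol) auto
  show ?thesis
  proof (rule Bochner_Integration.integrable_bound)
    show "integrable (vol TJ) (\<lambda>z. B * (indicator K z *\<^sub>R h z))" using hi by (rule integrable_mult_right)
    show "(\<lambda>z. h z * \<phi> z) \<in> borel_measurable (vol TJ)" using hm \<phi>m by simp
    have "\<bar>h z * \<phi> z\<bar> \<le> \<bar>B * (indicator K z * h z)\<bar>" if "z \<in> mis \<times> TJ" for z
    proof (cases "z \<in> K")
      case True
      then have "\<bar>\<phi> z\<bar> \<le> \<bar>B\<bar>" using B[of z] by linarith
      then show ?thesis using True by (simp add: abs_mult mult.commute mult_right_mono)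
    qed (use K that in auto)
    then show "AE z in vol TJ. norm (h z * \<phi> z) \<le> norm (B * (indicator K z *\<^sub>R h z))"
      by (intro AE_I2) (simp add: space_vol)
  qed
qed

text \<open>The fundamental lemma of the calculus of variations, proved in the chart: bumps on boxes
  whose closure lies in the domain are test functions, and sharpening them turns the hypothesis into
  vanishing integrals over boxes.\<close>

lemma AE_zero_if_test_integrals_zero:
  assumes TJ: "open TJ" and h: "loc_integrable TJ h"
    and z: "\<And>\<phi>. test_function TJ \<phi> \<Longrightarrow> (\<integral>z. h z * \<phi> z \<partial>vol TJ) = 0"
  shows "AE z in vol TJ. h z = 0"
proof -
  define V where "V = statepar -` (mis \<times> TJ)"
  define H where "H w = indicator (mis \<times> TJ) (statepar w) * h (statepar w)" for w
  have hm: "h \<in> borel_measurable (vol TJ)" using h by (simp add: loc_integrable_def)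
  have [measurable]: "H \<in> borel_measurable borel"
    unfolding H_def using borel_measurable_vol[OF TJ, of h] hm
      measurable_compose[OF statepar_measurable, of "\<lambda>z. indicator (mis \<times> TJ) z * h z" borel] by simp
  have "AE w in lborel. w \<in> V \<longrightarrow> H w = 0"
  proof (rule AE_zero_on_open_if_box_integrals_zero)
    show "open V" unfolding V_def by (rule open_statepar_vimage[OF TJ])
    fix l u assume lu: "cbox l u \<subseteq> V"
    let ?K = "statepar ` cbox l u"
    have K: "compact ?K" "?K \<subseteq> mis \<times> TJ"
      using lu by (auto simp: V_def intro!: compact_continuous_image linear_continuous_on statepar_linear)
    then have hi: "integrable (vol TJ) (\<lambda>z. indicator ?K z * h z)"
      using h by (auto simp: loc_integrable_def set_integrable_def)
    then have "integrable lborel (\<lambda>w. indicator (mis \<times> TJ) (statepar w) * (indicator ?K (statepar w) * h (statepar w)))"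
      using integrable_vol_par[OF TJ borel_measurable_integrable[OF hi]] by simp
    moreover have "indicator ?K (statepar w) = (indicator (cbox l u) w :: real)" for w
      by (auto simp: indicator_def) (metis stateunpar_par)
    ultimately show i: "integrable lborel (\<lambda>w. indicator (cbox l u) w * H w)"
      by (simp add: H_def mult.left_commute)
    have "(\<integral>w. boxbump n l u w * H w \<partial>lborel) = 0" for n
    proof -
      have t: "test_function TJ (\<lambda>z. boxbump n l u (stateunpar z))"
        using lu by (intro test_function_boxbump TJ) (auto simp: V_def)
      have "sqrt 3 * (\<integral>w. indicator (mis \<times> TJ) (statepar w) * (h (statepar w) * boxbump n l u w) \<partial>lborel) = 0"
        using z[OF t] integral_vol_par[OF TJ, of "\<lambda>z. h z * boxbump n l u (stateunpar z)"]
          test_function_bounded_mult[OF TJ h t] by auto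
      then show ?thesis by (simp add: H_def mult_ac)
    qed
    moreover have "(\<lambda>n. \<integral>w. boxbump n l u w * H w \<partial>lborel) \<longlonglongrightarrow> (\<integral>w. indicator (box l u) w * H w \<partial>lborel)"
    proof (rule integral_dominated_convergence[where w = "\<lambda>w. \<bar>indicator (cbox l u) w * H w\<bar>"])
      show "integrable lborel (\<lambda>w. \<bar>indicator (cbox l u) w * H w\<bar>)" using i by (rule integrable_abs)
      have [measurable]: "boxbump n l u \<in> borel_measurable borel" for n
        by (intro borel_measurable_continuous_onI smooth_continuous boxbump_smooth)
      show "(\<lambda>w. boxbump n l u w * H w) \<in> borel_measurable lborel" for n by simp
      show "(\<lambda>w. indicator (box l u) w * H w) \<in> borel_measurable lborel" by simp
      show "AE w in lborel. (\<lambda>n. boxbump n l u w * H w) \<longlonglongrightarrow> indicator (box l u) w * H w"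
        by (intro AE_I2 tendsto_mult boxbump_tendsto tendsto_const)
      have "\<bar>boxbump n l u w\<bar> \<le> indicator (cbox l u) w" for n w
        using boxbump_bounds[of n l u w] boxbump_zero[of w l u n] box_subset_cbox[of l u]
        by (auto simp: indicator_def)
      then show "AE w in lborel. norm (boxbump n l u w * H w) \<le> \<bar>indicator (cbox l u) w * H w\<bar>" for n
        by (intro AE_I2) (simp add: abs_mult mult_right_mono)
    qed
    ultimately show "(\<integral>w. indicator (box l u) w * H w \<partial>lborel) = 0"
      by (simp add: LIMSEQ_const_iff)
  qed
  then have "AE w in lborel. statepar w \<in> mis \<times> TJ \<longrightarrow> h (statepar w) = 0"
    by eventually_elim (simp add: V_def H_def)
  moreover have "{z \<in> mis \<times> TJ. h z = 0} \<in> sets borel"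
  proof -
    have m: "(\<lambda>z. indicator (mis \<times> TJ) z * h z) \<in> borel_measurable borel"
      using hm borel_measurable_vol[OF TJ] by blast
    have "(mis \<times> TJ) \<inter> (\<lambda>z. indicator (mis \<times> TJ) z * h z) -` {0} \<in> sets borel"
      by (intro sets.Int measurable_sets_borel[OF m] state_borel[OF TJ]) simp
    also have "(mis \<times> TJ) \<inter> (\<lambda>z. indicator (mis \<times> TJ) z * h z) -` {0} = {z \<in> mis \<times> TJ. h z = 0}"
      by auto
    finally show ?thesis .
  qed
  ultimately show ?thesis using AE_vol_par[OF TJ, of "\<lambda>z. h z = 0"] by blast
qed

text \<open>Each difference quotient of \<open>F\<close> along \<open>v\<close> has integral zero by
  translation invariance. The mean value theorem bounds the quotients by the supremum of
  \<open>G\<close>, so dominated convergence applies directly in the direction \<open>v\<close>,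
  which need not be a coordinate direction.\<close>

lemma integral_directional_derivative_zero:
  fixes F G :: "'a::euclidean_space \<Rightarrow> real"
  assumes cont: "continuous_on UNIV F" "continuous_on UNIV G"
    and K: "bounded K" "\<And>w. w \<notin> K \<Longrightarrow> F w = 0" "\<And>w. w \<notin> K \<Longrightarrow> G w = 0"
    and d: "\<And>w t. ((\<lambda>t. F (w + t *\<^sub>R v)) has_real_derivative G (w + t *\<^sub>R v)) (at t)"
  shows "(\<integral>w. G w \<partial>lborel) = 0"
proof -
  have [measurable]: "F \<in> borel_measurable borel" "G \<in> borel_measurable borel"
    using cont by (auto intro: borel_measurable_continuous_onI)
  obtain R where R: "\<And>w. w \<in> K \<Longrightarrow> norm w \<le> R" using K(1) bounded_iff by blast
  have "bounded (G ` cball 0 R)"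
    by (intro compact_imp_bounded compact_continuous_image continuous_on_subset[OF cont(2)] compact_cball) auto
  then obtain B where B: "\<And>w. w \<in> cball 0 R \<Longrightarrow> \<bar>G w\<bar> \<le> B"
    unfolding bounded_iff by (metis imageI real_norm_def)
  have GB: "\<bar>G w\<bar> \<le> \<bar>B\<bar>" for w
    using B[of w] K(3)[of w] R[of w] by (cases "w \<in> K") auto
  define s where "s = (\<lambda>n w. (F (w + (1 / real (Suc n)) *\<^sub>R v) - F w) * real (Suc n))"
  have intF: "integrable lborel F"
  proof -
    have "integrable lborel (\<lambda>w. indicator (cball 0 R) w *\<^sub>R F w)"
      by (intro borel_integrable_compact continuous_on_subset[OF cont(1)] compact_cball) simp
    moreover have "indicator (cball 0 R) w *\<^sub>R F w = F w" for w
      using K(2)[of w] R[of w] by (auto simp: indicator_def)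
    ultimately show ?thesis by (simp only:)
  qed
  have i: "integrable lborel (\<lambda>w. F (w + c))" "(\<integral>w. F (w + c) \<partial>lborel) = (\<integral>w. F w \<partial>lborel)" for c
  proof -
    show "(\<integral>w. F (w + c) \<partial>lborel) = (\<integral>w. F w \<partial>lborel)"
      using integral_distr[of "(+) c" lborel borel F] by (simp add: lborel_distr_plus add.commute)
    show "integrable lborel (\<lambda>w. F (w + c))"
      using integrable_distr_eq[of "(+) c" lborel borel F] intF by (simp add: lborel_distr_plus add.commute)
  qed
  have "(\<integral>w. s n w \<partial>lborel) = 0" for n
    unfolding s_def using i[of "(1 / real (Suc n)) *\<^sub>R v"] intF by simp
  moreover have "(\<lambda>n. \<integral>w. s n w \<partial>lborel) \<longlonglongrightarrow> (\<integral>w. G w \<partial>lborel)"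
  \<comment> \<open>A shift by at most \<open>v\<close> enlarges the support by at most
    \<open>norm v\<close>, whence the radius.\<close>
  proof (rule integral_dominated_convergence[where w = "\<lambda>w. indicator (cball 0 (R + norm v)) w * \<bar>B\<bar>"])
    show "integrable lborel (\<lambda>w::'a. indicator (cball 0 (R + norm v)) w * \<bar>B\<bar>)"
      using emeasure_bounded_finite[OF bounded_cball[of "0::'a" "R + norm v"]]
      by (intro integrable_mult_left integrable_real_indicator) (auto simp: less_top)
    show "s n \<in> borel_measurable lborel" for n unfolding s_def by simp
    show "G \<in> borel_measurable lborel" by simp
    have "(\<lambda>n. s n w) \<longlonglongrightarrow> G w" for w
    proof -
      have "((\<lambda>t. (F (w + t *\<^sub>R v) - F w) / t) \<longlongrightarrow> G w) (at 0)"
        using d[of w 0] by (simp add: has_field_derivative_iff)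
      moreover have "filterlim (\<lambda>n. 1 / real (Suc n)) (at 0) sequentially"
        unfolding filterlim_at using LIMSEQ_Suc[OF lim_1_over_n] by simp
      ultimately have "(\<lambda>n. (F (w + (1 / real (Suc n)) *\<^sub>R v) - F w) / (1 / real (Suc n))) \<longlonglongrightarrow> G w"
        by (rule filterlim_compose)
      then show ?thesis by (simp add: s_def)
    qed
    then show "AE w in lborel. (\<lambda>n. s n w) \<longlonglongrightarrow> G w" by simp
    have "\<bar>s n w\<bar> \<le> indicator (cball 0 (R + norm v)) w * \<bar>B\<bar>" for n w
    proof (cases "w \<in> cball 0 (R + norm v)")
      case True
      have "\<exists>z>0. z < 1 / real (Suc n) \<and> F (w + (1 / real (Suc n)) *\<^sub>R v) - F (w + 0 *\<^sub>R v) = (1 / real (Suc n) - 0) * G (w + z *\<^sub>R v)"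
        by (rule MVT2) (use d in auto)
      then obtain z where "F (w + (1 / real (Suc n)) *\<^sub>R v) - F w = (1 / real (Suc n)) * G (w + z *\<^sub>R v)"
        by auto
      then have "s n w = G (w + z *\<^sub>R v)" unfolding s_def by simp
      then show ?thesis using GB True by simp
    next
      case False
      have "norm w \<le> norm (w + (1 / real (Suc n)) *\<^sub>R v) + (1 / real (Suc n)) * norm v"
        using norm_triangle_ineq4[of "w + (1 / real (Suc n)) *\<^sub>R v" "(1 / real (Suc n)) *\<^sub>R v"] by simp
      moreover have "(1 / real (Suc n)) * norm v \<le> norm v"
        by (simp add: field_simps)
      ultimately have "norm (w + (1 / real (Suc n)) *\<^sub>R v) > R" "norm w > R"
        using False norm_ge_zero[of v] by (auto simp del: norm_ge_zero)
      then have "w + (1 / real (Suc n)) *\<^sub>R v \<notin> K" "w \<notin> K" using R by force+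
      then show ?thesis using K(2) by (simp add: s_def)
    qed
    then show "AE w in lborel. norm (s n w) \<le> indicator (cball 0 (R + norm v)) w * \<bar>B\<bar>" for n by simp
  qed
  ultimately show ?thesis by (simp add: LIMSEQ_const_iff)
qed

section \<open>Weak derivatives\<close>

lemma tproj_nth: "(tproj *v x) $ k = x $ k - (x$1 + x$2 + x$3) / 3"
  using exhaust_3[of k]
  by (auto simp: tproj_def matrix_vector_mult_def sum_3 mat_def field_simps)

lemma tproj_in_plane: "tproj *v x \<in> mis_plane"
  by (simp add: mis_plane_def tproj_nth field_simps)

text \<open>All directions in \<open>dirs\<close> are tangent to the plane, so lines along them are
  images of lines in the chart.\<close>

lemma dirs_statepar: "v \<in> dirs \<Longrightarrow> statepar (stateunpar v) = v"
  by (rule statepar_unpar)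
    (auto simp: dirs_def dir_th_def dir_a_def tproj_in_plane, simp add: mis_plane_def)

lemma finite_dirs: "finite dirs"
  by (simp add: dirs_def)

lemma continuous_bounded_on_state:
  fixes f :: "state \<Rightarrow> 'b::real_normed_vector"
  assumes "bounded TJ" "continuous_on UNIV f"
  obtains B where "B > 0" "\<And>z. z \<in> mis \<times> TJ \<Longrightarrow> norm (f z) \<le> B"
proof -
  have "compact (closure (mis \<times> TJ))" using assms bounded_Times[OF bounded_mis] by (simp add: compact_closure)
  then have "bounded (f ` closure (mis \<times> TJ))"
    by (intro compact_imp_bounded compact_continuous_image continuous_on_subset[OF assms(2)]) auto
  then obtain B where "B > 0" "\<forall>x\<in>f ` closure (mis \<times> TJ). norm x \<le> B" unfolding bounded_pos by blast
  then show ?thesis using closure_subset[of "mis \<times> TJ"] by (intro that[of B]) auto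
qed

lemma continuous_measurable_vol:
  fixes f :: "state \<Rightarrow> real"
  assumes "open TJ" "continuous_on UNIV f"
  shows "f \<in> borel_measurable (vol TJ)"
  using assms borel_measurable_continuous_onI[of f] state_borel by (subst borel_measurable_vol) auto

lemma borel_measurable_vol_subset:
  fixes f :: "state \<Rightarrow> real"
  assumes "open TJ" "f \<in> borel_measurable borel"
  shows "f \<in> borel_measurable (vol TJ)"
  using assms state_borel by (subst borel_measurable_vol) auto

lemma smooth_loc_integrable:
  assumes "open TJ" "bounded TJ" "continuous_on UNIV \<phi>"
  shows "loc_integrable TJ \<phi>"
  unfolding loc_integrable_def set_integrable_def
proof (intro conjI allI impI)
  show m: "\<phi> \<in> borel_measurable (vol TJ)" using assms continuous_measurable_vol by blast
  obtain B where B: "B > 0" "\<And>z. z \<in> mis \<times> TJ \<Longrightarrow> norm (\<phi> z) \<le> B"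
    using continuous_bounded_on_state assms by metis
  fix K :: "state set" assume K: "compact K \<and> K \<subseteq> mis \<times> TJ"
  then have "K \<in> sets borel" by (blast intro: borel_closed compact_imp_closed)
  then have "(indicator K :: state \<Rightarrow> real) \<in> borel_measurable (vol TJ)"
    by (intro borel_measurable_vol_subset assms) auto
  then show "integrable (vol TJ) (\<lambda>x. indicator K x *\<^sub>R \<phi> x)"
    using B by (intro integrable_vol_bounded[of _ _ B] assms) (use m in \<open>auto split: split_indicator simp: less_imp_le\<close>)
qed

text \<open>Integration by parts in the chart. A test function is controlled only on
  \<open>mis \<times> TJ\<close> and is arbitrary elsewhere, so \<open>F\<close> and
  \<open>G\<close> are the product and its derivative extended by zero. Their regularity is checked
  separately on the open sets \<open>V\<close> and \<open>- K'\<close>, which together cover the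
  space.\<close>

lemma smooth_has_weak_deriv:
  assumes TJ: "open TJ" "bounded TJ" and \<phi>: "smooth_on UNIV \<phi>" and v: "v \<in> dirs"
  shows "has_weak_deriv TJ v \<phi> (ddir v \<phi>)"
  unfolding has_weak_deriv_def
proof (intro conjI allI impI)
  show l: "loc_integrable TJ \<phi>" "loc_integrable TJ (ddir v \<phi>)"
    using smooth_loc_integrable[OF TJ smooth_continuous] \<phi> smooth_ddir by blast+
  fix \<psi> assume t: "test_function TJ \<psi>"
  then have \<psi>: "smooth_on UNIV \<psi>" by (simp add: test_function_def)
  obtain K where K: "compact K" "K \<subseteq> mis \<times> TJ" "\<And>z. z \<in> mis \<times> TJ - K \<Longrightarrow> \<psi> z = 0"
    using t by (auto simp: test_function_def)
  define v' where "v' = stateunpar v"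
  have v': "v = statepar v'" using dirs_statepar[OF v] by (simp add: v'_def)
  define F where "F w = indicator (mis \<times> TJ) (statepar w) * (\<phi> (statepar w) * \<psi> (statepar w))" for w
  define G where "G w = indicator (mis \<times> TJ) (statepar w) *
      (\<phi> (statepar w) * ddir v \<psi> (statepar w) + ddir v \<phi> (statepar w) * \<psi> (statepar w))" for w
  define V where "V = statepar -` (mis \<times> TJ)"
  define K' where "K' = stateunpar ` K"
  have oV: "open V" unfolding V_def by (rule open_statepar_vimage[OF TJ(1)])
  have cK': "compact K'" unfolding K'_def
    by (intro compact_continuous_image linear_continuous_on stateunpar_linear K)
  have K'V: "K' \<subseteq> V"
  proof
    fix w assume "w \<in> K'"
    then obtain z where z: "z \<in> K" "w = stateunpar z" by (auto simp: K'_def)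
    then have "fst z \<in> mis_plane" using K(2) mis_subset_plane by fastforce
    then have "statepar w = z" using z by (simp add: statepar_unpar)
    then show "w \<in> V" using z K(2) by (auto simp: V_def)
  qed
  have \<psi>0: "\<psi> (statepar w) = 0" if "w \<in> V - K'" for w
    using that K(3)[of "statepar w"] by (auto simp: V_def K'_def) (metis image_eqI stateunpar_par)
  have cover: "UNIV = V \<union> (- K')" using K'V by auto
  have oK': "open (- K')" using cK' compact_imp_closed by blast
  have par_line: "statepar (w + t *\<^sub>R v') = statepar w + t *\<^sub>R v" for w t
    using statepar_linear v' by (simp add: linear_simps)
  have d\<psi>: "((\<lambda>t. f (statepar (w + t *\<^sub>R v'))) has_real_derivative ddir v f (statepar (w + t *\<^sub>R v'))) (at t)"
    if "smooth_on UNIV f" for f :: "state \<Rightarrow> real" and w t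
  proof -
    have "((\<lambda>t. f (statepar w + t *\<^sub>R v)) has_derivative (\<lambda>h. ddir (h *\<^sub>R v) f (statepar w + t *\<^sub>R v))) (at t)"
      by (rule has_derivative_compose[of _ _ _ _ f "\<lambda>h. ddir h f (statepar w + t *\<^sub>R v)"])
        (auto intro!: derivative_eq_intros smooth_has_derivative that)
    moreover have "ddir (h *\<^sub>R v) f z = h * ddir v f z" for h z
      using has_derivative_linear[OF smooth_has_derivative[OF that]] by (simp add: linear_cmul)
    ultimately show ?thesis by (simp add: has_field_derivative_def par_line mult_commute_abs)
  qed
  \<comment> \<open>Off \<open>K'\<close> the function \<open>\<psi>\<close> is known to vanish only
    within the plane, so only tangential derivatives can be concluded to be zero; hence the argument
    along the line \<open>w + t v'\<close>.\<close>
  have \<psi>1: "ddir v \<psi> (statepar w) = 0" if w: "w \<in> V - K'" for w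
  proof -
    have "open (V - K')" using oV oK' by (simp add: Diff_eq open_Int)
    then have "open ((\<lambda>t. w + t *\<^sub>R v') -` (V - K'))"
      by (rule continuous_open_vimage) (intro continuous_intros)
    moreover have "((\<lambda>t. \<psi> (statepar (w + t *\<^sub>R v'))) has_real_derivative ddir v \<psi> (statepar (w + 0 *\<^sub>R v'))) (at 0)"
      by (rule d\<psi>[OF \<psi>])
    ultimately have "((\<lambda>t. 0) has_real_derivative ddir v \<psi> (statepar (w + 0 *\<^sub>R v'))) (at 0)"
      by (elim has_field_derivative_transform_within_open) (use w \<psi>0 in auto)
    then show ?thesis using DERIV_unique[OF _ DERIV_const] by fastforce
  qed
  have F0: "F w = 0" "G w = 0" if "w \<notin> K'" for w
    using that \<psi>0[of w] \<psi>1[of w] by (auto simp: F_def G_def V_def indicator_def)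
  have cc: "continuous_on UNIV (\<lambda>w. f (statepar w))" if "smooth_on UNIV f" for f :: "state \<Rightarrow> real"
    by (rule continuous_on_compose2[OF smooth_continuous[OF that]])
      (auto intro!: linear_continuous_on statepar_linear)
  have contV: "continuous_on UNIV g" if "continuous_on V f" "\<And>w. w \<in> V \<Longrightarrow> g w = f w" "\<And>w. w \<notin> K' \<Longrightarrow> g w = 0" for f g :: "_ \<Rightarrow> real"
  proof -
    have "continuous_on V g" using that by (simp cong: continuous_on_cong)
    moreover have "continuous_on (- K') g"
      using that(3) continuous_on_cong[of "- K'" "- K'" g "\<lambda>_. 0"] by simp
    ultimately show ?thesis unfolding cover using oV oK' by (intro continuous_on_open_Un)
  qed
  have "(\<integral>w. G w \<partial>lborel) = 0"
  proof (rule integral_directional_derivative_zero[of F G K' v'])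
    note c = continuous_on_subset[OF cc[OF \<phi>] subset_UNIV] continuous_on_subset[OF cc[OF \<psi>] subset_UNIV]
      continuous_on_subset[OF cc[OF smooth_ddir[OF \<phi>]] subset_UNIV] continuous_on_subset[OF cc[OF smooth_ddir[OF \<psi>]] subset_UNIV]
    show "continuous_on UNIV F"
    proof (rule contV)
      show "continuous_on V (\<lambda>w. \<phi> (statepar w) * \<psi> (statepar w))"
        by (intro continuous_on_mult c)
    qed (use F0 in \<open>auto simp: F_def V_def\<close>)
    show "continuous_on UNIV G"
    proof (rule contV)
      show "continuous_on V (\<lambda>w. \<phi> (statepar w) * ddir v \<psi> (statepar w) + ddir v \<phi> (statepar w) * \<psi> (statepar w))"
        by (intro continuous_on_mult continuous_on_add c)
    qed (use F0 in \<open>auto simp: G_def V_def\<close>)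
    show "bounded K'" using cK' compact_imp_bounded by blast
    show "((\<lambda>t. F (w + t *\<^sub>R v')) has_real_derivative G (w + t *\<^sub>R v')) (at t)" for w t
    proof (cases "w + t *\<^sub>R v' \<in> V")
      case True
      have "((\<lambda>t. \<phi> (statepar (w + t *\<^sub>R v')) * \<psi> (statepar (w + t *\<^sub>R v'))) has_real_derivative G (w + t *\<^sub>R v')) (at t)"
        using True by (auto intro!: derivative_eq_intros d\<psi> \<phi> \<psi> simp: G_def V_def)
      moreover have "open ((\<lambda>t. w + t *\<^sub>R v') -` V)"
        by (intro continuous_open_vimage continuous_intros oV)
      ultimately show ?thesis
        by (rule has_field_derivative_transform_within_open) (use True in \<open>auto simp: F_def V_def\<close>)
    next
      case False
      then have n: "w + t *\<^sub>R v' \<in> - K'" using K'V by auto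
      have "open ((\<lambda>t. w + t *\<^sub>R v') -` (- K'))"
        by (intro continuous_open_vimage continuous_intros oK')
      moreover have "((\<lambda>t. 0) has_real_derivative 0) (at t)" by simp
      ultimately have "((\<lambda>t. F (w + t *\<^sub>R v')) has_real_derivative 0) (at t)"
        by (elim has_field_derivative_transform_within_open) (use n F0 in auto)
      then show ?thesis using F0 n by simp
    qed
  qed (use F0 in auto)
  moreover
  let ?I = "\<lambda>z. \<phi> z * ddir v \<psi> z + ddir v \<phi> z * \<psi> z"
  have cI: "continuous_on UNIV (\<lambda>z. \<phi> z * ddir v \<psi> z)" "continuous_on UNIV (\<lambda>z. ddir v \<phi> z * \<psi> z)"
    by (intro continuous_intros smooth_continuous smooth_ddir \<phi> \<psi>)+
  have int: "integrable (vol TJ) f" if cf: "continuous_on UNIV f" for f :: "state \<Rightarrow> real"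
  proof -
    obtain B where "B > 0" "\<And>z. z \<in> mis \<times> TJ \<Longrightarrow> norm (f z) \<le> B"
      using continuous_bounded_on_state[OF TJ(2) cf] by metis
    then show ?thesis
      by (intro integrable_vol_bounded[of _ _ B] TJ continuous_measurable_vol cf) auto
  qed
  have "(\<integral>z. ?I z \<partial>vol TJ) = sqrt 3 * (\<integral>w. G w \<partial>lborel)"
    unfolding G_def
    by (rule integral_vol_par[OF TJ(1)]) (intro continuous_measurable_vol TJ continuous_on_add cI)
  ultimately have "(\<integral>z. ?I z \<partial>vol TJ) = 0" by simp
  then show "(\<integral>z. \<phi> z * ddir v \<psi> z \<partial>vol TJ) = - (\<integral>z. ddir v \<phi> z * \<psi> z \<partial>vol TJ)"
    by (subst (asm) Bochner_Integration.integral_add) (auto intro!: int cI)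
qed

lemma loc_integrable_diff:
  assumes "loc_integrable TJ g" "loc_integrable TJ h"
  shows "loc_integrable TJ (\<lambda>z. g z - h z)"
  using assms unfolding loc_integrable_def set_integrable_def
  by (auto simp: right_diff_distrib)

lemma loc_integrable_cong_AE:
  assumes "loc_integrable TJ g" "g' \<in> borel_measurable (vol TJ)" "AE z in vol TJ. g z = g' z" "open TJ"
  shows "loc_integrable TJ g'"
  unfolding loc_integrable_def set_integrable_def
proof (intro conjI allI impI assms)
  fix K :: "state set" assume K: "compact K \<and> K \<subseteq> mis \<times> TJ"
  have gm: "g \<in> borel_measurable (vol TJ)" and gi: "integrable (vol TJ) (\<lambda>z. indicator K z *\<^sub>R g z)"
    using assms(1) K by (auto simp: loc_integrable_def set_integrable_def)
  have "K \<in> sets borel" using K by (blast intro: borel_closed compact_imp_closed)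
  then have "(indicator K :: state \<Rightarrow> real) \<in> borel_measurable (vol TJ)"
    by (intro borel_measurable_vol_subset assms) auto
  then show "integrable (vol TJ) (\<lambda>x. indicator K x *\<^sub>R g' x)"
    using assms(2,3) gm
    by (intro Bochner_Integration.integrable_cong_AE_imp[OF gi]) auto
qed

text \<open>A tangential derivative of a test function is again a test function with the same
  compact set.\<close>

lemma test_function_ddir_mult:
  assumes TJ: "open TJ" and h: "loc_integrable TJ h" and \<phi>: "test_function TJ \<phi>" and v: "v \<in> dirs"
  shows "integrable (vol TJ) (\<lambda>z. h z * ddir v \<phi> z)"
proof -
  have s: "smooth_on UNIV \<phi>" using \<phi> by (simp add: test_function_def)
  obtain K where K: "compact K" "K \<subseteq> mis \<times> TJ" "\<And>z. z \<in> mis \<times> TJ - K \<Longrightarrow> \<phi> z = 0"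
    using \<phi> by (auto simp: test_function_def)
  have "ddir v \<phi> z = 0" if z: "z \<in> mis \<times> TJ - K" for z
  proof -
    define w where "w = stateunpar z"
    have zw: "z = statepar w" using z mis_subset_plane
      by (auto simp: w_def mem_Times_iff intro!: statepar_unpar[symmetric])
    define v' where "v' = stateunpar v"
    have v': "v = statepar v'" using dirs_statepar[OF v] by (simp add: v'_def)
    have par_line: "statepar (w + t *\<^sub>R v') = z + t *\<^sub>R v" for t
      using statepar_linear v' zw by (simp add: linear_simps)
    have "open (statepar -` (mis \<times> TJ) \<inter> statepar -` (- K))"
      using compact_imp_closed[OF K(1)]
      by (intro open_Int open_statepar_vimage[OF TJ] continuous_open_vimage[of "- K"] linear_continuous_at statepar_linear) auto
    then have "open ((\<lambda>t. w + t *\<^sub>R v') -` (statepar -` (mis \<times> TJ) \<inter> statepar -` (- K)))"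
      by (intro continuous_open_vimage continuous_intros)
    moreover have "((\<lambda>t. \<phi> (z + t *\<^sub>R v)) has_derivative (\<lambda>h. ddir (h *\<^sub>R v) \<phi> (z + 0 *\<^sub>R v))) (at 0)"
      by (rule has_derivative_compose[of _ _ _ _ \<phi> "\<lambda>h. ddir h \<phi> (z + 0 *\<^sub>R v)"])
        (auto intro!: derivative_eq_intros smooth_has_derivative s)
    ultimately have "((\<lambda>t. 0) has_derivative (\<lambda>h. ddir (h *\<^sub>R v) \<phi> (z + 0 *\<^sub>R v))) (at 0)"
      by (elim has_derivative_transform_within_open) (use z K(3) zw par_line in \<open>auto simp: vimage_def simp del: split_paired_All\<close>)
    from has_derivative_unique[OF this has_derivative_const] have "ddir (1 *\<^sub>R v) \<phi> (z + 0 *\<^sub>R v) = 0"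
      by metis
    then show ?thesis by simp
  qed
  then have "test_function TJ (ddir v \<phi>)"
    using K smooth_ddir[OF s] by (auto simp: test_function_def)
  then show ?thesis by (rule test_function_bounded_mult[OF TJ h])
qed

section \<open>Differences, uniqueness and representatives of weak derivatives\<close>

lemma has_weak_deriv_diff:
  assumes TJ: "open TJ" and v: "v \<in> dirs" and 1: "has_weak_deriv TJ v g1 h1" and 2: "has_weak_deriv TJ v g2 h2"
  shows "has_weak_deriv TJ v (\<lambda>z. g1 z - g2 z) (\<lambda>z. h1 z - h2 z)"
  unfolding has_weak_deriv_def
proof (intro conjI allI impI)
  have l: "loc_integrable TJ g1" "loc_integrable TJ g2" "loc_integrable TJ h1" "loc_integrable TJ h2"
    using 1 2 by (auto simp: has_weak_deriv_def)
  then show "loc_integrable TJ (\<lambda>z. g1 z - g2 z)" "loc_integrable TJ (\<lambda>z. h1 z - h2 z)"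
    by (auto intro: loc_integrable_diff)
  fix \<phi> assume t: "test_function TJ \<phi>"
  note i = test_function_ddir_mult[OF TJ _ t v] test_function_bounded_mult[OF TJ _ t]
  show "(\<integral>z. (g1 z - g2 z) * ddir v \<phi> z \<partial>vol TJ) = - (\<integral>z. (h1 z - h2 z) * \<phi> z \<partial>vol TJ)"
    using 1 2 t l by (simp add: left_diff_distrib i has_weak_deriv_def)
qed

text \<open>The difference of two weak derivatives of the same function integrates to zero against
  every test function.\<close>

lemma has_weak_deriv_unique:
  assumes TJ: "open TJ" and 1: "has_weak_deriv TJ v g h1" and 2: "has_weak_deriv TJ v g h2"
  shows "AE z in vol TJ. h1 z = h2 z"
proof -
  have l: "loc_integrable TJ h1" "loc_integrable TJ h2"
    using 1 2 by (auto simp: has_weak_deriv_def)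
  have "AE z in vol TJ. h1 z - h2 z = 0"
  proof (rule AE_zero_if_test_integrals_zero[OF TJ loc_integrable_diff[OF l]])
    fix \<phi> assume t: "test_function TJ \<phi>"
    show "(\<integral>z. (h1 z - h2 z) * \<phi> z \<partial>vol TJ) = 0"
      using 1 2 t test_function_bounded_mult[OF TJ l(1) t] test_function_bounded_mult[OF TJ l(2) t]
      by (simp add: left_diff_distrib has_weak_deriv_def)
  qed
  then show ?thesis by eventually_elim simp
qed

lemma has_weak_deriv_cong_AE:
  assumes TJ: "open TJ" and 1: "has_weak_deriv TJ v g h" and v: "v \<in> dirs"
    and g: "AE z in vol TJ. g z = g' z" "g' \<in> borel_measurable (vol TJ)"
  shows "has_weak_deriv TJ v g' h"
  unfolding has_weak_deriv_def
proof (intro conjI allI impI)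
  have l: "loc_integrable TJ g" "loc_integrable TJ h" using 1 by (auto simp: has_weak_deriv_def)
  show "loc_integrable TJ h" by fact
  show l': "loc_integrable TJ g'" using loc_integrable_cong_AE[OF l(1) g(2,1) TJ] .
  fix \<phi> assume t: "test_function TJ \<phi>"
  have "(\<integral>z. g' z * ddir v \<phi> z \<partial>vol TJ) = (\<integral>z. g z * ddir v \<phi> z \<partial>vol TJ)"
    using g(1) by (intro integral_cong_AE borel_measurable_integrable test_function_ddir_mult[OF TJ _ t v] l l') auto
  then show "(\<integral>z. g' z * ddir v \<phi> z \<partial>vol TJ) = - (\<integral>z. h z * \<phi> z \<partial>vol TJ)"
    using 1 t by (simp add: has_weak_deriv_def)
qed

text \<open>\<open>weak_deriv\<close> is a choice and is determined only almost everywhere. The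
  existence of some weak derivative makes the chosen one genuine and equal to any other up to a null
  set.\<close>

lemma weak_deriv_AE:
  assumes "open TJ" "has_weak_deriv TJ v g h"
  shows "AE z in vol TJ. weak_deriv TJ v g z = h z" "has_weak_deriv TJ v g (weak_deriv TJ v g)"
proof -
  show "has_weak_deriv TJ v g (weak_deriv TJ v g)"
    unfolding weak_deriv_def by (rule someI[of "has_weak_deriv TJ v g" h, OF assms(2)])
  then show "AE z in vol TJ. weak_deriv TJ v g z = h z"
    using has_weak_deriv_unique assms by blast
qed

lemma has_weak_deriv_measurable: "has_weak_deriv TJ v g h \<Longrightarrow> g \<in> borel_measurable (vol TJ) \<and> h \<in> borel_measurable (vol TJ)"
  by (simp add: has_weak_deriv_def loc_integrable_def)

lemma AE_expvol: "open TJ \<Longrightarrow> E \<in> borel_measurable (vol TJ) \<Longrightarrow> (AE z in expvol TJ E. P z) \<longleftrightarrow> (AE z in vol TJ. P z)"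
  unfolding expvol_def by (subst AE_density) auto

lemma sets_expvol [simp, measurable_cong]: "sets (expvol TJ E) = sets (vol TJ)"
  by (simp add: expvol_def)

lemma L2_cong_AE:
  assumes "f \<in> L2 M" "AE z in M. f z = g z" "g \<in> borel_measurable M"
  shows "g \<in> L2 M" "L2norm M g = L2norm M f"
proof -
  have i: "integrable M (\<lambda>z. (f z)\<^sup>2)" "f \<in> borel_measurable M" using assms by (auto simp: L2_def)
  have "integrable M (\<lambda>z. (g z)\<^sup>2)"
    by (rule Bochner_Integration.integrable_cong_AE_imp[OF i(1)]) (use assms in auto)
  then show "g \<in> L2 M" using assms by (simp add: L2_def)
  show "L2norm M g = L2norm M f" unfolding L2norm_def
    by (intro arg_cong[where f = sqrt] integral_cong_AE) (use assms i in auto)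
qed

text \<open>Membership in \<open>H2\<close> supplies witnesses \<open>h\<close> and
  \<open>k\<close>, with \<open>k\<close> a derivative of \<open>h\<close>, whereas
  \<open>H2norm\<close> and \<open>generator\<close> use iterated chosen derivatives. Almost
  everywhere uniqueness transfers the second derivative from \<open>h\<close> to the chosen
  representative.\<close>

lemma H2_weak_derivs:
  assumes TJ: "open TJ" and w: "W \<in> borel_measurable (vol TJ)" and g: "g \<in> H2 (expvol TJ W) TJ" and v: "v \<in> dirs"
  shows "has_weak_deriv TJ v g (weak_deriv TJ v g)" "weak_deriv TJ v g \<in> L2 (expvol TJ W)"
    and "u \<in> dirs \<Longrightarrow> has_weak_deriv TJ u (weak_deriv TJ v g) (weak_deriv TJ u (weak_deriv TJ v g))"
    and "u \<in> dirs \<Longrightarrow> weak_deriv TJ u (weak_deriv TJ v g) \<in> L2 (expvol TJ W)"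
proof -
  obtain h where h: "h \<in> L2 (expvol TJ W)" "has_weak_deriv TJ v g h"
      "\<And>u. u \<in> dirs \<Longrightarrow> \<exists>k\<in>L2 (expvol TJ W). has_weak_deriv TJ u h k"
    using g v unfolding H2_def by blast
  note a = weak_deriv_AE[OF TJ h(2)]
  have m: "weak_deriv TJ v g \<in> borel_measurable (vol TJ)" using has_weak_deriv_measurable[OF a(2)] by simp
  show "has_weak_deriv TJ v g (weak_deriv TJ v g)" by (rule a(2))
  have ae: "AE z in vol TJ. h z = weak_deriv TJ v g z" using a(1) by eventually_elim simp
  show "weak_deriv TJ v g \<in> L2 (expvol TJ W)"
    by (rule L2_cong_AE(1)[OF h(1)]) (use ae m AE_expvol[OF TJ w] in \<open>auto cong: measurable_cong_sets\<close>)
  assume u: "u \<in> dirs"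
  obtain k where k: "k \<in> L2 (expvol TJ W)" "has_weak_deriv TJ u h k" using h(3) u by blast
  have hk: "has_weak_deriv TJ u (weak_deriv TJ v g) k"
    by (rule has_weak_deriv_cong_AE[OF TJ k(2) u ae m])
  note b = weak_deriv_AE[OF TJ hk]
  show "has_weak_deriv TJ u (weak_deriv TJ v g) (weak_deriv TJ u (weak_deriv TJ v g))" by (rule b(2))
  have bm: "weak_deriv TJ u (weak_deriv TJ v g) \<in> borel_measurable (vol TJ)" using has_weak_deriv_measurable[OF b(2)] by simp
  have "AE z in vol TJ. k z = weak_deriv TJ u (weak_deriv TJ v g) z" using b(1) by eventually_elim simp
  then show "weak_deriv TJ u (weak_deriv TJ v g) \<in> L2 (expvol TJ W)"
    by (intro L2_cong_AE(1)[OF k(1)]) (use bm AE_expvol[OF TJ w] in \<open>auto cong: measurable_cong_sets\<close>)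
qed

lemma L2norm_cong_AE:
  assumes "AE z in M. f z = g z" "f \<in> borel_measurable M" "g \<in> borel_measurable M"
  shows "L2norm M g = L2norm M f"
  unfolding L2norm_def by (intro arg_cong[where f = sqrt] integral_cong_AE) (use assms in auto)

lemma H2norm_components:
  "L2norm M g \<le> H2norm M TJ g"
  "v \<in> dirs \<Longrightarrow> L2norm M (weak_deriv TJ v g) \<le> H2norm M TJ g"
  "v \<in> dirs \<Longrightarrow> u \<in> dirs \<Longrightarrow> L2norm M (weak_deriv TJ u (weak_deriv TJ v g)) \<le> H2norm M TJ g"
proof -
  let ?a = "(L2norm M g)\<^sup>2" and ?b = "\<Sum>v\<in>dirs. (L2norm M (weak_deriv TJ v g))\<^sup>2"
    and ?c = "\<Sum>v\<in>dirs. \<Sum>w\<in>dirs. (L2norm M (weak_deriv TJ w (weak_deriv TJ v g)))\<^sup>2"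
  have nn: "0 \<le> ?a" "0 \<le> ?b" "0 \<le> ?c" by (auto intro!: sum_nonneg)
  show "L2norm M g \<le> H2norm M TJ g"
    unfolding H2norm_def using nn by (intro real_le_rsqrt) linarith
  show "L2norm M (weak_deriv TJ v g) \<le> H2norm M TJ g" if "v \<in> dirs"
  proof -
    have "(L2norm M (weak_deriv TJ v g))\<^sup>2 \<le> ?b"
      by (rule member_le_sum[OF that]) (auto simp: finite_dirs)
    then show ?thesis unfolding H2norm_def using nn by (intro real_le_rsqrt) linarith
  qed
  show "L2norm M (weak_deriv TJ u (weak_deriv TJ v g)) \<le> H2norm M TJ g" if "v \<in> dirs" "u \<in> dirs"
  proof -
    have "(L2norm M (weak_deriv TJ u (weak_deriv TJ v g)))\<^sup>2 \<le> (\<Sum>w\<in>dirs. (L2norm M (weak_deriv TJ w (weak_deriv TJ v g)))\<^sup>2)"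
      by (rule member_le_sum[OF that(2)]) (auto simp: finite_dirs)
    also have "\<dots> \<le> ?c"
      by (rule member_le_sum[OF that(1)]) (auto simp: finite_dirs intro!: sum_nonneg)
    finally show ?thesis unfolding H2norm_def using nn by (intro real_le_rsqrt) linarith
  qed
qed

text \<open>\<open>H2norm\<close> of the difference is defined by derivatives chosen for the
  difference. By uniqueness they agree almost everywhere with the classical derivatives of
  \<open>\<phi>\<close> minus those chosen for \<open>g\<close>, so convergence in
  \<open>H2norm\<close> controls each derivative separately.\<close>

lemma H2norm_smooth_diff:
  assumes TJ: "open TJ" "bounded TJ" and w: "W \<in> borel_measurable (vol TJ)" and g: "g \<in> H2 (expvol TJ W) TJ"
    and \<phi>: "smooth_on UNIV \<phi>"
  defines "M \<equiv> expvol TJ W"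
  shows "L2norm M (\<lambda>z. \<phi> z - g z) \<le> H2norm M TJ (\<lambda>z. \<phi> z - g z)"
    and "v \<in> dirs \<Longrightarrow> L2norm M (\<lambda>z. ddir v \<phi> z - weak_deriv TJ v g z) \<le> H2norm M TJ (\<lambda>z. \<phi> z - g z)"
    and "v \<in> dirs \<Longrightarrow> u \<in> dirs \<Longrightarrow> L2norm M (\<lambda>z. ddir u (ddir v \<phi>) z - weak_deriv TJ u (weak_deriv TJ v g) z)
          \<le> H2norm M TJ (\<lambda>z. \<phi> z - g z)"
proof -
  show "L2norm M (\<lambda>z. \<phi> z - g z) \<le> H2norm M TJ (\<lambda>z. \<phi> z - g z)" by (rule H2norm_components)
  assume v: "v \<in> dirs"
  note d = H2_weak_derivs[OF TJ(1) w g v]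
  have h1: "has_weak_deriv TJ v (\<lambda>z. \<phi> z - g z) (\<lambda>z. ddir v \<phi> z - weak_deriv TJ v g z)"
    by (intro has_weak_deriv_diff TJ v smooth_has_weak_deriv \<phi> d(1))
  note a = weak_deriv_AE[OF TJ(1) h1]
  note m = has_weak_deriv_measurable[OF h1] has_weak_deriv_measurable[OF a(2)]
  have "L2norm M (\<lambda>z. ddir v \<phi> z - weak_deriv TJ v g z) = L2norm M (weak_deriv TJ v (\<lambda>z. \<phi> z - g z))"
    unfolding M_def
    by (intro L2norm_cong_AE) (use a(1) m AE_expvol[OF TJ(1) w] in \<open>auto cong: measurable_cong_sets\<close>)
  also have "\<dots> \<le> H2norm M TJ (\<lambda>z. \<phi> z - g z)" by (rule H2norm_components(2)[OF v])
  finally show "L2norm M (\<lambda>z. ddir v \<phi> z - weak_deriv TJ v g z) \<le> H2norm M TJ (\<lambda>z. \<phi> z - g z)" .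
  assume u: "u \<in> dirs"
  have h2: "has_weak_deriv TJ u (\<lambda>z. ddir v \<phi> z - weak_deriv TJ v g z) (\<lambda>z. ddir u (ddir v \<phi>) z - weak_deriv TJ u (weak_deriv TJ v g) z)"
    by (intro has_weak_deriv_diff TJ u smooth_has_weak_deriv smooth_ddir \<phi> d(3))
  have a': "AE z in vol TJ. ddir v \<phi> z - weak_deriv TJ v g z = weak_deriv TJ v (\<lambda>z. \<phi> z - g z) z"
    using a(1) by eventually_elim simp
  \<comment> \<open>The second derivative inside \<open>H2norm\<close> is taken of the chosen first
    derivative, which is why \<open>h2\<close> is transported along \<open>a'\<close>.\<close>
  have h3: "has_weak_deriv TJ u (weak_deriv TJ v (\<lambda>z. \<phi> z - g z)) (\<lambda>z. ddir u (ddir v \<phi>) z - weak_deriv TJ u (weak_deriv TJ v g) z)"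
    by (rule has_weak_deriv_cong_AE[OF TJ(1) h2 u a']) (use m in auto)
  note b = weak_deriv_AE[OF TJ(1) h3]
  note m = has_weak_deriv_measurable[OF h3] has_weak_deriv_measurable[OF b(2)]
  have "L2norm M (\<lambda>z. ddir u (ddir v \<phi>) z - weak_deriv TJ u (weak_deriv TJ v g) z) = L2norm M (weak_deriv TJ u (weak_deriv TJ v (\<lambda>z. \<phi> z - g z)))"
    unfolding M_def
    by (intro L2norm_cong_AE) (use b(1) m AE_expvol[OF TJ(1) w] in \<open>auto cong: measurable_cong_sets\<close>)
  also have "\<dots> \<le> H2norm M TJ (\<lambda>z. \<phi> z - g z)" by (rule H2norm_components(3)[OF v u])
  finally show "L2norm M (\<lambda>z. ddir u (ddir v \<phi>) z - weak_deriv TJ u (weak_deriv TJ v g) z) \<le> H2norm M TJ (\<lambda>z. \<phi> z - g z)" .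
qed

section \<open>One-dimensional Hausdorff measure\<close>

definition small_covers :: "real \<Rightarrow> 'a::metric_space set \<Rightarrow> (nat \<Rightarrow> 'a set) set" where
  "small_covers \<delta> A = {U. A \<subseteq> (\<Union>i. U i) \<and> (\<forall>i. bounded (U i) \<and> diameter (U i) \<le> \<delta>)}"

definition hausdorff1_pre :: "real \<Rightarrow> 'a::metric_space set \<Rightarrow> ennreal" where
  "hausdorff1_pre \<delta> A = (INF U\<in>small_covers \<delta> A. \<Sum>i. ennreal (diameter (U i)))"

lemma hausdorff1_outer_pre: "hausdorff1_outer A = (SUP \<delta>\<in>{0<..}. hausdorff1_pre \<delta> A)"
  by (simp add: hausdorff1_outer_def hausdorff1_pre_def small_covers_def)

lemma hausdorff1_pre_le: "\<delta> > 0 \<Longrightarrow> hausdorff1_pre \<delta> A \<le> hausdorff1_outer A"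
  unfolding hausdorff1_outer_pre by (intro SUP_upper) auto

lemma hausdorff1_pre_antimono: "\<delta> \<le> \<delta>' \<Longrightarrow> hausdorff1_pre \<delta>' A \<le> hausdorff1_pre \<delta> A"
  unfolding hausdorff1_pre_def by (rule INF_superset_mono) (auto simp: small_covers_def intro: order_trans)

lemma hausdorff1_outer_empty: "hausdorff1_outer {} = 0"
proof -
  have "hausdorff1_pre \<delta> ({}::'a set) = 0" if "\<delta> > 0" for \<delta>
  proof -
    have "hausdorff1_pre \<delta> ({}::'a set) \<le> (\<Sum>i::nat. ennreal (diameter ({}::'a set)))"
      unfolding hausdorff1_pre_def by (rule INF_lower) (use that in \<open>auto simp: small_covers_def\<close>)
    then show ?thesis by simp
  qed
  then show ?thesis unfolding hausdorff1_outer_pre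
    by (intro antisym SUP_least) auto
qed

lemma hausdorff1_outer_mono: "A \<subseteq> B \<Longrightarrow> hausdorff1_outer A \<le> hausdorff1_outer B"
  unfolding hausdorff1_outer_pre hausdorff1_pre_def
  by (intro SUP_mono' INF_superset_mono) (auto simp: small_covers_def)

text \<open>Covers of the single sets that are optimal up to \<open>e / 2^(n+1)\<close> are merged
  into one cover of the union, enumerated through \<open>prod_decode\<close>.\<close>

lemma hausdorff1_pre_subadditive:
  fixes A :: "nat \<Rightarrow> 'a::metric_space set"
  shows "hausdorff1_pre \<delta> (\<Union>n. A n) \<le> (\<Sum>n. hausdorff1_pre \<delta> (A n))"
proof (rule ennreal_le_epsilon)
  fix e :: real assume fin: "(\<Sum>n. hausdorff1_pre \<delta> (A n)) < top" and e: "0 < e"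
  have "\<exists>U\<in>small_covers \<delta> (A n). (\<Sum>i. ennreal (diameter (U i))) \<le> hausdorff1_pre \<delta> (A n) + ennreal (e * (1/2)^Suc n)" for n
  proof -
    have "hausdorff1_pre \<delta> (A n) < top" using ennreal_suminf_lessD[OF fin] .
    then have "hausdorff1_pre \<delta> (A n) < hausdorff1_pre \<delta> (A n) + ennreal (e * (1/2)^Suc n)"
      using e by (simp add: ennreal_add_left_cancel_less)
    then obtain U where "U \<in> small_covers \<delta> (A n)" "(\<Sum>i. ennreal (diameter (U i))) < hausdorff1_pre \<delta> (A n) + ennreal (e * (1/2)^Suc n)"
      unfolding hausdorff1_pre_def by (subst (asm) (1) INF_less_iff) auto
    then show ?thesis by (auto intro: less_imp_le)
  qed
  then obtain U where U: "\<And>n. U n \<in> small_covers \<delta> (A n)"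
    "\<And>n. (\<Sum>i. ennreal (diameter (U n i))) \<le> hausdorff1_pre \<delta> (A n) + ennreal (e * (1/2)^Suc n)"
    by metis
  define V where "V k = (case prod_decode k of (n, i) \<Rightarrow> U n i)" for k
  have "(\<Union>n. A n) \<subseteq> (\<Union>k. V k)"
  proof safe
    fix x n assume "x \<in> A n"
    then obtain i where "x \<in> U n i" using U(1)[of n] by (auto simp: small_covers_def)
    then have "x \<in> V (prod_encode (n, i))" by (simp add: V_def)
    then show "x \<in> (\<Union>k. V k)" by blast
  qed
  then have "V \<in> small_covers \<delta> (\<Union>n. A n)"
    using U(1) by (auto simp: small_covers_def V_def split: prod.split)
  then have "hausdorff1_pre \<delta> (\<Union>n. A n) \<le> (\<Sum>k. ennreal (diameter (V k)))"
    unfolding hausdorff1_pre_def by (rule INF_lower)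
  also have "\<dots> = (\<Sum>k. (case_prod (\<lambda>n i. ennreal (diameter (U n i)))) (prod_decode k))"
    by (intro suminf_cong) (simp add: V_def split: prod.split)
  also have "\<dots> = (\<Sum>n. \<Sum>i. ennreal (diameter (U n i)))"
    by (rule suminf_ennreal_2dimen) simp
  also have "\<dots> \<le> (\<Sum>n. hausdorff1_pre \<delta> (A n) + ennreal (e * (1/2)^Suc n))"
    by (intro suminf_le U) auto
  also have "\<dots> = (\<Sum>n. hausdorff1_pre \<delta> (A n)) + (\<Sum>n. ennreal (e * (1/2)^Suc n))"
    by (rule suminf_add[symmetric]) auto
  also have "(\<Sum>n. ennreal (e * (1/2)^Suc n)) = ennreal e"
    using sums_mult[OF power_half_series, of e] e by (intro suminf_ennreal_eq) auto
  finally show "hausdorff1_pre \<delta> (\<Union>n. A n) \<le> (\<Sum>n. hausdorff1_pre \<delta> (A n)) + ennreal e" .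
qed

lemma hausdorff1_outer_subadditive:
  fixes A :: "nat \<Rightarrow> 'a::metric_space set"
  shows "hausdorff1_outer (\<Union>n. A n) \<le> (\<Sum>n. hausdorff1_outer (A n))"
proof -
  have "hausdorff1_pre \<delta> (\<Union>n. A n) \<le> (\<Sum>n. hausdorff1_outer (A n))" if "\<delta> > 0" for \<delta>
    by (rule order_trans[OF hausdorff1_pre_subadditive]) (intro suminf_le hausdorff1_pre_le that, auto)
  then show ?thesis by (subst hausdorff1_outer_pre) (auto intro!: SUP_least)
qed

lemma hausdorff1_outer_Un: "hausdorff1_outer (A \<union> B) \<le> hausdorff1_outer A + hausdorff1_outer B"
proof -
  define F where "F = (\<lambda>n::nat. if n = 0 then A else if n = 1 then B else {})"
  have "A \<union> B = (\<Union>n. F n)"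
    by (auto simp: F_def split: if_splits)
  then have "hausdorff1_outer (A \<union> B) \<le> (\<Sum>n. hausdorff1_outer (F n))"
    using hausdorff1_outer_subadditive[of F] by simp
  also have "\<dots> = (\<Sum>n\<in>{0, 1}. hausdorff1_outer (F n))"
    by (rule suminf_finite) (auto simp: F_def hausdorff1_outer_empty)
  finally show ?thesis by (simp add: F_def)
qed

text \<open>The metric property of the outer measure: once the mesh is finer than \<open>d\<close>,
  no covering set meets both \<open>A\<close> and \<open>B\<close>, so every cover of the union
  splits into covers of the two parts.\<close>

lemma hausdorff1_outer_separated:
  fixes A B :: "'a::metric_space set"
  assumes d: "d > 0" "\<And>x y. x \<in> A \<Longrightarrow> y \<in> B \<Longrightarrow> d \<le> dist x y"
  shows "hausdorff1_outer A + hausdorff1_outer B \<le> hausdorff1_outer (A \<union> B)"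
proof -
  have *: "hausdorff1_pre \<delta>1 A + hausdorff1_pre \<delta>2 B \<le> hausdorff1_outer (A \<union> B)" if "\<delta>1 > 0" "\<delta>2 > 0" for \<delta>1 \<delta>2
  proof -
    \<comment> \<open>Half of \<open>d\<close> keeps the mesh strictly below the separation.\<close>
    define \<delta> where "\<delta> = min (min \<delta>1 \<delta>2) (d / 2)"
    have \<delta>: "\<delta> > 0" "\<delta> \<le> \<delta>1" "\<delta> \<le> \<delta>2" "\<delta> < d" using d that by (auto simp: \<delta>_def)
    have "hausdorff1_pre \<delta> A + hausdorff1_pre \<delta> B \<le> hausdorff1_pre \<delta> (A \<union> B)"
      unfolding hausdorff1_pre_def[of _ "A \<union> B"]
    proof (rule INF_greatest)
      fix U assume U: "U \<in> small_covers \<delta> (A \<union> B)"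
      define UA where "UA i = (if U i \<inter> A = {} then {} else U i)" for i
      define UB where "UB i = (if U i \<inter> B = {} then {} else U i)" for i
      have "UA \<in> small_covers \<delta> A" "UB \<in> small_covers \<delta> B"
        using U \<delta> by (fastforce simp: small_covers_def UA_def UB_def)+
      then have "hausdorff1_pre \<delta> A + hausdorff1_pre \<delta> B \<le> (\<Sum>i. ennreal (diameter (UA i))) + (\<Sum>i. ennreal (diameter (UB i)))"
        unfolding hausdorff1_pre_def by (intro add_mono INF_lower)
      also have "\<dots> = (\<Sum>i. ennreal (diameter (UA i)) + ennreal (diameter (UB i)))"
        by (rule suminf_add) auto
      also have "\<dots> \<le> (\<Sum>i. ennreal (diameter (U i)))"
      proof (intro suminf_le)
        fix i
        have "U i \<inter> A = {} \<or> U i \<inter> B = {}"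
        proof (rule ccontr)
          assume "\<not> ?thesis"
          then obtain x y where "x \<in> U i" "x \<in> A" "y \<in> U i" "y \<in> B" by auto
          moreover have "dist x y \<le> diameter (U i)"
            using U \<open>x \<in> U i\<close> \<open>y \<in> U i\<close> by (intro diameter_bounded_bound) (auto simp: small_covers_def)
          moreover have "diameter (U i) \<le> \<delta>" using U by (auto simp: small_covers_def)
          ultimately show False using d(2)[of x y] \<delta>(4) by linarith
        qed
        then show "ennreal (diameter (UA i)) + ennreal (diameter (UB i)) \<le> ennreal (diameter (U i))"
          by (auto simp: UA_def UB_def)
      qed auto
      finally show "hausdorff1_pre \<delta> A + hausdorff1_pre \<delta> B \<le> (\<Sum>i. ennreal (diameter (U i)))" .
    qed
    then show ?thesis
      using hausdorff1_pre_antimono[OF \<delta>(2), of A] hausdorff1_pre_antimono[OF \<delta>(3), of B] hausdorff1_pre_le[OF \<delta>(1), of "A \<union> B"]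
      by (meson add_mono order_trans)
  qed
  have "hausdorff1_outer A + hausdorff1_pre \<delta>2 B \<le> hausdorff1_outer (A \<union> B)" if "\<delta>2 > 0" for \<delta>2
    unfolding hausdorff1_outer_pre[of A]
    by (subst ennreal_SUP_add_left[symmetric]) (use * that in \<open>auto intro!: SUP_least gt_ex\<close>)
  then show ?thesis
    unfolding hausdorff1_outer_pre[of B]
    by (subst ennreal_SUP_add_right) (auto intro!: SUP_least gt_ex)
qed

section \<open>Borel sets are Caratheodory measurable\<close>

lemma infdist_separated:
  assumes "\<And>x. x \<in> A \<Longrightarrow> a \<le> infdist x C" "\<And>x. x \<in> B \<Longrightarrow> infdist x C \<le> b" "x \<in> A" "y \<in> B"
  shows "a - b \<le> dist x y"
  using assms(1)[OF assms(3)] assms(2)[OF assms(4)] infdist_triangle[of x C y] by linarith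

text \<open>Neighbouring shells may touch, but shells of equal parity are a positive distance apart.
  The sums over even and over odd indices are each at most the outer measure of \<open>X\<close>,
  whence the factor 2.\<close>

lemma hausdorff1_outer_shells:
  fixes R :: "nat \<Rightarrow> 'a::metric_space set"
  assumes R: "\<And>k x. x \<in> R k \<Longrightarrow> 1 / (real k + 2) \<le> infdist x C \<and> infdist x C < 1 / (real k + 1)"
    and X: "\<And>k. R k \<subseteq> X"
  shows "(\<Sum>k. hausdorff1_outer (R k)) \<le> 2 * hausdorff1_outer X"
proof -
  have par: "(\<Sum>j<n. hausdorff1_outer (R (2 * j + c))) \<le> hausdorff1_outer (\<Union>j<n. R (2 * j + c))" for n c
  proof (induction n)
    case (Suc n)
    let ?B = "\<Union>j<n. R (2 * j + c)"
    have 1: "1 / (real (2 * n + c)) \<le> infdist x C" if "x \<in> ?B" for x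
    proof -
      from that obtain j where j: "j < n" "x \<in> R (2 * j + c)" by auto
      have "1 / real (2 * n + c) \<le> 1 / (real (2 * j + c) + 2)"
        using j by (intro divide_left_mono) auto
      then show ?thesis using R[OF j(2)] by linarith
    qed
    have 2: "infdist x C \<le> 1 / (real (2 * n + c) + 1)" if "x \<in> R (2 * n + c)" for x
      using R[OF that] by auto
    have "hausdorff1_outer ?B + hausdorff1_outer (R (2 * n + c)) \<le> hausdorff1_outer (?B \<union> R (2 * n + c))"
    proof (cases "2 * n + c = 0")
      \<comment> \<open>Here \<open>n = 0\<close> and the union is empty; the bound
        \<open>1 / (2 n + c)\<close> would be a division by zero.\<close>
      case True then show ?thesis by (simp add: hausdorff1_outer_empty)
    next
      case False
      show ?thesis
      proof (rule hausdorff1_outer_separated)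
        show "0 < 1 / (real (2 * n + c)) - 1 / (real (2 * n + c) + 1)"
          using False by (simp add: divide_strict_left_mono del: of_nat_add of_nat_mult)
      qed (rule infdist_separated[OF 1 2])
    qed
    then show ?case using Suc by (simp add: lessThan_Suc Un_commute add.commute) (meson add_left_mono order_trans)
  qed simp
  have par': "(\<Sum>j<n. hausdorff1_outer (R (2 * j + c))) \<le> hausdorff1_outer X" for n c
    using par hausdorff1_outer_mono X by (meson UN_least order_trans)
  have "(\<Sum>k<n. hausdorff1_outer (R k)) \<le> 2 * hausdorff1_outer X" for n
  proof -
    have "(\<Sum>k<n. hausdorff1_outer (R k)) \<le> (\<Sum>k<2*n. hausdorff1_outer (R k))"
      by (rule sum_mono2) auto
    also have "\<dots> = (\<Sum>j<n. hausdorff1_outer (R (2 * j + 0))) + (\<Sum>j<n. hausdorff1_outer (R (2 * j + 1)))"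
      by (induction n) (auto simp: add_ac)
    also have "\<dots> \<le> hausdorff1_outer X + hausdorff1_outer X" by (intro add_mono par')
    finally show ?thesis by (simp add: mult_2)
  qed
  then show ?thesis by (intro suminf_le_const) auto
qed

lemma ennreal_suminf_tail:
  fixes f :: "nat \<Rightarrow> ennreal"
  assumes "(\<Sum>k. f k) < top" "e > 0"
  shows "\<exists>n. (\<Sum>k. f (k + n)) < ennreal e"
proof -
  define r where "r k = enn2real (f k)" for k
  have f: "f k = ennreal (r k)" for k
    using ennreal_suminf_lessD[OF assms(1)] by (simp add: r_def)
  have r0: "0 \<le> r k" for k by (simp add: r_def)
  have s: "summable r"
    using assms(1) r0 by (intro summable_suminf_not_top) (auto simp: f)
  obtain n where "norm (\<Sum>i. r (i + n)) < e" using suminf_exist_split[OF assms(2) s] by blast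
  moreover have "(\<Sum>k. f (k + n)) = ennreal (\<Sum>k. r (k + n))"
    unfolding f by (intro suminf_ennreal2 r0) (use s summable_iff_shift in blast)
  ultimately show ?thesis using assms(2) by (auto intro!: exI[of _ n] ennreal_lessI)
qed

text \<open>The part of \<open>X\<close> outside \<open>C\<close> is split into \<open>Xn n\<close>,
  which has positive distance from \<open>C\<close> and is therefore additive with
  \<open>C \<inter> X\<close>, and a tail of shells accumulating at \<open>C\<close>. The tail is
  small because the shells have finite total outer measure.\<close>

lemma closed_caratheodory_hausdorff1:
  fixes C :: "'a::metric_space set"
  assumes "closed C"
  shows "hausdorff1_outer (C \<inter> X) + hausdorff1_outer (- C \<inter> X) \<le> hausdorff1_outer X"
\<comment> \<open>\<open>infdist\<close> to the empty set is zero by convention, and summability of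
  the shells needs finite outer measure of \<open>X\<close>; both exceptional cases are
  immediate.\<close>
proof (cases "C = {} \<or> hausdorff1_outer X = top")
  case True
  then show ?thesis by (auto simp: hausdorff1_outer_empty)
next
  case False
  then have C: "C \<noteq> {}" and fin: "hausdorff1_outer X < top" by (auto simp: less_top)
  define R where "R k = {x\<in>X. 1 / (real k + 2) \<le> infdist x C \<and> infdist x C < 1 / (real k + 1)}" for k :: nat
  define Xn where "Xn n = {x\<in>X. 1 / (real n + 1) \<le> infdist x C}" for n :: nat
  have "(\<Sum>k. hausdorff1_outer (R k)) \<le> 2 * hausdorff1_outer X"
    by (rule hausdorff1_outer_shells[of _ C]) (auto simp: R_def)
  also have "\<dots> < top" using fin by (simp add: ennreal_mult_less_top)
  finally have finR: "(\<Sum>k. hausdorff1_outer (R k)) < top" .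
  show ?thesis
  proof (rule ennreal_le_epsilon)
    fix e :: real assume e: "0 < e"
    obtain n where n: "(\<Sum>k. hausdorff1_outer (R (k + n))) < ennreal e"
      using ennreal_suminf_tail[OF finR e] by blast
    have "- C \<inter> X \<subseteq> Xn n \<union> (\<Union>k. R (k + n))"
    proof
      fix x assume x: "x \<in> - C \<inter> X"
      then have pos: "infdist x C > 0"
        using assms C by (metis ComplD IntD1 in_closed_iff_infdist_zero infdist_nonneg less_eq_real_def)
      show "x \<in> Xn n \<union> (\<Union>k. R (k + n))"
      proof (cases "1 / (real n + 1) \<le> infdist x C")
        case True then show ?thesis using x by (auto simp: Xn_def)
      next
        case False
        obtain N where N: "1 / infdist x C < real N" using reals_Archimedean2 by blast
        define P where "P k \<longleftrightarrow> 1 / (real (k + n) + 2) \<le> infdist x C" for k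
        have "P N"
        proof -
          have N0: "0 < real N" using N pos by (smt (verit) zero_less_divide_1_iff)
          have "1 / (real (N + n) + 2) \<le> 1 / real N"
            using N0 by (intro divide_left_mono) auto
          also have "\<dots> \<le> infdist x C" using N pos N0 by (simp add: field_simps)
          finally show ?thesis by (simp add: P_def)
        qed
        \<comment> \<open>The first admissible index meets the lower bound of its shell. The upper
          bound comes from the failure of the preceding index or, for index zero, from the current
          case.\<close>
        define k where "k = (LEAST k. P k)"
        have Pk: "P k" unfolding k_def using \<open>P N\<close> by (rule LeastI)
        have "infdist x C < 1 / (real (k + n) + 1)"
        proof (cases k)
          case 0 then show ?thesis using False by simp
        next
          case (Suc j)
          then have "\<not> P j" using not_less_Least[of j P] by (simp add: k_def)
          then show ?thesis using Suc by (simp add: P_def add_ac)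
        qed
        then have "x \<in> R (k + n)" using x Pk by (auto simp: R_def P_def)
        then show ?thesis by blast
      qed
    qed
    then have "hausdorff1_outer (- C \<inter> X) \<le> hausdorff1_outer (Xn n \<union> (\<Union>k. R (k + n)))"
      by (rule hausdorff1_outer_mono)
    also have "\<dots> \<le> hausdorff1_outer (Xn n) + hausdorff1_outer (\<Union>k. R (k + n))"
      by (rule hausdorff1_outer_Un)
    also have "\<dots> \<le> hausdorff1_outer (Xn n) + (\<Sum>k. hausdorff1_outer (R (k + n)))"
      by (intro add_left_mono hausdorff1_outer_subadditive)
    also have "\<dots> \<le> hausdorff1_outer (Xn n) + ennreal e"
      using n by (intro add_left_mono) simp
    finally have 1: "hausdorff1_outer (- C \<inter> X) \<le> hausdorff1_outer (Xn n) + ennreal e" .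
    have "hausdorff1_outer (C \<inter> X) + hausdorff1_outer (Xn n) \<le> hausdorff1_outer (C \<inter> X \<union> Xn n)"
    proof (rule hausdorff1_outer_separated)
      show "0 < 1 / (real n + 1)" by simp
      fix x y assume "x \<in> C \<inter> X" "y \<in> Xn n"
      then show "1 / (real n + 1) \<le> dist x y"
        using infdist_triangle[of y C x] infdist_zero[of x C] by (auto simp: Xn_def dist_commute)
    qed
    also have "\<dots> \<le> hausdorff1_outer X" by (rule hausdorff1_outer_mono) (auto simp: Xn_def)
    finally have 2: "hausdorff1_outer (C \<inter> X) + hausdorff1_outer (Xn n) \<le> hausdorff1_outer X" .
    have "hausdorff1_outer (C \<inter> X) + hausdorff1_outer (- C \<inter> X) \<le> hausdorff1_outer (C \<inter> X) + hausdorff1_outer (Xn n) + ennreal e"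
      using 1 by (simp add: add.assoc add_left_mono)
    also have "\<dots> \<le> hausdorff1_outer X + ennreal e" using 2 by (rule add_right_mono)
    finally show "hausdorff1_outer (C \<inter> X) + hausdorff1_outer (- C \<inter> X) \<le> hausdorff1_outer X + ennreal e" .
  qed
qed

text \<open>All closed sets belong to the lambda system of the outer measure, hence all Borel sets
  do. Without countable additivity \<open>measure_of\<close> would return the zero measure, and
  integrals over \<open>hausdorff1\<close> could bound nothing.\<close>

lemma measure_space_hausdorff1: "measure_space UNIV (sets borel) (hausdorff1_outer :: 'a::metric_space set \<Rightarrow> ennreal)"
proof -
  interpret P: sigma_algebra UNIV "Pow UNIV :: 'a set set" by (rule sigma_algebra_Pow)
  have oms: "outer_measure_space (Pow UNIV) (hausdorff1_outer :: 'a set \<Rightarrow> ennreal)"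
    unfolding outer_measure_space_def positive_def increasing_def countably_subadditive_def
    by (auto simp: hausdorff1_outer_empty hausdorff1_outer_mono hausdorff1_outer_subadditive)
  define L where "L = lambda_system UNIV (Pow UNIV) (hausdorff1_outer :: 'a set \<Rightarrow> ennreal)"
  have ms: "measure_space UNIV L hausdorff1_outer"
    unfolding L_def by (rule P.caratheodory_lemma[OF oms])
  have "C \<in> L" if "closed C" for C :: "'a set"
    unfolding L_def lambda_system_def
  proof safe
    fix X :: "'a set"
    have "X = (C \<inter> X) \<union> (- C \<inter> X)" by auto
    then have "hausdorff1_outer X \<le> hausdorff1_outer (C \<inter> X) + hausdorff1_outer (- C \<inter> X)"
      using hausdorff1_outer_Un by metis
    then show "hausdorff1_outer (C \<inter> X) + hausdorff1_outer ((UNIV - C) \<inter> X) = hausdorff1_outer X"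
      using closed_caratheodory_hausdorff1[OF that, of X] by (simp add: Compl_eq_Diff_UNIV)
  qed auto
  then have "sigma_sets UNIV (Collect closed) \<subseteq> L"
    using ms unfolding measure_space_def by (intro sigma_algebra.sigma_sets_subset) auto
  then have sub: "sets borel \<subseteq> L" by (simp add: borel_eq_closed)
  show ?thesis
    using ms sub sets.sigma_algebra_axioms[of "borel :: 'a measure"]
    unfolding measure_space_def countably_additive_def positive_def
    by (metis (no_types, lifting) space_borel subset_trans subsetD)
qed

lemma emeasure_hausdorff1: "A \<in> sets borel \<Longrightarrow> emeasure hausdorff1 A = hausdorff1_outer A"
  using measure_space_hausdorff1 unfolding hausdorff1_def measure_space_def
  by (intro emeasure_measure_of_sigma) auto

lemma sets_hausdorff1 [simp, measurable_cong]: "sets hausdorff1 = sets borel"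
  unfolding hausdorff1_def using sets.sigma_sets_eq[of borel] by (simp add: sets_measure_of_conv)

text \<open>A covering set projects into an interval whose length is at most its diameter, and these
  intervals cover \<open>S\<close>.\<close>

lemma hausdorff1_outer_ge_projection:
  fixes \<pi> :: "'a::metric_space \<Rightarrow> real"
  assumes lip: "\<And>x y. \<bar>\<pi> x - \<pi> y\<bar> \<le> dist x y" and S: "S \<subseteq> \<pi> ` A" "S \<in> sets borel"
  shows "emeasure lborel S \<le> hausdorff1_outer A"
proof -
  \<comment> \<open>One mesh size is enough, since the supremum over all of them only increases the
    right-hand side.\<close>
  have "emeasure lborel S \<le> hausdorff1_pre 1 A"
    unfolding hausdorff1_pre_def
  proof (rule INF_greatest)
    fix U assume U: "U \<in> small_covers 1 A"
    define V where "V i = (if U i = {} then {} else {Inf (\<pi> ` U i)..Sup (\<pi> ` U i)})" for i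
    have osc: "\<pi> x - \<pi> y \<le> diameter (U i)" if "x \<in> U i" "y \<in> U i" for x y i
      using diameter_bounded_bound[of "U i" x y] U that lip[of x y] by (auto simp: small_covers_def)
    have bd: "bounded (\<pi> ` U i)" for i
    proof (cases "U i = {}")
      case False
      then obtain x where "x \<in> U i" by auto
      then have "\<bar>\<pi> y\<bar> \<le> \<bar>\<pi> x\<bar> + diameter (U i)" if "y \<in> U i" for y
        using osc[of y i x] osc[of x i y] that by linarith
      then show ?thesis by (auto simp: bounded_iff)
    qed simp
    have V: "emeasure lborel (V i) \<le> ennreal (diameter (U i))" "\<pi> ` U i \<subseteq> V i" for i
    proof -
      show "\<pi> ` U i \<subseteq> V i"
        using bd[of i] by (auto simp: V_def intro!: cInf_lower cSup_upper bounded_imp_bdd_above bounded_imp_bdd_below)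
      show "emeasure lborel (V i) \<le> ennreal (diameter (U i))"
      proof (cases "U i = {}")
        case False
        have "Sup (\<pi> ` U i) \<le> diameter (U i) + Inf (\<pi> ` U i)"
        proof (rule cSup_least)
          fix a assume "a \<in> \<pi> ` U i"
          then have "a - diameter (U i) \<le> Inf (\<pi> ` U i)"
            using False osc by (intro cInf_greatest) (auto, smt (verit))
          then show "a \<le> diameter (U i) + Inf (\<pi> ` U i)" by simp
        qed (use False in auto)
        then show ?thesis using False by (auto simp: V_def emeasure_lborel_Icc_eq intro!: ennreal_leI)
      qed (simp add: V_def)
    qed
    have "S \<subseteq> (\<Union>i. V i)"
    proof
      fix s assume "s \<in> S"
      then obtain a where a: "a \<in> A" "s = \<pi> a" using S(1) by auto
      then obtain i where "a \<in> U i" using U by (auto simp: small_covers_def)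
      then show "s \<in> (\<Union>i. V i)" using V(2)[of i] a by blast
    qed
    then have "emeasure lborel S \<le> emeasure lborel (\<Union>i. V i)"
      by (intro emeasure_mono) (auto simp: V_def)
    also have "\<dots> \<le> (\<Sum>i. emeasure lborel (V i))"
      by (intro emeasure_subadditive_countably) (auto simp: V_def)
    also have "\<dots> \<le> (\<Sum>i. ennreal (diameter (U i)))"
      by (intro suminf_le V) auto
    finally show "emeasure lborel S \<le> (\<Sum>i. ennreal (diameter (U i)))" .
  qed
  also have "\<dots> \<le> hausdorff1_outer A" by (rule hausdorff1_pre_le) simp
  finally show ?thesis .
qed

text \<open>\<open>\<gamma>\<close> is a section of the projection over \<open>J\<close>: a
  parameter \<open>s\<close> with \<open>\<gamma> s\<close> in \<open>A\<close> is the projection of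
  a point of \<open>A\<close>. So the image of Lebesgue measure on \<open>J\<close> is dominated by
  \<open>hausdorff1\<close>. The comparison is one-sided and carries no speed factor.\<close>

lemma nn_integral_section_le_hausdorff1:
  fixes \<gamma> :: "real \<Rightarrow> 'a::euclidean_space" and G :: "'a \<Rightarrow> ennreal"
  assumes \<gamma>: "\<gamma> \<in> borel_measurable borel" and J: "J \<in> sets borel"
    and lip: "\<And>x y. \<bar>\<pi> x - \<pi> y\<bar> \<le> dist x y" and sec: "\<And>s. s \<in> J \<Longrightarrow> \<pi> (\<gamma> s) = s"
    and G: "G \<in> borel_measurable borel"
  shows "(\<integral>\<^sup>+s\<in>J. G (\<gamma> s) \<partial>lborel) \<le> (\<integral>\<^sup>+z. G z \<partial>hausdorff1)"
proof -
  define N where "N = distr (density lborel (indicator J)) borel \<gamma>"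
  have [measurable]: "\<gamma> \<in> borel_measurable borel" "J \<in> sets borel" "G \<in> borel_measurable borel" by fact+
  have "N \<le> hausdorff1"
  proof (subst le_measure)
    show "sets N = sets hausdorff1" by (simp add: N_def)
    show "\<forall>A\<in>sets N. emeasure N A \<le> emeasure hausdorff1 A"
    proof
      fix A assume "A \<in> sets N"
      then have A [measurable]: "A \<in> sets borel" by (simp add: N_def)
      have m: "\<gamma> -` A \<in> sets borel" using measurable_sets_borel[OF \<gamma> A] .
      have "emeasure N A = emeasure lborel (J \<inter> \<gamma> -` A)"
        using m by (simp add: N_def emeasure_distr emeasure_density flip: indicator_inter_arith)
      also have "\<dots> \<le> hausdorff1_outer A"
      proof (rule hausdorff1_outer_ge_projection[of \<pi>])
        show "J \<inter> \<gamma> -` A \<subseteq> \<pi> ` A"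
        proof
          fix s assume "s \<in> J \<inter> \<gamma> -` A"
          then have "s = \<pi> (\<gamma> s)" "\<gamma> s \<in> A" using sec by auto
          then show "s \<in> \<pi> ` A" by (rule image_eqI)
        qed
      qed (use lip m J in auto)
      finally show "emeasure N A \<le> emeasure hausdorff1 A" using A by (simp add: emeasure_hausdorff1)
    qed
  qed
  then have "nn_integral N G \<le> nn_integral hausdorff1 G"
    by (intro nn_integral_mono_measure) (simp add: N_def)
  also have "nn_integral N G = (\<integral>\<^sup>+s\<in>J. G (\<gamma> s) \<partial>lborel)"
    by (simp add: N_def nn_integral_distr nn_integral_density mult.commute)
  finally show ?thesis .
qed

section \<open>The divergence theorem above a graph\<close>

lemma integrable_bounded_support:
  fixes F :: "'a::euclidean_space \<Rightarrow> real"
  assumes "F \<in> borel_measurable borel" "\<And>z. \<bar>F z\<bar> \<le> B" "bounded K" "\<And>z. z \<notin> K \<Longrightarrow> F z = 0"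
  shows "integrable lborel F"
proof -
  obtain R where "K \<subseteq> ball 0 R" using bounded_subset_ballD[OF assms(3), of 0] by auto
  then have R: "K \<subseteq> cball 0 R" using ball_subset_cball by blast
  show ?thesis
  proof (rule Bochner_Integration.integrable_bound)
  show "integrable lborel (\<lambda>z::'a. indicator (cball 0 R) z * \<bar>B\<bar>)"
    using emeasure_bounded_finite[OF bounded_cball[of "0::'a" R]]
    by (intro integrable_mult_left integrable_real_indicator) (auto simp: less_top)
  show "F \<in> borel_measurable lborel" using assms(1) by simp
  have "\<bar>F z\<bar> \<le> indicator (cball 0 R) z * \<bar>B\<bar>" for z
  proof (cases "z \<in> K")
    case True
    then show ?thesis using R assms(2)[of z] by (auto simp: indicator_def subset_iff)
  qed (use assms(4) in simp)
  then show "AE z in lborel. norm (F z) \<le> norm (indicator (cball 0 R) z * \<bar>B\<bar>)"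
    by (intro AE_I2) (simp add: abs_mult)
  qed
qed

text \<open>The exceptional set will come from the points \<open>x j\<close>, where the weight may
  fail to be differentiable. The gauge integral tolerates finitely many such points; boundedness and
  measurability of \<open>g'\<close> then turn it into a Lebesgue integral.\<close>

lemma lebesgue_ftc_finite_exceptions:
  fixes g g' :: "real \<Rightarrow> real"
  assumes "finite T" "a \<le> b" "continuous_on {a..b} g"
    and d: "\<And>t. t \<in> {a<..<b} - T \<Longrightarrow> (g has_real_derivative g' t) (at t)"
    and m: "g' \<in> borel_measurable borel" and B: "\<And>t. t \<in> {a..b} \<Longrightarrow> \<bar>g' t\<bar> \<le> B"
  shows "(\<integral>t. indicator {a..b} t * g' t \<partial>lborel) = g b - g a"
proof -
  have "integrable lborel (\<lambda>t. indicator {a..b} t * g' t)"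
    by (rule integrable_bounded_support[of _ "\<bar>B\<bar>" "{a..b}"])
      (use m B in \<open>auto simp: indicator_def intro: order_trans[OF _ abs_ge_self]\<close>)
  then have i: "set_integrable lborel {a..b} g'" by (simp add: set_integrable_def)
  have "(g' has_integral (g b - g a)) {a..b}"
    by (rule fundamental_theorem_of_calculus_interior_strong[OF assms(1,2)])
      (use d assms(3) in \<open>auto simp: has_real_derivative_iff_has_vector_derivative\<close>)
  then have "integral {a..b} g' = g b - g a" by (rule integral_unique)
  then show ?thesis
    using set_borel_integral_eq_integral(2)[OF i] by (simp add: set_lebesgue_integral_def)
qed

text \<open>A compactly supported function with gradient \<open>(fs, fy)\<close> off a finite set,
  considered on the region above the graph of \<open>c\<close>. Each result integrates one partial
  derivative only, because the two components of a vector field will be two separate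
  instances.\<close>

locale graph_green =
  fixes T :: "(real \<times> real) set" and f fs fy :: "real \<times> real \<Rightarrow> real" and R B :: real
    and c c' :: "real \<Rightarrow> real"
  assumes T: "finite T"
    and cont: "continuous_on UNIV f"
    and deriv: "\<And>z. z \<notin> T \<Longrightarrow> (f has_derivative (\<lambda>h. fs z * fst h + fy z * snd h)) (at z)"
    and meas [measurable]: "fs \<in> borel_measurable borel" "fy \<in> borel_measurable borel"
    and bnd: "\<And>z. \<bar>fs z\<bar> \<le> B" "\<And>z. \<bar>fy z\<bar> \<le> B"
    and R: "R > 0"
    and supp: "\<And>s y. \<bar>s\<bar> \<ge> R \<or> \<bar>y\<bar> \<ge> R \<Longrightarrow> f (s, y) = 0 \<and> fs (s, y) = 0 \<and> fy (s, y) = 0"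
    and c: "\<And>s. (c has_real_derivative c' s) (at s)" and cc': "continuous_on UNIV c'"
begin

lemma B0: "B \<ge> 0" using bnd(1)[of 0] by linarith

lemma supp_box: "z \<notin> cbox (-R,-R) (R,R) \<Longrightarrow> f z = 0 \<and> fs z = 0 \<and> fy z = 0"
proof -
  assume z: "z \<notin> cbox (-R,-R) (R,R)"
  have "\<bar>fst z\<bar> \<ge> R \<or> \<bar>snd z\<bar> \<ge> R"
  proof (rule ccontr)
    assume "\<not> ?thesis"
    then have "-R \<le> fst z" "fst z \<le> R" "-R \<le> snd z" "snd z \<le> R" by linarith+
    then show False using z by (cases z) (auto simp: mem_box Basis_prod_def)
  qed
  then show ?thesis using supp[of "fst z" "snd z"] by simp
qed

lemma supp_s: "s \<notin> {-R..R} \<Longrightarrow> f (s, y) = 0 \<and> fs (s, y) = 0 \<and> fy (s, y) = 0"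
proof -
  assume "s \<notin> {-R..R}"
  then have "\<bar>s\<bar> \<ge> R" by (simp add: abs_if) linarith
  then show ?thesis using supp[of s y] by blast
qed

lemma cc: "continuous_on UNIV c"
  using c by (meson DERIV_continuous_on has_field_derivative_at_within)

lemma c_meas [measurable]: "c \<in> borel_measurable borel" "c' \<in> borel_measurable borel"
  using cc cc' by (auto intro: borel_measurable_continuous_onI)

lemma integrable_above:
  "integrable lborel (\<lambda>z. indicator {z. c (fst z) < snd z} z * fs z)"
  "integrable lborel (\<lambda>z. indicator {z. c (fst z) < snd z} z * fy z)"
proof -
  have *: "integrable lborel (\<lambda>z. indicator {z. c (fst z) < snd z} z * h z)"
    if [measurable]: "h \<in> borel_measurable borel" and "\<And>z. \<bar>h z\<bar> \<le> B" "\<And>z. z \<notin> cbox (-R,-R) (R,R) \<Longrightarrow> h z = 0"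
    for h :: "real \<times> real \<Rightarrow> real"
  proof (rule integrable_bounded_support[of _ B "cbox (-R,-R) (R,R)"])
    have [measurable]: "{z. c (fst z) < snd z} \<in> sets borel"
      by (intro borel_open open_Collect_less continuous_intros continuous_on_compose2[OF cc]) auto
    show "(\<lambda>z. indicator {z. c (fst z) < snd z} z * h z) \<in> borel_measurable borel" by measurable
    show "\<bar>indicator {z. c (fst z) < snd z} z * h z\<bar> \<le> B" for z
      using that(2)[of z] B0 by (simp add: indicator_def)
    show "indicator {z. c (fst z) < snd z} z * h z = 0" if "z \<notin> cbox (-R,-R) (R,R)" for z
      using \<open>\<And>z. z \<notin> cbox (-R,-R) (R,R) \<Longrightarrow> h z = 0\<close>[OF that] by simp
  qed (rule bounded_cbox)
  show "integrable lborel (\<lambda>z. indicator {z. c (fst z) < snd z} z * fs z)"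
    "integrable lborel (\<lambda>z. indicator {z. c (fst z) < snd z} z * fy z)"
    by (rule *[OF meas(1) bnd(1)], use supp_box in blast) (rule *[OF meas(2) bnd(2)], use supp_box in blast)
qed

lemma deriv_y:
  assumes "(s, y) \<notin> T"
  shows "((\<lambda>y. f (s, y)) has_real_derivative fy (s, y)) (at y)"
proof -
  have "((\<lambda>y. f (s, y)) has_derivative (\<lambda>h. fs (s, y) * fst (0::real, h) + fy (s, y) * snd (0::real, h))) (at y)"
    by (rule has_derivative_compose[of "\<lambda>y. (s, y)" "\<lambda>h. (0, h)" y UNIV f])
      (auto intro!: derivative_eq_intros deriv[OF assms, simplified])
  then show ?thesis by (simp add: has_field_derivative_def)
qed

lemma line_y: "(\<integral>y. indicator {c s<..} y * fy (s, y) \<partial>lborel) = - f (s, c s)"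
proof -
  \<comment> \<open>A height where \<open>f\<close> already vanishes and which is not below the
    graph, even where the graph leaves the square.\<close>
  define b where "b = max R (c s)"
  have fb: "f (s, b) = 0" using supp[of s b] R by (auto simp: b_def)
  have "(\<integral>y. indicator {c s<..} y * fy (s, y) \<partial>lborel) = (\<integral>y. indicator {c s..b} y * fy (s, y) \<partial>lborel)"
  proof (rule integral_cong_AE)
    show "AE y in lborel. indicator {c s<..} y * fy (s, y) = indicator {c s..b} y * fy (s, y)"
      using AE_lborel_singleton[of "c s"]
      by eventually_elim (use supp[of s] R in \<open>auto simp: indicator_def b_def not_le\<close>)
  qed auto
  also have "\<dots> = f (s, b) - f (s, c s)"
  proof (rule lebesgue_ftc_finite_exceptions)
    show "finite ((\<lambda>y. (s, y)) -` T)" using T by (auto intro: finite_vimageI injI)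
    show "continuous_on {c s..b} (\<lambda>y. f (s, y))"
      by (rule continuous_on_compose2[OF cont]) (auto intro!: continuous_intros)
  qed (use deriv_y bnd in \<open>auto simp: b_def\<close>)
  finally show ?thesis using fb by simp
qed

lemma shift: "(\<integral>y. indicator {c s<..} y * h (s, y) \<partial>lborel) = (\<integral>t. indicator {0<..} t * h (s, c s + t) \<partial>lborel)"
  for h :: "real \<times> real \<Rightarrow> real"
  using lborel_integral_real_affine[of 1 "\<lambda>y. indicator {c s<..} y * h (s, y)" "c s"]
  by (simp add: indicator_def)

text \<open>Along a vertical translate of the graph the total derivative \<open>fs + c' fy\<close>
  integrates to zero by compact support.\<close>

lemma line_s:
  shows "(\<integral>s. fs (s, c s + t) \<partial>lborel) = - (\<integral>s. c' s * fy (s, c s + t) \<partial>lborel)"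
proof -
  obtain C where C: "\<And>s. s \<in> {-R..R} \<Longrightarrow> \<bar>c' s\<bar> \<le> C"
    using compact_imp_bounded[OF compact_continuous_image[OF continuous_on_subset[OF cc' subset_UNIV] compact_Icc[of "-R" R]]]
    unfolding bounded_iff by (metis imageI real_norm_def)
  have C0: "C \<ge> 0" using C[of 0] R by fastforce
  have i1: "integrable lborel (\<lambda>s. fs (s, c s + t))"
    by (rule integrable_bounded_support[of _ B "{-R..R}"]) (use bnd supp_s in auto)
  have b2: "\<bar>c' s * fy (s, c s + t)\<bar> \<le> C * B" for s
  proof (cases "s \<in> {-R..R}")
    case True
    then show ?thesis using C[OF True] bnd(2) C0 by (simp add: abs_mult mult_mono)
  next
    case False
    then have "fy (s, c s + t) = 0" using supp_s by blast
    then show ?thesis using C0 B0 by simp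
  qed
  have i2: "integrable lborel (\<lambda>s. c' s * fy (s, c s + t))"
    by (rule integrable_bounded_support[of _ "C * B" "{-R..R}"]) (use b2 supp_s in auto)
  have "(\<integral>s. fs (s, c s + t) + c' s * fy (s, c s + t) \<partial>lborel) =
      (\<integral>s. indicator {-R..R} s * (fs (s, c s + t) + c' s * fy (s, c s + t)) \<partial>lborel)"
  proof (rule Bochner_Integration.integral_cong)
    fix s
    show "fs (s, c s + t) + c' s * fy (s, c s + t) = indicator {-R..R} s * (fs (s, c s + t) + c' s * fy (s, c s + t))"
      using supp_s[of s "c s + t"] by (cases "s \<in> {-R..R}") (simp_all add: indicator_def)
  qed simp
  also have "\<dots> = f (R, c R + t) - f (-R, c (-R) + t)"
  proof (rule lebesgue_ftc_finite_exceptions)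
    show "finite ((\<lambda>s. (s, c s + t)) -` T)" using T by (auto intro: finite_vimageI injI)
    show "continuous_on {-R..R} (\<lambda>s. f (s, c s + t))"
      by (rule continuous_on_compose2[OF cont]) (auto intro!: continuous_intros continuous_on_subset[OF cc])
    show "((\<lambda>s. f (s, c s + t)) has_real_derivative fs (s, c s + t) + c' s * fy (s, c s + t)) (at s)"
      if "s \<in> {-R<..<R} - (\<lambda>s. (s, c s + t)) -` T" for s
    proof -
      have "((\<lambda>s. f (s, c s + t)) has_derivative (\<lambda>h. fs (s, c s + t) * fst (h, c' s * h) + fy (s, c s + t) * snd (h, c' s * h))) (at s)"
        by (rule has_derivative_compose[of "\<lambda>s. (s, c s + t)" "\<lambda>h. (h, c' s * h)" s UNIV f])
          (use that c[of s] in \<open>auto intro!: derivative_eq_intros deriv simp: has_field_derivative_def\<close>)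
      then show ?thesis unfolding has_field_derivative_def
        by (rule has_derivative_eq_rhs) (auto simp: fun_eq_iff algebra_simps)
    qed
    show "\<bar>fs (s, c s + t) + c' s * fy (s, c s + t)\<bar> \<le> B + C * B" for s
      using bnd(1)[of "(s, c s + t)"] b2[of s] by linarith
  qed (use R in auto)
  also have "\<dots> = 0" using supp[of R "c R + t"] supp[of "-R" "c (-R) + t"] R by simp
  finally show ?thesis using i1 i2 by simp
qed

lemma above_fy: "(\<integral>z. indicator {z. c (fst z) < snd z} z * fy z \<partial>lborel) = - (\<integral>s. f (s, c s) \<partial>lborel)"
proof -
  note i = integrable_above(2)
  have "(\<integral>z. indicator {z. c (fst z) < snd z} z * fy z \<partial>lborel) =
      (\<integral>s. \<integral>y. indicator {z. c (fst z) < snd z} (s, y) * fy (s, y) \<partial>lborel \<partial>lborel)"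
    using lborel_pair.integral_fst'[of "\<lambda>z. indicator {z. c (fst z) < snd z} z * fy z"] i by (simp add: lborel_prod)
  also have "\<dots> = (\<integral>s. \<integral>y. indicator {c s<..} y * fy (s, y) \<partial>lborel \<partial>lborel)"
    by (simp add: indicator_def)
  finally show ?thesis by (simp add: line_y)
qed

text \<open>Flattening by \<open>y = c s + t\<close> and exchanging the order of integration puts
  the \<open>s\<close>-integral along translated graphs, where \<open>line_s\<close> trades
  \<open>fs\<close> for \<open>- c' fy\<close>; after exchanging back, \<open>line_y\<close>
  applies. Together with \<open>above_fy\<close> this produces the unnormalised outer normal
  \<open>(c', -1)\<close>.\<close>

lemma above_fs: "(\<integral>z. indicator {z. c (fst z) < snd z} z * fs z \<partial>lborel) = (\<integral>s. c' s * f (s, c s) \<partial>lborel)"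
proof -
  obtain C where C: "\<And>s. s \<in> {-R..R} \<Longrightarrow> \<bar>c' s\<bar> \<le> C"
    using compact_imp_bounded[OF compact_continuous_image[OF continuous_on_subset[OF cc' subset_UNIV] compact_Icc[of "-R" R]]]
    unfolding bounded_iff by (metis imageI real_norm_def)
  have C0: "C \<ge> 0" using C[of 0] R by fastforce
  obtain A where A: "\<And>s. s \<in> {-R..R} \<Longrightarrow> \<bar>c s\<bar> \<le> A"
    using compact_imp_bounded[OF compact_continuous_image[OF continuous_on_subset[OF cc subset_UNIV] compact_Icc[of "-R" R]]]
    unfolding bounded_iff by (metis imageI real_norm_def)
  \<comment> \<open>The support in flattened coordinates: the bound \<open>A\<close> for
    \<open>c\<close> on \<open>{-R..R}\<close> enlarges the height from \<open>R\<close> to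
    \<open>R + A\<close>.\<close>
  let ?K = "cbox (-R, -(R + A)) (R, R + A)"
  have K: "fs (s, c s + t) = 0 \<and> fy (s, c s + t) = 0" if "(s, t) \<notin> ?K" for s t
  proof (cases "s \<in> {-R..R}")
    case True
    then have "\<bar>t\<bar> > R + A" using that by (auto simp: mem_box Basis_prod_def abs_le_iff)
    then have "\<bar>c s + t\<bar> \<ge> R" using A[OF True] by linarith
    then show ?thesis using supp by blast
  next
    case False
    then show ?thesis using supp_s by blast
  qed
  have [measurable]: "(\<lambda>z. indicator {0<..} (snd z) * fs (fst z, c (fst z) + snd z)) \<in> borel_measurable borel"
    "(\<lambda>z. indicator {0<..} (snd z) * (c' (fst z) * fy (fst z, c (fst z) + snd z))) \<in> borel_measurable borel"
    by (simp_all flip: borel_prod)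
  note i = integrable_above(1)
  have i1: "integrable lborel (\<lambda>z. indicator {0<..} (snd z) * fs (fst z, c (fst z) + snd z))"
  proof (rule integrable_bounded_support[of _ B ?K])
    show "\<bar>indicator {0<..} (snd z) * fs (fst z, c (fst z) + snd z)\<bar> \<le> B" for z :: "real \<times> real"
      using bnd(1) B0 by (simp add: indicator_def)
    show "indicator {0<..} (snd z) * fs (fst z, c (fst z) + snd z) = 0" if "z \<notin> ?K" for z :: "real \<times> real"
      using K[of "fst z" "snd z"] that by simp
  qed (simp_all add: bounded_cbox)
  have i2: "integrable lborel (\<lambda>z. indicator {0<..} (snd z) * (c' (fst z) * fy (fst z, c (fst z) + snd z)))"
  proof (rule integrable_bounded_support[of _ "C * B" ?K])
    show "\<bar>indicator {0<..} (snd z) * (c' (fst z) * fy (fst z, c (fst z) + snd z))\<bar> \<le> C * B" for z :: "real \<times> real"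
    proof (cases "fst z \<in> {-R..R}")
      case True
      then show ?thesis using C[OF True] bnd(2) C0 B0 by (simp add: abs_mult mult_mono indicator_def)
    next
      case False
      then have "fy (fst z, c (fst z) + snd z) = 0" using supp_s by blast
      then show ?thesis using C0 B0 by simp
    qed
    show "indicator {0<..} (snd z) * (c' (fst z) * fy (fst z, c (fst z) + snd z)) = 0" if "z \<notin> ?K" for z :: "real \<times> real"
      using K[of "fst z" "snd z"] that by simp
  qed (simp_all add: bounded_cbox)
  have "(\<integral>z. indicator {z. c (fst z) < snd z} z * fs z \<partial>lborel) =
      (\<integral>s. \<integral>y. indicator {z. c (fst z) < snd z} (s, y) * fs (s, y) \<partial>lborel \<partial>lborel)"
    using lborel_pair.integral_fst'[of "\<lambda>z. indicator {z. c (fst z) < snd z} z * fs z"] i by (simp add: lborel_prod)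
  also have "\<dots> = (\<integral>s. \<integral>y. indicator {c s<..} y * fs (s, y) \<partial>lborel \<partial>lborel)"
    by (simp add: indicator_def)
  also have "\<dots> = (\<integral>s. \<integral>t. indicator {0<..} t * fs (s, c s + t) \<partial>lborel \<partial>lborel)"
    by (simp add: shift)
  also have "\<dots> = (\<integral>t. \<integral>s. indicator {0<..} t * fs (s, c s + t) \<partial>lborel \<partial>lborel)"
    by (rule lborel_pair.Fubini_integral[symmetric]) (use i1 in \<open>simp add: lborel_prod case_prod_unfold\<close>)
  also have "\<dots> = - (\<integral>t. \<integral>s. indicator {0<..} t * (c' s * fy (s, c s + t)) \<partial>lborel \<partial>lborel)"
    by (simp add: line_s)
  also have "(\<integral>t. \<integral>s. indicator {0<..} t * (c' s * fy (s, c s + t)) \<partial>lborel \<partial>lborel) =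
      (\<integral>s. \<integral>t. indicator {0<..} t * (c' s * fy (s, c s + t)) \<partial>lborel \<partial>lborel)"
    by (rule lborel_pair.Fubini_integral) (use i2 in \<open>simp add: lborel_prod case_prod_unfold\<close>)
  also have "\<dots> = (\<integral>s. c' s * \<integral>t. indicator {0<..} t * fy (s, c s + t) \<partial>lborel \<partial>lborel)"
    by (simp add: mult.left_commute[of "indicator _ _"])
  also have "\<dots> = (\<integral>s. c' s * (- f (s, c s)) \<partial>lborel)"
    by (simp add: line_y flip: shift)
  finally show ?thesis by simp
qed

end

section \<open>Frames, multipliers and vector fields in the plane\<close>

lemma orthonormal_2:
  fixes u n :: "real^2"
  assumes "norm u = 1" "norm n = 1" "u \<bullet> n = 0"
  obtains d where "d\<^sup>2 = 1" "n$1 = d * u$2" "n$2 = - d * u$1" "(u$1)\<^sup>2 + (u$2)\<^sup>2 = 1"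
proof -
  have u: "u$1 * u$1 + u$2 * u$2 = 1" using assms(1) by (simp add: norm_eq_1 inner_vec_def sum_2)
  have n: "n$1 * n$1 + n$2 * n$2 = 1" using assms(2) by (simp add: norm_eq_1 inner_vec_def sum_2)
  have un: "u$1 * n$1 + u$2 * n$2 = 0" using assms(3) by (simp add: inner_vec_def sum_2)
  define d where "d = u$2 * n$1 - u$1 * n$2"
  have "d * u$2 = n$1 * (u$1 * u$1 + u$2 * u$2) - u$1 * (u$1 * n$1 + u$2 * n$2)"
    by (simp add: d_def algebra_simps)
  then have 1: "n$1 = d * u$2" using u un by simp
  have "- d * u$1 = n$2 * (u$1 * u$1 + u$2 * u$2) - u$2 * (u$1 * n$1 + u$2 * n$2)"
    by (simp add: d_def algebra_simps)
  then have 2: "n$2 = - d * u$1" using u un by simp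
  have "d\<^sup>2 * (u$1 * u$1 + u$2 * u$2) = 1" using n unfolding 1 2 by (simp add: power2_eq_square algebra_simps)
  then have "d\<^sup>2 = 1" using u by simp
  with 1 2 u that show ?thesis by (simp add: power2_eq_square)
qed

text \<open>By \<open>orthonormal_2\<close>, \<open>n\<close> is a quarter turn of \<open>u\<close>
  in one of the two orientations \<open>d\<close>, which reduces everything to
  \<open>d * d = 1\<close>. The unit Jacobian feeds \<open>lborel_lin_param\<close>, and the
  invariance of the trace lets the divergence be computed in the frame of a boundary chart.\<close>

lemma orthonormal_expand_2:
  fixes u n :: "real^2"
  assumes "norm u = 1" "norm n = 1" "u \<bullet> n = 0"
  shows "z = (u \<bullet> z) *\<^sub>R u + (n \<bullet> z) *\<^sub>R n"
    and "x \<bullet> z = (x \<bullet> u) * (z \<bullet> u) + (x \<bullet> n) * (z \<bullet> n)"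
    and "\<bar>u$1 * n$2 - u$2 * n$1\<bar> = 1"
    and "linear L \<Longrightarrow> L u \<bullet> u + L n \<bullet> n = L (axis 1 1) $ 1 + L (axis 2 1) $ 2"
proof -
  obtain d where d: "d\<^sup>2 = 1" "n$1 = d * u$2" "n$2 = - d * u$1" "(u$1)\<^sup>2 + (u$2)\<^sup>2 = 1"
    using orthonormal_2[OF assms] .
  have dd: "d * (d * x) = x" for x using d(1) by (simp add: power2_eq_square flip: mult.assoc)
  have uu: "u$1 * (u$1 * x) + u$2 * (u$2 * x) = x" for x
    using d(4) by (simp add: power2_eq_square flip: mult.assoc distrib_right)
  have uu': "u$1 * (u$1 * x) = x - u$2 * (u$2 * x)" for x using uu[of x] by linarith
  show *: "z = (u \<bullet> z) *\<^sub>R u + (n \<bullet> z) *\<^sub>R n" for z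
    by (simp add: vec_eq_iff forall_2 inner_vec_def sum_2 d(2,3) algebra_simps dd uu')
  show "x \<bullet> z = (x \<bullet> u) * (z \<bullet> u) + (x \<bullet> n) * (z \<bullet> n)"
    by (subst *[of z]) (simp add: inner_add_right inner_commute mult.commute)
  have "u$1 * n$2 - u$2 * n$1 = - d * ((u$1)\<^sup>2 + (u$2)\<^sup>2)"
    by (simp add: d(2,3) power2_eq_square algebra_simps)
  then have "\<bar>u$1 * n$2 - u$2 * n$1\<bar> = \<bar>d\<bar>" unfolding d(4) by simp
  also have "\<dots> = 1" using d(1) by (auto simp: power2_eq_1_iff)
  finally show "\<bar>u$1 * n$2 - u$2 * n$1\<bar> = 1" .
  assume L: "linear L"
  have e: "x = x$1 *\<^sub>R axis 1 1 + x$2 *\<^sub>R axis 2 1" for x :: "real^2"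
    by (simp add: vec_eq_iff forall_2 axis_def)
  have Le: "L x = x$1 *\<^sub>R L (axis 1 1) + x$2 *\<^sub>R L (axis 2 1)" for x
    by (subst e[of x]) (simp add: linear_add[OF L] linear_cmul[OF L])
  show "L u \<bullet> u + L n \<bullet> n = L (axis 1 1) $ 1 + L (axis 2 1) $ 2"
    unfolding Le[of u] Le[of n] inner_vec_def
    by (simp add: sum_2 d(2,3) algebra_simps dd uu')
qed

text \<open>The multipliers of interest are \<open>w * \<psi> / B\<close> at fixed angles:
  continuous, possibly with kinks at the points \<open>x j\<close>. The gradient \<open>k\<close> is
  set to zero on \<open>T\<close>, so that it vanishes on every open set where
  \<open>\<kappa>\<close> does; it need not extend continuously to \<open>T\<close>, which is why a
  local bound is demanded.\<close>

definition piecewise_C1 :: "(real^2) set \<Rightarrow> (real^2 \<Rightarrow> real) \<Rightarrow> (real^2 \<Rightarrow> real^2) \<Rightarrow> bool" where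
  "piecewise_C1 T \<kappa> k \<longleftrightarrow> finite T \<and> continuous_on UNIV \<kappa> \<and>
     (\<forall>z. z \<notin> T \<longrightarrow> (\<kappa> has_derivative (\<lambda>h. k z \<bullet> h)) (at z)) \<and> (\<forall>z\<in>T. k z = 0) \<and>
     k \<in> borel_measurable borel \<and> (\<forall>R. \<exists>B. \<forall>z\<in>cball 0 R. norm (k z) \<le> B)"

definition C1_field :: "(real^2 \<Rightarrow> real^2) \<Rightarrow> (real^2 \<Rightarrow> real^2 \<Rightarrow> real^2) \<Rightarrow> bool" where
  "C1_field G G' \<longleftrightarrow> (\<forall>z. (G has_derivative G' z) (at z)) \<and> (\<forall>v. continuous_on UNIV (\<lambda>z. G' z v))"

definition dvg :: "(real^2 \<Rightarrow> real^2 \<Rightarrow> real^2) \<Rightarrow> real^2 \<Rightarrow> real" where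
  "dvg G' z = G' z (axis 1 1) $ 1 + G' z (axis 2 1) $ 2"

lemma C1_field_continuous: "C1_field G G' \<Longrightarrow> continuous_on UNIV G"
  unfolding C1_field_def by (meson continuous_at_imp_continuous_on has_derivative_continuous)

lemma piecewise_C1_zero:
  assumes "piecewise_C1 T \<kappa> k" "open V" "z \<in> V" "\<And>z. z \<in> V \<Longrightarrow> \<kappa> z = 0"
  shows "k z = 0"
proof (cases "z \<in> T")
  case True then show ?thesis using assms by (simp add: piecewise_C1_def)
next
  case False
  then have "(\<kappa> has_derivative (\<lambda>h. k z \<bullet> h)) (at z)" using assms by (simp add: piecewise_C1_def)
  then have "((\<lambda>_. 0) has_derivative (\<lambda>h. k z \<bullet> h)) (at z)"
    by (rule has_derivative_transform_within_open[OF _ assms(2,3)]) (use assms(4) in auto)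
  then have "(\<lambda>h. k z \<bullet> h) = (\<lambda>_. 0)" by (rule has_derivative_unique) (rule has_derivative_const)
  then have "k z \<bullet> k z = 0" by metis
  then show ?thesis by simp
qed

text \<open>The integrand is the divergence of \<open>\<kappa> G\<close>. In the frame
  \<open>(u, n)\<close> it is the \<open>u\<close>-derivative of
  \<open>\<kappa> (G \<bullet> u)\<close> plus the \<open>n\<close>-derivative of
  \<open>\<kappa> (G \<bullet> n)\<close>, and each summand is covered by one instance of
  \<open>graph_green\<close>.\<close>

lemma green_above_graph:
  fixes u n p :: "real^2"
  assumes un: "norm u = 1" "norm n = 1" "u \<bullet> n = 0"
    and \<kappa>: "piecewise_C1 T \<kappa> k" and G: "C1_field G G'"
    and supp: "\<And>z. z \<notin> cball p \<rho> \<Longrightarrow> \<kappa> z = 0" and \<rho>: "\<rho> > 0"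
    and c: "\<And>s. (c has_real_derivative c' s) (at s)" and cc': "continuous_on UNIV c'"
  shows "(\<integral>z. indicator {z. c (u \<bullet> (z - p)) < n \<bullet> (z - p)} z * (\<kappa> z * dvg G' z + k z \<bullet> G z) \<partial>lborel) =
      (\<integral>s. \<kappa> (p + s *\<^sub>R u + c s *\<^sub>R n) * (G (p + s *\<^sub>R u + c s *\<^sub>R n) \<bullet> (c' s *\<^sub>R u - n)) \<partial>lborel)"
proof -
  define \<Psi> where "\<Psi> = (\<lambda>z::real\<times>real. p + fst z *\<^sub>R u + snd z *\<^sub>R n)"
  have \<Psi>_cont: "continuous_on A \<Psi>" for A unfolding \<Psi>_def by (intro continuous_intros)
  have \<Psi>m [measurable]: "\<Psi> \<in> borel_measurable borel" using \<Psi>_cont by (rule borel_measurable_continuous_onI)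
  have uu: "u \<bullet> u = 1" "n \<bullet> n = 1" using un by (simp_all add: norm_eq_1)
  have nu: "n \<bullet> u = 0" using un by (simp add: inner_commute)
  have coord: "u \<bullet> (\<Psi> z - p) = fst z" "n \<bullet> (\<Psi> z - p) = snd z" for z
    by (simp_all add: \<Psi>_def inner_add_right uu nu un)
  have \<Psi>d: "(\<Psi> has_derivative (\<lambda>h. fst h *\<^sub>R u + snd h *\<^sub>R n)) (at z)" for z
    unfolding \<Psi>_def by (auto intro!: derivative_eq_intros)
  have inj: "inj \<Psi>" by (rule injI) (metis coord prod_eqI)
  have \<kappa>': "finite T" "continuous_on UNIV \<kappa>" "\<And>z. z \<notin> T \<Longrightarrow> (\<kappa> has_derivative (\<lambda>h. k z \<bullet> h)) (at z)"
    "\<And>z. z \<in> T \<Longrightarrow> k z = 0" and km [measurable]: "k \<in> borel_measurable borel"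
    using \<kappa> by (auto simp: piecewise_C1_def)
  have k0: "k z = 0" if "z \<notin> cball p \<rho>" for z
    by (rule piecewise_C1_zero[OF \<kappa>, of "- cball p \<rho>"]) (use that supp in auto)
  have G': "\<And>z. (G has_derivative G' z) (at z)" "\<And>v. continuous_on UNIV (\<lambda>z. G' z v)"
    and Gc: "continuous_on UNIV G"
    using G C1_field_continuous by (auto simp: C1_field_def)
  obtain Bk where Bk: "\<And>z. z \<in> cball p \<rho> \<Longrightarrow> norm (k z) \<le> Bk"
  proof -
    obtain B where "\<forall>z\<in>cball 0 (norm p + \<rho>). norm (k z) \<le> B" using \<kappa> unfolding piecewise_C1_def by blast
    moreover have "cball p \<rho> \<subseteq> cball 0 (norm p + \<rho>)"
      by (auto simp: dist_norm) (metis add.commute add_le_cancel_left dist_norm norm_minus_commute norm_triangle_sub order_trans)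
    ultimately show ?thesis using that by blast
  qed
  \<comment> \<open>The extra 1 places points with a coordinate of modulus at least \<open>R\<close>
    strictly outside the closed ball, where \<open>\<kappa>\<close> and \<open>k\<close>
    vanish.\<close>
  define R where "R = \<rho> + 1"
  have far: "\<Psi> z \<notin> cball p \<rho>" if "\<bar>fst z\<bar> \<ge> R \<or> \<bar>snd z\<bar> \<ge> R" for z
  proof -
    have "\<bar>fst z\<bar> \<le> norm (\<Psi> z - p)" "\<bar>snd z\<bar> \<le> norm (\<Psi> z - p)"
      using Cauchy_Schwarz_ineq2[of u "\<Psi> z - p"] Cauchy_Schwarz_ineq2[of n "\<Psi> z - p"] un
      by (simp_all add: coord)
    then show ?thesis using that by (auto simp: R_def dist_norm norm_minus_commute)
  qed
  \<comment> \<open>Stated for an arbitrary fixed vector \<open>w\<close>, since it is instantiated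
    with \<open>w = u\<close> and with \<open>w = n\<close>.\<close>
  have main: "graph_green (\<Psi> -` T) (\<lambda>z. \<kappa> (\<Psi> z) * (G (\<Psi> z) \<bullet> w))
      (\<lambda>z. if \<Psi> z \<in> T then 0 else (k (\<Psi> z) \<bullet> u) * (G (\<Psi> z) \<bullet> w) + \<kappa> (\<Psi> z) * (G' (\<Psi> z) u \<bullet> w))
      (\<lambda>z. if \<Psi> z \<in> T then 0 else (k (\<Psi> z) \<bullet> n) * (G (\<Psi> z) \<bullet> w) + \<kappa> (\<Psi> z) * (G' (\<Psi> z) n \<bullet> w)) R B c c'"
    if B: "\<And>z. z \<in> cball p \<rho> \<Longrightarrow> \<bar>(k z \<bullet> u) * (G z \<bullet> w) + \<kappa> z * (G' z u \<bullet> w)\<bar> \<le> B"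
      "\<And>z. z \<in> cball p \<rho> \<Longrightarrow> \<bar>(k z \<bullet> n) * (G z \<bullet> w) + \<kappa> z * (G' z n \<bullet> w)\<bar> \<le> B" for w B
  proof
    have B0: "B \<ge> 0" using B(1)[of p] \<rho> by fastforce
    have [measurable]: "\<kappa> \<in> borel_measurable borel" "G \<in> borel_measurable borel"
       "(\<lambda>z. G' z u) \<in> borel_measurable borel" "(\<lambda>z. G' z n) \<in> borel_measurable borel"
      using \<kappa>' G' Gc by (auto intro: borel_measurable_continuous_onI)
    have [measurable]: "T \<in> sets borel" using \<kappa>'(1) by (simp add: finite_imp_closed)
    show "finite (\<Psi> -` T)" by (intro finite_vimageI \<kappa>' inj)
    show "continuous_on UNIV (\<lambda>z. \<kappa> (\<Psi> z) * (G (\<Psi> z) \<bullet> w))"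
      by (intro continuous_intros continuous_on_compose2[OF \<kappa>'(2)] continuous_on_compose2[OF Gc] \<Psi>_cont) auto
    show "(\<lambda>z. if \<Psi> z \<in> T then 0 else (k (\<Psi> z) \<bullet> u) * (G (\<Psi> z) \<bullet> w) + \<kappa> (\<Psi> z) * (G' (\<Psi> z) u \<bullet> w)) \<in> borel_measurable borel"
      "(\<lambda>z. if \<Psi> z \<in> T then 0 else (k (\<Psi> z) \<bullet> n) * (G (\<Psi> z) \<bullet> w) + \<kappa> (\<Psi> z) * (G' (\<Psi> z) n \<bullet> w)) \<in> borel_measurable borel"
      by measurable
    show "0 < R" using \<rho> by (simp add: R_def)
    show "\<bar>if \<Psi> z \<in> T then 0 else (k (\<Psi> z) \<bullet> u) * (G (\<Psi> z) \<bullet> w) + \<kappa> (\<Psi> z) * (G' (\<Psi> z) u \<bullet> w)\<bar> \<le> B" for z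
      using B(1)[of "\<Psi> z"] k0[of "\<Psi> z"] supp[of "\<Psi> z"] B0 by (cases "\<Psi> z \<in> cball p \<rho>") auto
    show "\<bar>if \<Psi> z \<in> T then 0 else (k (\<Psi> z) \<bullet> n) * (G (\<Psi> z) \<bullet> w) + \<kappa> (\<Psi> z) * (G' (\<Psi> z) n \<bullet> w)\<bar> \<le> B" for z
      using B(2)[of "\<Psi> z"] k0[of "\<Psi> z"] supp[of "\<Psi> z"] B0 by (cases "\<Psi> z \<in> cball p \<rho>") auto
    show "continuous_on UNIV c'" "(c has_real_derivative c' s) (at s)" for s by fact+
    show "\<kappa> (\<Psi> (s, y)) * (G (\<Psi> (s, y)) \<bullet> w) = 0 \<and>
      (if \<Psi> (s, y) \<in> T then 0 else (k (\<Psi> (s, y)) \<bullet> u) * (G (\<Psi> (s, y)) \<bullet> w) + \<kappa> (\<Psi> (s, y)) * (G' (\<Psi> (s, y)) u \<bullet> w)) = 0 \<and>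
      (if \<Psi> (s, y) \<in> T then 0 else (k (\<Psi> (s, y)) \<bullet> n) * (G (\<Psi> (s, y)) \<bullet> w) + \<kappa> (\<Psi> (s, y)) * (G' (\<Psi> (s, y)) n \<bullet> w)) = 0"
      if "R \<le> \<bar>s\<bar> \<or> R \<le> \<bar>y\<bar>" for s y
      using far[of "(s, y)"] that supp[of "\<Psi> (s, y)"] k0[of "\<Psi> (s, y)"] by auto
    fix z assume z: "z \<notin> \<Psi> -` T"
    have 1: "((\<lambda>z. \<kappa> (\<Psi> z)) has_derivative (\<lambda>h. k (\<Psi> z) \<bullet> (fst h *\<^sub>R u + snd h *\<^sub>R n))) (at z)"
      by (rule has_derivative_compose[OF \<Psi>d]) (use z \<kappa>'(3) in auto)
    have 2: "((\<lambda>z. G (\<Psi> z)) has_derivative (\<lambda>h. G' (\<Psi> z) (fst h *\<^sub>R u + snd h *\<^sub>R n))) (at z)"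
      by (rule has_derivative_compose[OF \<Psi>d G'(1)])
    have lin: "G' y (a *\<^sub>R u + b *\<^sub>R n) = a *\<^sub>R G' y u + b *\<^sub>R G' y n" for y a b
      using has_derivative_linear[OF G'(1)[of y]] by (simp add: linear_add linear_cmul)
    have "((\<lambda>z. \<kappa> (\<Psi> z) * (G (\<Psi> z) \<bullet> w)) has_derivative
      (\<lambda>h. \<kappa> (\<Psi> z) * (G' (\<Psi> z) (fst h *\<^sub>R u + snd h *\<^sub>R n) \<bullet> w) + (k (\<Psi> z) \<bullet> (fst h *\<^sub>R u + snd h *\<^sub>R n)) * (G (\<Psi> z) \<bullet> w))) (at z)"
      by (auto intro!: derivative_eq_intros 1 2)
    then show "((\<lambda>z. \<kappa> (\<Psi> z) * (G (\<Psi> z) \<bullet> w)) has_derivative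
          (\<lambda>h. (if \<Psi> z \<in> T then 0 else (k (\<Psi> z) \<bullet> u) * (G (\<Psi> z) \<bullet> w) + \<kappa> (\<Psi> z) * (G' (\<Psi> z) u \<bullet> w)) * fst h +
           (if \<Psi> z \<in> T then 0 else (k (\<Psi> z) \<bullet> n) * (G (\<Psi> z) \<bullet> w) + \<kappa> (\<Psi> z) * (G' (\<Psi> z) n \<bullet> w)) * snd h)) (at z)"
      using z by (simp add: lin inner_add_left inner_add_right algebra_simps)
  qed
  have bd: "\<exists>B. \<forall>z\<in>cball p \<rho>. \<bar>(k z \<bullet> a) * (G z \<bullet> w) + \<kappa> z * (G' z a \<bullet> w)\<bar> \<le> B" for a w
  proof -
    define h where "h z = norm a * (\<bar>Bk\<bar> * \<bar>G z \<bullet> w\<bar>) + \<bar>\<kappa> z * (G' z a \<bullet> w)\<bar>" for z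
    have "bounded (h ` cball p \<rho>)"
      unfolding h_def by (intro compact_imp_bounded compact_continuous_image continuous_intros continuous_on_subset[OF \<kappa>'(2)]
          continuous_on_subset[OF Gc] continuous_on_subset[OF G'(2)]) auto
    then obtain B where "\<And>z. z \<in> cball p \<rho> \<Longrightarrow> \<bar>h z\<bar> \<le> B"
      unfolding bounded_iff by (metis imageI real_norm_def)
    then have B: "norm a * (\<bar>Bk\<bar> * \<bar>G z \<bullet> w\<bar>) + \<bar>\<kappa> z * (G' z a \<bullet> w)\<bar> \<le> B" if "z \<in> cball p \<rho>" for z
      using that abs_ge_self[of "h z"] unfolding h_def by force
    have "\<bar>(k z \<bullet> a) * (G z \<bullet> w) + \<kappa> z * (G' z a \<bullet> w)\<bar> \<le> B" if z: "z \<in> cball p \<rho>" for z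
    proof -
      have "\<bar>k z \<bullet> a\<bar> \<le> norm a * \<bar>Bk\<bar>"
        using Cauchy_Schwarz_ineq2[of "k z" a] mult_right_mono[OF order_trans[OF Bk[OF z] abs_ge_self], of "norm a"]
        by (simp add: mult.commute)
      then have "\<bar>(k z \<bullet> a) * (G z \<bullet> w)\<bar> \<le> norm a * (\<bar>Bk\<bar> * \<bar>G z \<bullet> w\<bar>)"
        unfolding abs_mult mult.assoc[symmetric] by (rule mult_right_mono) simp
      then show ?thesis using B[OF z] by linarith
    qed
    then show ?thesis by blast
  qed
  have bd2: "\<exists>B. (\<forall>z\<in>cball p \<rho>. \<bar>(k z \<bullet> u) * (G z \<bullet> w) + \<kappa> z * (G' z u \<bullet> w)\<bar> \<le> B) \<and>
      (\<forall>z\<in>cball p \<rho>. \<bar>(k z \<bullet> n) * (G z \<bullet> w) + \<kappa> z * (G' z n \<bullet> w)\<bar> \<le> B)" for w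
  proof -
    obtain B1 B2 where "\<forall>z\<in>cball p \<rho>. \<bar>(k z \<bullet> u) * (G z \<bullet> w) + \<kappa> z * (G' z u \<bullet> w)\<bar> \<le> B1"
      "\<forall>z\<in>cball p \<rho>. \<bar>(k z \<bullet> n) * (G z \<bullet> w) + \<kappa> z * (G' z n \<bullet> w)\<bar> \<le> B2" using bd by meson
    then show ?thesis by (intro exI[of _ "max B1 B2"]) (auto simp: le_max_iff_disj)
  qed
  obtain Bu where "(\<forall>z\<in>cball p \<rho>. \<bar>(k z \<bullet> u) * (G z \<bullet> u) + \<kappa> z * (G' z u \<bullet> u)\<bar> \<le> Bu) \<and>
      (\<forall>z\<in>cball p \<rho>. \<bar>(k z \<bullet> n) * (G z \<bullet> u) + \<kappa> z * (G' z n \<bullet> u)\<bar> \<le> Bu)" using bd2 by blast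
  then interpret U: graph_green "\<Psi> -` T" "\<lambda>z. \<kappa> (\<Psi> z) * (G (\<Psi> z) \<bullet> u)"
      "\<lambda>z. if \<Psi> z \<in> T then 0 else (k (\<Psi> z) \<bullet> u) * (G (\<Psi> z) \<bullet> u) + \<kappa> (\<Psi> z) * (G' (\<Psi> z) u \<bullet> u)"
      "\<lambda>z. if \<Psi> z \<in> T then 0 else (k (\<Psi> z) \<bullet> n) * (G (\<Psi> z) \<bullet> u) + \<kappa> (\<Psi> z) * (G' (\<Psi> z) n \<bullet> u)" R Bu c c'
    by (intro main) auto
  obtain Bn where "(\<forall>z\<in>cball p \<rho>. \<bar>(k z \<bullet> u) * (G z \<bullet> n) + \<kappa> z * (G' z u \<bullet> n)\<bar> \<le> Bn) \<and>
      (\<forall>z\<in>cball p \<rho>. \<bar>(k z \<bullet> n) * (G z \<bullet> n) + \<kappa> z * (G' z n \<bullet> n)\<bar> \<le> Bn)" using bd2 by blast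
  then interpret N: graph_green "\<Psi> -` T" "\<lambda>z. \<kappa> (\<Psi> z) * (G (\<Psi> z) \<bullet> n)"
      "\<lambda>z. if \<Psi> z \<in> T then 0 else (k (\<Psi> z) \<bullet> u) * (G (\<Psi> z) \<bullet> n) + \<kappa> (\<Psi> z) * (G' (\<Psi> z) u \<bullet> n)"
      "\<lambda>z. if \<Psi> z \<in> T then 0 else (k (\<Psi> z) \<bullet> n) * (G (\<Psi> z) \<bullet> n) + \<kappa> (\<Psi> z) * (G' (\<Psi> z) n \<bullet> n)" R Bn c c'
    by (intro main) auto
  let ?fs = "\<lambda>z. if \<Psi> z \<in> T then 0 else (k (\<Psi> z) \<bullet> u) * (G (\<Psi> z) \<bullet> u) + \<kappa> (\<Psi> z) * (G' (\<Psi> z) u \<bullet> u)"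
  let ?fy = "\<lambda>z. if \<Psi> z \<in> T then 0 else (k (\<Psi> z) \<bullet> n) * (G (\<Psi> z) \<bullet> n) + \<kappa> (\<Psi> z) * (G' (\<Psi> z) n \<bullet> n)"
  let ?A = "{z. c (fst z) < snd z}"
  let ?I = "\<lambda>z. \<kappa> z * dvg G' z + k z \<bullet> G z"
  let ?P = "{z. c (u \<bullet> (z - p)) < n \<bullet> (z - p)}"
  \<comment> \<open>Trace invariance and Parseval recombine the two retained partial derivatives
    into the divergence of \<open>\<kappa> G\<close>.\<close>
  have sum: "?fs z + ?fy z = ?I (\<Psi> z)" if "\<Psi> z \<notin> T" for z
  proof -
    have t: "dvg G' (\<Psi> z) = G' (\<Psi> z) u \<bullet> u + G' (\<Psi> z) n \<bullet> n"
      using orthonormal_expand_2(4)[OF un has_derivative_linear[OF G'(1)]] by (simp add: dvg_def)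
    have "k (\<Psi> z) \<bullet> G (\<Psi> z) = (k (\<Psi> z) \<bullet> u) * (G (\<Psi> z) \<bullet> u) + (k (\<Psi> z) \<bullet> n) * (G (\<Psi> z) \<bullet> n)"
      by (rule orthonormal_expand_2(2)[OF un])
    then show ?thesis using that t by (simp add: algebra_simps)
  qed
  have [measurable]: "\<kappa> \<in> borel_measurable borel" "G \<in> borel_measurable borel" "\<And>v. (\<lambda>z. G' z v) \<in> borel_measurable borel"
    "(\<lambda>z. dvg G' z) \<in> borel_measurable borel"
    using \<kappa>' G' Gc by (auto intro!: borel_measurable_continuous_onI continuous_intros simp: dvg_def)
  have [measurable]: "c \<in> borel_measurable borel" by (rule U.c_meas)
  have "(lborel :: (real^2) measure) = distr (density lborel (\<lambda>_. ennreal 1)) borel (\<lambda>(s, y). p + s *\<^sub>R u + y *\<^sub>R n)"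
    by (rule lborel_lin_param) (use orthonormal_expand_2(3)[OF un] in auto)
  then have lb: "(lborel :: (real^2) measure) = distr lborel borel \<Psi>"
    by (simp add: density_1 \<Psi>_def case_prod_unfold)
  have "(\<integral>z. indicator ?P z * ?I z \<partial>lborel) = (\<integral>z. indicator ?P (\<Psi> z) * ?I (\<Psi> z) \<partial>lborel)"
    by (subst lb, subst integral_distr) (simp_all add: pred_def[symmetric])
  also have "\<dots> = (\<integral>z. indicator ?A z * ?fs z + indicator ?A z * ?fy z \<partial>lborel)"
  proof (rule integral_cong_AE)
    have "AE z in lborel. z \<notin> \<Psi> -` T"
      by (intro AE_not_in finite_imp_null_set_lborel finite_vimageI \<kappa>' inj)
    then show "AE z in lborel. indicator ?P (\<Psi> z) * ?I (\<Psi> z) = indicator ?A z * ?fs z + indicator ?A z * ?fy z"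
    proof eventually_elim
      case (elim z)
      have "indicator ?P (\<Psi> z) = (indicator ?A z :: real)"
        by (simp add: indicator_def coord)
      moreover have "indicator ?A z * ?fs z + indicator ?A z * ?fy z = indicator ?A z * (?fs z + ?fy z)"
        by (rule distrib_left[symmetric])
      ultimately show ?case using sum[of z] elim by (simp del: distrib_left)
    qed
    show "(\<lambda>z. indicator ?P (\<Psi> z) * ?I (\<Psi> z)) \<in> borel_measurable lborel" by simp
    show "(\<lambda>z. indicator ?A z * ?fs z + indicator ?A z * ?fy z) \<in> borel_measurable lborel"
      by (intro borel_measurable_add borel_measurable_integrable U.integrable_above(1) N.integrable_above(2))
  qed
  also have "\<dots> = (\<integral>z. indicator ?A z * ?fs z \<partial>lborel) + (\<integral>z. indicator ?A z * ?fy z \<partial>lborel)"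
    by (rule Bochner_Integration.integral_add[OF U.integrable_above(1) N.integrable_above(2)])
  also have "\<dots> = (\<integral>s. c' s * (\<kappa> (\<Psi> (s, c s)) * (G (\<Psi> (s, c s)) \<bullet> u)) \<partial>lborel) - (\<integral>s. \<kappa> (\<Psi> (s, c s)) * (G (\<Psi> (s, c s)) \<bullet> n) \<partial>lborel)"
    unfolding U.above_fs N.above_fy by simp
  also have "\<dots> = (\<integral>s. c' s * (\<kappa> (\<Psi> (s, c s)) * (G (\<Psi> (s, c s)) \<bullet> u)) - \<kappa> (\<Psi> (s, c s)) * (G (\<Psi> (s, c s)) \<bullet> n) \<partial>lborel)"
  proof (rule Bochner_Integration.integral_diff[symmetric])
    have int: "integrable lborel h" if h: "continuous_on UNIV h" "\<And>s. s \<notin> {-R..R} \<Longrightarrow> h s = 0" for h :: "real \<Rightarrow> real"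
    proof -
      have "integrable lborel (\<lambda>s. indicator {-R..R} s *\<^sub>R h s)"
        by (intro borel_integrable_compact continuous_on_subset[OF h(1)]) auto
      moreover have "indicator {-R..R} s *\<^sub>R h s = h s" for s using h(2)[of s] by (auto simp: indicator_def)
      ultimately show ?thesis by (simp only:)
    qed
    have \<gamma>c: "continuous_on UNIV (\<lambda>s. \<Psi> (s, c s))"
      by (intro continuous_on_compose2[OF \<Psi>_cont[of UNIV]] continuous_intros U.cc) auto
    have z: "\<kappa> (\<Psi> (s, c s)) = 0" if "s \<notin> {-R..R}" for s
    proof -
      have "\<bar>s\<bar> \<ge> R" using that by (simp add: abs_if) linarith
      then show ?thesis using far[of "(s, c s)"] supp by simp
    qed
    show "integrable lborel (\<lambda>s. c' s * (\<kappa> (\<Psi> (s, c s)) * (G (\<Psi> (s, c s)) \<bullet> u)))"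
      "integrable lborel (\<lambda>s. \<kappa> (\<Psi> (s, c s)) * (G (\<Psi> (s, c s)) \<bullet> n))"
      using z by (auto intro!: int continuous_intros cc' continuous_on_compose2[OF \<kappa>'(2) \<gamma>c] continuous_on_compose2[OF Gc \<gamma>c])
  qed
  finally show ?thesis by (simp add: \<Psi>_def inner_diff_right algebra_simps)
qed

section \<open>The divergence theorem on a planar \<open>C\<^sup>2\<close> domain\<close>

text \<open>The integral of \<open>(t f - g)^2\<close> is nonnegative for every \<open>t\<close>;
  for \<open>A > 0\<close> the resulting quadratic polynomial is evaluated at its minimum
  \<open>B / A\<close>.\<close>

lemma integral_Cauchy_Schwarz:
  fixes f g :: "'a \<Rightarrow> real"
  assumes f: "f \<in> borel_measurable M" "integrable M (\<lambda>x. (f x)\<^sup>2)"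
    and g: "g \<in> borel_measurable M" "integrable M (\<lambda>x. (g x)\<^sup>2)"
  shows "integrable M (\<lambda>x. f x * g x)"
    and "(\<integral>x. f x * g x \<partial>M)\<^sup>2 \<le> (\<integral>x. (f x)\<^sup>2 \<partial>M) * (\<integral>x. (g x)\<^sup>2 \<partial>M)"
proof -
  show i: "integrable M (\<lambda>x. f x * g x)"
  proof (rule Bochner_Integration.integrable_bound)
    show "integrable M (\<lambda>x. (f x)\<^sup>2 + (g x)\<^sup>2)" using f g by simp
    have "\<bar>a * b\<bar> \<le> \<bar>a\<^sup>2 + b\<^sup>2\<bar>" for a b :: real
      using sum_squares_bound[of "\<bar>a\<bar>" "\<bar>b\<bar>"] abs_ge_zero[of "a * b"]
      unfolding abs_mult power2_abs by linarith
    then show "AE x in M. norm (f x * g x) \<le> norm ((f x)\<^sup>2 + (g x)\<^sup>2)" by simp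
  qed (use f g in auto)
  define A B C where "A = (\<integral>x. (f x)\<^sup>2 \<partial>M)" and "B = (\<integral>x. f x * g x \<partial>M)" and "C = (\<integral>x. (g x)\<^sup>2 \<partial>M)"
  have q: "0 \<le> t\<^sup>2 * A - 2 * t * B + C" for t
  proof -
    have "0 \<le> (\<integral>x. (t * f x - g x)\<^sup>2 \<partial>M)" by simp
    also have "\<dots> = (\<integral>x. t\<^sup>2 * (f x)\<^sup>2 - 2 * t * (f x * g x) + (g x)\<^sup>2 \<partial>M)"
      by (simp add: power2_eq_square algebra_simps)
    also have "\<dots> = t\<^sup>2 * A - 2 * t * B + C"
      using f g i by (simp add: A_def B_def C_def)
    finally show ?thesis .
  qed
  have A0: "A \<ge> 0" by (simp add: A_def)
  have "B\<^sup>2 \<le> A * C"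
  proof (cases "A = 0")
    case True
    have "B = 0"
    proof (rule ccontr)
      assume "B \<noteq> 0"
      \<comment> \<open>With \<open>A = 0\<close> the polynomial is affine in \<open>t\<close>, and
        at this \<open>t\<close> it equals \<open>-1\<close>.\<close>
      have "0 \<le> C - 2 * ((C + 1) / (2 * B)) * B" using q[of "(C + 1) / (2 * B)"] True by simp
      then show False using \<open>B \<noteq> 0\<close> by simp
    qed
    then show ?thesis using True by simp
  next
    case False
    have "0 \<le> (B / A)\<^sup>2 * A - 2 * (B / A) * B + C" by (rule q)
    also have "\<dots> = C - B\<^sup>2 / A" using False by (simp add: power2_eq_square field_simps)
    finally show ?thesis using False A0 by (simp add: field_simps)
  qed
  then show "(\<integral>x. f x * g x \<partial>M)\<^sup>2 \<le> (\<integral>x. (f x)\<^sup>2 \<partial>M) * (\<integral>x. (g x)\<^sup>2 \<partial>M)"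
    by (simp add: A_def B_def C_def)
qed

text \<open>\<open>outer_normal\<close> is a definite description, so uniqueness is the point. If
  two normals differed, a small multiple of \<open>q = \<nu> - \<mu>\<close> would lie on the outer
  side for \<open>\<nu>\<close> and on the inner side for \<open>\<mu>\<close>.\<close>

lemma outer_normal_eq:
  assumes V: "subspace V" and \<nu>: "is_outer_normal V S p \<nu>"
  shows "outer_normal V S p = \<nu>"
  unfolding outer_normal_def
proof (rule the_equality)
  fix \<mu> assume \<mu>: "is_outer_normal V S p \<mu>"
  show "\<mu> = \<nu>"
  proof (rule ccontr)
    assume ne: "\<mu> \<noteq> \<nu>"
    have n: "\<nu> \<bullet> \<nu> = 1" "\<mu> \<bullet> \<mu> = 1" "\<nu> \<in> V" "\<mu> \<in> V"
      using \<nu> \<mu> by (auto simp: is_outer_normal_def norm_eq_1)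
    define q where "q = \<nu> - \<mu>"
    \<comment> \<open>\<open>q \<bullet> \<nu>\<close> is half of \<open>(norm q)^2\<close> and
      \<open>q \<bullet> \<mu>\<close> is its negative, so a quarter leaves room on both
      sides.\<close>
    define \<epsilon> where "\<epsilon> = norm q / 4"
    have q: "q \<in> V" "norm q > 0" using n V ne by (auto simp: q_def subspace_diff)
    then have e: "\<epsilon> > 0" by (simp add: \<epsilon>_def)
    have qq: "(norm q)\<^sup>2 = 2 * (q \<bullet> \<nu>)" "(norm q)\<^sup>2 = - 2 * (q \<bullet> \<mu>)"
      using n by (simp_all add: q_def power2_norm_eq_inner inner_diff_left inner_diff_right inner_commute)
    obtain r1 where r1: "r1 > 0" "\<And>h. h \<in> V \<Longrightarrow> norm h < r1 \<Longrightarrow> h \<bullet> \<nu> > \<epsilon> * norm h \<Longrightarrow> p + h \<notin> S"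
      using \<nu> e unfolding is_outer_normal_def by meson
    obtain r2 where r2: "r2 > 0" "\<And>h. h \<in> V \<Longrightarrow> norm h < r2 \<Longrightarrow> h \<bullet> \<mu> < - \<epsilon> * norm h \<Longrightarrow> p + h \<in> S"
      using \<mu> e unfolding is_outer_normal_def by meson
    define t where "t = min r1 r2 / (2 * norm q)"
    have t: "t > 0" using r1 r2 q by (simp add: t_def)
    define h where "h = t *\<^sub>R q"
    have "norm h = t * norm q" using t by (simp add: h_def)
    also have "\<dots> = min r1 r2 / 2" using q by (simp add: t_def)
    finally have "norm h = min r1 r2 / 2" .
    then have "norm h < r1" "norm h < r2" using r1(1) r2(1) by auto
    moreover have "h \<in> V" using q V by (simp add: h_def subspace_scale)
    moreover have "h \<bullet> \<nu> > \<epsilon> * norm h"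
    proof -
      have "q \<bullet> \<nu> = (norm q)\<^sup>2 / 2" using qq(1) by linarith
      then have "h \<bullet> \<nu> = t * ((norm q)\<^sup>2 / 2)" by (simp add: h_def)
      moreover have "\<epsilon> * norm h = t * ((norm q)\<^sup>2 / 4)" using t by (simp add: h_def \<epsilon>_def power2_eq_square)
      moreover have "t * (norm q)\<^sup>2 > 0" using t q by simp
      ultimately show ?thesis by linarith
    qed
    moreover have "h \<bullet> \<mu> < - \<epsilon> * norm h"
    proof -
      have "q \<bullet> \<mu> = - ((norm q)\<^sup>2 / 2)" using qq(2) by linarith
      then have "h \<bullet> \<mu> = - (t * ((norm q)\<^sup>2 / 2))" by (simp add: h_def)
      moreover have "\<epsilon> * norm h = t * ((norm q)\<^sup>2 / 4)" using t by (simp add: h_def \<epsilon>_def power2_eq_square)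
      moreover have "t * (norm q)\<^sup>2 > 0" using t q by simp
      ultimately show ?thesis by linarith
    qed
    ultimately show False using r1(2) r2(2) by blast
  qed
qed (rule \<nu>)

locale graph_chart =
  fixes S :: "(real^2) set" and p u n :: "real^2" and r :: real and c c' :: "real \<Rightarrow> real"
  assumes S: "open S" and r: "r > 0" and un: "norm u = 1" "norm n = 1" "u \<bullet> n = 0"
    and c: "\<And>s. (c has_real_derivative c' s) (at s)" and cc': "continuous_on UNIV c'"
    and chart: "\<And>z. z \<in> ball p r \<Longrightarrow> z \<in> S \<longleftrightarrow> n \<bullet> (z - p) > c (u \<bullet> (z - p))"
begin

text \<open>The domain lies above the graph, so the outer normal points down. The formula depends on
  \<open>z\<close> only through its tangential coordinate and is continuous on the whole plane,
  which gives measurability of the boundary integrand.\<close>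

definition normal :: "real^2 \<Rightarrow> real^2" where
  "normal z = (1 / sqrt (1 + (c' (u \<bullet> (z - p)))\<^sup>2)) *\<^sub>R (c' (u \<bullet> (z - p)) *\<^sub>R u - n)"

lemma cc: "continuous_on UNIV c"
  using c by (meson DERIV_continuous_on has_field_derivative_at_within)

lemma inner_un: "u \<bullet> u = 1" "n \<bullet> n = 1" "n \<bullet> u = 0"
  using un by (simp_all add: norm_eq_1 inner_commute)

text \<open>A point below the graph has a neighbourhood free of \<open>S\<close>, while a point on
  the graph is approached from inside along \<open>n\<close>.\<close>

lemma frontier_chart:
  assumes z: "z \<in> ball p r"
  shows "z \<in> frontier S \<longleftrightarrow> n \<bullet> (z - p) = c (u \<bullet> (z - p))"
proof
  assume fr: "z \<in> frontier S"
  then have "z \<notin> S" using S by (simp add: frontier_def interior_open)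
  then have le: "n \<bullet> (z - p) \<le> c (u \<bullet> (z - p))" using chart[OF z] by simp
  show "n \<bullet> (z - p) = c (u \<bullet> (z - p))"
  proof (rule ccontr)
    assume "n \<bullet> (z - p) \<noteq> c (u \<bullet> (z - p))"
    with le have lt: "n \<bullet> (z - p) < c (u \<bullet> (z - p))" by simp
    let ?W = "ball p r \<inter> {z. n \<bullet> (z - p) < c (u \<bullet> (z - p))}"
    have "open ?W"
      by (intro open_Int open_ball open_Collect_less continuous_intros continuous_on_compose2[OF cc]) auto
    moreover have "z \<in> ?W" using z lt by simp
    moreover have "?W \<inter> S = {}" using chart by auto
    ultimately have "?W \<inter> closure S = {}" "z \<in> ?W" using open_Int_closure_eq_empty[of ?W S] by simp_all
    then have "z \<notin> closure S" by blast
    then show False using fr by (simp add: frontier_def)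
  qed
next
  assume eq: "n \<bullet> (z - p) = c (u \<bullet> (z - p))"
  then have "z \<notin> S" using chart[OF z] by simp
  moreover have "z \<in> closure S"
    unfolding closure_approachable
  proof (intro allI impI)
    fix e :: real assume e: "e > 0"
    define t where "t = min e (r - dist p z) / 2"
    have t: "t > 0" "t < e" "t < r - dist p z" using e z by (auto simp: t_def min_def)
    have d: "dist (z + t *\<^sub>R n) z = t" using t un by (simp add: dist_norm)
    have "z + t *\<^sub>R n \<in> ball p r"
      using dist_triangle[of p "z + t *\<^sub>R n" z] d t by (simp add: dist_commute)
    moreover have "n \<bullet> (z + t *\<^sub>R n - p) = n \<bullet> (z - p) + t" "u \<bullet> (z + t *\<^sub>R n - p) = u \<bullet> (z - p)"
      by (simp_all add: inner_add_right inner_diff_right inner_un un)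
    ultimately have "z + t *\<^sub>R n \<in> S" using chart eq t by simp
    then show "\<exists>y\<in>S. dist y z < e" using d t by (intro bexI[of _ "z + t *\<^sub>R n"]) auto
  qed
  ultimately show "z \<in> frontier S" using S by (simp add: frontier_def interior_open)
qed

text \<open>First-order expansion of \<open>c\<close> at \<open>s\<close>: the remainder is at most
  \<open>\<epsilon> * norm h\<close>, and it is absorbed because the normalising factor
  \<open>N\<close> is at least 1.\<close>

lemma outer_normal_chart:
  assumes z: "z \<in> ball p r" "z \<in> frontier S"
  shows "outer_normal UNIV S z = normal z"
proof (rule outer_normal_eq)
  define s where "s = u \<bullet> (z - p)"
  define N where "N = sqrt (1 + (c' s)\<^sup>2)"
  have N1: "N \<ge> 1" by (simp add: N_def)
  have eq: "n \<bullet> (z - p) = c s" using frontier_chart z by (simp add: s_def)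
  have nz: "normal z = (1 / N) *\<^sub>R (c' s *\<^sub>R u - n)" by (simp add: normal_def s_def N_def)
  show "is_outer_normal UNIV S z (normal z)"
    unfolding is_outer_normal_def
  proof (intro conjI allI impI)
    have "(c' s *\<^sub>R u - n) \<bullet> (c' s *\<^sub>R u - n) = 1 + (c' s)\<^sup>2"
      by (simp add: inner_diff_left inner_diff_right inner_un un power2_eq_square)
    then have "norm (c' s *\<^sub>R u - n) = N" by (simp add: norm_eq_sqrt_inner N_def)
    then show "norm (normal z) = 1" using N1 by (simp add: nz)
    fix \<epsilon> :: real assume e: "\<epsilon> > 0"
    obtain d where d: "d > 0" "\<And>y. norm (y - s) < d \<Longrightarrow> norm (c y - c s - c' s * (y - s)) \<le> \<epsilon> * norm (y - s)"
      using c[of s] e unfolding has_field_derivative_def has_derivative_at_alt by meson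
    show "\<exists>r>0. \<forall>h\<in>UNIV. norm h < r \<longrightarrow> (h \<bullet> normal z < - \<epsilon> * norm h \<longrightarrow> z + h \<in> S) \<and> (h \<bullet> normal z > \<epsilon> * norm h \<longrightarrow> z + h \<notin> S)"
    proof (intro exI[of _ "min d (r - dist p z)"] conjI ballI impI)
      show "min d (r - dist p z) > 0" using d z by simp
      fix h :: "real^2" assume h: "norm h < min d (r - dist p z)"
      have uh: "\<bar>u \<bullet> h\<bar> \<le> norm h" using Cauchy_Schwarz_ineq2[of u h] un by simp
      have "\<bar>c (s + u \<bullet> h) - c s - c' s * (u \<bullet> h)\<bar> \<le> \<epsilon> * \<bar>u \<bullet> h\<bar>"
        using d(2)[of "s + u \<bullet> h"] uh h by simp
      also have "\<dots> \<le> \<epsilon> * norm h" using uh e by (intro mult_left_mono) auto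
      finally have ch: "\<bar>c (s + u \<bullet> h) - c s - c' s * (u \<bullet> h)\<bar> \<le> \<epsilon> * norm h" .
      have Nh: "\<epsilon> * norm h \<le> \<epsilon> * norm h * N"
        using mult_left_mono[OF N1, of "\<epsilon> * norm h"] e by simp
      have "dist p (z + h) \<le> dist p z + norm h"
        using dist_triangle[of p "z + h" z] by (simp add: dist_norm)
      then have zh: "z + h \<in> ball p r" using h by simp
      have co: "n \<bullet> (z + h - p) = c s + n \<bullet> h" "u \<bullet> (z + h - p) = s + u \<bullet> h"
        using eq by (simp_all add: s_def inner_add_right inner_diff_right)
      have hn: "h \<bullet> normal z = (c' s * (u \<bullet> h) - n \<bullet> h) / N"
        by (simp add: nz inner_diff_right inner_commute)
      show "z + h \<in> S" if "h \<bullet> normal z < - \<epsilon> * norm h"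
      proof -
        have "c' s * (u \<bullet> h) - n \<bullet> h < - (\<epsilon> * norm h * N)"
          using that N1 by (simp add: hn divide_less_eq)
        then have "n \<bullet> h > c (s + u \<bullet> h) - c s" using ch Nh by linarith
        then show ?thesis using chart[OF zh] co by simp
      qed
      show "z + h \<notin> S" if "h \<bullet> normal z > \<epsilon> * norm h"
      proof -
        have "c' s * (u \<bullet> h) - n \<bullet> h > \<epsilon> * norm h * N"
          using that N1 by (simp add: hn less_divide_eq)
        then have "n \<bullet> h < c (s + u \<bullet> h) - c s" using ch Nh by linarith
        then show ?thesis using chart[OF zh] co by simp
      qed
    qed
  qed simp
qed (rule subspace_UNIV)

text \<open>The constant must not depend on \<open>\<kappa>\<close>, \<open>G\<close> or the
  exceptional set. Cauchy-Schwarz separates \<open>\<kappa> N\<close>, whose square integrates to at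
  most \<open>A * r\<close> because \<open>\<kappa>\<close> is bounded by 1 on the boundary, from
  the normal component of \<open>G\<close>. Here \<open>A\<close> bounds \<open>1 + c'^2\<close> on
  a parameter interval of length \<open>r\<close>. The support radius \<open>r / 2\<close> keeps
  everything inside the open chart ball.\<close>

lemma green_chart:
  obtains \<epsilon> where "\<epsilon> > 0"
    "\<And>T \<kappa> k G G'. piecewise_C1 T \<kappa> k \<Longrightarrow> C1_field G G' \<Longrightarrow> (\<And>z. z \<in> frontier S \<Longrightarrow> \<bar>\<kappa> z\<bar> \<le> 1) \<Longrightarrow>
       (\<And>z. z \<notin> cball p (r / 2) \<Longrightarrow> \<kappa> z = 0) \<Longrightarrow>
       ennreal (\<epsilon> * (\<integral>z. indicator S z * (\<kappa> z * dvg G' z + k z \<bullet> G z) \<partial>lborel)\<^sup>2) \<le>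
       (\<integral>\<^sup>+z\<in>frontier S. ennreal ((G z \<bullet> outer_normal UNIV S z)\<^sup>2) \<partial>hausdorff1)"
proof -
  have "bounded ((\<lambda>s. 1 + (c' s)\<^sup>2) ` {-(r/2)..r/2})"
    by (intro compact_imp_bounded compact_continuous_image continuous_intros continuous_on_subset[OF cc']) auto
  then obtain A where A: "\<And>s. s \<in> {-(r/2)..r/2} \<Longrightarrow> \<bar>1 + (c' s)\<^sup>2\<bar> \<le> A"
    unfolding bounded_iff by (metis imageI real_norm_def)
  have A1: "A \<ge> 1" using A[of 0] r by (auto intro: order_trans[rotated])
  show ?thesis
  proof (rule that)
    show e0: "1 / (A * r) > 0" using A1 r by simp
    fix T \<kappa> k G G'
    assume \<kappa>: "piecewise_C1 T \<kappa> k" and G: "C1_field G G'" and \<kappa>1: "\<And>z. z \<in> frontier S \<Longrightarrow> \<bar>\<kappa> z\<bar> \<le> 1"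
      and supp: "\<And>z. z \<notin> cball p (r / 2) \<Longrightarrow> \<kappa> z = 0"
    define I where "I = (\<integral>z. indicator S z * (\<kappa> z * dvg G' z + k z \<bullet> G z) \<partial>lborel)"
    define \<gamma> where "\<gamma> s = p + s *\<^sub>R u + c s *\<^sub>R n" for s
    define J where "J = \<gamma> -` cball p (r/2)"
    have k0: "k z = 0" if "z \<notin> cball p (r / 2)" for z
      by (rule piecewise_C1_zero[OF \<kappa>, of "- cball p (r / 2)"]) (use that supp in auto)
    have sub: "cball p (r/2) \<subseteq> ball p r" using r by auto
    have \<kappa>c: "continuous_on UNIV \<kappa>" using \<kappa> by (simp add: piecewise_C1_def)
    have Gc: "continuous_on UNIV G" using C1_field_continuous[OF G] .
    have \<gamma>c: "continuous_on UNIV \<gamma>" unfolding \<gamma>_def by (intro continuous_intros cc)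
    have co: "u \<bullet> (\<gamma> s - p) = s" "n \<bullet> (\<gamma> s - p) = c s" for s
      by (simp_all add: \<gamma>_def inner_add_right inner_un un)
    have J_sub: "J \<subseteq> {-(r/2)..r/2}"
    proof
      fix s assume "s \<in> J"
      then have "norm (\<gamma> s - p) \<le> r/2" by (simp add: J_def dist_norm norm_minus_commute)
      then have "\<bar>s\<bar> \<le> r/2" using Cauchy_Schwarz_ineq2[of u "\<gamma> s - p"] un by (simp add: co)
      then show "s \<in> {-(r/2)..r/2}" by auto
    qed
    have "closed J" unfolding J_def
      using \<gamma>c continuous_closed_vimage[of "cball p (r/2)" \<gamma>] by (auto simp: continuous_on_eq_continuous_at)
    then have Jm [measurable]: "J \<in> sets borel" by simp
    have Jfr: "\<gamma> s \<in> frontier S" if "s \<in> J" for s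
      using that frontier_chart[of "\<gamma> s"] sub by (auto simp: J_def co)
    have I_eq: "I = (\<integral>s. \<kappa> (\<gamma> s) * (G (\<gamma> s) \<bullet> (c' s *\<^sub>R u - n)) \<partial>lborel)"
    proof -
      have "indicator S z * (\<kappa> z * dvg G' z + k z \<bullet> G z) =
          indicator {z. c (u \<bullet> (z - p)) < n \<bullet> (z - p)} z * (\<kappa> z * dvg G' z + k z \<bullet> G z)" for z
      proof (cases "z \<in> cball p (r/2)")
        case True
        then show ?thesis using chart[of z] sub by (auto simp: indicator_def)
      next
        case False
        then show ?thesis using supp k0 by simp
      qed
      then have "I = (\<integral>z. indicator {z. c (u \<bullet> (z - p)) < n \<bullet> (z - p)} z * (\<kappa> z * dvg G' z + k z \<bullet> G z) \<partial>lborel)"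
        unfolding I_def by presburger
      then show ?thesis
        unfolding \<gamma>_def
        using green_above_graph[OF un \<kappa> G supp half_gt_zero[OF r] c cc'] by simp
    qed
    define N where "N s = sqrt (1 + (c' s)\<^sup>2)" for s
    have N1: "N s \<ge> 1" for s by (simp add: N_def)
    have N2: "(N s)\<^sup>2 = 1 + (c' s)\<^sup>2" for s by (simp add: N_def)
    have nor: "normal (\<gamma> s) = (1 / N s) *\<^sub>R (c' s *\<^sub>R u - n)" for s by (simp add: normal_def co N_def)
    \<comment> \<open>The length factor \<open>N\<close> is put on the side of
      \<open>\<kappa>\<close>, since \<open>nn_integral_section_le_hausdorff1\<close> compares with
      the parameter measure and not with arc length.\<close>
    define a where "a s = indicator J s * (\<kappa> (\<gamma> s) * N s)" for s
    define b where "b s = indicator J s * (G (\<gamma> s) \<bullet> normal (\<gamma> s))" for s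
    have ab: "\<kappa> (\<gamma> s) * (G (\<gamma> s) \<bullet> (c' s *\<^sub>R u - n)) = a s * b s" for s
    proof (cases "s \<in> J")
      case True
      then show ?thesis using N1[of s] by (simp add: a_def b_def nor)
    next
      case False
      then show ?thesis using supp[of "\<gamma> s"] by (simp add: a_def b_def J_def)
    qed
    have Nc: "continuous_on UNIV N" unfolding N_def by (intro continuous_intros cc')
    have norc: "continuous_on UNIV normal" unfolding normal_def
      by (intro continuous_intros continuous_on_compose2[OF cc'])
        (auto simp: add_nonneg_eq_0_iff)
    have cn: "continuous_on UNIV (\<lambda>s. \<kappa> (\<gamma> s) * N s)" "continuous_on UNIV (\<lambda>s. G (\<gamma> s) \<bullet> normal (\<gamma> s))"
      by (intro continuous_intros Nc continuous_on_compose2[OF \<kappa>c \<gamma>c] continuous_on_compose2[OF Gc \<gamma>c]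
            continuous_on_compose2[OF norc \<gamma>c]; auto)+
    have [measurable]: "(\<lambda>s. \<kappa> (\<gamma> s) * N s) \<in> borel_measurable borel" "(\<lambda>s. G (\<gamma> s) \<bullet> normal (\<gamma> s)) \<in> borel_measurable borel"
      using cn by (auto intro: borel_measurable_continuous_onI)
    have abm [measurable]: "a \<in> borel_measurable borel" "b \<in> borel_measurable borel"
      unfolding a_def b_def by measurable
    have a2: "(a s)\<^sup>2 \<le> indicator {-(r/2)..r/2} s * A" for s
    proof (cases "s \<in> J")
      case True
      then have s: "s \<in> {-(r/2)..r/2}" using J_sub by auto
      have "\<bar>\<kappa> (\<gamma> s)\<bar> \<le> 1" using \<kappa>1 Jfr[OF True] by simp
      then have "(\<kappa> (\<gamma> s))\<^sup>2 \<le> 1" by (simp add: abs_square_le_1)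
      then have "(\<kappa> (\<gamma> s))\<^sup>2 * (N s)\<^sup>2 \<le> 1 * (N s)\<^sup>2" by (intro mult_right_mono) auto
      also have "\<dots> \<le> A" using A[OF s] by (simp add: N2)
      finally show ?thesis using True s by (simp add: a_def power_mult_distrib)
    next
      case False
      then show ?thesis using A1 by (simp add: a_def)
    qed
    have iI: "integrable lborel (\<lambda>s. indicator {-(r/2)..r/2} s * A)"
      by (intro integrable_mult_left integrable_real_indicator) (auto simp: emeasure_lborel_Icc_eq)
    have ia: "integrable lborel (\<lambda>s. (a s)\<^sup>2)"
      by (rule Bochner_Integration.integrable_bound[OF iI]) (use a2 in \<open>auto intro: order_trans[OF _ abs_ge_self]\<close>)
    have "(\<integral>s. (a s)\<^sup>2 \<partial>lborel) \<le> (\<integral>s. indicator {-(r/2)..r/2} s * A \<partial>lborel)"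
      by (intro integral_mono ia iI a2)
    also have "\<dots> = r * A" using r by simp
    finally have aA: "(\<integral>s. (a s)\<^sup>2 \<partial>lborel) \<le> r * A" .
    have ib: "integrable lborel (\<lambda>s. (b s)\<^sup>2)"
    proof -
      have "integrable lborel (\<lambda>s. indicator {-(r/2)..r/2} s *\<^sub>R (G (\<gamma> s) \<bullet> normal (\<gamma> s))\<^sup>2)"
        by (intro borel_integrable_compact continuous_intros continuous_on_subset[OF cn(2)]) auto
      then show ?thesis
        by (rule Bochner_Integration.integrable_bound) (use J_sub in \<open>auto intro!: AE_I2 simp: b_def indicator_def\<close>)
    qed
    have "I\<^sup>2 \<le> (\<integral>s. (a s)\<^sup>2 \<partial>lborel) * (\<integral>s. (b s)\<^sup>2 \<partial>lborel)"
      unfolding I_eq ab by (rule integral_Cauchy_Schwarz(2)) (use ia ib in simp_all)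
    also have "\<dots> \<le> (r * A) * (\<integral>s. (b s)\<^sup>2 \<partial>lborel)" by (intro mult_right_mono aA) simp
    finally have I2: "1 / (A * r) * I\<^sup>2 \<le> (\<integral>s. (b s)\<^sup>2 \<partial>lborel)"
      using A1 r by (simp add: field_simps)
    define F where "F z = ennreal ((G z \<bullet> normal z)\<^sup>2) * indicator (frontier S \<inter> cball p (r/2)) z" for z
    have Fm: "F \<in> borel_measurable borel"
    proof -
      have "(\<lambda>z. (G z \<bullet> normal z)\<^sup>2) \<in> borel_measurable borel"
        by (intro borel_measurable_continuous_onI continuous_intros Gc norc)
      then show ?thesis unfolding F_def
        by (intro borel_measurable_times_ennreal measurable_compose[OF _ measurable_ennreal] borel_measurable_indicator) auto
    qed
    have "ennreal (1 / (A * r) * I\<^sup>2) \<le> ennreal (\<integral>s. (b s)\<^sup>2 \<partial>lborel)" by (rule ennreal_leI[OF I2])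
    also have "\<dots> = (\<integral>\<^sup>+s. ennreal ((b s)\<^sup>2) \<partial>lborel)" by (rule nn_integral_eq_integral[symmetric]) (use ib in auto)
    also have "\<dots> = (\<integral>\<^sup>+s\<in>J. F (\<gamma> s) \<partial>lborel)"
      by (rule nn_integral_cong) (use Jfr in \<open>auto simp: b_def F_def J_def indicator_def\<close>)
    also have "\<dots> \<le> (\<integral>\<^sup>+z. F z \<partial>hausdorff1)"
    proof (rule nn_integral_section_le_hausdorff1[where \<pi> = "\<lambda>z. u \<bullet> (z - p)"])
      show "\<gamma> \<in> borel_measurable borel" using \<gamma>c by (rule borel_measurable_continuous_onI)
      show "\<bar>u \<bullet> (x - p) - u \<bullet> (y - p)\<bar> \<le> dist x y" for x y
        using Cauchy_Schwarz_ineq2[of u "x - y"] un by (simp add: dist_norm inner_diff_right)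
    qed (use Jm co Fm in auto)
    also have "\<dots> \<le> (\<integral>\<^sup>+z\<in>frontier S. ennreal ((G z \<bullet> outer_normal UNIV S z)\<^sup>2) \<partial>hausdorff1)"
    proof (rule nn_integral_mono)
      fix z
      show "F z \<le> ennreal ((G z \<bullet> outer_normal UNIV S z)\<^sup>2) * indicator (frontier S) z"
        using outer_normal_chart[of z] sub by (auto simp: F_def indicator_def)
    qed
    finally show "ennreal (1 / (A * r) * (\<integral>z. indicator S z * (\<kappa> z * dvg G' z + k z \<bullet> G z) \<partial>lborel)\<^sup>2) \<le>
       (\<integral>\<^sup>+z\<in>frontier S. ennreal ((G z \<bullet> outer_normal UNIV S z)\<^sup>2) \<partial>hausdorff1)"
      by (simp add: I_def)
  qed
qed

end

lemma C2_boundary_chart: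
  assumes "open S" "C2_boundary S" "p \<in> frontier S"
  obtains r u n c c' where "graph_chart S p u n r c c'"
proof -
  obtain r u n c where *: "r > 0" "norm u = 1" "norm n = 1" "u \<bullet> n = 0" "Ck_on 2 UNIV c"
    "\<And>z. z \<in> ball p r \<Longrightarrow> z \<in> S \<longleftrightarrow> n \<bullet> (z - p) > c (u \<bullet> (z - p))"
    using assms(2,3) unfolding C2_boundary_def by meson
  have "Ck_on (Suc (Suc 0)) UNIV c" using *(5) by (simp add: numeral_2_eq_2)
  then have d: "\<And>x. c differentiable (at x)" and k: "Ck_on (Suc 0) UNIV (ddir 1 c)" by auto
  have "graph_chart S p u n r c (ddir 1 c)"
  proof
    show "(c has_real_derivative ddir 1 c s) (at s)" for s
    proof -
      have "(c has_derivative frechet_derivative c (at s)) (at s)" using d frechet_derivative_works by blast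
      moreover have "frechet_derivative c (at s) = (*) (ddir 1 c s)"
      proof
        fix t
        show "frechet_derivative c (at s) t = ddir 1 c s * t"
          using linear_cmul[OF linear_frechet_derivative[OF d[of s]], of t 1] by simp
      qed
      ultimately show ?thesis by (simp add: has_field_derivative_def)
    qed
    show "continuous_on UNIV (ddir 1 c)" using Ck_on_Suc_imp[OF k] by simp
  qed (use assms * in auto)
  then show ?thesis by (rule that)
qed

section \<open>Localisation by cutoffs\<close>

lemma max0_square_deriv: "((\<lambda>x::real. (max 0 x)\<^sup>2) has_real_derivative 2 * max 0 x) (at x)"
proof (cases x "0::real" rule: linorder_cases)
  case less
  have "((\<lambda>x::real. 0) has_real_derivative 0) (at x)" by simp
  then have "((\<lambda>x::real. (max 0 x)\<^sup>2) has_real_derivative 0) (at x)"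
    by (rule has_field_derivative_transform_within_open[of _ _ _ "{..<0}"]) (use less in auto)
  then show ?thesis using less by simp
next
  case greater
  have "((\<lambda>x::real. x\<^sup>2) has_real_derivative 2 * x) (at x)" by (auto intro!: derivative_eq_intros)
  then have "((\<lambda>x::real. (max 0 x)\<^sup>2) has_real_derivative 2 * x) (at x)"
    by (rule has_field_derivative_transform_within_open[of _ _ _ "{0<..}"]) (use greater in auto)
  then show ?thesis using greater by simp
next
  case equal
  have "((\<lambda>y::real. (max 0 y)\<^sup>2 / y) \<longlongrightarrow> 0) (at 0)"
  proof (rule Lim_null_comparison)
    show "\<forall>\<^sub>F y in at 0. norm ((max 0 y)\<^sup>2 / y) \<le> \<bar>y :: real\<bar>"
      by (auto simp: max_def power2_eq_square)
    show "((\<lambda>y. \<bar>y :: real\<bar>) \<longlongrightarrow> 0) (at 0)" by (intro tendsto_eq_intros) auto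
  qed
  then show ?thesis using equal by (simp add: has_field_derivative_iff)
qed

text \<open>One continuous derivative is enough for a multiplier, so the truncated square
  \<open>m\<close> serves as profile. \<open>X\<close> is nonpositive on the inner ball and at least
  1 outside the outer one; there \<open>1 - m (X z)\<close> is nonpositive, and the outer
  application of \<open>m\<close> makes \<open>\<zeta>\<close> vanish.\<close>

lemma cutoff:
  fixes p :: "real^2"
  assumes \<rho>: "\<rho> > 0"
  obtains \<zeta> k where "piecewise_C1 {} \<zeta> k" "continuous_on UNIV k" "\<And>z. 0 \<le> \<zeta> z \<and> \<zeta> z \<le> 1"
    "\<And>z. z \<in> cball p \<rho> \<Longrightarrow> \<zeta> z = 1" "\<And>z. z \<notin> cball p (2 * \<rho>) \<Longrightarrow> \<zeta> z = 0"
proof -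
  define m where "m x = (max 0 x)\<^sup>2" for x :: real
  define X where "X z = ((z - p) \<bullet> (z - p) - \<rho>\<^sup>2) / \<rho>\<^sup>2" for z
  define \<zeta> where "\<zeta> z = m (1 - m (X z))" for z
  define k where "k z = (2 * max 0 (1 - m (X z)) * (- (2 * max 0 (X z))) * (2 / \<rho>\<^sup>2)) *\<^sub>R (z - p)" for z
  have Xd: "(X has_derivative (\<lambda>h. (2 / \<rho>\<^sup>2) * ((z - p) \<bullet> h))) (at z)" for z
    unfolding X_def using \<rho> by (auto intro!: derivative_eq_intros simp: inner_commute field_simps)
  have md: "(m has_derivative (\<lambda>h. (2 * max 0 x) * h)) (at x)" for x
    using max0_square_deriv[of x] by (simp add: has_field_derivative_def m_def[abs_def])
  have "(\<zeta> has_derivative (\<lambda>h. k z \<bullet> h)) (at z)" for z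
  proof -
    have "((\<lambda>z. 1 - m (X z)) has_derivative (\<lambda>h. - ((2 * max 0 (X z)) * ((2 / \<rho>\<^sup>2) * ((z - p) \<bullet> h))))) (at z)"
      by (rule has_derivative_eq_rhs, rule has_derivative_diff[OF has_derivative_const has_derivative_compose[OF Xd md]]) auto
    then have "(\<zeta> has_derivative (\<lambda>h. (2 * max 0 (1 - m (X z))) * - ((2 * max 0 (X z)) * ((2 / \<rho>\<^sup>2) * ((z - p) \<bullet> h))))) (at z)"
      unfolding \<zeta>_def by (rule has_derivative_compose[OF _ md])
    then show ?thesis by (rule has_derivative_eq_rhs) (auto simp: k_def fun_eq_iff)
  qed
  note d = this
  have Xc: "continuous_on UNIV X" using Xd by (meson continuous_at_imp_continuous_on has_derivative_continuous)
  have mc: "continuous_on UNIV m" using md by (meson continuous_at_imp_continuous_on has_derivative_continuous)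
  have kc: "continuous_on UNIV k"
    unfolding k_def by (intro continuous_intros Xc continuous_on_compose2[OF mc]) auto
  have m0: "m x = 0 \<longleftrightarrow> x \<le> 0" "m x \<ge> 0" for x by (auto simp: m_def max_def)
  have m1: "x \<ge> 1 \<Longrightarrow> m x \<ge> 1" for x by (simp add: m_def max_def one_le_power)
  show ?thesis
  proof (rule that[of \<zeta> k])
    show "continuous_on UNIV k" by fact
    show "piecewise_C1 {} \<zeta> k"
      unfolding piecewise_C1_def
    proof (intro conjI allI ballI impI)
      show "continuous_on UNIV \<zeta>" using d by (meson continuous_at_imp_continuous_on has_derivative_continuous)
      show "k \<in> borel_measurable borel" using kc by (rule borel_measurable_continuous_onI)
      fix R
      have "bounded (k ` cball 0 R)"
        by (intro compact_imp_bounded compact_continuous_image continuous_on_subset[OF kc]) auto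
      then show "\<exists>B. \<forall>z\<in>cball 0 R. norm (k z) \<le> B" by (auto simp: bounded_iff)
    qed (use d in auto)
    show "0 \<le> \<zeta> z \<and> \<zeta> z \<le> 1" for z
    proof
      show "0 \<le> \<zeta> z" by (simp add: \<zeta>_def m0)
      have "max 0 (1 - m (X z)) \<le> 1" "max 0 (1 - m (X z)) \<ge> 0" using m0(2)[of "X z"] by auto
      then show "\<zeta> z \<le> 1" unfolding \<zeta>_def m_def[of "1 - m (X z)"] by (rule power_le_one[rotated])
    qed
    show "\<zeta> z = 1" if "z \<in> cball p \<rho>" for z
    proof -
      have "(norm (z - p))\<^sup>2 \<le> \<rho>\<^sup>2" using that by (intro power_mono) (auto simp: dist_norm norm_minus_commute)
      then have "X z \<le> 0" using \<rho> by (simp add: X_def power2_norm_eq_inner divide_le_0_iff)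
      then have "m (X z) = 0" using m0 by blast
      then show ?thesis by (simp add: \<zeta>_def m_def)
    qed
    show "\<zeta> z = 0" if "z \<notin> cball p (2 * \<rho>)" for z
    proof -
      have "(2 * \<rho>)\<^sup>2 \<le> (norm (z - p))\<^sup>2" using that \<rho> by (intro power_mono) (auto simp: dist_norm norm_minus_commute)
      then have "4 * \<rho>\<^sup>2 \<le> (z - p) \<bullet> (z - p)"
        by (simp add: power2_norm_eq_inner power_mult_distrib)
      then have "2 * \<rho>\<^sup>2 \<le> (z - p) \<bullet> (z - p)"
        using zero_le_power2[of \<rho>] by linarith
      then have "X z \<ge> 1" using \<rho> by (simp add: X_def le_divide_eq)
      then have "1 - m (X z) \<le> 0" using m1 by force
      then show ?thesis using m0 by (simp add: \<zeta>_def)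
    qed
  qed
qed

text \<open>The product rule off \<open>T\<close>. The gradient is reset to zero on \<open>T\<close>
  because \<open>\<kappa> z *\<^sub>R l z\<close> need not vanish there.\<close>

lemma piecewise_C1_mult:
  assumes "piecewise_C1 T \<kappa> k" "piecewise_C1 {} \<zeta> l"
  shows "piecewise_C1 T (\<lambda>z::real^2. \<zeta> z * \<kappa> z) (\<lambda>z. if z \<in> T then 0 else \<zeta> z *\<^sub>R k z + \<kappa> z *\<^sub>R l z)"
  unfolding piecewise_C1_def
proof (intro conjI allI ballI impI)
  have 1: "finite T" "continuous_on UNIV \<kappa>" "\<And>z. z \<notin> T \<Longrightarrow> (\<kappa> has_derivative (\<lambda>h. k z \<bullet> h)) (at z)"
    "k \<in> borel_measurable borel" "\<And>R. \<exists>B. \<forall>z\<in>cball (0::real^2) R. norm (k z) \<le> B"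
    and 2: "continuous_on UNIV \<zeta>" "\<And>z. (\<zeta> has_derivative (\<lambda>h. l z \<bullet> h)) (at z)"
    "l \<in> borel_measurable borel" "\<And>R. \<exists>B. \<forall>z\<in>cball 0 R. norm (l z) \<le> B"
    using assms by (auto simp: piecewise_C1_def)
  show "finite T" by fact
  show "continuous_on UNIV (\<lambda>z. \<zeta> z * \<kappa> z)" by (intro continuous_intros 1 2)
  show "((\<lambda>z. \<zeta> z * \<kappa> z) has_derivative (\<lambda>h. (if z \<in> T then 0 else \<zeta> z *\<^sub>R k z + \<kappa> z *\<^sub>R l z) \<bullet> h)) (at z)" if "z \<notin> T" for z
    using has_derivative_mult[OF 2(2)[of z] 1(3)[OF that]] that by (simp add: inner_add_left algebra_simps)
  have [measurable]: "T \<in> sets borel" "\<kappa> \<in> borel_measurable borel" "\<zeta> \<in> borel_measurable borel"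
      "k \<in> borel_measurable borel" "l \<in> borel_measurable borel"
    using 1 2 borel_closed[OF finite_imp_closed[OF 1(1)]] by (auto intro: borel_measurable_continuous_onI)
  show "(\<lambda>z. if z \<in> T then 0 else \<zeta> z *\<^sub>R k z + \<kappa> z *\<^sub>R l z) \<in> borel_measurable borel" by measurable
  fix R :: real
  obtain B1 where B1: "\<And>z. z \<in> cball 0 R \<Longrightarrow> norm (k z) \<le> B1" using 1(5) by blast
  obtain B2 where B2: "\<And>z. z \<in> cball 0 R \<Longrightarrow> norm (l z) \<le> B2" using 2(4) by blast
  have "bounded (\<zeta> ` cball 0 R)" "bounded (\<kappa> ` cball 0 R)"
    by (intro compact_imp_bounded compact_continuous_image continuous_on_subset[OF 1(2)] continuous_on_subset[OF 2(1)]; auto)+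
  then obtain A1 A2 where A: "\<And>z. z \<in> cball (0::real^2) R \<Longrightarrow> \<bar>\<zeta> z\<bar> \<le> A1" "\<And>z. z \<in> cball 0 R \<Longrightarrow> \<bar>\<kappa> z\<bar> \<le> A2"
    unfolding bounded_iff by (metis imageI real_norm_def)
  show "\<exists>B. \<forall>z\<in>cball 0 R. norm (if z \<in> T then 0 else \<zeta> z *\<^sub>R k z + \<kappa> z *\<^sub>R l z) \<le> B"
  proof (intro exI[of _ "A1 * B1 + A2 * B2"] ballI)
    fix z :: "real^2" assume z: "z \<in> cball 0 R"
    have "norm (\<zeta> z *\<^sub>R k z + \<kappa> z *\<^sub>R l z) \<le> \<bar>\<zeta> z\<bar> * norm (k z) + \<bar>\<kappa> z\<bar> * norm (l z)"
      using norm_triangle_ineq[of "\<zeta> z *\<^sub>R k z" "\<kappa> z *\<^sub>R l z"] by simp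
    also have "\<dots> \<le> A1 * B1 + A2 * B2"
      using A[OF z] B1[OF z] B2[OF z] by (intro add_mono mult_mono) (auto intro: order_trans[OF abs_ge_zero])
    finally have *: "norm (\<zeta> z *\<^sub>R k z + \<kappa> z *\<^sub>R l z) \<le> A1 * B1 + A2 * B2" .
    show "norm (if z \<in> T then 0 else \<zeta> z *\<^sub>R k z + \<kappa> z *\<^sub>R l z) \<le> A1 * B1 + A2 * B2"
      using order_trans[OF norm_ge_zero *] * by simp
  qed
qed auto

lemma piecewise_C1_compl:
  assumes "piecewise_C1 {} \<zeta> l"
  shows "piecewise_C1 {} (\<lambda>z. 1 - \<zeta> z) (\<lambda>z. - l z)"
  using assms unfolding piecewise_C1_def
  by (auto intro!: continuous_intros derivative_eq_intros)

lemma green_integrand_integrable: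
  assumes S: "open S" "bounded S" and \<kappa>: "piecewise_C1 T \<kappa> k" and G: "C1_field G G'"
  shows "integrable lborel (\<lambda>z. indicator S z * (\<kappa> z * dvg G' z + k z \<bullet> G z))"
proof -
  obtain R where "S \<subseteq> ball 0 R" using bounded_subset_ballD[OF S(2), of 0] by auto
  then have R: "S \<subseteq> cball 0 R" using ball_subset_cball by blast
  have k: "continuous_on UNIV \<kappa>" and km [measurable]: "k \<in> borel_measurable borel" using \<kappa> by (auto simp: piecewise_C1_def)
  have g: "continuous_on UNIV (dvg G')" "continuous_on UNIV G"
    using G C1_field_continuous by (auto simp: C1_field_def dvg_def[abs_def] intro!: continuous_intros)
  obtain Bk where Bk: "\<And>z. z \<in> cball 0 R \<Longrightarrow> norm (k z) \<le> Bk" using \<kappa> unfolding piecewise_C1_def by blast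
  have "bounded ((\<lambda>z. \<kappa> z * dvg G' z) ` cball 0 R)" "bounded (G ` cball 0 R)"
    by (intro compact_imp_bounded compact_continuous_image continuous_intros continuous_on_subset[OF k]
        continuous_on_subset[OF g(1)] continuous_on_subset[OF g(2)]; auto)+
  then obtain B1 B2 where B: "\<And>z. z \<in> cball 0 R \<Longrightarrow> \<bar>\<kappa> z * dvg G' z\<bar> \<le> B1" "\<And>z. z \<in> cball 0 R \<Longrightarrow> norm (G z) \<le> B2"
    unfolding bounded_iff by (metis imageI real_norm_def)
  have [measurable]: "\<kappa> \<in> borel_measurable borel" "(\<lambda>z. dvg G' z) \<in> borel_measurable borel" "G \<in> borel_measurable borel" "S \<in> sets borel"
    using k g S by (auto intro: borel_measurable_continuous_onI)
  show ?thesis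
  proof (rule integrable_bounded_support[of _ "\<bar>B1 + Bk * B2\<bar>" S])
    show "\<bar>indicator S z * (\<kappa> z * dvg G' z + k z \<bullet> G z)\<bar> \<le> \<bar>B1 + Bk * B2\<bar>" for z
    proof (cases "z \<in> S")
      case True
      then have z: "z \<in> cball 0 R" using R by auto
      have "\<bar>k z \<bullet> G z\<bar> \<le> norm (k z) * norm (G z)" by (rule Cauchy_Schwarz_ineq2)
      also have "\<dots> \<le> Bk * B2"
        using Bk[OF z] B(2)[OF z] by (intro mult_mono) (auto intro: order_trans[OF norm_ge_zero])
      finally show ?thesis using B(1)[OF z] True by simp
    qed simp
  qed (use S in auto)
qed

text \<open>A multiplier that vanishes near the boundary of \<open>S\<close> can be cut off by the
  indicator of \<open>S\<close> without losing regularity. The graph formula is then applied to the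
  horizontal line at height \<open>- R\<close> below \<open>S\<close>, on which the extension
  vanishes.\<close>

lemma green_interior:
  assumes S: "open S" "bounded S" and \<kappa>: "piecewise_C1 T \<kappa> k" and G: "C1_field G G'"
    and V: "open V" "frontier S \<subseteq> V" "\<And>z. z \<in> V \<Longrightarrow> \<kappa> z = 0"
  shows "(\<integral>z. indicator S z * (\<kappa> z * dvg G' z + k z \<bullet> G z) \<partial>lborel) = 0"
proof -
  define \<kappa>' where "\<kappa>' z = indicator S z * \<kappa> z" for z
  define k' where "k' z = indicator S z *\<^sub>R k z" for z
  obtain R where R: "R > 0" "S \<subseteq> ball 0 R" using bounded_subset_ballD[OF S(2), of 0] by auto
  \<comment> \<open>Regularity of \<open>\<kappa>'\<close> can be checked on two open sets: on
    \<open>S\<close> it agrees with \<open>\<kappa>\<close>, and on the other it is zero, the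
    boundary being covered by \<open>V\<close>.\<close>
  have cover: "UNIV = S \<union> (V \<union> (- closure S))"
    using V(2) S(1) by (auto simp: frontier_def interior_open)
  have op: "open (V \<union> (- closure S))" using V(1) by auto
  have \<kappa>f: "finite T" "continuous_on UNIV \<kappa>" "\<And>z. z \<notin> T \<Longrightarrow> (\<kappa> has_derivative (\<lambda>h. k z \<bullet> h)) (at z)" "\<And>z. z \<in> T \<Longrightarrow> k z = 0"
    "k \<in> borel_measurable borel" "\<And>R. \<exists>B. \<forall>z\<in>cball 0 R. norm (k z) \<le> B"
    using \<kappa> by (auto simp: piecewise_C1_def)
  have z0: "\<kappa>' z = 0" if "z \<in> V \<union> (- closure S)" for z
    using that V(3) closure_subset by (auto simp: \<kappa>'_def indicator_def)
  have k0: "k' z = 0" if "z \<in> V \<union> (- closure S)" for z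
  proof (cases "z \<in> V")
    case True
    then show ?thesis using piecewise_C1_zero[OF \<kappa> V(1) _ V(3)] by (simp add: k'_def)
  next
    case False
    then show ?thesis using that closure_subset by (auto simp: k'_def indicator_def)
  qed
  have pc: "piecewise_C1 T \<kappa>' k'"
    unfolding piecewise_C1_def
  proof (intro conjI allI ballI impI)
    show "continuous_on UNIV \<kappa>'"
      unfolding cover
    proof (rule continuous_on_open_Un[OF S(1) op])
      show "continuous_on S \<kappa>'"
        using continuous_on_cong[of S S \<kappa>' \<kappa>] continuous_on_subset[OF \<kappa>f(2)] by (auto simp: \<kappa>'_def)
      show "continuous_on (V \<union> - closure S) \<kappa>'"
        using continuous_on_cong[of "V \<union> - closure S" "V \<union> - closure S" \<kappa>' "\<lambda>_. 0"] z0 by auto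
    qed
    show "(\<kappa>' has_derivative (\<lambda>h. k' z \<bullet> h)) (at z)" if "z \<notin> T" for z
    proof (cases "z \<in> S")
      case True
      then have "(\<kappa>' has_derivative (\<lambda>h. k z \<bullet> h)) (at z)"
        by (intro has_derivative_transform_within_open[OF \<kappa>f(3)[OF that] S(1)]) (auto simp: \<kappa>'_def)
      then show ?thesis using True by (simp add: k'_def)
    next
      case False
      then have z: "z \<in> V \<union> - closure S" using cover by auto
      have "(\<kappa>' has_derivative (\<lambda>h. 0)) (at z)"
        by (rule has_derivative_transform_within_open[OF has_derivative_const op z]) (use z0 in auto)
      then show ?thesis using k0[OF z] by simp
    qed
    show "k' z = 0" if "z \<in> T" for z using \<kappa>f(4)[OF that] by (simp add: k'_def)
    show "k' \<in> borel_measurable borel" unfolding k'_def using \<kappa>f(5) S(1) by simp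
    fix \<rho> :: real
    obtain B where B: "\<forall>z\<in>cball 0 \<rho>. norm (k z) \<le> B" using \<kappa>f(6) by blast
    show "\<exists>B. \<forall>z\<in>cball 0 \<rho>. norm (k' z) \<le> B"
      by (rule exI[of _ "\<bar>B\<bar>"]) (use B in \<open>auto simp: k'_def indicator_def\<close>)
  qed fact
  have e: "indicator S z * (\<kappa> z * dvg G' z + k z \<bullet> G z) =
      indicator {z. - R < axis 2 1 \<bullet> (z - 0)} z * (\<kappa>' z * dvg G' z + k' z \<bullet> G z)" for z
  proof (cases "z \<in> S")
    case True
    then have "norm z < R" using R by auto
    then have "\<bar>axis 2 1 \<bullet> z\<bar> < R"
      using Cauchy_Schwarz_ineq2[of "axis 2 1" z] by (simp add: norm_axis_1)
    then have "- R < axis 2 1 \<bullet> z" by simp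
    then show ?thesis using True by (simp add: \<kappa>'_def k'_def)
  qed (simp add: \<kappa>'_def k'_def)
  have "(\<integral>z. indicator {z. - R < axis 2 1 \<bullet> (z - 0)} z * (\<kappa>' z * dvg G' z + k' z \<bullet> G z) \<partial>lborel) =
     (\<integral>s. \<kappa>' (0 + s *\<^sub>R axis 1 1 + (- R) *\<^sub>R axis 2 1) * (G (0 + s *\<^sub>R axis 1 1 + (- R) *\<^sub>R axis 2 1) \<bullet> (0 *\<^sub>R axis 1 1 - axis 2 1)) \<partial>lborel)"
    by (rule green_above_graph[OF _ _ _ pc G, of "axis 1 1" "axis 2 1" 0 R "\<lambda>_. -R" "\<lambda>_. 0"])
      (use R in \<open>auto simp: norm_axis_1 inner_axis_axis \<kappa>'_def indicator_def subset_iff not_less\<close>)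
  also have "\<dots> = 0"
  proof -
    have "\<kappa>' (0 + s *\<^sub>R axis 1 1 + (- R) *\<^sub>R axis 2 1) = 0" for s
    proof -
      let ?z = "0 + s *\<^sub>R axis 1 1 + (- R) *\<^sub>R axis 2 1 :: real^2"
      have "\<bar>?z $ 2\<bar> \<le> norm ?z" by (rule component_le_norm_cart)
      moreover have "?z $ 2 = - R" by (simp add: axis_def)
      ultimately have "?z \<notin> S" using R by (auto simp del: vector_add_component vector_scaleR_component)
      then show ?thesis by (simp add: \<kappa>'_def)
    qed
    then show ?thesis by simp
  qed
  finally show ?thesis using e by simp
qed

text \<open>Compactness covers the boundary by finitely many chart balls, and induction over the
  cover peels off one ball at a time through
  \<open>\<kappa> = \<zeta> \<kappa> + (1 - \<zeta>) \<kappa>\<close>. Both pieces stay bounded by 1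
  on the boundary, and what is left after the last ball falls to
  \<open>green_interior\<close>.\<close>

theorem green_C2:
  assumes S: "open S" "bounded S" "C2_boundary S"
  obtains \<epsilon> where "\<epsilon> > 0"
    "\<And>T \<kappa> k G G'. piecewise_C1 T \<kappa> k \<Longrightarrow> C1_field G G' \<Longrightarrow> (\<And>z. z \<in> frontier S \<Longrightarrow> \<bar>\<kappa> z\<bar> \<le> 1) \<Longrightarrow>
       ennreal (\<epsilon> * (\<integral>z. indicator S z * (\<kappa> z * dvg G' z + k z \<bullet> G z) \<partial>lborel)\<^sup>2) \<le>
       (\<integral>\<^sup>+z\<in>frontier S. ennreal ((G z \<bullet> outer_normal UNIV S z)\<^sup>2) \<partial>hausdorff1)"
proof -
  let ?I = "\<lambda>\<kappa> k G G'. (\<integral>z. indicator S z * (\<kappa> z * dvg G' z + k z \<bullet> G z) \<partial>lborel)"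
  let ?B = "\<lambda>G. (\<integral>\<^sup>+z\<in>frontier S. ennreal ((G z \<bullet> outer_normal UNIV S z)\<^sup>2) \<partial>hausdorff1)"
  define Q where "Q p \<rho> \<longleftrightarrow> (\<exists>\<epsilon>>0. \<forall>T \<kappa> k G G'. piecewise_C1 T \<kappa> k \<longrightarrow> C1_field G G' \<longrightarrow> (\<forall>z\<in>frontier S. \<bar>\<kappa> z\<bar> \<le> 1) \<longrightarrow>
      (\<forall>z. z \<notin> cball p (2 * \<rho>) \<longrightarrow> \<kappa> z = 0) \<longrightarrow> ennreal (\<epsilon> * (?I \<kappa> k G G')\<^sup>2) \<le> ?B G)" for p \<rho>
  have "\<exists>\<rho>>0. Q p \<rho>" if p: "p \<in> frontier S" for p
  proof -
    obtain r u n c c' where "graph_chart S p u n r c c'" using C2_boundary_chart[OF S(1,3) p] .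
    then interpret graph_chart S p u n r c c' .
    show ?thesis
    proof (rule green_chart)
      fix \<epsilon> :: real
      assume e: "\<epsilon> > 0" "\<And>T \<kappa> k G G'. piecewise_C1 T \<kappa> k \<Longrightarrow> C1_field G G' \<Longrightarrow> (\<And>z. z \<in> frontier S \<Longrightarrow> \<bar>\<kappa> z\<bar> \<le> 1) \<Longrightarrow>
       (\<And>z. z \<notin> cball p (r / 2) \<Longrightarrow> \<kappa> z = 0) \<Longrightarrow> ennreal (\<epsilon> * (?I \<kappa> k G G')\<^sup>2) \<le> ?B G"
    show ?thesis
      unfolding Q_def
    \<comment> \<open>A quarter of the chart radius: the cutoff lives on twice this radius and so
      stays within \<open>cball p (r / 2)\<close>.\<close>
    proof (rule exI[of _ "r / 4"], intro conjI)
      show "\<exists>\<epsilon>>0. \<forall>T \<kappa> k G G'. piecewise_C1 T \<kappa> k \<longrightarrow> C1_field G G' \<longrightarrow> (\<forall>z\<in>frontier S. \<bar>\<kappa> z\<bar> \<le> 1) \<longrightarrow>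
          (\<forall>z. z \<notin> cball p (2 * (r / 4)) \<longrightarrow> \<kappa> z = 0) \<longrightarrow> ennreal (\<epsilon> * (?I \<kappa> k G G')\<^sup>2) \<le> ?B G"
      proof (intro exI[of _ \<epsilon>] conjI allI impI)
        fix T \<kappa> k G G'
        assume "piecewise_C1 T \<kappa> k" "C1_field G G'" "\<forall>z\<in>frontier S. \<bar>\<kappa> z\<bar> \<le> 1" "\<forall>z. z \<notin> cball p (2 * (r / 4)) \<longrightarrow> \<kappa> z = 0"
        then show "ennreal (\<epsilon> * (?I \<kappa> k G G')\<^sup>2) \<le> ?B G" by (intro e(2)) auto
      qed (rule e(1))
    qed (use r in simp)
    qed
  qed
  then obtain \<rho> where \<rho>: "\<And>p. p \<in> frontier S \<Longrightarrow> \<rho> p > 0"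
    "\<And>p. p \<in> frontier S \<Longrightarrow> Q p (\<rho> p)"
    by metis
  have "compact (frontier S)" using S(2) by (simp add: compact_frontier_bounded)
  then obtain F where F: "F \<subseteq> frontier S" "finite F" "frontier S \<subseteq> (\<Union>p\<in>F. ball p (\<rho> p))"
    using \<rho>(1) by (elim compactE_image[of _ "frontier S" "\<lambda>p. ball p (\<rho> p)"]) auto
  \<comment> \<open>\<open>V\<close> is a neighbourhood of the whole boundary that does not change
    during the induction; when no balls are left, \<open>\<kappa>\<close> vanishes on all of
    \<open>V\<close>.\<close>
  have ind: "\<exists>\<epsilon>>0. \<forall>T \<kappa> k G G' V. piecewise_C1 T \<kappa> k \<longrightarrow> C1_field G G' \<longrightarrow> (\<forall>z\<in>frontier S. \<bar>\<kappa> z\<bar> \<le> 1) \<longrightarrow>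
      open V \<longrightarrow> frontier S \<subseteq> V \<longrightarrow> (\<forall>z\<in>V - (\<Union>p\<in>F. ball p (\<rho> p)). \<kappa> z = 0) \<longrightarrow> ennreal (\<epsilon> * (?I \<kappa> k G G')\<^sup>2) \<le> ?B G"
    if "finite F" "F \<subseteq> frontier S" for F
    using that
  proof (induction F rule: finite_induct)
    case empty
    show ?case
    proof (intro exI[of _ 1] conjI allI impI)
      fix T \<kappa> k G G' V
      assume "piecewise_C1 T \<kappa> k" "C1_field G G'" "open V" "frontier S \<subseteq> V" "\<forall>z\<in>V - (\<Union>p\<in>{}. ball p (\<rho> p)). \<kappa> z = 0"
      then have "?I \<kappa> k G G' = 0" by (intro green_interior[OF S(1,2)]) auto
      then show "ennreal (1 * (?I \<kappa> k G G')\<^sup>2) \<le> ?B G" by simp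
    qed simp
  next
    case (insert p F)
    obtain \<epsilon>1 where e1: "\<epsilon>1 > 0" "\<And>T \<kappa> k G G' V. piecewise_C1 T \<kappa> k \<Longrightarrow> C1_field G G' \<Longrightarrow> (\<forall>z\<in>frontier S. \<bar>\<kappa> z\<bar> \<le> 1) \<Longrightarrow>
      open V \<Longrightarrow> frontier S \<subseteq> V \<Longrightarrow> (\<forall>z\<in>V - (\<Union>p\<in>F. ball p (\<rho> p)). \<kappa> z = 0) \<Longrightarrow> ennreal (\<epsilon>1 * (?I \<kappa> k G G')\<^sup>2) \<le> ?B G"
      using insert.IH insert.prems by blast
    have p: "p \<in> frontier S" using insert.prems by simp
    obtain \<epsilon>2 where e2: "\<epsilon>2 > 0" "\<And>T \<kappa> k G G'. piecewise_C1 T \<kappa> k \<Longrightarrow> C1_field G G' \<Longrightarrow> (\<forall>z\<in>frontier S. \<bar>\<kappa> z\<bar> \<le> 1) \<Longrightarrow>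
      (\<forall>z. z \<notin> cball p (2 * \<rho> p) \<longrightarrow> \<kappa> z = 0) \<Longrightarrow> ennreal (\<epsilon>2 * (?I \<kappa> k G G')\<^sup>2) \<le> ?B G"
      using \<rho>(2)[OF p] unfolding Q_def by blast
    obtain \<zeta> l where \<zeta>: "piecewise_C1 {} \<zeta> l" "\<And>z. 0 \<le> \<zeta> z \<and> \<zeta> z \<le> 1"
      "\<And>z. z \<in> cball p (\<rho> p) \<Longrightarrow> \<zeta> z = 1" "\<And>z. z \<notin> cball p (2 * \<rho> p) \<Longrightarrow> \<zeta> z = 0"
      using cutoff[OF \<rho>(1)[OF p]] by metis
    \<comment> \<open>A factor 2 is lost in \<open>(x + y)^2 \<le> 2 x^2 + 2 y^2\<close> and another
      in bounding a sum of two terms by twice the larger one.\<close>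
    define \<epsilon> where "\<epsilon> = min \<epsilon>1 \<epsilon>2 / 4"
    show ?case
    proof (intro exI[of _ \<epsilon>] conjI allI impI)
      show "\<epsilon> > 0" using e1(1) e2(1) by (simp add: \<epsilon>_def)
      fix T \<kappa> k G G' V
      assume \<kappa>: "piecewise_C1 T \<kappa> k" and G: "C1_field G G'" and \<kappa>1: "\<forall>z\<in>frontier S. \<bar>\<kappa> z\<bar> \<le> 1"
        and V: "open V" "frontier S \<subseteq> V" and z: "\<forall>z\<in>V - (\<Union>p\<in>insert p F. ball p (\<rho> p)). \<kappa> z = 0"
      define \<kappa>1 \<kappa>2 where "\<kappa>1 = (\<lambda>z. \<zeta> z * \<kappa> z)" and "\<kappa>2 = (\<lambda>z. (1 - \<zeta> z) * \<kappa> z)"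
      define k1 k2 where "k1 = (\<lambda>z. if z \<in> T then 0 else \<zeta> z *\<^sub>R k z + \<kappa> z *\<^sub>R l z)"
        and "k2 = (\<lambda>z. if z \<in> T then 0 else (1 - \<zeta> z) *\<^sub>R k z + \<kappa> z *\<^sub>R (- l z))"
      have pc1: "piecewise_C1 T \<kappa>1 k1" unfolding \<kappa>1_def k1_def by (rule piecewise_C1_mult[OF \<kappa> \<zeta>(1)])
      have pc2: "piecewise_C1 T \<kappa>2 k2" unfolding \<kappa>2_def k2_def by (rule piecewise_C1_mult[OF \<kappa> piecewise_C1_compl[OF \<zeta>(1)]])
      have bd: "\<bar>\<kappa>1 z\<bar> \<le> 1" "\<bar>\<kappa>2 z\<bar> \<le> 1" if "z \<in> frontier S" for z
        using \<kappa>1 that \<zeta>(2)[of z] by (auto simp: \<kappa>1_def \<kappa>2_def abs_mult intro!: mult_le_one)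
      have "ennreal (\<epsilon>2 * (?I \<kappa>1 k1 G G')\<^sup>2) \<le> ?B G"
        by (rule e2(2)[OF pc1 G]) (use bd \<zeta>(4) in \<open>auto simp: \<kappa>1_def\<close>)
      moreover have "ennreal (\<epsilon>1 * (?I \<kappa>2 k2 G G')\<^sup>2) \<le> ?B G"
        by (rule e1(2)[OF pc2 G _ V]) (use bd \<zeta>(3) z in \<open>auto simp: \<kappa>2_def\<close>)
      moreover have "?I \<kappa> k G G' = ?I \<kappa>1 k1 G G' + ?I \<kappa>2 k2 G G'"
      proof -
        have kk: "k z = k1 z + k2 z" for z
          using \<kappa> by (cases "z \<in> T") (auto simp: k1_def k2_def piecewise_C1_def algebra_simps)
        have "indicator S z * (\<kappa> z * dvg G' z + k z \<bullet> G z) =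
            indicator S z * (\<kappa>1 z * dvg G' z + k1 z \<bullet> G z) + indicator S z * (\<kappa>2 z * dvg G' z + k2 z \<bullet> G z)" for z
          unfolding kk by (simp add: \<kappa>1_def \<kappa>2_def inner_add_left algebra_simps)
        then show ?thesis
          using green_integrand_integrable[OF S(1,2) pc1 G] green_integrand_integrable[OF S(1,2) pc2 G] by simp
      qed
      moreover have "\<epsilon> * (x + y)\<^sup>2 \<le> max (\<epsilon>2 * x\<^sup>2) (\<epsilon>1 * y\<^sup>2)" for x y
      proof -
        have "\<epsilon> * (x + y)\<^sup>2 \<le> \<epsilon> * (2 * x\<^sup>2 + 2 * y\<^sup>2)"
          using e1(1) e2(1) sum_squares_bound[of x y] by (intro mult_left_mono) (auto simp: \<epsilon>_def power2_sum)
        also have "\<dots> = (min \<epsilon>1 \<epsilon>2 * x\<^sup>2 + min \<epsilon>1 \<epsilon>2 * y\<^sup>2) / 2"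
          by (simp add: \<epsilon>_def algebra_simps)
        also have "\<dots> \<le> (\<epsilon>2 * x\<^sup>2 + \<epsilon>1 * y\<^sup>2) / 2"
          by (intro divide_right_mono add_mono mult_right_mono) auto
        also have "\<dots> \<le> max (\<epsilon>2 * x\<^sup>2) (\<epsilon>1 * y\<^sup>2)" by (simp add: max_def)
        finally show ?thesis .
      qed
      ultimately show "ennreal (\<epsilon> * (?I \<kappa> k G G')\<^sup>2) \<le> ?B G"
        by (smt (verit) ennreal_leI max_def order_trans)
    qed
  qed
  obtain \<epsilon> where e: "\<epsilon> > 0" "\<And>T \<kappa> k G G' V. piecewise_C1 T \<kappa> k \<Longrightarrow> C1_field G G' \<Longrightarrow> (\<forall>z\<in>frontier S. \<bar>\<kappa> z\<bar> \<le> 1) \<Longrightarrow>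
      open V \<Longrightarrow> frontier S \<subseteq> V \<Longrightarrow> (\<forall>z\<in>V - (\<Union>p\<in>F. ball p (\<rho> p)). \<kappa> z = 0) \<Longrightarrow> ennreal (\<epsilon> * (?I \<kappa> k G G')\<^sup>2) \<le> ?B G"
    using ind[OF F(2,1)] by blast
  show ?thesis
  proof (rule that[OF e(1)])
    fix T \<kappa> k G G'
    assume "piecewise_C1 T \<kappa> k" "C1_field G G'" "\<And>z. z \<in> frontier S \<Longrightarrow> \<bar>\<kappa> z\<bar> \<le> 1"
    \<comment> \<open>With \<open>V\<close> chosen as the union of the balls, the condition on the
      rest of \<open>V\<close> is empty.\<close>
    then show "ennreal (\<epsilon> * (?I \<kappa> k G G')\<^sup>2) \<le> ?B G"
      using F(3) by (intro e(2)[of T \<kappa> k G G' "\<Union>p\<in>F. ball p (\<rho> p)"]) auto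
  qed
qed

section \<open>The divergence theorem on the hexagon\<close>

lemma plane_closed_subspace: "closed mis_plane" "subspace mis_plane"
  unfolding mis_plane_def
  by (intro closed_Collect_eq continuous_intros) (auto simp: subspace_def algebra_simps, metis distrib_left mult_zero_right)

text \<open>\<open>tproj *v axis k 1\<close> represents the coordinate \<open>\<theta> $ k\<close>
  on the plane: up to its length \<open>sqrt (2/3)\<close> it is the normal of the sides on which
  this coordinate is constant.\<close>

lemma inner_tproj:
  assumes "h \<in> mis_plane"
  shows "h \<bullet> (tproj *v axis k 1) = h $ k"
proof -
  have "h $ 3 = - h $ 1 - h $ 2" using assms by (simp add: mis_plane_def)
  then show ?thesis using exhaust_3[of k]
    by (auto simp: inner_vec_def sum_3 tproj_nth axis_def field_simps)
qed

lemma norm_tproj_axis: "norm (sqrt (3/2) *\<^sub>R (tproj *v axis k 1)) = 1"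
proof -
  have "(tproj *v axis k 1) \<bullet> (tproj *v axis k 1) = (2/3 :: real)"
    using exhaust_3[of k] by (auto simp: inner_vec_def sum_3 tproj_nth axis_def)
  then have "norm (tproj *v axis k 1) = sqrt (2/3)" by (simp add: norm_eq_sqrt_inner)
  then show ?thesis by (simp flip: real_sqrt_mult)
qed

text \<open>One open side for each \<open>k\<close> and each sign \<open>s = 1\<close> or
  \<open>s = -1\<close>. The corners are left out because they have no outer normal.\<close>

definition hex_edge :: "3 \<Rightarrow> real \<Rightarrow> (real^3) set" where
  "hex_edge k s = {\<theta> \<in> mis_plane. \<theta>$k = s * (pi/4) \<and> (\<forall>i. i \<noteq> k \<longrightarrow> \<bar>\<theta>$i\<bar> < pi/4)}"

lemma hex_edge_rel_frontier:
  assumes \<theta>: "\<theta> \<in> hex_edge k s" and s: "\<bar>s\<bar> = 1"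
  shows "\<theta> \<in> rel_frontier mis"
proof -
  have le: "\<bar>\<theta>$i\<bar> \<le> pi/4" for i
  proof (cases "i = k")
    case True
    then have "\<theta>$i = s * (pi/4)" using \<theta> unfolding hex_edge_def by blast
    then have "\<bar>\<theta>$i\<bar> = \<bar>s\<bar> * \<bar>pi/4\<bar>" by (simp only: abs_mult)
    then show ?thesis using s by simp
  next
    case False
    then show ?thesis using \<theta> by (auto simp: hex_edge_def intro: less_imp_le)
  qed
  have "\<theta> \<notin> mis"
  proof
    assume "\<theta> \<in> mis"
    then have "- (pi/4) < \<theta>$k" "\<theta>$k < pi/4" by (auto simp: mis_def)
    moreover have "\<theta>$k = s * (pi/4)" using \<theta> unfolding hex_edge_def by blast
    moreover have "s = 1 \<or> s = -1" using s by linarith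
    ultimately show False by auto
  qed
  then have "\<theta> \<notin> rel_interior mis" using rel_interior_subset by blast
  moreover have "\<theta> \<in> closure mis"
    unfolding closure_sequential
  proof (intro exI conjI allI)
    \<comment> \<open>Shrinking towards the origin, a point of \<open>mis\<close>, moves the side
      into the hexagon.\<close>
    let ?x = "\<lambda>n::nat. (1 - 1 / real (n + 2)) *\<^sub>R \<theta>"
    have "(\<lambda>n. 1 / real (n + 2)) \<longlonglongrightarrow> 0"
      using LIMSEQ_ignore_initial_segment[OF lim_1_over_n, of 2] by simp
    then have "?x \<longlonglongrightarrow> (1 - 0) *\<^sub>R \<theta>" by (intro tendsto_intros)
    then show "?x \<longlonglongrightarrow> \<theta>" by simp
    fix n
    define t where "t = 1 - 1 / real (n + 2)"
    have t: "0 < t" "t < 1" by (auto simp: t_def field_simps)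
    have "\<bar>t * \<theta>$i\<bar> < pi/4" for i
    proof -
      have "\<bar>t * \<theta>$i\<bar> = t * \<bar>\<theta>$i\<bar>" using t by (simp add: abs_mult)
      also have "\<dots> \<le> t * (pi/4)" using t le by (intro mult_left_mono) auto
      also have "\<dots> < 1 * (pi/4)" using t by (intro mult_strict_right_mono) auto
      finally show ?thesis by simp
    qed
    then have "- (pi/4) < t * \<theta>$i \<and> t * \<theta>$i < pi/4" for i by (meson abs_less_iff minus_less_iff)
    moreover have "t * \<theta>$1 + t * \<theta>$2 + t * \<theta>$3 = 0"
      using \<theta> by (simp add: hex_edge_def mis_plane_def flip: distrib_left)
    ultimately show "?x n \<in> mis" unfolding t_def[symmetric] by (simp add: mis_def)
  qed
  ultimately show ?thesis by (simp add: rel_frontier_def)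
qed

text \<open>Near a point of an open side only one of the six constraints is active, so locally
  \<open>mis\<close> is exactly a half plane. The radius \<open>r\<close> collects the slack in the
  constraints on the other coordinates, and its bound by \<open>pi/4\<close> keeps off the opposite
  side.\<close>

lemma hex_edge_normal:
  assumes \<theta>: "\<theta> \<in> hex_edge k s" and s: "\<bar>s\<bar> = 1"
  shows "outer_normal mis_plane mis \<theta> = s *\<^sub>R sqrt (3/2) *\<^sub>R (tproj *v axis k 1)"
proof (rule outer_normal_eq[OF plane_closed_subspace(2)])
  let ?\<nu> = "s *\<^sub>R sqrt (3/2) *\<^sub>R (tproj *v axis k 1)"
  have \<theta>': "\<theta> \<in> mis_plane" "\<theta>$k = s * (pi/4)" "\<And>i. i \<noteq> k \<Longrightarrow> \<bar>\<theta>$i\<bar> < pi/4"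
    using \<theta> by (auto simp: hex_edge_def)
  show "is_outer_normal mis_plane mis \<theta> ?\<nu>"
    unfolding is_outer_normal_def
  proof (intro conjI allI impI)
    show "?\<nu> \<in> mis_plane"
      using plane_closed_subspace(2) tproj_in_plane by (auto intro!: subspace_scale)
    show "norm ?\<nu> = 1" using s norm_tproj_axis[of k] by (simp only: norm_scaleR)
    fix \<epsilon> :: real assume e: "\<epsilon> > 0"
    define r where "r = Min (insert (pi/4) ((\<lambda>i. pi/4 - \<bar>\<theta>$i\<bar>) ` (UNIV - {k})))"
    have r: "r > 0" using \<theta>'(3) by (auto simp: r_def)
    have ri: "r \<le> pi/4 - \<bar>\<theta>$i\<bar>" if "i \<noteq> k" for i using that by (auto simp: r_def intro!: Min_le)
    have r4: "r \<le> pi/4" unfolding r_def by (rule Min_le) auto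
    have s2: "s * s = 1" using s by (metis abs_mult_self_eq mult.right_neutral)
    have s1: "s = 1 \<or> s = -1" using s by linarith
    show "\<exists>r>0. \<forall>h\<in>mis_plane. norm h < r \<longrightarrow> (h \<bullet> ?\<nu> < - \<epsilon> * norm h \<longrightarrow> \<theta> + h \<in> mis) \<and> (\<epsilon> * norm h < h \<bullet> ?\<nu> \<longrightarrow> \<theta> + h \<notin> mis)"
    proof (intro exI[of _ r] conjI ballI impI)
      fix h assume h: "h \<in> mis_plane" and hr: "norm h < r"
      have hi: "\<bar>h$i\<bar> < r" for i using component_le_norm_cart[of h i] hr by linarith
      have hn: "h \<bullet> ?\<nu> = sqrt (3/2) * (s * h$k)" by (simp add: inner_tproj[OF h])
      have sq: "sqrt (3/2) > (0::real)" by simp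
      have plane: "(\<theta> + h)$1 + (\<theta> + h)$2 + (\<theta> + h)$3 = 0"
        using \<theta>'(1) h by (simp add: mis_plane_def)
      show "\<theta> + h \<in> mis" if "h \<bullet> ?\<nu> < - \<epsilon> * norm h"
      proof -
        have "\<epsilon> * norm h \<ge> 0" using e by simp
        then have "sqrt (3/2) * (s * h$k) < 0" using that hn by linarith
        then have "s * h$k < 0" using sq by (simp only: mult_less_0_iff) auto
        then have "\<bar>(\<theta> + h)$k\<bar> < pi/4"
          using s1 \<theta>'(2) hi[of k] r4 by auto
        moreover have "\<bar>(\<theta> + h)$i\<bar> < pi/4" if "i \<noteq> k" for i
          using ri[OF that] hi[of i] by (simp add: abs_if split: if_splits)
        ultimately have "\<bar>(\<theta> + h)$i\<bar> < pi/4" for i by metis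
        then have "- (pi/4) < (\<theta> + h)$i \<and> (\<theta> + h)$i < pi/4" for i by (meson abs_less_iff minus_less_iff)
        then show ?thesis using plane by (simp add: mis_def)
      qed
      show "\<theta> + h \<notin> mis" if "\<epsilon> * norm h < h \<bullet> ?\<nu>"
      proof -
        have "\<epsilon> * norm h \<ge> 0" using e by simp
        then have "sqrt (3/2) * (s * h$k) > 0" using that hn by linarith
        then have "s * h$k > 0" using sq by (simp only: zero_less_mult_iff) auto
        then have "\<not> (- (pi/4) < (\<theta> + h)$k \<and> (\<theta> + h)$k < pi/4)"
          using s1 \<theta>'(2) by auto
        then show ?thesis by (auto simp: mis_def)
      qed
    qed (rule r)
  qed
qed

lemma hex_edge_borel: "hex_edge k s \<in> sets borel"
proof -
  have "hex_edge k s = mis_plane \<inter> {\<theta>. \<theta>$k = s * (pi/4)} \<inter> (\<Inter>i\<in>UNIV - {k}. {\<theta>. \<bar>\<theta>$i\<bar> < pi/4})"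
    by (auto simp: hex_edge_def)
  moreover have "closed {\<theta>::real^3. \<theta>$k = s * (pi/4)}" by (intro closed_Collect_eq continuous_intros)
  moreover have "open (\<Inter>i\<in>UNIV - {k}. {\<theta>::real^3. \<bar>\<theta>$i\<bar> < pi/4})"
    by (intro open_INT ballI open_Collect_less continuous_intros) auto
  ultimately show ?thesis
    using sets.Int[OF sets.Int[OF borel_closed[OF plane_closed_subspace(1)] borel_closed] borel_open] by simp
qed

text \<open>The hexagonal counterpart of \<open>green_chart\<close>. The side is parametrised by a
  coordinate \<open>j\<close>, which is itself a projection, over an interval of length
  \<open>pi/4\<close>. The squared normal component is \<open>3/2\<close> times
  \<open>(G \<theta> $ k)^2\<close>, and this factor is dropped.\<close>

lemma hex_edge_estimate:
  fixes \<gamma> :: "real \<Rightarrow> real^3"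
  assumes \<gamma>: "continuous_on UNIV \<gamma>" "\<And>t. t \<in> {a<..<b} \<Longrightarrow> \<gamma> t \<in> hex_edge k s" "\<And>t. t \<in> {a<..<b} \<Longrightarrow> \<gamma> t $ j = t"
    and s: "\<bar>s\<bar> = 1" and ab: "b - a = pi/4"
    and \<kappa>: "continuous_on UNIV \<kappa>" "\<And>\<theta>. \<theta> \<in> rel_frontier mis \<Longrightarrow> \<bar>\<kappa> \<theta>\<bar> \<le> 1"
    and G: "continuous_on UNIV G" "\<And>\<theta>. G \<theta> \<in> mis_plane"
  shows "ennreal ((\<integral>t. indicator {a<..<b} t * (\<kappa> (\<gamma> t) * G (\<gamma> t) $ k) \<partial>lborel)\<^sup>2 / (pi/4)) \<le>
    (\<integral>\<^sup>+\<theta>\<in>rel_frontier mis. ennreal ((G \<theta> \<bullet> outer_normal mis_plane mis \<theta>)\<^sup>2) \<partial>hausdorff1)"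
proof -
  define J where "J = {a<..<b}"
  define I where "I = (\<integral>t. indicator J t * (\<kappa> (\<gamma> t) * G (\<gamma> t) $ k) \<partial>lborel)"
  define f where "f t = indicator J t * \<kappa> (\<gamma> t)" for t
  define g where "g t = indicator J t * G (\<gamma> t) $ k" for t
  have c: "continuous_on UNIV (\<lambda>t. \<kappa> (\<gamma> t))" "continuous_on UNIV (\<lambda>t. G (\<gamma> t) $ k)"
    by (intro continuous_intros continuous_on_compose2[OF \<kappa>(1) \<gamma>(1)] continuous_on_compose2[OF G(1) \<gamma>(1)]; auto)+
  have [measurable]: "(\<lambda>t. \<kappa> (\<gamma> t)) \<in> borel_measurable borel" "(\<lambda>t. G (\<gamma> t) $ k) \<in> borel_measurable borel" "J \<in> sets borel"
    using c by (auto intro: borel_measurable_continuous_onI simp: J_def)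
  have fg [measurable]: "f \<in> borel_measurable borel" "g \<in> borel_measurable borel"
    unfolding f_def g_def by measurable
  have ab0: "a < b" using ab pi_gt_zero by linarith
  have iJ: "integrable lborel (indicator J :: real \<Rightarrow> real)" "(\<integral>t. indicator J t \<partial>lborel) = pi/4"
    using ab ab0 by (auto simp: J_def intro!: integrable_real_indicator)
  have f1: "(f t)\<^sup>2 \<le> indicator J t" for t
    using \<kappa>(2)[OF hex_edge_rel_frontier[OF \<gamma>(2) s]] by (auto simp: f_def J_def indicator_def abs_square_le_1)
  have if2: "integrable lborel (\<lambda>t. (f t)\<^sup>2)"
  proof (rule Bochner_Integration.integrable_bound[OF iJ(1)])
    show "AE t in lborel. norm ((f t)\<^sup>2) \<le> norm (indicator J t :: real)"
      by (rule AE_I2) (use f1 in simp)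
  qed simp
  have ig2: "integrable lborel (\<lambda>t. (g t)\<^sup>2)"
  proof -
    have "integrable lborel (\<lambda>t. indicator {a..b} t *\<^sub>R (G (\<gamma> t) $ k)\<^sup>2)"
      by (intro borel_integrable_compact continuous_intros continuous_on_subset[OF c(2)]) auto
    then show ?thesis
      by (rule Bochner_Integration.integrable_bound) (auto intro!: AE_I2 simp: g_def J_def indicator_def)
  qed
  have "I = (\<integral>t. f t * g t \<partial>lborel)"
    unfolding I_def by (rule Bochner_Integration.integral_cong) (auto simp: f_def g_def indicator_def)
  then have "I\<^sup>2 \<le> (\<integral>t. (f t)\<^sup>2 \<partial>lborel) * (\<integral>t. (g t)\<^sup>2 \<partial>lborel)"
    using integral_Cauchy_Schwarz(2)[of f lborel g] if2 ig2 by simp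
  also have "\<dots> \<le> (pi/4) * (\<integral>t. (g t)\<^sup>2 \<partial>lborel)"
  proof (rule mult_right_mono)
    have "(\<integral>t. (f t)\<^sup>2 \<partial>lborel) \<le> (\<integral>t. indicator J t \<partial>lborel)" by (intro integral_mono if2 iJ f1)
    then show "(\<integral>t. (f t)\<^sup>2 \<partial>lborel) \<le> pi/4" using iJ(2) by simp
  qed simp
  finally have "I\<^sup>2 / (pi/4) \<le> (\<integral>t. (g t)\<^sup>2 \<partial>lborel)" by (simp add: field_simps)
  then have "ennreal (I\<^sup>2 / (pi/4)) \<le> ennreal (\<integral>t. (g t)\<^sup>2 \<partial>lborel)" by (rule ennreal_leI)
  also have "\<dots> = (\<integral>\<^sup>+t. ennreal ((g t)\<^sup>2) \<partial>lborel)" by (rule nn_integral_eq_integral[symmetric]) (use ig2 in auto)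
  also have "\<dots> = (\<integral>\<^sup>+t\<in>J. (\<lambda>\<theta>. ennreal ((G \<theta> $ k)\<^sup>2) * indicator (hex_edge k s) \<theta>) (\<gamma> t) \<partial>lborel)"
    by (rule nn_integral_cong) (use \<gamma>(2) in \<open>auto simp: g_def J_def indicator_def\<close>)
  also have "\<dots> \<le> (\<integral>\<^sup>+\<theta>. ennreal ((G \<theta> $ k)\<^sup>2) * indicator (hex_edge k s) \<theta> \<partial>hausdorff1)"
  proof (rule nn_integral_section_le_hausdorff1[where \<pi> = "\<lambda>\<theta>. \<theta> $ j"])
    show "\<gamma> \<in> borel_measurable borel" using \<gamma>(1) by (rule borel_measurable_continuous_onI)
    show "\<bar>x $ j - y $ j\<bar> \<le> dist x y" for x y :: "real^3"
      using component_le_norm_cart[of "x - y" j] by (simp add: dist_norm)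
    have "(\<lambda>\<theta>. (G \<theta> $ k)\<^sup>2) \<in> borel_measurable borel"
      by (intro borel_measurable_continuous_onI continuous_intros G)
    then show "(\<lambda>\<theta>. ennreal ((G \<theta> $ k)\<^sup>2) * indicator (hex_edge k s) \<theta>) \<in> borel_measurable borel"
      by (intro borel_measurable_times_ennreal measurable_compose[OF _ measurable_ennreal] borel_measurable_indicator hex_edge_borel) auto
  qed (use \<gamma>(3) in \<open>auto simp: J_def\<close>)
  also have "\<dots> \<le> (\<integral>\<^sup>+\<theta>\<in>rel_frontier mis. ennreal ((G \<theta> \<bullet> outer_normal mis_plane mis \<theta>)\<^sup>2) \<partial>hausdorff1)"
  proof (rule nn_integral_mono)
    fix \<theta>
    show "ennreal ((G \<theta> $ k)\<^sup>2) * indicator (hex_edge k s) \<theta> \<le>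
        ennreal ((G \<theta> \<bullet> outer_normal mis_plane mis \<theta>)\<^sup>2) * indicator (rel_frontier mis) \<theta>"
    proof (cases "\<theta> \<in> hex_edge k s")
      case True
      have s2: "s\<^sup>2 = 1" using s by (metis one_power2 power2_abs)
      have "G \<theta> \<bullet> outer_normal mis_plane mis \<theta> = s * (sqrt (3/2) * G \<theta> $ k)"
        by (simp add: hex_edge_normal[OF True s] inner_tproj[OF G(2)])
      then have "(G \<theta> \<bullet> outer_normal mis_plane mis \<theta>)\<^sup>2 = (3/2) * (G \<theta> $ k)\<^sup>2"
        by (simp add: power_mult_distrib s2)
      then have "(G \<theta> $ k)\<^sup>2 \<le> (G \<theta> \<bullet> outer_normal mis_plane mis \<theta>)\<^sup>2"
        using zero_le_power2[of "G \<theta> $ k"] by linarith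
      then show ?thesis using True hex_edge_rel_frontier[OF True s] by (auto intro!: ennreal_leI)
    qed simp
  qed
  finally show ?thesis by (simp add: I_def J_def)
qed

section \<open>Iterated integration over the hexagon\<close>

lemma hexpar_in_mis:
  "hexpar (p, q) \<in> mis \<longleftrightarrow> \<bar>q\<bar> < pi/4 \<and> max (- (pi/4)) (- (pi/4) - q) < p \<and> p < min (pi/4) (pi/4 - q)"
  "hexpar (p, q) \<in> mis \<longleftrightarrow> \<bar>p\<bar> < pi/4 \<and> max (- (pi/4)) (- (pi/4) - p) < q \<and> q < min (pi/4) (pi/4 - p)"
  by (auto simp: mis_def forall_3 abs_if)

lemma lebesgue_ftc_open_interval:
  fixes g g' :: "real \<Rightarrow> real"
  assumes "a \<le> b" and d: "\<And>t. (g has_real_derivative g' t) (at t)" and c: "continuous_on UNIV g'"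
  shows "(\<integral>t. indicator {a<..<b} t * g' t \<partial>lborel) = g b - g a"
proof -
  have m [measurable]: "g' \<in> borel_measurable borel" using c by (rule borel_measurable_continuous_onI)
  have gc: "continuous_on UNIV g" using d by (meson DERIV_continuous_on has_field_derivative_at_within)
  have "bounded (g' ` {a..b})"
    by (intro compact_imp_bounded compact_continuous_image continuous_on_subset[OF c]) auto
  then obtain B where B: "\<And>t. t \<in> {a..b} \<Longrightarrow> \<bar>g' t\<bar> \<le> B" unfolding bounded_iff by (metis imageI real_norm_def)
  have "(\<integral>t. indicator {a<..<b} t * g' t \<partial>lborel) = (\<integral>t. indicator {a..b} t * g' t \<partial>lborel)"
  proof (rule integral_cong_AE)
    show "AE t in lborel. indicator {a<..<b} t * g' t = indicator {a..b} t * g' t"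
      using AE_lborel_singleton[of a] AE_lborel_singleton[of b] by eventually_elim (auto simp: indicator_def)
  qed auto
  also have "\<dots> = g b - g a"
    by (rule lebesgue_ftc_finite_exceptions[where T = "{}" and B = B])
      (use assms d m B continuous_on_subset[OF gc] in auto)
  finally show ?thesis .
qed

lemma hexpar_vimage_props:
  "hexpar -` mis \<in> sets borel" "bounded (hexpar -` mis)"
proof -
  show "hexpar -` mis \<in> sets borel" using measurable_sets_borel[OF hexpar_measurable mis_borel] .
  have "hexpar -` mis \<subseteq> cbox (-(pi/4), -(pi/4)) (pi/4, pi/4)"
    by (auto simp: hexpar_in_mis mem_box Basis_prod_def abs_if split: if_splits)
  then show "bounded (hexpar -` mis)" using bounded_cbox bounded_subset by blast
qed

lemma integrable_hex:
  fixes h :: "real \<times> real \<Rightarrow> real"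
  assumes "continuous_on UNIV h"
  shows "integrable lborel (\<lambda>z. indicator (hexpar -` mis) z * h z)"
proof -
  obtain R where "hexpar -` mis \<subseteq> ball 0 R" using bounded_subset_ballD[OF hexpar_vimage_props(2), of 0] by auto
  then have R: "hexpar -` mis \<subseteq> cball 0 R" using ball_subset_cball by blast
  have "bounded (h ` cball 0 R)"
    by (intro compact_imp_bounded compact_continuous_image continuous_on_subset[OF assms]) auto
  then obtain B where B: "\<And>z. z \<in> cball 0 R \<Longrightarrow> \<bar>h z\<bar> \<le> B" unfolding bounded_iff by (metis imageI real_norm_def)
  have [measurable]: "h \<in> borel_measurable borel" "hexpar -` mis \<in> sets borel"
    using assms hexpar_vimage_props by (auto intro: borel_measurable_continuous_onI)
  show ?thesis
  proof (rule integrable_bounded_support[of _ "\<bar>B\<bar>" "hexpar -` mis"])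
    show "\<bar>indicator (hexpar -` mis) z * h z\<bar> \<le> \<bar>B\<bar>" for z
    proof (cases "z \<in> hexpar -` mis")
      case True
      then have "z \<in> cball 0 R" using R by blast
      then show ?thesis using B[of z] True by simp
    qed simp
    show "(\<lambda>z. indicator (hexpar -` mis) z * h z) \<in> borel_measurable borel" by measurable
  qed (use hexpar_vimage_props in auto)
qed

text \<open>Each coordinate slice of the hexagon is a single interval, whose ends \<open>min\<close>
  and \<open>max\<close> select the sides that are hit, so the fundamental theorem applies slice by
  slice. The two parts are the two orders of integration.\<close>

lemma hex_ftc:
  fixes f h :: "real \<times> real \<Rightarrow> real"
  assumes hc: "continuous_on UNIV h"
  shows "(\<And>p q. ((\<lambda>p. f (p, q)) has_real_derivative h (p, q)) (at p)) \<Longrightarrow>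
      (\<integral>z. indicator (hexpar -` mis) z * h z \<partial>lborel) =
      (\<integral>q. indicator {-(pi/4)<..<pi/4} q * (f (min (pi/4) (pi/4 - q), q) - f (max (- (pi/4)) (- (pi/4) - q), q)) \<partial>lborel)"
    and "(\<And>p q. ((\<lambda>q. f (p, q)) has_real_derivative h (p, q)) (at q)) \<Longrightarrow>
      (\<integral>z. indicator (hexpar -` mis) z * h z \<partial>lborel) =
      (\<integral>p. indicator {-(pi/4)<..<pi/4} p * (f (p, min (pi/4) (pi/4 - p)) - f (p, max (- (pi/4)) (- (pi/4) - p))) \<partial>lborel)"
proof -
  let ?H = "hexpar -` mis"
  have i: "integrable (lborel \<Otimes>\<^sub>M lborel) (\<lambda>z. indicator ?H z * h z)"
    using integrable_hex[OF hc] by (simp add: lborel_prod)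
  have i': "integrable (lborel \<Otimes>\<^sub>M lborel) (\<lambda>(p, q). indicator ?H (p, q) * h (p, q))"
    using i by (simp add: case_prod_unfold)
  have cp: "continuous_on UNIV (\<lambda>p. h (p, q))" "continuous_on UNIV (\<lambda>q. h (p, q))" for p q
    by (intro continuous_on_compose2[OF hc] continuous_intros; auto)+
  show "(\<integral>z. indicator ?H z * h z \<partial>lborel) =
      (\<integral>q. indicator {-(pi/4)<..<pi/4} q * (f (min (pi/4) (pi/4 - q), q) - f (max (- (pi/4)) (- (pi/4) - q), q)) \<partial>lborel)"
    if d: "\<And>p q. ((\<lambda>p. f (p, q)) has_real_derivative h (p, q)) (at p)"
  proof -
    have "(\<integral>p. indicator ?H (p, q) * h (p, q) \<partial>lborel) =
       indicator {-(pi/4)<..<pi/4} q * (f (min (pi/4) (pi/4 - q), q) - f (max (- (pi/4)) (- (pi/4) - q), q))" for q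
    proof (cases "\<bar>q\<bar> < pi/4")
      case True
      have "(\<integral>p. indicator ?H (p, q) * h (p, q) \<partial>lborel) =
          (\<integral>p. indicator {max (- (pi/4)) (- (pi/4) - q)<..<min (pi/4) (pi/4 - q)} p * h (p, q) \<partial>lborel)"
        using True by (simp add: indicator_def hexpar_in_mis(1))
      also have "\<dots> = f (min (pi/4) (pi/4 - q), q) - f (max (- (pi/4)) (- (pi/4) - q), q)"
        by (rule lebesgue_ftc_open_interval[OF _ d cp(1)]) (use True pi_gt_zero in \<open>auto simp: max_def min_def abs_if split: if_splits\<close>)
      finally show ?thesis using True by (auto simp: abs_if split: if_splits)
    next
      case False
      then show ?thesis by (auto simp: indicator_def hexpar_in_mis(1))
    qed
    moreover have "(\<integral>z. indicator ?H z * h z \<partial>lborel) = (\<integral>q. \<integral>p. indicator ?H (p, q) * h (p, q) \<partial>lborel \<partial>lborel)"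
      using lborel_pair.integral_snd[OF i'] by (simp add: case_prod_unfold lborel_prod)
    ultimately show ?thesis by simp
  qed
  show "(\<integral>z. indicator ?H z * h z \<partial>lborel) =
      (\<integral>p. indicator {-(pi/4)<..<pi/4} p * (f (p, min (pi/4) (pi/4 - p)) - f (p, max (- (pi/4)) (- (pi/4) - p))) \<partial>lborel)"
    if d: "\<And>p q. ((\<lambda>q. f (p, q)) has_real_derivative h (p, q)) (at q)"
  proof -
    have "(\<integral>q. indicator ?H (p, q) * h (p, q) \<partial>lborel) =
       indicator {-(pi/4)<..<pi/4} p * (f (p, min (pi/4) (pi/4 - p)) - f (p, max (- (pi/4)) (- (pi/4) - p)))" for p
    proof (cases "\<bar>p\<bar> < pi/4")
      case True
      have "(\<integral>q. indicator ?H (p, q) * h (p, q) \<partial>lborel) =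
          (\<integral>q. indicator {max (- (pi/4)) (- (pi/4) - p)<..<min (pi/4) (pi/4 - p)} q * h (p, q) \<partial>lborel)"
        using True by (simp add: indicator_def hexpar_in_mis(2))
      also have "\<dots> = f (p, min (pi/4) (pi/4 - p)) - f (p, max (- (pi/4)) (- (pi/4) - p))"
        by (rule lebesgue_ftc_open_interval[OF _ d cp(2)]) (use True pi_gt_zero in \<open>auto simp: max_def min_def abs_if split: if_splits\<close>)
      finally show ?thesis using True by (auto simp: abs_if split: if_splits)
    next
      case False
      then show ?thesis by (auto simp: indicator_def hexpar_in_mis(2))
    qed
    moreover have "(\<integral>z. indicator ?H z * h z \<partial>lborel) = (\<integral>p. \<integral>q. indicator ?H (p, q) * h (p, q) \<partial>lborel \<partial>lborel)"
      using lborel_pair.integral_fst'[OF i] by (simp add: lborel_prod)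
    ultimately show ?thesis by simp
  qed
qed

text \<open>Differentiating the \<open>k\<close>-th component along the \<open>k\<close>-th
  projected axis and summing gives, for a tangential field, the intrinsic divergence of the
  plane.\<close>

definition dvg_th :: "(real^3 \<Rightarrow> real^3 \<Rightarrow> real^3) \<Rightarrow> real^3 \<Rightarrow> real" where
  "dvg_th G' \<theta> = (\<Sum>k\<in>UNIV. G' \<theta> (tproj *v axis k 1) $ k)"

text \<open>On \<open>hex_edge 3\<close> the two coordinate derivatives contribute to the same edge, and their sum is
  the third component because \<open>F\<close> is tangential.\<close>

lemma hexagon_divergence:
  fixes F :: "real^3 \<Rightarrow> real^3"
  assumes F: "\<And>\<theta>. F \<theta> \<in> mis_plane" and d: "\<And>\<theta>. (F has_derivative F' \<theta>) (at \<theta>)"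
    and c: "\<And>v. continuous_on UNIV (\<lambda>\<theta>. F' \<theta> v)"
  defines "\<delta> \<equiv> pi/4"
  shows "(\<integral>\<theta>. indicator mis \<theta> * dvg_th F' \<theta> \<partial>plane_measure) = sqrt 3 *
    ((\<integral>q. indicator {-\<delta><..<0} q * F (hexpar (\<delta>, q)) $ 1 \<partial>lborel)
   - (\<integral>q. indicator {0<..<\<delta>} q * F (hexpar (-\<delta>, q)) $ 1 \<partial>lborel)
   + (\<integral>p. indicator {-\<delta><..<0} p * F (hexpar (p, \<delta>)) $ 2 \<partial>lborel)
   - (\<integral>p. indicator {0<..<\<delta>} p * F (hexpar (p, -\<delta>)) $ 2 \<partial>lborel)
   + (\<integral>q. indicator {-\<delta><..<0} q * F (hexpar (-\<delta> - q, q)) $ 3 \<partial>lborel)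
   - (\<integral>q. indicator {0<..<\<delta>} q * F (hexpar (\<delta> - q, q)) $ 3 \<partial>lborel))"
proof -
  have \<delta>: "\<delta> > 0" by (simp add: \<delta>_def)
  define e1 e2 :: "real^3" where "e1 = hexpar (1, 0)" and "e2 = hexpar (0, 1)"
  have linF: "linear (F' \<theta>)" for \<theta> using d has_derivative_linear by blast
  have F3: "F \<theta> $ 3 = - F \<theta> $ 1 - F \<theta> $ 2" for \<theta> using F[of \<theta>] by (simp add: mis_plane_def)
  have F'3: "F' \<theta> v $ 3 = - F' \<theta> v $ 1 - F' \<theta> v $ 2" for \<theta> v
  proof -
    have "((\<lambda>\<theta>. F \<theta> $ 1 + F \<theta> $ 2 + F \<theta> $ 3) has_derivative (\<lambda>v. F' \<theta> v $ 1 + F' \<theta> v $ 2 + F' \<theta> v $ 3)) (at \<theta>)"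
      by (intro has_derivative_add bounded_linear.has_derivative[OF bounded_linear_vec_nth d])
    moreover have "(\<lambda>\<theta>. F \<theta> $ 1 + F \<theta> $ 2 + F \<theta> $ 3) = (\<lambda>_. 0)" by (simp add: F3)
    ultimately have "((\<lambda>_. 0) has_derivative (\<lambda>v. F' \<theta> v $ 1 + F' \<theta> v $ 2 + F' \<theta> v $ 3)) (at \<theta>)"
      by simp
    from fun_cong[OF has_derivative_unique[OF this has_derivative_const], of v]
    have "F' \<theta> v $ 1 + F' \<theta> v $ 2 + F' \<theta> v $ 3 = 0" .
    then show ?thesis by linarith
  qed
  \<comment> \<open>Differentiating \<open>F $ 3 = - F $ 1 - F $ 2\<close> eliminates the third
    component, and the projected axes combine to the chart directions \<open>e1\<close> and
    \<open>e2\<close>; two coordinate derivatives remain.\<close>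
  have dv: "dvg_th F' \<theta> = F' \<theta> e1 $ 1 + F' \<theta> e2 $ 2" for \<theta>
  proof -
    have "e1 = tproj *v axis 1 1 - tproj *v axis 3 1" "e2 = tproj *v axis 2 1 - tproj *v axis 3 1"
      by (auto simp: e1_def e2_def vec_eq_iff forall_3 tproj_nth axis_def)
    then show ?thesis by (simp add: dvg_th_def sum_3 F'3[of _ "tproj *v axis 3 1"] linear_diff[OF linF])
  qed
  have par_c: "continuous_on UNIV hexpar" using hexpar_linear by (rule linear_continuous_on)
  have hc: "continuous_on UNIV (\<lambda>z. F' (hexpar z) v $ i)" for v i
    by (intro continuous_intros continuous_on_compose2[OF c par_c]) auto
  have Fc: "continuous_on UNIV F" using d by (meson continuous_at_imp_continuous_on has_derivative_continuous)
  have Fhc: "continuous_on UNIV (\<lambda>t. F (hexpar (\<alpha> t)) $ i)" if "continuous_on UNIV \<alpha>" for \<alpha> :: "real \<Rightarrow> real \<times> real" and i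
    by (intro continuous_intros continuous_on_compose2[OF Fc] continuous_on_compose2[OF par_c that]) auto
  have d1: "((\<lambda>p. F (hexpar (p, q)) $ i) has_real_derivative F' (hexpar (p, q)) e1 $ i) (at p)" for p q i
  proof -
    have e: "(\<lambda>p. hexpar (p, q)) = (\<lambda>p. p *\<^sub>R e1 + hexpar (0, q))"
      by (simp add: e1_def fun_eq_iff vec_eq_iff forall_3)
    have 1: "((\<lambda>p. hexpar (p, q)) has_derivative (\<lambda>h. h *\<^sub>R e1)) (at p)"
      unfolding e by (auto intro!: derivative_eq_intros)
    have "((\<lambda>p. F (hexpar (p, q)) $ i) has_derivative (\<lambda>h. F' (hexpar (p, q)) (h *\<^sub>R e1) $ i)) (at p)"
      by (rule bounded_linear.has_derivative[OF bounded_linear_vec_nth has_derivative_compose[OF 1 d]])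
    then show ?thesis by (simp add: has_field_derivative_def linear_cmul[OF linF] mult_commute_abs)
  qed
  have d2: "((\<lambda>q. F (hexpar (p, q)) $ i) has_real_derivative F' (hexpar (p, q)) e2 $ i) (at q)" for p q i
  proof -
    have e: "(\<lambda>q. hexpar (p, q)) = (\<lambda>q. q *\<^sub>R e2 + hexpar (p, 0))"
      by (simp add: e2_def fun_eq_iff vec_eq_iff forall_3)
    have 1: "((\<lambda>q. hexpar (p, q)) has_derivative (\<lambda>h. h *\<^sub>R e2)) (at q)"
      unfolding e by (auto intro!: derivative_eq_intros)
    have "((\<lambda>q. F (hexpar (p, q)) $ i) has_derivative (\<lambda>h. F' (hexpar (p, q)) (h *\<^sub>R e2) $ i)) (at q)"
      by (rule bounded_linear.has_derivative[OF bounded_linear_vec_nth has_derivative_compose[OF 1 d]])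
    then show ?thesis by (simp add: has_field_derivative_def linear_cmul[OF linF] mult_commute_abs)
  qed
  have int: "integrable lborel (\<lambda>t. indicator {a<..<b} t * g t)" if g: "continuous_on UNIV g" for g :: "real \<Rightarrow> real" and a b
  proof -
    have [measurable]: "g \<in> borel_measurable borel" using g by (rule borel_measurable_continuous_onI)
    have "integrable lborel (\<lambda>t. indicator {a..b} t *\<^sub>R g t)"
      by (intro borel_integrable_compact continuous_on_subset[OF g]) auto
    then show ?thesis
      by (rule Bochner_Integration.integrable_bound) (auto intro!: AE_I2 simp: indicator_def)
  qed
  define D1 where "D1 = (\<lambda>q. indicator {-\<delta><..<0} q * F (hexpar (\<delta>, q)) $ 1)"
  define D2 where "D2 = (\<lambda>q. indicator {0<..<\<delta>} q * F (hexpar (-\<delta>, q)) $ 1)"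
  define D3 where "D3 = (\<lambda>q. indicator {0<..<\<delta>} q * F (hexpar (\<delta> - q, q)) $ 1)"
  define D4 where "D4 = (\<lambda>q. indicator {-\<delta><..<0} q * F (hexpar (-\<delta> - q, q)) $ 1)"
  define N1 where "N1 = (\<lambda>p. indicator {-\<delta><..<0} p * F (hexpar (p, \<delta>)) $ 2)"
  define N2 where "N2 = (\<lambda>p. indicator {0<..<\<delta>} p * F (hexpar (p, -\<delta>)) $ 2)"
  define N3 where "N3 = (\<lambda>p. indicator {0<..<\<delta>} p * F (hexpar (p, \<delta> - p)) $ 2)"
  define N4 where "N4 = (\<lambda>p. indicator {-\<delta><..<0} p * F (hexpar (p, -\<delta> - p)) $ 2)"
  have iD: "integrable lborel D1" "integrable lborel D2" "integrable lborel D3" "integrable lborel D4"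
    "integrable lborel N1" "integrable lborel N2" "integrable lborel N3" "integrable lborel N4"
    unfolding D1_def D2_def D3_def D4_def N1_def N2_def N3_def N4_def
    by (intro int Fhc continuous_intros)+
  have "(\<integral>z. indicator (hexpar -` mis) z * F' (hexpar z) e1 $ 1 \<partial>lborel) =
      (\<integral>q. indicator {-\<delta><..<\<delta>} q * (F (hexpar (min \<delta> (\<delta> - q), q)) $ 1 - F (hexpar (max (-\<delta>) (-\<delta> - q), q)) $ 1) \<partial>lborel)"
    unfolding \<delta>_def by (rule hex_ftc(1)[OF hc, of "\<lambda>z. F (hexpar z) $ 1"]) (rule d1)
  also have "\<dots> = (\<integral>q. D1 q - D2 q + D3 q - D4 q \<partial>lborel)"
  proof (rule integral_cong_AE)
    show "AE q in lborel. indicator {-\<delta><..<\<delta>} q * (F (hexpar (min \<delta> (\<delta> - q), q)) $ 1 - F (hexpar (max (-\<delta>) (-\<delta> - q), q)) $ 1) = D1 q - D2 q + D3 q - D4 q"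
      using AE_lborel_singleton[of 0]
    proof eventually_elim
      case (elim q)
      then show ?case using \<delta> by (cases "q < 0") (auto simp: D1_def D2_def D3_def D4_def indicator_def min_def max_def)
    qed
    have "continuous_on UNIV (\<lambda>q. F (hexpar (min \<delta> (\<delta> - q), q)) $ 1 - F (hexpar (max (-\<delta>) (-\<delta> - q), q)) $ 1)"
      by (intro continuous_intros Fhc)
    then show "(\<lambda>q. indicator {-\<delta><..<\<delta>} q * (F (hexpar (min \<delta> (\<delta> - q), q)) $ 1 - F (hexpar (max (-\<delta>) (-\<delta> - q), q)) $ 1)) \<in> borel_measurable lborel"
      by (intro borel_measurable_integrable int)
  qed (use iD in auto)
  also have "\<dots> = (\<integral>q. D1 q \<partial>lborel) - (\<integral>q. D2 q \<partial>lborel) + (\<integral>q. D3 q \<partial>lborel) - (\<integral>q. D4 q \<partial>lborel)"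
    using iD by simp
  finally have E1: "(\<integral>z. indicator (hexpar -` mis) z * F' (hexpar z) e1 $ 1 \<partial>lborel) =
    (\<integral>q. D1 q \<partial>lborel) - (\<integral>q. D2 q \<partial>lborel) + (\<integral>q. D3 q \<partial>lborel) - (\<integral>q. D4 q \<partial>lborel)" .
  have "(\<integral>z. indicator (hexpar -` mis) z * F' (hexpar z) e2 $ 2 \<partial>lborel) =
      (\<integral>p. indicator {-\<delta><..<\<delta>} p * (F (hexpar (p, min \<delta> (\<delta> - p))) $ 2 - F (hexpar (p, max (-\<delta>) (-\<delta> - p))) $ 2) \<partial>lborel)"
    unfolding \<delta>_def by (rule hex_ftc(2)[OF hc, of "\<lambda>z. F (hexpar z) $ 2"]) (rule d2)
  also have "\<dots> = (\<integral>p. N1 p - N2 p + N3 p - N4 p \<partial>lborel)"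
  proof (rule integral_cong_AE)
    show "AE p in lborel. indicator {-\<delta><..<\<delta>} p * (F (hexpar (p, min \<delta> (\<delta> - p))) $ 2 - F (hexpar (p, max (-\<delta>) (-\<delta> - p))) $ 2) = N1 p - N2 p + N3 p - N4 p"
      using AE_lborel_singleton[of 0]
    proof eventually_elim
      case (elim p)
      then show ?case using \<delta> by (cases "p < 0") (auto simp: N1_def N2_def N3_def N4_def indicator_def min_def max_def)
    qed
    have "continuous_on UNIV (\<lambda>p. F (hexpar (p, min \<delta> (\<delta> - p))) $ 2 - F (hexpar (p, max (-\<delta>) (-\<delta> - p))) $ 2)"
      by (intro continuous_intros Fhc)
    then show "(\<lambda>p. indicator {-\<delta><..<\<delta>} p * (F (hexpar (p, min \<delta> (\<delta> - p))) $ 2 - F (hexpar (p, max (-\<delta>) (-\<delta> - p))) $ 2)) \<in> borel_measurable lborel"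
      by (intro borel_measurable_integrable int)
  qed (use iD in auto)
  also have "\<dots> = (\<integral>q. N1 q \<partial>lborel) - (\<integral>q. N2 q \<partial>lborel) + (\<integral>q. N3 q \<partial>lborel) - (\<integral>q. N4 q \<partial>lborel)"
    using iD by simp
  finally have E2: "(\<integral>z. indicator (hexpar -` mis) z * F' (hexpar z) e2 $ 2 \<partial>lborel) =
    (\<integral>q. N1 q \<partial>lborel) - (\<integral>q. N2 q \<partial>lborel) + (\<integral>q. N3 q \<partial>lborel) - (\<integral>q. N4 q \<partial>lborel)" .
  \<comment> \<open>The sides with \<open>p + q\<close> constant appear parametrised by
    \<open>q\<close> from the first derivative and by \<open>p\<close> from the second; a reflection
    brings both to \<open>q\<close>, so that their integrands can be added.\<close>
  have rev: "(\<integral>p. h p \<partial>lborel) = (\<integral>q. h (x - q) \<partial>lborel)" for h :: "real \<Rightarrow> real" and x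
    using lborel_integral_real_affine[of "-1" h x] by simp
  have N3: "(\<integral>p. N3 p \<partial>lborel) = (\<integral>q. indicator {0<..<\<delta>} q * F (hexpar (\<delta> - q, q)) $ 2 \<partial>lborel)"
    by (subst rev[of _ \<delta>], rule Bochner_Integration.integral_cong) (auto simp: N3_def indicator_def)
  have N4: "(\<integral>p. N4 p \<partial>lborel) = (\<integral>q. indicator {-\<delta><..<0} q * F (hexpar (-\<delta> - q, q)) $ 2 \<partial>lborel)"
    by (subst rev[of _ "-\<delta>"], rule Bochner_Integration.integral_cong) (auto simp: N4_def indicator_def)
  have S3: "(\<integral>q. indicator {0<..<\<delta>} q * F (hexpar (\<delta> - q, q)) $ 3 \<partial>lborel) = - (\<integral>q. D3 q \<partial>lborel) - (\<integral>p. N3 p \<partial>lborel)"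
  proof -
    have "integrable lborel (\<lambda>q. indicator {0<..<\<delta>} q * F (hexpar (\<delta> - q, q)) $ 2)"
      by (intro int Fhc continuous_intros)
    then show ?thesis using iD(3) unfolding N3 D3_def F3 by (simp add: right_diff_distrib)
  qed
  have S4: "(\<integral>q. indicator {-\<delta><..<0} q * F (hexpar (-\<delta> - q, q)) $ 3 \<partial>lborel) = - (\<integral>q. D4 q \<partial>lborel) - (\<integral>p. N4 p \<partial>lborel)"
  proof -
    have "integrable lborel (\<lambda>q. indicator {-\<delta><..<0} q * F (hexpar (-\<delta> - q, q)) $ 2)"
      by (intro int Fhc continuous_intros)
    then show ?thesis using iD(4) unfolding N4 D4_def F3 by (simp add: right_diff_distrib)
  qed
  have m: "(\<lambda>\<theta>. indicator mis \<theta> * dvg_th F' \<theta>) \<in> borel_measurable borel"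
    unfolding dv by (intro borel_measurable_times borel_measurable_indicator mis_borel borel_measurable_continuous_onI continuous_intros c)
  have "(\<integral>\<theta>. indicator mis \<theta> * dvg_th F' \<theta> \<partial>plane_measure) =
      sqrt 3 * (\<integral>z. indicator (hexpar -` mis) z * dvg_th F' (hexpar z) \<partial>lborel)"
  proof -
    have "(\<lambda>z. indicator mis (hexpar z) * dvg_th F' (hexpar z)) \<in> borel_measurable borel"
      using measurable_compose[OF hexpar_measurable m] .
    then have "(\<integral>\<theta>. indicator mis \<theta> * dvg_th F' \<theta> \<partial>plane_measure) =
        sqrt 3 * (\<integral>z. indicator mis (hexpar z) * dvg_th F' (hexpar z) \<partial>lborel)"
      unfolding plane_measure_hexpar using m by (subst integral_distr) (auto simp: integral_density)
    then show ?thesis by (simp add: indicator_def)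
  qed
  also have "(\<integral>z. indicator (hexpar -` mis) z * dvg_th F' (hexpar z) \<partial>lborel) =
    (\<integral>z. indicator (hexpar -` mis) z * F' (hexpar z) e1 $ 1 \<partial>lborel) + (\<integral>z. indicator (hexpar -` mis) z * F' (hexpar z) e2 $ 2 \<partial>lborel)"
    using integrable_hex[OF hc] by (simp add: dv distrib_left)
  finally show ?thesis
    unfolding E1 E2 S3 S4 using D1_def D2_def N1_def N2_def by simp
qed

text \<open>The square of each of the six side terms is at most \<open>pi/4\<close> times the
  boundary integral. With the Jacobian \<open>sqrt 3\<close> and Cauchy-Schwarz for six summands the
  constant becomes \<open>3 * 6 * 6 * (pi/4) = 27 * pi\<close>.\<close>

theorem green_hexagon:
  fixes \<kappa> :: "real^3 \<Rightarrow> real"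
  assumes \<kappa>: "\<And>\<theta>. (\<kappa> has_derivative \<kappa>' \<theta>) (at \<theta>)" "\<And>v. continuous_on UNIV (\<lambda>\<theta>. \<kappa>' \<theta> v)"
    "\<And>\<theta>. \<theta> \<in> rel_frontier mis \<Longrightarrow> \<bar>\<kappa> \<theta>\<bar> \<le> 1"
    and G: "\<And>\<theta>. (G has_derivative G' \<theta>) (at \<theta>)" "\<And>v. continuous_on UNIV (\<lambda>\<theta>. G' \<theta> v)"
    "\<And>\<theta>. G \<theta> \<in> mis_plane"
  shows "ennreal ((\<integral>\<theta>. indicator mis \<theta> * (\<kappa> \<theta> * dvg_th G' \<theta> + (\<Sum>k\<in>UNIV. \<kappa>' \<theta> (tproj *v axis k 1) * G \<theta> $ k)) \<partial>plane_measure)\<^sup>2 / (27 * pi))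
    \<le> (\<integral>\<^sup>+\<theta>\<in>rel_frontier mis. ennreal ((G \<theta> \<bullet> outer_normal mis_plane mis \<theta>)\<^sup>2) \<partial>hausdorff1)"
proof -
  let ?B = "\<integral>\<^sup>+\<theta>\<in>rel_frontier mis. ennreal ((G \<theta> \<bullet> outer_normal mis_plane mis \<theta>)\<^sup>2) \<partial>hausdorff1"
  define \<delta> where "\<delta> = pi/4"
  have \<delta>: "\<delta> > 0" by (simp add: \<delta>_def)
  define F where "F \<theta> = \<kappa> \<theta> *\<^sub>R G \<theta>" for \<theta>
  define F' where "F' \<theta> v = \<kappa> \<theta> *\<^sub>R G' \<theta> v + \<kappa>' \<theta> v *\<^sub>R G \<theta>" for \<theta> v
  have \<kappa>c: "continuous_on UNIV \<kappa>" using \<kappa>(1) by (meson continuous_at_imp_continuous_on has_derivative_continuous)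
  have Gc: "continuous_on UNIV G" using G(1) by (meson continuous_at_imp_continuous_on has_derivative_continuous)
  have F: "F \<theta> \<in> mis_plane" "(F has_derivative F' \<theta>) (at \<theta>)" "continuous_on UNIV (\<lambda>\<theta>. F' \<theta> v)" for \<theta> v
  proof -
    show "F \<theta> \<in> mis_plane" unfolding F_def by (rule subspace_scale[OF plane_closed_subspace(2) G(3)])
    show "(F has_derivative F' \<theta>) (at \<theta>)" unfolding F_def F'_def by (rule has_derivative_scaleR[OF \<kappa>(1) G(1)])
    show "continuous_on UNIV (\<lambda>\<theta>. F' \<theta> v)" unfolding F'_def by (intro continuous_intros \<kappa>c Gc \<kappa>(2) G(2))
  qed
  have I: "\<kappa> \<theta> * dvg_th G' \<theta> + (\<Sum>k\<in>UNIV. \<kappa>' \<theta> (tproj *v axis k 1) * G \<theta> $ k) = dvg_th F' \<theta>" for \<theta>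
    by (simp add: dvg_th_def F'_def sum.distrib sum_distrib_left)
  have pc: "continuous_on UNIV hexpar" using hexpar_linear by (rule linear_continuous_on)
  have edge: "ennreal ((\<integral>t. indicator {a<..<b} t * F (hexpar (\<alpha> t)) $ k \<partial>lborel)\<^sup>2 / \<delta>) \<le> ?B"
    if "continuous_on UNIV \<alpha>" "\<And>t. t \<in> {a<..<b} \<Longrightarrow> hexpar (\<alpha> t) \<in> hex_edge k s" "\<bar>s\<bar> = 1" "b - a = \<delta>"
      "\<And>t. t \<in> {a<..<b} \<Longrightarrow> hexpar (\<alpha> t) $ j = t" for \<alpha> :: "real \<Rightarrow> real \<times> real" and a b k s j
    using hex_edge_estimate[of "\<lambda>t. hexpar (\<alpha> t)" a b k s j \<kappa> G] that \<kappa>(3) G(3) \<kappa>c Gc continuous_on_compose2[OF pc that(1)]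
    by (simp add: F_def \<delta>_def)
  define x1 where "x1 = (\<integral>q. indicator {-\<delta><..<0} q * F (hexpar (\<delta>, q)) $ 1 \<partial>lborel)"
  define x2 where "x2 = (\<integral>q. indicator {0<..<\<delta>} q * F (hexpar (-\<delta>, q)) $ 1 \<partial>lborel)"
  define x3 where "x3 = (\<integral>p. indicator {-\<delta><..<0} p * F (hexpar (p, \<delta>)) $ 2 \<partial>lborel)"
  define x4 where "x4 = (\<integral>p. indicator {0<..<\<delta>} p * F (hexpar (p, -\<delta>)) $ 2 \<partial>lborel)"
  define x5 where "x5 = (\<integral>q. indicator {-\<delta><..<0} q * F (hexpar (-\<delta> - q, q)) $ 3 \<partial>lborel)"
  define x6 where "x6 = (\<integral>q. indicator {0<..<\<delta>} q * F (hexpar (\<delta> - q, q)) $ 3 \<partial>lborel)"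
  have h: "hexpar z \<in> mis_plane" for z by (simp add: mis_plane_def)
  have b1: "ennreal (x1\<^sup>2 / \<delta>) \<le> ?B" unfolding x1_def
    by (rule edge[of "\<lambda>q. (\<delta>, q)" _ _ _ 1 2]) (auto intro!: continuous_intros simp: hex_edge_def forall_3 h \<delta>_def[symmetric])
  have b2: "ennreal (x2\<^sup>2 / \<delta>) \<le> ?B" unfolding x2_def
    by (rule edge[of "\<lambda>q. (-\<delta>, q)" _ _ _ "-1" 2]) (auto intro!: continuous_intros simp: hex_edge_def forall_3 h \<delta>_def[symmetric])
  have b3: "ennreal (x3\<^sup>2 / \<delta>) \<le> ?B" unfolding x3_def
    by (rule edge[of "\<lambda>p. (p, \<delta>)" _ _ _ 1 1]) (auto intro!: continuous_intros simp: hex_edge_def forall_3 h \<delta>_def[symmetric])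
  have b4: "ennreal (x4\<^sup>2 / \<delta>) \<le> ?B" unfolding x4_def
    by (rule edge[of "\<lambda>p. (p, -\<delta>)" _ _ _ "-1" 1]) (auto intro!: continuous_intros simp: hex_edge_def forall_3 h \<delta>_def[symmetric])
  have b5: "ennreal (x5\<^sup>2 / \<delta>) \<le> ?B" unfolding x5_def
    by (rule edge[of "\<lambda>q. (-\<delta> - q, q)" _ _ _ 1 2]) (auto intro!: continuous_intros simp: hex_edge_def forall_3 h \<delta>_def[symmetric])
  have b6: "ennreal (x6\<^sup>2 / \<delta>) \<le> ?B" unfolding x6_def
    by (rule edge[of "\<lambda>q. (\<delta> - q, q)" _ _ _ "-1" 2]) (auto intro!: continuous_intros simp: hex_edge_def forall_3 h \<delta>_def[symmetric])
  have tot: "(\<integral>\<theta>. indicator mis \<theta> * dvg_th F' \<theta> \<partial>plane_measure) = sqrt 3 * (x1 - x2 + x3 - x4 + x5 - x6)"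
    using hexagon_divergence[of F F', OF F(1) F(2) F(3)]
    unfolding x1_def x2_def x3_def x4_def x5_def x6_def \<delta>_def by simp
  show ?thesis
  proof (cases "?B = top")
    case False
    then obtain \<beta> where \<beta>: "?B = ennreal \<beta>" "\<beta> \<ge> 0" by (cases ?B rule: ennreal_cases) auto
    have bb: "x1\<^sup>2 \<le> \<delta> * \<beta>" "x2\<^sup>2 \<le> \<delta> * \<beta>" "x3\<^sup>2 \<le> \<delta> * \<beta>" "x4\<^sup>2 \<le> \<delta> * \<beta>" "x5\<^sup>2 \<le> \<delta> * \<beta>" "x6\<^sup>2 \<le> \<delta> * \<beta>"
      using b1 b2 b3 b4 b5 b6 \<delta> \<beta>(2) unfolding \<beta>(1) by (simp_all add: field_simps)
    have cs: "(x1 - x2 + x3 - x4 + x5 - x6)\<^sup>2 \<le> 6 * (x1\<^sup>2 + x2\<^sup>2 + x3\<^sup>2 + x4\<^sup>2 + x5\<^sup>2 + x6\<^sup>2)"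
    proof -
      \<comment> \<open>Lagrange's identity for six signed terms: the fifteen squares add up to the
        gap in the Cauchy-Schwarz inequality.\<close>
      have "0 \<le> (x1 + x2)\<^sup>2 + (x1 - x3)\<^sup>2 + (x1 + x4)\<^sup>2 + (x1 - x5)\<^sup>2 + (x1 + x6)\<^sup>2 + (x2 + x3)\<^sup>2 + (x2 - x4)\<^sup>2
        + (x2 + x5)\<^sup>2 + (x2 - x6)\<^sup>2 + (x3 + x4)\<^sup>2 + (x3 - x5)\<^sup>2 + (x3 + x6)\<^sup>2 + (x4 + x5)\<^sup>2 + (x4 - x6)\<^sup>2 + (x5 + x6)\<^sup>2"
        by (intro add_nonneg_nonneg zero_le_power2)
      also have "\<dots> = 6 * (x1\<^sup>2 + x2\<^sup>2 + x3\<^sup>2 + x4\<^sup>2 + x5\<^sup>2 + x6\<^sup>2) - (x1 - x2 + x3 - x4 + x5 - x6)\<^sup>2"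
        by algebra
      finally show ?thesis by simp
    qed
    have "(sqrt 3 * (x1 - x2 + x3 - x4 + x5 - x6))\<^sup>2 = 3 * (x1 - x2 + x3 - x4 + x5 - x6)\<^sup>2"
      by (simp add: power_mult_distrib)
    also have "\<dots> \<le> 3 * (6 * (6 * (\<delta> * \<beta>)))"
    proof -
      have "x1\<^sup>2 + x2\<^sup>2 + x3\<^sup>2 + x4\<^sup>2 + x5\<^sup>2 + x6\<^sup>2 \<le> \<delta> * \<beta> + \<delta> * \<beta> + \<delta> * \<beta> + \<delta> * \<beta> + \<delta> * \<beta> + \<delta> * \<beta>"
        by (intro add_mono bb)
      also have "\<dots> = 6 * (\<delta> * \<beta>)" by simp
      finally have "6 * (x1\<^sup>2 + x2\<^sup>2 + x3\<^sup>2 + x4\<^sup>2 + x5\<^sup>2 + x6\<^sup>2) \<le> 6 * (6 * (\<delta> * \<beta>))"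
        by (rule mult_left_mono) simp
      with cs have "(x1 - x2 + x3 - x4 + x5 - x6)\<^sup>2 \<le> 6 * (6 * (\<delta> * \<beta>))" by (rule order_trans)
      then show ?thesis by (rule mult_left_mono) simp
    qed
    also have "\<dots> = 27 * pi * \<beta>" by (simp add: \<delta>_def)
    finally have "(sqrt 3 * (x1 - x2 + x3 - x4 + x5 - x6))\<^sup>2 / (27 * pi) \<le> \<beta>"
      by (simp add: field_simps)
    then show ?thesis unfolding I tot \<beta>(1) by (rule ennreal_leI)
  qed simp
qed

section \<open>Curves in \<open>L\<^sup>2\<close>\<close>

lemma L2_diff:
  assumes "f \<in> L2 M" "g \<in> L2 M"
  shows "(\<lambda>z. f z - g z) \<in> L2 M"
proof -
  have f: "f \<in> borel_measurable M" "integrable M (\<lambda>z. (f z)\<^sup>2)" and g: "g \<in> borel_measurable M" "integrable M (\<lambda>z. (g z)\<^sup>2)"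
    using assms by (auto simp: L2_def)
  have "(\<lambda>z. (f z - g z)\<^sup>2) = (\<lambda>z. (f z)\<^sup>2 + (g z)\<^sup>2 - 2 * (f z * g z))"
    by (auto simp: power2_eq_square algebra_simps)
  then show ?thesis using f g integral_Cauchy_Schwarz(1)[OF f g] by (simp add: L2_def)
qed

lemma L2_cmult: "f \<in> L2 M \<Longrightarrow> (\<lambda>z. c * f z) \<in> L2 M"
  by (auto simp: L2_def power_mult_distrib)

lemma L2_add: "f \<in> L2 M \<Longrightarrow> g \<in> L2 M \<Longrightarrow> (\<lambda>z. f z + g z) \<in> L2 M"
  using L2_diff[of f M "\<lambda>z. - 1 * g z"] L2_cmult[of g M "-1"] by simp

lemma L2_mult_integrable: "f \<in> L2 M \<Longrightarrow> g \<in> L2 M \<Longrightarrow> integrable M (\<lambda>z. f z * g z)"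
  unfolding L2_def using integral_Cauchy_Schwarz(1)[of f M g] by blast

lemma L2norm_nonneg: "0 \<le> L2norm M f"
  by (simp add: L2norm_def)

lemma L2norm_square: "(L2norm M f)\<^sup>2 = (\<integral>z. (f z)\<^sup>2 \<partial>M)"
  by (simp add: L2norm_def)

lemma L2_inner_le: "f \<in> L2 M \<Longrightarrow> g \<in> L2 M \<Longrightarrow> \<bar>\<integral>z. f z * g z \<partial>M\<bar> \<le> L2norm M f * L2norm M g"
  unfolding L2_def L2norm_def real_sqrt_mult[symmetric]
  using integral_Cauchy_Schwarz(2)[of f M g] by (intro real_le_rsqrt) auto

text \<open>Convergence in \<open>L2\<close> is expressed by \<open>L2norm\<close> of differences
  along an arbitrary filter, so that one lemma serves limits in time and limits of approximating
  sequences. Expanding around \<open>f'\<close> and \<open>h'\<close> leaves three error terms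
  controlled by Cauchy-Schwarz.\<close>

lemma L2_inner_tendsto:
  assumes f: "\<forall>\<^sub>F s in F. f s \<in> L2 M" "f' \<in> L2 M" "((\<lambda>s. L2norm M (\<lambda>z. f s z - f' z)) \<longlongrightarrow> 0) F"
    and h: "\<forall>\<^sub>F s in F. h s \<in> L2 M" "h' \<in> L2 M" "((\<lambda>s. L2norm M (\<lambda>z. h s z - h' z)) \<longlongrightarrow> 0) F"
  shows "((\<lambda>s. \<integral>z. f s z * h s z \<partial>M) \<longlongrightarrow> (\<integral>z. f' z * h' z \<partial>M)) F"
proof -
  let ?a = "\<lambda>s. L2norm M (\<lambda>z. f s z - f' z)" and ?b = "\<lambda>s. L2norm M (\<lambda>z. h s z - h' z)"
  have "((\<lambda>s. (\<integral>z. f s z * h s z \<partial>M) - (\<integral>z. f' z * h' z \<partial>M)) \<longlongrightarrow> 0) F"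
  proof (rule Lim_null_comparison)
    show "\<forall>\<^sub>F s in F. norm ((\<integral>z. f s z * h s z \<partial>M) - (\<integral>z. f' z * h' z \<partial>M)) \<le>
        ?a s * ?b s + ?a s * L2norm M h' + L2norm M f' * ?b s"
      using f(1) h(1)
    proof eventually_elim
      case (elim s)
      have df: "(\<lambda>z. f s z - f' z) \<in> L2 M" and dh: "(\<lambda>z. h s z - h' z) \<in> L2 M"
        using elim f(2) h(2) by (auto intro: L2_diff)
      have "(\<integral>z. f s z * h s z \<partial>M) =
        (\<integral>z. (f s z - f' z) * (h s z - h' z) + (f s z - f' z) * h' z + f' z * (h s z - h' z) + f' z * h' z \<partial>M)"
        by (simp add: algebra_simps)
      also have "\<dots> = (\<integral>z. (f s z - f' z) * (h s z - h' z) \<partial>M) + (\<integral>z. (f s z - f' z) * h' z \<partial>M)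
          + (\<integral>z. f' z * (h s z - h' z) \<partial>M) + (\<integral>z. f' z * h' z \<partial>M)"
        using L2_mult_integrable[OF df dh] L2_mult_integrable[OF df h(2)] L2_mult_integrable[OF f(2) dh] L2_mult_integrable[OF f(2) h(2)]
        by simp
      finally show ?case
        using L2_inner_le[OF df dh] L2_inner_le[OF df h(2)] L2_inner_le[OF f(2) dh] by simp
    qed
    show "((\<lambda>s. ?a s * ?b s + ?a s * L2norm M h' + L2norm M f' * ?b s) \<longlongrightarrow> 0) F"
      using f(3) h(3) by (auto intro!: tendsto_eq_intros)
  qed
  then show ?thesis by (simp add: LIM_zero_iff)
qed

lemma L2norm_cmult: "L2norm M (\<lambda>z. c * f z) = \<bar>c\<bar> * L2norm M f"
  by (simp add: L2norm_def power_mult_distrib real_sqrt_mult)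

lemma L2norm_triangle:
  assumes "f \<in> L2 M" "g \<in> L2 M"
  shows "L2norm M (\<lambda>z. f z + g z) \<le> L2norm M f + L2norm M g"
proof (rule power2_le_imp_le)
  have i: "integrable M (\<lambda>z. (f z)\<^sup>2)" "integrable M (\<lambda>z. (g z)\<^sup>2)" "integrable M (\<lambda>z. f z * g z)"
    using assms L2_mult_integrable by (auto simp: L2_def)
  have "(L2norm M (\<lambda>z. f z + g z))\<^sup>2 = (\<integral>z. (f z)\<^sup>2 + (g z)\<^sup>2 + 2 * (f z * g z) \<partial>M)"
    unfolding L2norm_square by (simp add: power2_eq_square algebra_simps)
  also have "\<dots> = (L2norm M f)\<^sup>2 + (L2norm M g)\<^sup>2 + 2 * (\<integral>z. f z * g z \<partial>M)"
    using i by (simp add: L2norm_square)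
  also have "\<dots> \<le> (L2norm M f + L2norm M g)\<^sup>2"
    using L2_inner_le[OF assms] by (simp add: power2_sum)
  finally show "(L2norm M (\<lambda>z. f z + g z))\<^sup>2 \<le> (L2norm M f + L2norm M g)\<^sup>2" .
qed (simp add: L2norm_nonneg)

lemma L2norm_diff_tendsto:
  assumes "\<forall>\<^sub>F s in F. f s \<in> L2 M" "f' \<in> L2 M" "((\<lambda>s. L2norm M (\<lambda>z. f s z - f' z)) \<longlongrightarrow> 0) F"
    and "\<forall>\<^sub>F s in F. h s \<in> L2 M" "h' \<in> L2 M" "((\<lambda>s. L2norm M (\<lambda>z. h s z - h' z)) \<longlongrightarrow> 0) F"
  shows "((\<lambda>s. L2norm M (\<lambda>z. (f s z - h s z) - (f' z - h' z))) \<longlongrightarrow> 0) F"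
proof (rule Lim_null_comparison)
  show "\<forall>\<^sub>F s in F. norm (L2norm M (\<lambda>z. (f s z - h s z) - (f' z - h' z))) \<le>
      L2norm M (\<lambda>z. f s z - f' z) + L2norm M (\<lambda>z. h s z - h' z)"
    using assms(1,4)
  proof eventually_elim
    case (elim s)
    have df: "(\<lambda>z. f s z - f' z) \<in> L2 M" and dh: "(\<lambda>z. (-1) * (h s z - h' z)) \<in> L2 M"
      using elim assms(2,5) by (intro L2_diff L2_cmult; simp)+
    have "L2norm M (\<lambda>z. (f s z - h s z) - (f' z - h' z)) = L2norm M (\<lambda>z. (f s z - f' z) + (-1) * (h s z - h' z))"
      by (simp add: algebra_simps)
    also have "\<dots> \<le> L2norm M (\<lambda>z. f s z - f' z) + L2norm M (\<lambda>z. (-1) * (h s z - h' z))"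
      by (rule L2norm_triangle[OF df dh])
    finally show ?case by (simp only: L2norm_cmult) (simp add: L2norm_nonneg)
  qed
  show "((\<lambda>s. L2norm M (\<lambda>z. f s z - f' z) + L2norm M (\<lambda>z. h s z - h' z)) \<longlongrightarrow> 0) F"
    using assms(3,6) by (auto intro!: tendsto_eq_intros)
qed

section \<open>Time derivatives of curves in \<open>L2\<close>\<close>

lemma has_L2_deriv_shift:
  assumes "has_L2_deriv M g h (t + c)"
  shows "has_L2_deriv M (\<lambda>s. g (s + c)) h t"
proof -
  have at: "at (t + c) = filtermap (\<lambda>s. s + c) (at t)"
    using filtermap_at_shift[of "-c" t] by simp
  show ?thesis
    using assms unfolding has_L2_deriv_def at filterlim_filtermap eventually_filtermap by simp
qed

lemma has_L2_deriv_diff: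
  assumes g: "has_L2_deriv M g g' t" and h: "has_L2_deriv M h h' t"
  shows "has_L2_deriv M (\<lambda>s z. g s z - h s z) (\<lambda>z. g' z - h' z) t"
  unfolding has_L2_deriv_def
proof (intro conjI)
  have L: "g' \<in> L2 M" "g t \<in> L2 M" "h' \<in> L2 M" "h t \<in> L2 M" "\<forall>\<^sub>F s in at t. g s \<in> L2 M" "\<forall>\<^sub>F s in at t. h s \<in> L2 M"
    using g h by (auto simp: has_L2_deriv_def)
  then show "(\<lambda>z. g' z - h' z) \<in> L2 M" "(\<lambda>z. g t z - h t z) \<in> L2 M" by (auto intro: L2_diff)
  show "\<forall>\<^sub>F s in at t. (\<lambda>z. g s z - h s z) \<in> L2 M" using L(5,6) by eventually_elim (rule L2_diff)
  have q: "(\<lambda>z. (k s z - k t z) / (s - t)) \<in> L2 M" if "k s \<in> L2 M" "k t \<in> L2 M" for k s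
    using L2_cmult[OF L2_diff[OF that], of "1 / (s - t)"] by simp
  have "((\<lambda>s. L2norm M (\<lambda>z. ((g s z - g t z) / (s - t) - (h s z - h t z) / (s - t)) - (g' z - h' z))) \<longlongrightarrow> 0) (at t)"
  proof (rule L2norm_diff_tendsto)
    show "\<forall>\<^sub>F s in at t. (\<lambda>z. (g s z - g t z) / (s - t)) \<in> L2 M" using L(5) by eventually_elim (use q[of g] L(2) in blast)
    show "\<forall>\<^sub>F s in at t. (\<lambda>z. (h s z - h t z) / (s - t)) \<in> L2 M" using L(6) by eventually_elim (use q[of h] L(4) in blast)
  qed (use g h in \<open>auto simp: has_L2_deriv_def\<close>)
  moreover have "((g s z - h s z) - (g t z - h t z)) / (s - t) - (g' z - h' z) =
      ((g s z - g t z) / (s - t) - (h s z - h t z) / (s - t)) - (g' z - h' z)" for s z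
    by (simp add: diff_divide_distrib)
  ultimately show "((\<lambda>s. L2norm M (\<lambda>z. ((g s z - h s z) - (g t z - h t z)) / (s - t) - (g' z - h' z))) \<longlongrightarrow> 0) (at t)"
    by presburger
qed

text \<open>\<open>has_L2_deriv\<close> does not state continuity at \<open>t\<close>; it follows
  because the increment is \<open>s - t\<close> times a quotient whose norm stays bounded.\<close>

lemma has_L2_deriv_quotient:
  assumes "has_L2_deriv M u u' t"
  shows "\<forall>\<^sub>F s in at t. (\<lambda>z. (u s z - u t z) / (s - t)) \<in> L2 M"
    and "((\<lambda>s. L2norm M (\<lambda>z. u s z - u t z)) \<longlongrightarrow> 0) (at t)"
proof -
  have L: "u' \<in> L2 M" "u t \<in> L2 M" "\<forall>\<^sub>F s in at t. u s \<in> L2 M" and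
    lim: "((\<lambda>s. L2norm M (\<lambda>z. (u s z - u t z) / (s - t) - u' z)) \<longlongrightarrow> 0) (at t)"
    using assms by (auto simp: has_L2_deriv_def)
  show q: "\<forall>\<^sub>F s in at t. (\<lambda>z. (u s z - u t z) / (s - t)) \<in> L2 M"
    using L(3)
  proof eventually_elim
    case (elim s)
    show ?case using L2_cmult[OF L2_diff[OF elim L(2)], of "1 / (s - t)"] by simp
  qed
  show "((\<lambda>s. L2norm M (\<lambda>z. u s z - u t z)) \<longlongrightarrow> 0) (at t)"
  proof (rule Lim_null_comparison)
    have "\<forall>\<^sub>F s in at t. s \<noteq> t" by (simp add: eventually_at_filter)
    then show "\<forall>\<^sub>F s in at t. norm (L2norm M (\<lambda>z. u s z - u t z)) \<le>
       \<bar>s - t\<bar> * (L2norm M (\<lambda>z. (u s z - u t z) / (s - t) - u' z) + L2norm M u')"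
      using q
    proof eventually_elim
      case (elim s)
      have "L2norm M (\<lambda>z. u s z - u t z) = \<bar>s - t\<bar> * L2norm M (\<lambda>z. (u s z - u t z) / (s - t))"
        using elim(1) by (subst L2norm_cmult[symmetric]) simp
      also have "L2norm M (\<lambda>z. (u s z - u t z) / (s - t)) \<le> L2norm M (\<lambda>z. (u s z - u t z) / (s - t) - u' z) + L2norm M u'"
        using L2norm_triangle[OF L2_diff[OF elim(2) L(1)] L(1)] by simp
      finally show ?case by (simp add: L2norm_nonneg mult_left_mono)
    qed
    show "((\<lambda>s. \<bar>s - t\<bar> * (L2norm M (\<lambda>z. (u s z - u t z) / (s - t) - u' z) + L2norm M u')) \<longlongrightarrow> 0) (at t)"
      using lim by (auto intro!: tendsto_eq_intros)
  qed
qed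

text \<open>The difference of squares factors into the difference quotient and the sum, and the
  inner product of two convergent families converges.\<close>

lemma has_L2_deriv_energy:
  assumes "has_L2_deriv M u u' t"
  shows "((\<lambda>s. \<integral>z. (u s z)\<^sup>2 \<partial>M) has_real_derivative 2 * (\<integral>z. u t z * u' z \<partial>M)) (at t)"
proof -
  have L: "u' \<in> L2 M" "u t \<in> L2 M" "\<forall>\<^sub>F s in at t. u s \<in> L2 M" and
    lim: "((\<lambda>s. L2norm M (\<lambda>z. (u s z - u t z) / (s - t) - u' z)) \<longlongrightarrow> 0) (at t)"
    using assms by (auto simp: has_L2_deriv_def)
  note q = has_L2_deriv_quotient[OF assms]
  have "((\<lambda>s. \<integral>z. (u s z - u t z) / (s - t) * (u s z + u t z) \<partial>M) \<longlongrightarrow> (\<integral>z. u' z * (2 * u t z) \<partial>M)) (at t)"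
  proof (rule L2_inner_tendsto)
    show "\<forall>\<^sub>F s in at t. (\<lambda>z. u s z + u t z) \<in> L2 M" using L(3) by eventually_elim (rule L2_add[OF _ L(2)])
    show "(\<lambda>z. 2 * u t z) \<in> L2 M" by (rule L2_cmult[OF L(2)])
    show "((\<lambda>s. L2norm M (\<lambda>z. u s z + u t z - 2 * u t z)) \<longlongrightarrow> 0) (at t)" using q(2) by simp
  qed (use q lim L in auto)
  moreover have "(\<integral>z. u' z * (2 * u t z) \<partial>M) = 2 * (\<integral>z. u t z * u' z \<partial>M)"
    unfolding integral_mult_right_zero[symmetric] by (simp only: mult_ac)
  moreover have "\<forall>\<^sub>F s in at t. (\<integral>z. (u s z - u t z) / (s - t) * (u s z + u t z) \<partial>M) =
      ((\<integral>z. (u s z)\<^sup>2 \<partial>M) - (\<integral>z. (u t z)\<^sup>2 \<partial>M)) / (s - t)"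
    using L(3)
  proof eventually_elim
    case (elim s)
    have "(\<integral>z. (u s z - u t z) / (s - t) * (u s z + u t z) \<partial>M) = (\<integral>z. ((u s z)\<^sup>2 - (u t z)\<^sup>2) / (s - t) \<partial>M)"
      by (simp add: power2_eq_square algebra_simps)
    then show ?case using elim L(2) by (simp add: L2_def)
  qed
  ultimately have "((\<lambda>s. ((\<integral>z. (u s z)\<^sup>2 \<partial>M) - (\<integral>z. (u t z)\<^sup>2 \<partial>M)) / (s - t)) \<longlongrightarrow> 2 * (\<integral>z. u t z * u' z \<partial>M)) (at t)"
    using Lim_transform_eventually by fastforce
  then show ?thesis
    unfolding has_field_derivative_iff .
qed

text \<open>On a finite measure the constant 1 belongs to \<open>L2\<close>, so the integral is an
  inner product.\<close>

lemma has_L2_deriv_integral: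
  assumes fin: "finite_measure M" and u: "has_L2_deriv M u u' t"
  shows "((\<lambda>s. \<integral>z. u s z \<partial>M) has_real_derivative (\<integral>z. u' z \<partial>M)) (at t)"
proof -
  have L: "u' \<in> L2 M" "u t \<in> L2 M" "\<forall>\<^sub>F s in at t. u s \<in> L2 M" and
    lim: "((\<lambda>s. L2norm M (\<lambda>z. (u s z - u t z) / (s - t) - u' z)) \<longlongrightarrow> 0) (at t)"
    using u by (auto simp: has_L2_deriv_def)
  have one: "(\<lambda>_. 1) \<in> L2 M" using fin by (simp add: L2_def finite_measure.integrable_const)
  have i: "integrable M f" if "f \<in> L2 M" for f using L2_mult_integrable[OF that one] by simp
  have "((\<lambda>s. \<integral>z. (u s z - u t z) / (s - t) * 1 \<partial>M) \<longlongrightarrow> (\<integral>z. u' z * 1 \<partial>M)) (at t)"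
    by (rule L2_inner_tendsto) (use has_L2_deriv_quotient[OF u] lim L one in \<open>auto simp: L2norm_def\<close>)
  moreover have "\<forall>\<^sub>F s in at t. (\<integral>z. (u s z - u t z) / (s - t) * 1 \<partial>M) = ((\<integral>z. u s z \<partial>M) - (\<integral>z. u t z \<partial>M)) / (s - t)"
    using L(3) by eventually_elim (use i L(2) in simp)
  ultimately have "((\<lambda>s. ((\<integral>z. u s z \<partial>M) - (\<integral>z. u t z \<partial>M)) / (s - t)) \<longlongrightarrow> (\<integral>z. u' z * 1 \<partial>M)) (at t)"
    by (rule Lim_transform_eventually)
  then show ?thesis unfolding has_field_derivative_iff by simp
qed

lemma L2_mean_constant:
  assumes fin: "finite_measure M" and d: "\<And>t. t > 0 \<Longrightarrow> has_L2_deriv M g (g' t) t" and z: "\<And>t. t > 0 \<Longrightarrow> (\<integral>z. g' t z \<partial>M) = 0"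
    and st: "s > 0" "t > 0"
  shows "(\<integral>z. g s z \<partial>M) = (\<integral>z. g t z \<partial>M)"
proof (rule has_field_derivative_zero_constant[of "{0<..}" "\<lambda>t. \<integral>z. g t z \<partial>M", THEN exE])
  show "((\<lambda>t. \<integral>z. g t z \<partial>M) has_field_derivative 0) (at x within {0<..})" if "x \<in> {0<..}" for x
    using has_L2_deriv_integral[OF fin d, of x] z[of x] that by (auto intro: has_field_derivative_at_within)
  fix c assume "\<forall>x\<in>{0<..}. (\<integral>z. g x z \<partial>M) = c"
  then show ?thesis using st by simp
qed auto

text \<open>No time derivative of \<open>g'\<close> is given, only increments of \<open>g\<close>
  can be differentiated; this is why \<open>diss\<close> is required for pairs of times.\<close>

lemma L2_decay_of_derivative:
  assumes d: "\<And>t. t > 0 \<Longrightarrow> has_L2_deriv M g (g' t) t"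
    and diss: "\<And>s t. s > 0 \<Longrightarrow> t > 0 \<Longrightarrow>
      (\<integral>z. (g s z - g t z) * (g' s z - g' t z) \<partial>M) \<le> - \<omega> * (\<integral>z. (g s z - g t z)\<^sup>2 \<partial>M)"
    and t: "0 < t0" "t0 \<le> t1"
  shows "(\<integral>z. (g' t1 z)\<^sup>2 \<partial>M) * exp (2 * \<omega> * t1) \<le> (\<integral>z. (g' t0 z)\<^sup>2 \<partial>M) * exp (2 * \<omega> * t0)"
proof -
  define N where "N h t = (\<integral>z. (g (t + h) z - g t z)\<^sup>2 \<partial>M)" for h t
  have mono: "N h t1 * exp (2 * \<omega> * t1) \<le> N h t0 * exp (2 * \<omega> * t0)" if h: "h > 0" for h
  proof (rule DERIV_nonpos_imp_nonincreasing[OF t(2)])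
    fix s assume "t0 \<le> s" "s \<le> t1"
    then have s: "s > 0" "s + h > 0" using t h by auto
    have "has_L2_deriv M (\<lambda>t z. g (t + h) z - g t z) (\<lambda>z. g' (s + h) z - g' s z) s"
      by (rule has_L2_deriv_diff[OF has_L2_deriv_shift[OF d[OF s(2)]] d[OF s(1)]])
    then have "(N h has_real_derivative 2 * (\<integral>z. (g (s + h) z - g s z) * (g' (s + h) z - g' s z) \<partial>M)) (at s)"
      unfolding N_def[abs_def] by (rule has_L2_deriv_energy)
    then have "((\<lambda>t. N h t * exp (2 * \<omega> * t)) has_real_derivative
       (2 * (\<integral>z. (g (s + h) z - g s z) * (g' (s + h) z - g' s z) \<partial>M) + 2 * \<omega> * N h s) * exp (2 * \<omega> * s)) (at s)"
      by (auto intro!: derivative_eq_intros simp: algebra_simps)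
    moreover have "(2 * (\<integral>z. (g (s + h) z - g s z) * (g' (s + h) z - g' s z) \<partial>M) + 2 * \<omega> * N h s) * exp (2 * \<omega> * s) \<le> 0"
      using diss[OF s(2,1)] by (intro mult_nonpos_nonneg) (auto simp: N_def)
    ultimately show "\<exists>y. ((\<lambda>t. N h t * exp (2 * \<omega> * t)) has_real_derivative y) (at s) \<and> y \<le> 0" by blast
  qed
  \<comment> \<open>Strong convergence of the difference quotient gives convergence of its squared
    norm; \<open>s = h + t\<close> moves the limit point to zero.\<close>
  have lim: "((\<lambda>h. N h t / h\<^sup>2) \<longlongrightarrow> (\<integral>z. (g' t z)\<^sup>2 \<partial>M)) (at_right 0)" if "t > 0" for t
  proof -
    have L: "g' t \<in> L2 M" and
      l: "((\<lambda>s. L2norm M (\<lambda>z. (g s z - g t z) / (s - t) - g' t z)) \<longlongrightarrow> 0) (at t)"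
      using d[OF that] by (auto simp: has_L2_deriv_def)
    note q = has_L2_deriv_quotient(1)[OF d[OF that]]
    have "((\<lambda>s. \<integral>z. (g s z - g t z) / (s - t) * ((g s z - g t z) / (s - t)) \<partial>M) \<longlongrightarrow> (\<integral>z. g' t z * g' t z \<partial>M)) (at t)"
      by (rule L2_inner_tendsto[OF q L l q L l])
    moreover have "at t = filtermap (\<lambda>h. h + t) (at 0)" using filtermap_at_shift[of "-t" 0] by simp
    ultimately have "((\<lambda>h. \<integral>z. (g (h + t) z - g t z) / h * ((g (h + t) z - g t z) / h) \<partial>M) \<longlongrightarrow> (\<integral>z. g' t z * g' t z \<partial>M)) (at 0)"
      by (simp add: filterlim_filtermap)
    moreover have "(\<integral>z. (g (h + t) z - g t z) / h * ((g (h + t) z - g t z) / h) \<partial>M) = N h t / h\<^sup>2" for h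
      unfolding N_def times_divide_times_eq power2_eq_square[symmetric] by (simp add: add.commute power_divide)
    ultimately have "((\<lambda>h. N h t / h\<^sup>2) \<longlongrightarrow> (\<integral>z. (g' t z)\<^sup>2 \<partial>M)) (at 0)"
      by (simp only: power2_eq_square)
    then show ?thesis by (rule filterlim_mono) (auto simp: at_le)
  qed
  have t1: "t1 > 0" using t by simp
  show ?thesis
  proof (rule tendsto_le[of "at_right (0::real)"])
    show "((\<lambda>h. N h t0 / h\<^sup>2 * exp (2 * \<omega> * t0)) \<longlongrightarrow> (\<integral>z. (g' t0 z)\<^sup>2 \<partial>M) * exp (2 * \<omega> * t0)) (at_right 0)"
      by (intro tendsto_intros lim t)
    show "((\<lambda>h. N h t1 / h\<^sup>2 * exp (2 * \<omega> * t1)) \<longlongrightarrow> (\<integral>z. (g' t1 z)\<^sup>2 \<partial>M) * exp (2 * \<omega> * t1)) (at_right 0)"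
      by (intro tendsto_intros lim t1)
    show "\<forall>\<^sub>F h in at_right 0. N h t1 / h\<^sup>2 * exp (2 * \<omega> * t1) \<le> N h t0 / h\<^sup>2 * exp (2 * \<omega> * t0)"
      using eventually_at_right_less
    proof eventually_elim
      case (elim h)
      show ?case using divide_right_mono[OF mono[OF elim], of "h\<^sup>2"] by simp
    qed
  qed simp
qed

section \<open>The weighted flux\<close>

text \<open>Cauchy-Schwarz against the indicator of \<open>A\<close>. It lets a bound valid on each
  slice be integrated over the slices into a bound for the square of the total flux.\<close>

lemma nn_integral_square_ge:
  fixes I :: "'a \<Rightarrow> real"
  assumes A: "A \<in> sets N" "emeasure N A \<le> ennreal m" "m > 0" and i: "integrable N (\<lambda>z. indicator A z * I z)"
  shows "ennreal ((\<integral>z. indicator A z * I z \<partial>N)\<^sup>2 / m) \<le> (\<integral>\<^sup>+z\<in>A. ennreal ((I z)\<^sup>2) \<partial>N)"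
proof -
  define f where "f z = indicator A z * I z" for z
  have fm: "f \<in> borel_measurable N" using i by (simp add: f_def[abs_def])
  have eq: "(\<integral>\<^sup>+z\<in>A. ennreal ((I z)\<^sup>2) \<partial>N) = (\<integral>\<^sup>+z. ennreal ((f z)\<^sup>2) \<partial>N)"
    by (rule nn_integral_cong) (simp add: f_def indicator_def)
  show ?thesis
  proof (cases "(\<integral>\<^sup>+z. ennreal ((f z)\<^sup>2) \<partial>N) = \<infinity>")
    case True
    then show ?thesis by (simp add: eq)
  next
    case False
    have f2: "integrable N (\<lambda>z. (f z)\<^sup>2)"
      using False fm by (intro integrableI_bounded) (auto simp: less_top)
    have Afin: "emeasure N A < \<infinity>" using A(2) by (simp add: le_less_trans)
    have i2: "integrable N (\<lambda>z. (indicator A z :: real)\<^sup>2)"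
      using Afin A(1) by (simp add: power2_eq_square flip: indicator_inter_arith)
    have "(\<integral>z. f z \<partial>N)\<^sup>2 = (\<integral>z. f z * indicator A z \<partial>N)\<^sup>2"
      by (intro arg_cong[where f = "\<lambda>x. x\<^sup>2"] Bochner_Integration.integral_cong) (auto simp: f_def indicator_def)
    also have "\<dots> \<le> (\<integral>z. (f z)\<^sup>2 \<partial>N) * (\<integral>z. (indicator A z)\<^sup>2 \<partial>N)"
      by (rule integral_Cauchy_Schwarz(2)) (use fm f2 i2 A in auto)
    also have "(\<integral>z. (indicator A z)\<^sup>2 \<partial>N) = measure N A"
      using A(1) sets.sets_into_space[OF A(1)] by (simp add: power2_eq_square Int_absorb2 flip: indicator_inter_arith)
    also have "(\<integral>z. (f z)\<^sup>2 \<partial>N) * measure N A \<le> (\<integral>z. (f z)\<^sup>2 \<partial>N) * m"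
      using A by (intro mult_left_mono) (auto simp: measure_def enn2real_leI)
    finally have "(\<integral>z. f z \<partial>N)\<^sup>2 / m \<le> (\<integral>z. (f z)\<^sup>2 \<partial>N)" using A(3) by (simp add: divide_le_eq)
    then have "ennreal ((\<integral>z. f z \<partial>N)\<^sup>2 / m) \<le> ennreal (\<integral>z. (f z)\<^sup>2 \<partial>N)" by (rule ennreal_leI)
    also have "\<dots> = (\<integral>\<^sup>+z. ennreal ((f z)\<^sup>2) \<partial>N)" by (rule nn_integral_eq_integral[symmetric]) (use f2 in auto)
    finally show ?thesis unfolding eq by (simp add: f_def)
  qed
qed

section \<open>Gradients by components\<close>

lemma ddir_linear:
  assumes "smooth_on UNIV \<phi>"
  shows "linear (\<lambda>v. ddir v \<phi> z)"
  using has_derivative_linear[OF smooth_has_derivative[OF assms]] .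

text \<open>Symmetry of \<open>tproj\<close> moves the projection from the gradient to the
  direction. Only linearity at the point is assumed, so that the lemma also serves \<open>E\<close>,
  which is not smooth.\<close>

lemma grad_th_nth_linear:
  assumes l: "linear (\<lambda>v. ddir v \<phi> z)"
  shows "grad_th \<phi> z $ k = ddir (dir_th k) \<phi> z"
proof -
  have e: "dir_th k = (\<Sum>j\<in>UNIV. (tproj $ k $ j) *\<^sub>R (axis j 1, 0))"
    using exhaust_3[of k] by (auto simp: dir_th_def sum_3 prod_eq_iff vec_eq_iff forall_3 tproj_nth axis_def) (simp_all add: tproj_def mat_def)
  have "ddir (dir_th k) \<phi> z = (\<Sum>j\<in>UNIV. (tproj $ k $ j) * ddir (axis j 1, 0) \<phi> z)"
    by (simp only: e linear_sum[OF l] linear_cmul[OF l] real_scaleR_def)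
  then show ?thesis by (simp add: grad_th_def matrix_vector_mult_def)
qed

lemma grad_th_nth: "smooth_on UNIV \<phi> \<Longrightarrow> grad_th \<phi> z $ k = ddir (dir_th k) \<phi> z"
  by (intro grad_th_nth_linear ddir_linear)

lemma grad_a_nth: "grad_a \<phi> z $ i = ddir (dir_a i) \<phi> z"
  by (simp add: grad_a_def dir_a_def)

lemma has_derivative_vec:
  fixes f :: "'n::finite \<Rightarrow> 'a::real_normed_vector \<Rightarrow> real"
  assumes "\<And>i. (f i has_derivative f' i) (at z)"
  shows "((\<lambda>x. \<chi> i. f i x) has_derivative (\<lambda>h. \<chi> i. f' i h)) (at z)"
  using assms by (subst has_derivative_componentwise_within) (auto simp: Basis_vec_def inner_axis)

lemma borel_measurable_vec_lambda:
  fixes f :: "'n::finite \<Rightarrow> 'a \<Rightarrow> real"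
  assumes "\<And>i. f i \<in> borel_measurable N"
  shows "(\<lambda>x. \<chi> i. f i x) \<in> borel_measurable N"
  using assms by (subst borel_measurable_euclidean_space) (auto simp: Basis_vec_def inner_axis)

lemma dir_in_dirs [simp]: "dir_th k \<in> dirs" "dir_a i \<in> dirs"
  by (auto simp: dirs_def)

section \<open>Energy, weight and weighted measure\<close>

locale fokker_planck =
  fixes \<gamma> \<eta> D C\<^sub>P :: real and \<sigma> \<sigma>' :: "real \<Rightarrow> real" and x :: "3 \<Rightarrow> real^2" and TJ :: "(real^2) set"
  assumes pos: "\<gamma> > 0" "\<eta> > 0" "D > 0" "C\<^sub>P > 0"
    and TJ: "open TJ" "bounded TJ" "TJ \<noteq> {}" "C2_boundary TJ"
    and \<sigma>: "\<And>t. (\<sigma> has_real_derivative \<sigma>' t) (at t)" "continuous_on UNIV \<sigma>'"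
    and pw: "poincare_wirtinger TJ C\<^sub>P"
begin

definition E :: "state \<Rightarrow> real" where "E = energy \<sigma> x"

definition W :: "state \<Rightarrow> real" where "W z = - E z / D"

definition w :: "state \<Rightarrow> real" where "w z = exp (W z)"

definition M :: "state measure" where "M = expvol TJ W"

text \<open>The directional derivative of \<open>E\<close> along \<open>v\<close>. As
  \<open>sgn 0 = 0\<close>, it is defined, linear in \<open>v\<close>, measurable and locally
  bounded everywhere, including the points \<open>x j\<close> where \<open>E\<close> may fail to be
  differentiable.\<close>

definition gE :: "state \<Rightarrow> state \<Rightarrow> real" where
  "gE v z = (\<Sum>j\<in>UNIV. \<sigma>' (fst z $ j) * (fst v $ j) * norm (snd z - x j) + \<sigma> (fst z $ j) * (sgn (snd z - x j) \<bullet> snd v))"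

lemma E_eq: "E z = (\<Sum>j\<in>UNIV. \<sigma> (fst z $ j) * norm (snd z - x j))"
  by (simp add: E_def energy_def case_prod_unfold)

lemma \<sigma>_cont: "continuous_on UNIV \<sigma>"
  using \<sigma>(1) by (meson DERIV_continuous_on has_field_derivative_at_within)

lemma E_cont: "continuous_on UNIV E"
  unfolding E_eq[abs_def] by (intro continuous_intros continuous_on_compose2[OF \<sigma>_cont]) auto

lemma W_cont: "continuous_on UNIV W"
  unfolding W_def[abs_def] using pos by (intro continuous_intros E_cont) auto

lemma w_cont: "continuous_on UNIV w"
  unfolding w_def[abs_def] by (intro continuous_intros W_cont)

lemma w_pos: "w z > 0" by (simp add: w_def)

lemma W_meas: "W \<in> borel_measurable (vol TJ)" and w_meas: "w \<in> borel_measurable (vol TJ)"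
  by (intro continuous_measurable_vol TJ W_cont w_cont)+

definition wi :: real where "wi = (INF z\<in>mis \<times> TJ. w z)"
definition ws :: real where "ws = (SUP z\<in>mis \<times> TJ. w z)"

lemma w_bounds:
  shows "wi > 0" and "z \<in> mis \<times> TJ \<Longrightarrow> wi \<le> w z" and "z \<in> mis \<times> TJ \<Longrightarrow> w z \<le> ws" and "ws > 0"
proof -
  obtain B where B: "B > 0" "\<And>z. z \<in> mis \<times> TJ \<Longrightarrow> norm (W z) \<le> B"
    using continuous_bounded_on_state[OF TJ(2) W_cont] by metis
  have ne: "mis \<times> TJ \<noteq> {}" using zero_in_mis TJ(3) by auto
  have b: "exp (- B) \<le> w z" "w z \<le> exp B" if "z \<in> mis \<times> TJ" for z
    using B(2)[OF that] by (auto simp: w_def abs_le_iff)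
  have "exp (- B) \<le> wi" unfolding wi_def by (rule cINF_greatest[OF ne b(1)])
  then show "wi > 0" by (rule less_le_trans[rotated]) simp
  have bb: "bdd_below (w ` (mis \<times> TJ))" using b(1) by (rule bdd_belowI2)
  have ba: "bdd_above (w ` (mis \<times> TJ))" using b(2) by (rule bdd_aboveI2)
  show "wi \<le> w z" if "z \<in> mis \<times> TJ" unfolding wi_def by (rule cINF_lower[OF bb that])
  show le: "w z \<le> ws" if "z \<in> mis \<times> TJ" for z unfolding ws_def by (rule cSUP_upper[OF that ba])
  obtain z where "z \<in> mis \<times> TJ" using ne by blast
  then show "ws > 0" using le[of z] w_pos[of z] by linarith
qed

lemma gE_linear: "linear (\<lambda>v. gE v z)"
  unfolding gE_def
  by (rule linearI) (simp_all add: sum.distrib[symmetric] sum_distrib_left algebra_simps inner_add_right)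

lemma \<sigma>_component: "((\<lambda>z. \<sigma> (fst z $ j)) has_derivative (\<lambda>h. \<sigma>' (fst z $ j) * (fst h $ j))) (at (z::state))"
proof -
  have 1: "((\<lambda>z::state. fst z $ j) has_derivative (\<lambda>h. fst h $ j)) (at z)"
    by (intro bounded_linear.has_derivative[OF bounded_linear_vec_nth] has_derivative_fst has_derivative_ident)
  show ?thesis
    using has_derivative_compose[OF 1 \<sigma>(1)[unfolded has_field_derivative_def]] .
qed

lemma E_deriv:
  assumes "snd z \<notin> range x"
  shows "(E has_derivative (\<lambda>v. gE v z)) (at z)"
proof -
  have n: "((\<lambda>z::state. norm (snd z - x j)) has_derivative (\<lambda>h. snd h \<bullet> sgn (snd z - x j))) (at z)" for j
  proof -
    have "snd z - x j \<noteq> 0" using assms by auto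
    moreover have "((\<lambda>z::state. snd z - x j) has_derivative snd) (at z)"
      by (auto intro!: derivative_eq_intros)
    ultimately show ?thesis by (rule has_derivative_compose[OF _ has_derivative_norm, rotated])
  qed
  have "((\<lambda>z. \<Sum>j\<in>UNIV. \<sigma> (fst z $ j) * norm (snd z - x j)) has_derivative
      (\<lambda>h. \<Sum>j\<in>UNIV. \<sigma> (fst z $ j) * (snd h \<bullet> sgn (snd z - x j)) + \<sigma>' (fst z $ j) * (fst h $ j) * norm (snd z - x j))) (at z)"
    by (intro has_derivative_sum has_derivative_mult \<sigma>_component n)
  then show ?thesis unfolding E_eq[abs_def]
    by (rule has_derivative_eq_rhs) (simp add: gE_def inner_commute add.commute)
qed

text \<open>At fixed \<open>a\<close> the norms are constants, so the derivative in
  \<open>\<theta>\<close> exists for every \<open>a\<close>, also for \<open>a = x j\<close>;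
  \<open>green_hexagon\<close> relies on this.\<close>

lemma E_deriv_th: "((\<lambda>\<theta>. E (\<theta>, a)) has_derivative (\<lambda>h. gE (h, 0) (\<theta>, a))) (at \<theta>)"
proof -
  have s: "((\<lambda>\<theta>::real^3. \<sigma> (\<theta> $ j)) has_derivative (\<lambda>h. \<sigma>' (\<theta> $ j) * (h $ j))) (at \<theta>)" for j
    by (rule has_derivative_compose[OF bounded_linear.has_derivative[OF bounded_linear_vec_nth has_derivative_ident] \<sigma>(1)[unfolded has_field_derivative_def]])
  have "((\<lambda>\<theta>. \<Sum>j\<in>UNIV. \<sigma> (\<theta> $ j) * norm (a - x j)) has_derivative
      (\<lambda>h. \<Sum>j\<in>UNIV. \<sigma>' (\<theta> $ j) * (h $ j) * norm (a - x j))) (at \<theta>)"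
    by (intro has_derivative_sum has_derivative_mult_left s)
  then show ?thesis unfolding E_eq[abs_def]
    by (simp add: gE_def)
qed

lemma gE_meas: "gE v \<in> borel_measurable borel"
proof -
  have m1: "(\<lambda>z::state. \<sigma>' (fst z $ j) * (fst v $ j) * norm (snd z - x j)) \<in> borel_measurable borel"
    and m2: "(\<lambda>z::state. \<sigma> (fst z $ j)) \<in> borel_measurable borel" for j
    by (intro borel_measurable_continuous_onI continuous_intros continuous_on_compose2[OF \<sigma>_cont] continuous_on_compose2[OF \<sigma>(2)]; auto)+
  have m3: "(\<lambda>z::state. sgn (snd z - x j) \<bullet> snd v) \<in> borel_measurable borel" for j
  proof -
    have "(\<lambda>z::state. snd z - x j) \<in> borel_measurable borel" by (intro borel_measurable_continuous_onI continuous_intros)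
    then show ?thesis unfolding sgn_div_norm by measurable
  qed
  show ?thesis unfolding gE_def
    by (rule borel_measurable_sum, rule borel_measurable_add, rule m1, rule borel_measurable_times[OF m2 m3])
qed

text \<open>Because of \<open>sgn\<close>, \<open>gE v\<close> need not be continuous, so the bound
  goes through a continuous majorant in which \<open>sgn\<close> is replaced by its norm bound
  1.\<close>

lemma gE_bounded: "\<exists>B. \<forall>z\<in>mis \<times> TJ. \<bar>gE v z\<bar> \<le> B"
proof -
  define F where "F z = (\<Sum>j\<in>UNIV. \<bar>\<sigma>' (fst z $ j) * (fst v $ j) * norm (snd z - x j)\<bar> + \<bar>\<sigma> (fst z $ j)\<bar> * norm (snd v))" for z :: state
  have "continuous_on UNIV F" unfolding F_def
    by (intro continuous_intros continuous_on_compose2[OF \<sigma>_cont] continuous_on_compose2[OF \<sigma>(2)]) auto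
  then obtain B where B: "\<And>z. z \<in> mis \<times> TJ \<Longrightarrow> norm (F z) \<le> B"
    using continuous_bounded_on_state[OF TJ(2)] by metis
  have "\<bar>gE v z\<bar> \<le> F z" for z
    unfolding gE_def F_def
  proof (rule order_trans[OF sum_abs], rule sum_mono)
    fix j
    have "\<bar>sgn (snd z - x j) \<bullet> snd v\<bar> \<le> norm (sgn (snd z - x j)) * norm (snd v)" by (rule Cauchy_Schwarz_ineq2)
    also have "\<dots> \<le> 1 * norm (snd v)" by (intro mult_right_mono) (auto simp: norm_sgn)
    finally have "\<bar>\<sigma> (fst z $ j) * (sgn (snd z - x j) \<bullet> snd v)\<bar> \<le> \<bar>\<sigma> (fst z $ j)\<bar> * norm (snd v)"
      by (simp add: abs_mult mult_left_mono)
    then show "\<bar>\<sigma>' (fst z $ j) * (fst v $ j) * norm (snd z - x j) + \<sigma> (fst z $ j) * (sgn (snd z - x j) \<bullet> snd v)\<bar>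
      \<le> \<bar>\<sigma>' (fst z $ j) * (fst v $ j) * norm (snd z - x j)\<bar> + \<bar>\<sigma> (fst z $ j)\<bar> * norm (snd v)"
      by (rule order_trans[OF abs_triangle_ineq add_left_mono])
  qed
  then have "\<bar>gE v z\<bar> \<le> B" if "z \<in> mis \<times> TJ" for z
    using B[OF that] abs_ge_self[of "F z"] by (metis order_trans real_norm_def)
  then show ?thesis by blast
qed

lemma sets_M [simp, measurable_cong]: "sets M = sets (vol TJ)"
  by (simp add: M_def)

lemma measurable_M: "f \<in> borel_measurable M \<longleftrightarrow> f \<in> borel_measurable (vol TJ)"
  by (simp cong: measurable_cong_sets)

lemma space_M: "space M = mis \<times> TJ"
  using sets_eq_imp_space_eq[OF sets_M] by (simp add: space_vol)

lemma M_density: "M = density (vol TJ) (\<lambda>z. ennreal (w z))"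
  by (simp add: M_def expvol_def w_def)

lemma AE_M: "(AE z in M. P z) \<longleftrightarrow> (AE z in vol TJ. P z)"
  unfolding M_def using AE_expvol[OF TJ(1) W_meas] by blast

lemma integral_M: "f \<in> borel_measurable (vol TJ) \<Longrightarrow> (\<integral>z. f z \<partial>M) = (\<integral>z. w z * f z \<partial>vol TJ)" for f :: "state \<Rightarrow> real"
  unfolding M_density using w_meas w_pos by (subst integral_density) (auto intro!: AE_I2 less_imp_le[OF w_pos])

lemma integrable_M: "f \<in> borel_measurable (vol TJ) \<Longrightarrow> integrable M f \<longleftrightarrow> integrable (vol TJ) (\<lambda>z. w z * f z)" for f :: "state \<Rightarrow> real"
  unfolding M_density using w_meas w_pos by (subst integrable_density) (auto intro!: AE_I2 less_imp_le[OF w_pos])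

lemma finite_M: "finite_measure M"
proof -
  have "integrable M (\<lambda>_. 1 :: real)"
    using w_bounds(3) w_pos
    by (subst integrable_M, simp, intro integrable_vol_bounded[of _ _ ws] TJ) (auto simp: w_meas abs_of_pos less_imp_le)
  then have "emeasure M (space M) < \<infinity>" by (simp add: integrable_iff_bounded)
  then show ?thesis by (intro finite_measureI) simp
qed

lemma bounded_L2:
  assumes "f \<in> borel_measurable (vol TJ)" "\<And>z. z \<in> mis \<times> TJ \<Longrightarrow> \<bar>f z\<bar> \<le> B"
  shows "f \<in> L2 M"
proof -
  have "(f z)\<^sup>2 \<le> B\<^sup>2" if "z \<in> mis \<times> TJ" for z using assms(2)[OF that] by (rule abs_le_square_iff[THEN iffD1, OF order_trans[OF _ abs_ge_self]])
  then have "integrable M (\<lambda>z. (f z)\<^sup>2)"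
    using assms(1) by (intro finite_measure.integrable_const_bound[OF finite_M, of _ "B\<^sup>2"]) (auto simp: measurable_M space_M)
  then show ?thesis using assms(1) by (simp add: L2_def measurable_M)
qed

lemma continuous_L2: "continuous_on UNIV f \<Longrightarrow> f \<in> L2 M"
proof -
  assume c: "continuous_on UNIV f"
  obtain B where "\<And>z. z \<in> mis \<times> TJ \<Longrightarrow> norm (f z) \<le> B" using continuous_bounded_on_state[OF TJ(2) c] by metis
  then show ?thesis using continuous_measurable_vol[OF TJ(1) c] by (intro bounded_L2) auto
qed

lemma smooth_L2: "smooth_on UNIV f \<Longrightarrow> f \<in> L2 M"
  by (intro continuous_L2 smooth_continuous)

lemma gE_times_L2: "continuous_on UNIV f \<Longrightarrow> (\<lambda>z. f z * gE v z) \<in> L2 M"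
proof -
  assume c: "continuous_on UNIV f"
  obtain B where B: "B > 0" "\<And>z. z \<in> mis \<times> TJ \<Longrightarrow> norm (f z) \<le> B" using continuous_bounded_on_state[OF TJ(2) c] by metis
  obtain B' where B': "\<And>z. z \<in> mis \<times> TJ \<Longrightarrow> \<bar>gE v z\<bar> \<le> B'" using gE_bounded by blast
  have "\<bar>f z * gE v z\<bar> \<le> B * B'" if "z \<in> mis \<times> TJ" for z
    unfolding abs_mult using B(1) B(2)[OF that] B'[OF that] by (intro mult_mono) auto
  then show ?thesis
    by (intro bounded_L2 borel_measurable_times continuous_measurable_vol TJ c borel_measurable_vol_subset gE_meas)
qed

text \<open>At each fixed angle the excluded positions form a finite set, hence a planar null
  set.\<close>

lemma AE_regular: "AE z in vol TJ. snd z \<notin> range x"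
proof -
  interpret p: pair_sigma_finite plane_measure "lborel :: (real^2) measure"
    by (intro pair_sigma_finite.intro sigma_finite_plane lborel.sigma_finite_measure_axioms)
  have fin: "finite (range x)" by simp
  have "AE z in plane_measure \<Otimes>\<^sub>M lborel. snd z \<notin> range x"
  proof (rule p.AE_pair_measure)
    have "{z :: state. snd z \<notin> range x} = UNIV \<times> (- range x)" by auto
    moreover have "open (UNIV \<times> (- range x) :: state set)"
      by (intro open_Times open_UNIV open_Compl finite_imp_closed fin)
    ultimately show "{z \<in> space (plane_measure \<Otimes>\<^sub>M lborel). snd z \<notin> range x} \<in> sets (plane_measure \<Otimes>\<^sub>M lborel)"
      by (simp add: space_pair_measure)
    show "AE \<theta> in plane_measure. AE a in lborel. snd (\<theta>, a) \<notin> range x"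
      using AE_not_in[OF finite_imp_null_set_lborel[OF fin]] by simp
  qed
  then show ?thesis unfolding vol_def
    by (subst AE_restrict_space_iff) (use state_borel[OF TJ(1)] in \<open>auto simp: space_pair_measure\<close>)
qed

lemma wE_deriv_th: "((\<lambda>\<theta>. w (\<theta>, a)) has_derivative (\<lambda>h. - (w (\<theta>, a) * gE (h, 0) (\<theta>, a) / D))) (at \<theta>)"
  unfolding w_def W_def using pos by (auto intro!: derivative_eq_intros E_deriv_th simp: field_simps)

lemma w_deriv:
  assumes "snd z \<notin> range x"
  shows "(w has_derivative (\<lambda>v. - (w z * gE v z / D))) (at z)"
  unfolding w_def[abs_def] W_def using pos by (auto intro!: derivative_eq_intros E_deriv[OF assms] simp: field_simps)

text \<open>The multiplier is evaluated on the boundary, so its bound is needed on the closures;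
  dividing by \<open>B\<close> makes it admissible in the divergence estimates.\<close>

lemma closure_bound:
  assumes "continuous_on UNIV \<psi>"
  obtains B where "B > 0" "\<And>z. z \<in> closure mis \<times> closure TJ \<Longrightarrow> \<bar>w z * \<psi> z\<bar> \<le> B"
proof -
  have "compact (closure mis \<times> closure TJ)" using bounded_mis TJ(2) by (intro compact_Times) (auto simp: compact_closure)
  then have "bounded ((\<lambda>z. w z * \<psi> z) ` (closure mis \<times> closure TJ))"
    by (intro compact_imp_bounded compact_continuous_image continuous_intros
        continuous_on_subset[OF w_cont] continuous_on_subset[OF assms]) auto
  then obtain B where "B > 0" "\<forall>z \<in> closure mis \<times> closure TJ. \<bar>w z * \<psi> z\<bar> \<le> B"
    unfolding bounded_pos by auto
  then show ?thesis using that by blast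
qed

text \<open>\<open>w * flux v \<phi> \<psi>\<close> is the divergence of \<open>w * \<psi> * \<nabla>\<phi>\<close> in the directions \<open>v\<close>.\<close>

definition flux :: "('k::finite \<Rightarrow> state) \<Rightarrow> (state \<Rightarrow> real) \<Rightarrow> (state \<Rightarrow> real) \<Rightarrow> state \<Rightarrow> real" where
  "flux v \<phi> \<psi> z = \<psi> z * (\<Sum>k\<in>UNIV. ddir (v k) (ddir (v k) \<phi>) z)
     + (\<Sum>k\<in>UNIV. ddir (v k) \<phi> z * (ddir (v k) \<psi> z - \<psi> z * gE (v k) z / D))"

lemma flux_meas:
  assumes "smooth_on UNIV \<phi>" "smooth_on UNIV \<psi>"
  shows "flux v \<phi> \<psi> \<in> borel_measurable borel"
proof -
  have s: "f \<in> borel_measurable borel" if "smooth_on UNIV f" for f :: "state \<Rightarrow> real"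
    by (rule borel_measurable_continuous_onI[OF smooth_continuous[OF that]])
  note [measurable] = s[OF assms(1)] s[OF assms(2)] s[OF smooth_ddir[OF assms(1)]] s[OF smooth_ddir[OF assms(2)]]
    s[OF smooth_ddir[OF smooth_ddir[OF assms(1)]]] gE_meas
  show ?thesis unfolding flux_def by measurable
qed

lemma flux_integrable:
  assumes "smooth_on UNIV \<phi>" "smooth_on UNIV \<psi>"
  shows "integrable M (flux v \<phi> \<psi>)" "integrable (vol TJ) (\<lambda>z. w z * flux v \<phi> \<psi> z)"
proof -
  have "(\<lambda>z. ddir (v k) \<psi> z - (1 / D) * (\<psi> z * gE (v k) z)) \<in> L2 M" for k
    by (intro L2_diff L2_cmult gE_times_L2 smooth_L2 smooth_continuous smooth_ddir assms)
  then have "integrable M (\<lambda>z. ddir (v k) \<phi> z * (ddir (v k) \<psi> z - \<psi> z * gE (v k) z / D))" for k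
    using L2_mult_integrable[OF smooth_L2[OF smooth_ddir[OF assms(1)]], of "\<lambda>z. ddir (v k) \<psi> z - \<psi> z * gE (v k) z / D"] by simp
  moreover have "integrable M (\<lambda>z. \<psi> z * ddir (v k) (ddir (v k) \<phi>) z)" for k
    by (intro L2_mult_integrable smooth_L2 smooth_ddir assms)
  ultimately show *: "integrable M (flux v \<phi> \<psi>)" unfolding flux_def[abs_def] by (simp add: sum_distrib_left)
  show "integrable (vol TJ) (\<lambda>z. w z * flux v \<phi> \<psi> z)"
    using * by (subst (asm) integrable_M) (intro borel_measurable_vol_subset TJ flux_meas assms)
qed

text \<open>At fixed \<open>a\<close>, \<open>green_hexagon\<close> is applied to the multiplier
  \<open>w * \<psi> / B\<close> and the field \<open>grad_th \<phi>\<close>; Cauchy-Schwarz over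
  \<open>TJ\<close> follows. The constant depends on \<open>\<psi>\<close> but not on
  \<open>\<phi>\<close>, as the limit over approximating \<open>\<phi>\<close> demands. The term
  \<open>- 0\<close> keeps the right-hand side in the form of \<open>has_normal_trace_th\<close>
  with zero trace.\<close>

lemma flux_th_bound:
  assumes \<psi>: "smooth_on UNIV \<psi>"
  obtains C where "C > 0" "\<And>\<phi>. smooth_on UNIV \<phi> \<Longrightarrow>
    ennreal (C * (\<integral>z. flux dir_th \<phi> \<psi> z \<partial>M)\<^sup>2) \<le>
    (\<integral>\<^sup>+a\<in>TJ. (\<integral>\<^sup>+\<theta>\<in>rel_frontier mis. ennreal ((grad_th \<phi> (\<theta>, a) \<bullet> outer_normal mis_plane mis \<theta> - 0)\<^sup>2) \<partial>hausdorff1) \<partial>lborel)"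
proof -
  obtain B where B: "B > 0" "\<And>z. z \<in> closure mis \<times> closure TJ \<Longrightarrow> \<bar>w z * \<psi> z\<bar> \<le> B"
    using closure_bound[OF smooth_continuous[OF \<psi>]] by blast
  \<comment> \<open>The summand 1 secures positivity of the divisor.\<close>
  define m where "m = measure lborel TJ + 1"
  have m: "emeasure lborel TJ \<le> ennreal m" "m > 0"
    using emeasure_bounded_finite[OF TJ(2)]
    by (auto simp: m_def emeasure_eq_ennreal_measure less_top add_nonneg_pos intro!: ennreal_leI)
  \<comment> \<open>Absorbs the rescaling by \<open>B\<close> and the constant of
    \<open>green_hexagon\<close>, so that the slice bound reads \<open>(I a / q)^2\<close>.\<close>
  define q where "q = B * sqrt (27 * pi)"
  have q: "q > 0" using B(1) by (simp add: q_def)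
  have q2: "q\<^sup>2 = B\<^sup>2 * (27 * pi)" by (simp add: q_def power_mult_distrib)
  show ?thesis
  proof (rule that)
    show "1 / (m * q\<^sup>2) > 0" using m q by simp
    fix \<phi> :: "state \<Rightarrow> real" assume \<phi>: "smooth_on UNIV \<phi>"
    define I where "I a = (\<integral>\<theta>. indicator mis \<theta> * (w (\<theta>, a) * flux dir_th \<phi> \<psi> (\<theta>, a)) \<partial>plane_measure)" for a
    note i = flux_integrable[OF \<phi> \<psi>, of dir_th]
    have R: "(\<integral>z. flux dir_th \<phi> \<psi> z \<partial>M) = (\<integral>a. indicator TJ a * I a \<partial>lborel)"
      unfolding I_def using integral_vol_fubini(2)[OF TJ(1) i(2)]
      by (subst integral_M) (auto intro!: borel_measurable_vol_subset TJ flux_meas \<phi> \<psi>)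
    have iI: "integrable lborel (\<lambda>a. indicator TJ a * I a)"
      unfolding I_def using integral_vol_fubini(4)[OF TJ(1) i(2)] .
    have bd: "ennreal ((I a / q)\<^sup>2) \<le> (\<integral>\<^sup>+\<theta>\<in>rel_frontier mis. ennreal ((grad_th \<phi> (\<theta>, a) \<bullet> outer_normal mis_plane mis \<theta> - 0)\<^sup>2) \<partial>hausdorff1)"
      if a: "a \<in> TJ" for a
    proof -
      define \<kappa> where "\<kappa> \<theta> = (1 / B) * (w (\<theta>, a) * \<psi> (\<theta>, a))" for \<theta>
      define \<kappa>' where "\<kappa>' \<theta> h = (1 / B) * (w (\<theta>, a) * (ddir (h, 0) \<psi> (\<theta>, a) - \<psi> (\<theta>, a) * gE (h, 0) (\<theta>, a) / D))" for \<theta> h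
      define G where "G \<theta> = grad_th \<phi> (\<theta>, a)" for \<theta>
      define G' where "G' \<theta> h = (\<chi> k. ddir (h, 0) (ddir (dir_th k) \<phi>) (\<theta>, a))" for \<theta> h
      have slice: "((\<lambda>\<theta>. f (\<theta>, a)) has_derivative (\<lambda>h. ddir (h, 0) f (\<theta>, a))) (at \<theta>)" if "smooth_on UNIV f" for f :: "state \<Rightarrow> real" and \<theta>
        by (rule has_derivative_compose[of "\<lambda>\<theta>. (\<theta>, a)" "\<lambda>h. (h, 0)" \<theta> UNIV f "\<lambda>h. ddir h f (\<theta>, a)"])
          (auto intro!: derivative_eq_intros smooth_has_derivative[OF that])
      have sc: "continuous_on UNIV (\<lambda>\<theta>. f (\<theta>, a))" if "continuous_on UNIV f" for f :: "state \<Rightarrow> real"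
        by (intro continuous_on_compose2[OF that] continuous_intros) auto
      have "ennreal ((\<integral>\<theta>. indicator mis \<theta> * (\<kappa> \<theta> * dvg_th G' \<theta> + (\<Sum>k\<in>UNIV. \<kappa>' \<theta> (tproj *v axis k 1) * G \<theta> $ k)) \<partial>plane_measure)\<^sup>2 / (27 * pi))
         \<le> (\<integral>\<^sup>+\<theta>\<in>rel_frontier mis. ennreal ((G \<theta> \<bullet> outer_normal mis_plane mis \<theta>)\<^sup>2) \<partial>hausdorff1)"
      proof (rule green_hexagon)
        show "(\<kappa> has_derivative \<kappa>' \<theta>) (at \<theta>)" for \<theta>
        proof -
          have "((\<lambda>\<theta>. (1 / B) * (w (\<theta>, a) * \<psi> (\<theta>, a))) has_derivative
              (\<lambda>h. (1 / B) * (w (\<theta>, a) * ddir (h, 0) \<psi> (\<theta>, a) + (- (w (\<theta>, a) * gE (h, 0) (\<theta>, a) / D)) * \<psi> (\<theta>, a)))) (at \<theta>)"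
            by (intro has_derivative_mult_right has_derivative_mult wE_deriv_th slice \<psi>)
          then show ?thesis unfolding \<kappa>_def[abs_def]
            by (rule has_derivative_eq_rhs) (auto simp: \<kappa>'_def fun_eq_iff algebra_simps)
        qed
        show "continuous_on UNIV (\<lambda>\<theta>. \<kappa>' \<theta> h)" for h
        proof -
          have "continuous_on UNIV (\<lambda>\<theta>. gE (h, 0) (\<theta>, a))"
            unfolding gE_def by (simp, intro continuous_intros continuous_on_compose2[OF \<sigma>(2)]) auto
          then show ?thesis unfolding \<kappa>'_def using pos
            by (intro continuous_intros sc[OF w_cont] sc[OF smooth_continuous[OF \<psi>]] sc[OF smooth_continuous[OF smooth_ddir[OF \<psi>]]]) auto
        qed
        show "\<bar>\<kappa> \<theta>\<bar> \<le> 1" if "\<theta> \<in> rel_frontier mis" for \<theta>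
        proof -
          have "(\<theta>, a) \<in> closure mis \<times> closure TJ" using that a closure_subset by (auto simp: rel_frontier_def)
          from B(2)[OF this] show ?thesis using B(1) by (simp add: \<kappa>_def abs_mult)
        qed
        have Gk: "G \<theta> = (\<chi> k. ddir (dir_th k) \<phi> (\<theta>, a))" for \<theta> by (simp add: G_def vec_eq_iff grad_th_nth[OF \<phi>])
        show "(G has_derivative G' \<theta>) (at \<theta>)" for \<theta>
          unfolding Gk[abs_def] G'_def by (intro has_derivative_vec slice smooth_ddir \<phi>)
        show "continuous_on UNIV (\<lambda>\<theta>. G' \<theta> v)" for v
          unfolding G'_def by (intro continuous_on_vec_lambda sc[OF smooth_continuous[OF smooth_ddir[OF smooth_ddir[OF \<phi>]]]])
        show "G \<theta> \<in> mis_plane" for \<theta> by (simp add: G_def grad_th_def tproj_in_plane)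
      qed
      moreover have "(\<integral>\<theta>. indicator mis \<theta> * (\<kappa> \<theta> * dvg_th G' \<theta> + (\<Sum>k\<in>UNIV. \<kappa>' \<theta> (tproj *v axis k 1) * G \<theta> $ k)) \<partial>plane_measure) = I a / B"
      proof -
        have "\<kappa> \<theta> * dvg_th G' \<theta> + (\<Sum>k\<in>UNIV. \<kappa>' \<theta> (tproj *v axis k 1) * G \<theta> $ k) = (w (\<theta>, a) * flux dir_th \<phi> \<psi> (\<theta>, a)) / B" for \<theta>
          unfolding flux_def dvg_th_def \<kappa>_def \<kappa>'_def G'_def G_def grad_th_nth[OF \<phi>]
          by (simp add: sum_distrib_left sum_divide_distrib distrib_left add_divide_distrib mult_ac dir_th_def)
        then show ?thesis by (simp add: I_def)
      qed
      moreover have "(I a / B)\<^sup>2 / (27 * pi) = (I a / q)\<^sup>2" by (simp add: power_divide q2)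
      ultimately show ?thesis by (simp add: G_def)
    qed
    have "ennreal (1 / (m * q\<^sup>2) * (\<integral>z. flux dir_th \<phi> \<psi> z \<partial>M)\<^sup>2) = ennreal ((\<integral>a. indicator TJ a * (I a / q) \<partial>lborel)\<^sup>2 / m)"
      unfolding R by (simp add: power_divide mult.commute)
    also have "\<dots> \<le> (\<integral>\<^sup>+a\<in>TJ. ennreal ((I a / q)\<^sup>2) \<partial>lborel)"
      by (rule nn_integral_square_ge) (use m iI TJ in auto)
    also have "\<dots> \<le> (\<integral>\<^sup>+a\<in>TJ. (\<integral>\<^sup>+\<theta>\<in>rel_frontier mis. ennreal ((grad_th \<phi> (\<theta>, a) \<bullet> outer_normal mis_plane mis \<theta> - 0)\<^sup>2) \<partial>hausdorff1) \<partial>lborel)"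
      by (rule nn_integral_mono) (use bd in \<open>auto simp: indicator_def\<close>)
    finally show "ennreal (1 / (m * q\<^sup>2) * (\<integral>z. flux dir_th \<phi> \<psi> z \<partial>M)\<^sup>2) \<le>
      (\<integral>\<^sup>+a\<in>TJ. (\<integral>\<^sup>+\<theta>\<in>rel_frontier mis. ennreal ((grad_th \<phi> (\<theta>, a) \<bullet> outer_normal mis_plane mis \<theta> - 0)\<^sup>2) \<partial>hausdorff1) \<partial>lborel)" .
  qed
qed

text \<open>The same at fixed \<open>\<theta>\<close> with \<open>green_C2\<close>. The multiplier
  may have kinks at the points \<open>x j\<close>, so \<open>range x\<close> is the exceptional set;
  the constant \<open>\<epsilon>\<close> of the domain enters through
  \<open>q = sqrt \<epsilon> / B\<close>.\<close>

lemma flux_a_bound: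
  assumes \<psi>: "smooth_on UNIV \<psi>"
  obtains C where "C > 0" "\<And>\<phi>. smooth_on UNIV \<phi> \<Longrightarrow>
    ennreal (C * (\<integral>z. flux dir_a \<phi> \<psi> z \<partial>M)\<^sup>2) \<le>
    (\<integral>\<^sup>+\<theta>\<in>mis. (\<integral>\<^sup>+a\<in>frontier TJ. ennreal ((grad_a \<phi> (\<theta>, a) \<bullet> outer_normal UNIV TJ a - 0)\<^sup>2) \<partial>hausdorff1) \<partial>plane_measure)"
proof (rule green_C2[OF TJ(1,2,4)])
  fix \<epsilon> :: real
  assume e: "\<epsilon> > 0" "\<And>T \<kappa> k G G'. piecewise_C1 T \<kappa> k \<Longrightarrow> C1_field G G' \<Longrightarrow> (\<And>z. z \<in> frontier TJ \<Longrightarrow> \<bar>\<kappa> z\<bar> \<le> 1) \<Longrightarrow>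
       ennreal (\<epsilon> * (\<integral>z. indicator TJ z * (\<kappa> z * dvg G' z + k z \<bullet> G z) \<partial>lborel)\<^sup>2) \<le>
       (\<integral>\<^sup>+z\<in>frontier TJ. ennreal ((G z \<bullet> outer_normal UNIV TJ z)\<^sup>2) \<partial>hausdorff1)"
  obtain B where B: "B > 0" "\<And>z. z \<in> closure mis \<times> closure TJ \<Longrightarrow> \<bar>w z * \<psi> z\<bar> \<le> B"
    using closure_bound[OF smooth_continuous[OF \<psi>]] by blast
  define m where "m = measure plane_measure mis + 1"
  have m: "emeasure plane_measure mis \<le> ennreal m" "m > 0"
    using emeasure_plane_bounded[OF bounded_mis]
    by (auto simp: m_def emeasure_eq_ennreal_measure less_top add_nonneg_pos intro!: ennreal_leI)
  define q where "q = sqrt \<epsilon> / B"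
  have q: "q > 0" using B(1) e(1) by (simp add: q_def)
  show ?thesis
  proof (rule that)
    show "q\<^sup>2 / m > 0" using m q by simp
    fix \<phi> :: "state \<Rightarrow> real" assume \<phi>: "smooth_on UNIV \<phi>"
    define I where "I \<theta> = (\<integral>a. indicator TJ a * (w (\<theta>, a) * flux dir_a \<phi> \<psi> (\<theta>, a)) \<partial>lborel)" for \<theta>
    note i = flux_integrable[OF \<phi> \<psi>, of dir_a]
    have R: "(\<integral>z. flux dir_a \<phi> \<psi> z \<partial>M) = (\<integral>\<theta>. indicator mis \<theta> * I \<theta> \<partial>plane_measure)"
      unfolding I_def using integral_vol_fubini(1)[OF TJ(1) i(2)]
      by (subst integral_M) (auto intro!: borel_measurable_vol_subset TJ flux_meas \<phi> \<psi>)
    have iI: "integrable plane_measure (\<lambda>\<theta>. indicator mis \<theta> * I \<theta>)"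
      unfolding I_def using integral_vol_fubini(3)[OF TJ(1) i(2)] .
    have bd: "ennreal ((q * I \<theta>)\<^sup>2) \<le> (\<integral>\<^sup>+a\<in>frontier TJ. ennreal ((grad_a \<phi> (\<theta>, a) \<bullet> outer_normal UNIV TJ a - 0)\<^sup>2) \<partial>hausdorff1)"
      if \<theta>: "\<theta> \<in> mis" for \<theta>
    proof -
      define \<kappa> where "\<kappa> a = (1 / B) * (w (\<theta>, a) * \<psi> (\<theta>, a))" for a
      \<comment> \<open>Off \<open>range x\<close> this is the gradient of \<open>\<kappa>\<close>
        in \<open>a\<close>; the value zero on \<open>range x\<close> is the convention of
        \<open>piecewise_C1\<close>.\<close>
      define k where "k a = (if a \<in> range x then 0 else (\<chi> i. (1 / B) * (w (\<theta>, a) * (ddir (dir_a i) \<psi> (\<theta>, a) - \<psi> (\<theta>, a) * gE (dir_a i) (\<theta>, a) / D))))" for a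
      define G where "G a = grad_a \<phi> (\<theta>, a)" for a
      define G' where "G' a h = (\<chi> i. ddir (0, h) (ddir (dir_a i) \<phi>) (\<theta>, a))" for a h
      have slice: "((\<lambda>a. f (\<theta>, a)) has_derivative (\<lambda>h. f' (0, h))) (at a)" if "(f has_derivative f') (at (\<theta>, a))" for f :: "state \<Rightarrow> real" and f' a
        by (rule has_derivative_compose[of "\<lambda>a. (\<theta>, a)" "\<lambda>h. (0, h)" a UNIV f f'])
          (use that in \<open>auto intro!: derivative_eq_intros\<close>)
      have sc: "continuous_on UNIV (\<lambda>a. f (\<theta>, a))" if "continuous_on UNIV f" for f :: "state \<Rightarrow> real"
        by (intro continuous_on_compose2[OF that] continuous_intros) auto
      have fin: "finite (range x)" by simp
      have "ennreal (\<epsilon> * (\<integral>z. indicator TJ z * (\<kappa> z * dvg G' z + k z \<bullet> G z) \<partial>lborel)\<^sup>2) \<le>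
         (\<integral>\<^sup>+z\<in>frontier TJ. ennreal ((G z \<bullet> outer_normal UNIV TJ z)\<^sup>2) \<partial>hausdorff1)"
      proof (rule e(2))
        show "C1_field G G'"
          unfolding C1_field_def
        proof (intro conjI allI)
          have Gk: "G = (\<lambda>a. \<chi> i. ddir (dir_a i) \<phi> (\<theta>, a))" by (simp add: G_def fun_eq_iff vec_eq_iff grad_a_nth)
          show "(G has_derivative G' a) (at a)" for a
            unfolding Gk G'_def by (intro has_derivative_vec slice smooth_has_derivative smooth_ddir \<phi>)
          show "continuous_on UNIV (\<lambda>a. G' a v)" for v
            unfolding G'_def by (intro continuous_on_vec_lambda sc[OF smooth_continuous[OF smooth_ddir[OF smooth_ddir[OF \<phi>]]]])
        qed
        show "\<bar>\<kappa> a\<bar> \<le> 1" if "a \<in> frontier TJ" for a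
        proof -
          have "(\<theta>, a) \<in> closure mis \<times> closure TJ" using that \<theta> closure_subset by (auto simp: frontier_def)
          from B(2)[OF this] show ?thesis using B(1) by (simp add: \<kappa>_def abs_mult)
        qed
        show "piecewise_C1 (range x) \<kappa> k"
          unfolding piecewise_C1_def
        proof (intro conjI allI ballI impI)
          show "continuous_on UNIV \<kappa>"
            unfolding \<kappa>_def by (intro continuous_intros sc[OF w_cont] sc[OF smooth_continuous[OF \<psi>]])
          show "(\<kappa> has_derivative (\<lambda>h. k a \<bullet> h)) (at a)" if a: "a \<notin> range x" for a
          proof -
            have "((\<lambda>z. (1 / B) * (w z * \<psi> z)) has_derivative
                (\<lambda>v. (1 / B) * (w (\<theta>, a) * ddir v \<psi> (\<theta>, a) + (- (w (\<theta>, a) * gE v (\<theta>, a) / D)) * \<psi> (\<theta>, a)))) (at (\<theta>, a))"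
              by (intro has_derivative_mult_right has_derivative_mult w_deriv smooth_has_derivative \<psi>) (use a in simp)
            from slice[OF this]
            have d: "(\<kappa> has_derivative (\<lambda>h. (1 / B) * (w (\<theta>, a) * ddir (0, h) \<psi> (\<theta>, a) + (- (w (\<theta>, a) * gE (0, h) (\<theta>, a) / D)) * \<psi> (\<theta>, a)))) (at a)"
              unfolding \<kappa>_def[abs_def] .
            show ?thesis
            proof (rule has_derivative_eq_rhs[OF d], rule ext)
              fix h :: "real^2"
              have h: "(0, h) = h$1 *\<^sub>R dir_a 1 + h$2 *\<^sub>R dir_a 2"
                by (simp add: dir_a_def prod_eq_iff vec_eq_iff forall_2 axis_def)
              have l1: "ddir (0, h) \<psi> (\<theta>, a) = h$1 * ddir (dir_a 1) \<psi> (\<theta>, a) + h$2 * ddir (dir_a 2) \<psi> (\<theta>, a)"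
                unfolding h using ddir_linear[OF \<psi>, of "(\<theta>, a)"] by (simp add: linear_add linear_cmul)
              have l2: "gE (0, h) (\<theta>, a) = h$1 * gE (dir_a 1) (\<theta>, a) + h$2 * gE (dir_a 2) (\<theta>, a)"
                unfolding h
                by (simp only: linear_add[OF gE_linear[of "(\<theta>, a)"]] linear_cmul[OF gE_linear[of "(\<theta>, a)"]] real_scaleR_def)
              show "(1 / B) * (w (\<theta>, a) * ddir (0, h) \<psi> (\<theta>, a) + (- (w (\<theta>, a) * gE (0, h) (\<theta>, a) / D)) * \<psi> (\<theta>, a)) = k a \<bullet> h"
                unfolding l1 l2 using a B(1) pos by (simp add: k_def inner_vec_def sum_2 field_simps)
            qed
          qed
          have gm: "(\<lambda>a. gE v (\<theta>, a)) \<in> borel_measurable borel" for v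
            using measurable_compose[OF _ gE_meas, of "\<lambda>a. (\<theta>, a)" borel v] by simp
          have cm: "(\<lambda>a. f (\<theta>, a)) \<in> borel_measurable borel" if "continuous_on UNIV f" for f :: "state \<Rightarrow> real"
            by (rule borel_measurable_continuous_onI[OF sc[OF that]])
          note [measurable] = gm cm[OF w_cont] cm[OF smooth_continuous[OF \<psi>]] cm[OF smooth_continuous[OF smooth_ddir[OF \<psi>]]]
          have [measurable]: "range x \<in> sets borel" using borel_closed[OF finite_imp_closed[OF fin]] .
          have "(\<lambda>a. \<chi> i. (1 / B) * (w (\<theta>, a) * (ddir (dir_a i) \<psi> (\<theta>, a) - \<psi> (\<theta>, a) * gE (dir_a i) (\<theta>, a) / D))) \<in> borel_measurable borel"
          proof (rule borel_measurable_vec_lambda)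
          qed measurable
          then show "k \<in> borel_measurable borel" unfolding k_def by measurable
          fix R :: real
          \<comment> \<open>\<open>k\<close> may jump at the points \<open>x j\<close>; a continuous
            majorant, with \<open>gE\<close> replaced by the sum of the absolute values of
            \<open>\<sigma> (\<theta> $ j)\<close>, supplies its local bound.\<close>
          define F where "F a = (\<Sum>i\<in>UNIV. \<bar>1 / B\<bar> * (\<bar>w (\<theta>, a)\<bar> * (\<bar>ddir (dir_a i) \<psi> (\<theta>, a)\<bar> + \<bar>\<psi> (\<theta>, a) / D\<bar> * (\<Sum>j\<in>UNIV. \<bar>\<sigma> (\<theta> $ j)\<bar>))))" for a
          have "continuous_on UNIV F" unfolding F_def using pos
            by (intro continuous_intros sc[OF w_cont] sc[OF smooth_continuous[OF \<psi>]] sc[OF smooth_continuous[OF smooth_ddir[OF \<psi>]]]) auto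
          then have "bounded (F ` cball 0 R)"
            by (blast intro: compact_imp_bounded[OF compact_continuous_image[OF continuous_on_subset[OF _ subset_UNIV] compact_cball]])
          then obtain A where A: "\<And>a. a \<in> cball 0 R \<Longrightarrow> \<bar>F a\<bar> \<le> A" unfolding bounded_iff by (metis imageI real_norm_def)
          have gb: "\<bar>gE (dir_a i) (\<theta>, a)\<bar> \<le> (\<Sum>j\<in>UNIV. \<bar>\<sigma> (\<theta> $ j)\<bar>)" for i a
            unfolding gE_def
          proof (rule order_trans[OF sum_abs], rule sum_mono)
            fix j
            have "\<bar>sgn (a - x j) \<bullet> axis i 1\<bar> \<le> norm (sgn (a - x j)) * norm (axis i (1::real))" by (rule Cauchy_Schwarz_ineq2)
            also have "\<dots> \<le> 1" by (simp add: norm_sgn norm_axis_1)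
            finally show "\<bar>\<sigma>' (fst (\<theta>, a) $ j) * (fst (dir_a i) $ j) * norm (snd (\<theta>, a) - x j) + \<sigma> (fst (\<theta>, a) $ j) * (sgn (snd (\<theta>, a) - x j) \<bullet> snd (dir_a i))\<bar> \<le> \<bar>\<sigma> (\<theta> $ j)\<bar>"
              by (simp add: dir_a_def abs_mult mult_left_le)
          qed
          have kF: "norm (k a) \<le> F a" for a
          proof (cases "a \<in> range x")
            case True
            then show ?thesis by (auto simp: k_def F_def intro!: sum_nonneg mult_nonneg_nonneg add_nonneg_nonneg)
          next
            case False
            have "norm (k a) \<le> (\<Sum>i\<in>UNIV. \<bar>k a $ i\<bar>)" by (rule norm_le_l1_cart)
            also have "\<dots> \<le> F a" unfolding F_def
            proof (rule sum_mono)
              fix i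
              have "\<bar>ddir (dir_a i) \<psi> (\<theta>, a) - \<psi> (\<theta>, a) * gE (dir_a i) (\<theta>, a) / D\<bar> \<le>
                \<bar>ddir (dir_a i) \<psi> (\<theta>, a)\<bar> + \<bar>\<psi> (\<theta>, a) / D\<bar> * \<bar>gE (dir_a i) (\<theta>, a)\<bar>"
                using abs_triangle_ineq4[of "ddir (dir_a i) \<psi> (\<theta>, a)" "\<psi> (\<theta>, a) * gE (dir_a i) (\<theta>, a) / D"] by (simp add: abs_mult)
              also have "\<dots> \<le> \<bar>ddir (dir_a i) \<psi> (\<theta>, a)\<bar> + \<bar>\<psi> (\<theta>, a) / D\<bar> * (\<Sum>j\<in>UNIV. \<bar>\<sigma> (\<theta> $ j)\<bar>)"
                by (intro add_left_mono mult_left_mono gb) simp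
              finally show "\<bar>k a $ i\<bar> \<le> \<bar>1 / B\<bar> * (\<bar>w (\<theta>, a)\<bar> * (\<bar>ddir (dir_a i) \<psi> (\<theta>, a)\<bar> + \<bar>\<psi> (\<theta>, a) / D\<bar> * (\<Sum>j\<in>UNIV. \<bar>\<sigma> (\<theta> $ j)\<bar>)))"
                using False unfolding k_def by (simp only: if_False vec_lambda_beta abs_mult) (intro mult_left_mono; simp)
            qed
            finally show ?thesis .
          qed
          have "norm (k a) \<le> A" if "a \<in> cball 0 R" for a
            by (rule order_trans[OF kF order_trans[OF abs_ge_self A[OF that]]])
          then show "\<exists>A. \<forall>a\<in>cball 0 R. norm (k a) \<le> A" by blast
        qed (simp_all add: k_def)
      qed
      moreover have "(\<integral>a. indicator TJ a * (\<kappa> a * dvg G' a + k a \<bullet> G a) \<partial>lborel) = I \<theta> / B"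
      proof -
        have "(\<integral>a. indicator TJ a * (\<kappa> a * dvg G' a + k a \<bullet> G a) \<partial>lborel) = (\<integral>a. indicator TJ a * ((w (\<theta>, a) * flux dir_a \<phi> \<psi> (\<theta>, a)) / B) \<partial>lborel)"
        \<comment> \<open>At the points \<open>x j\<close> the convention \<open>k = 0\<close>
          breaks the identity with the flux, but these points form a null set.\<close>
        proof (rule integral_cong_AE)
          have "AE a in lborel. a \<notin> range x" by (rule AE_not_in[OF finite_imp_null_set_lborel[OF fin]])
          then show "AE a in lborel. indicator TJ a * (\<kappa> a * dvg G' a + k a \<bullet> G a) = indicator TJ a * ((w (\<theta>, a) * flux dir_a \<phi> \<psi> (\<theta>, a)) / B)"
          proof eventually_elim
            case (elim a)
            have "\<kappa> a * dvg G' a + k a \<bullet> G a = (w (\<theta>, a) * flux dir_a \<phi> \<psi> (\<theta>, a)) / B"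
              using elim unfolding flux_def dvg_def \<kappa>_def k_def G'_def G_def
              by (simp add: inner_vec_def sum_2 grad_a_nth distrib_left add_divide_distrib mult_ac dir_a_def)
            then show ?case by simp
          qed
          have pm: "(\<lambda>a. (\<theta>, a)) \<in> borel_measurable borel" by (intro borel_measurable_continuous_onI continuous_intros)
          have fm: "(\<lambda>a. flux dir_a \<phi> \<psi> (\<theta>, a)) \<in> borel_measurable borel"
            using measurable_compose[OF pm flux_meas[OF \<phi> \<psi>]] .
          have wm: "(\<lambda>a. w (\<theta>, a)) \<in> borel_measurable borel" by (rule borel_measurable_continuous_onI[OF sc[OF w_cont]])
          show "(\<lambda>a. indicator TJ a * ((w (\<theta>, a) * flux dir_a \<phi> \<psi> (\<theta>, a)) / B)) \<in> borel_measurable lborel"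
            using fm wm TJ(1) by simp
          have gm: "(\<lambda>a. gE v (\<theta>, a)) \<in> borel_measurable borel" for v
            using measurable_compose[OF pm gE_meas] .
          have cm: "(\<lambda>a. f (\<theta>, a)) \<in> borel_measurable borel" if "continuous_on UNIV f" for f :: "state \<Rightarrow> real"
            by (rule borel_measurable_continuous_onI[OF sc[OF that]])
          note [measurable] = gm cm[OF w_cont] cm[OF smooth_continuous[OF \<psi>]] cm[OF smooth_continuous[OF smooth_ddir[OF \<psi>]]]
             cm[OF smooth_continuous[OF smooth_ddir[OF \<phi>]]] cm[OF smooth_continuous[OF smooth_ddir[OF smooth_ddir[OF \<phi>]]]]
          have [measurable]: "range x \<in> sets borel" "TJ \<in> sets borel" using borel_closed[OF finite_imp_closed[OF fin]] TJ(1) by auto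
          have "k a \<bullet> G a = (if a \<in> range x then 0 else (\<Sum>i\<in>UNIV. (1 / B) * (w (\<theta>, a) * (ddir (dir_a i) \<psi> (\<theta>, a) - \<psi> (\<theta>, a) * gE (dir_a i) (\<theta>, a) / D)) * ddir (dir_a i) \<phi> (\<theta>, a)))" for a
            by (simp add: k_def G_def inner_vec_def grad_a_nth)
          then show "(\<lambda>a. indicator TJ a * (\<kappa> a * dvg G' a + k a \<bullet> G a)) \<in> borel_measurable lborel"
            by (simp add: \<kappa>_def dvg_def G'_def)
        qed
        then show ?thesis by (simp add: I_def)
      qed
      moreover have "\<epsilon> * (I \<theta> / B)\<^sup>2 = (q * I \<theta>)\<^sup>2" using e(1) by (simp add: power_divide q_def power_mult_distrib)
      ultimately show ?thesis by (simp add: G_def)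
    qed
    have "ennreal (q\<^sup>2 / m * (\<integral>z. flux dir_a \<phi> \<psi> z \<partial>M)\<^sup>2) = ennreal ((\<integral>\<theta>. indicator mis \<theta> * (q * I \<theta>) \<partial>plane_measure)\<^sup>2 / m)"
      unfolding R by (simp add: power_mult_distrib mult.left_commute[of _ q])
    also have "\<dots> \<le> (\<integral>\<^sup>+\<theta>\<in>mis. ennreal ((q * I \<theta>)\<^sup>2) \<partial>plane_measure)"
      by (rule nn_integral_square_ge) (use m iI in \<open>auto simp: mult.left_commute[of _ q]\<close>)
    also have "\<dots> \<le> (\<integral>\<^sup>+\<theta>\<in>mis. (\<integral>\<^sup>+a\<in>frontier TJ. ennreal ((grad_a \<phi> (\<theta>, a) \<bullet> outer_normal UNIV TJ a - 0)\<^sup>2) \<partial>hausdorff1) \<partial>plane_measure)"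
      by (rule nn_integral_mono) (use bd in \<open>auto simp: indicator_def\<close>)
    finally show "ennreal (q\<^sup>2 / m * (\<integral>z. flux dir_a \<phi> \<psi> z \<partial>M)\<^sup>2) \<le>
      (\<integral>\<^sup>+\<theta>\<in>mis. (\<integral>\<^sup>+a\<in>frontier TJ. ennreal ((grad_a \<phi> (\<theta>, a) \<bullet> outer_normal UNIV TJ a - 0)\<^sup>2) \<partial>hausdorff1) \<partial>plane_measure)" .
  qed
qed

end

section \<open>Dissipativity of the generator and decay\<close>

text \<open>Passes from bounds in \<open>ennreal\<close>, where the boundary integrals may be
  infinite, to convergence of real fluxes.\<close>

lemma tendsto_zero_if_square_le:
  fixes r :: "nat \<Rightarrow> real" and b :: "nat \<Rightarrow> ennreal"
  assumes C: "C > 0" and le: "\<And>n. ennreal (C * (r n)\<^sup>2) \<le> b n" and b: "b \<longlonglongrightarrow> 0"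
  shows "r \<longlonglongrightarrow> 0"
proof -
  have "(\<lambda>n. ennreal (C * (r n)\<^sup>2)) \<longlonglongrightarrow> 0"
    by (rule tendsto_sandwich[OF _ _ tendsto_const b]) (use le in auto)
  then have "(\<lambda>n. C * (r n)\<^sup>2) \<longlonglongrightarrow> 0"
    using C by (subst (asm) ennreal_tendsto_0_iff) auto
  then have "(\<lambda>n. C * (r n)\<^sup>2 / C) \<longlonglongrightarrow> 0 / C" using C by (intro tendsto_divide tendsto_const) auto
  then have "(\<lambda>n. sqrt ((r n)\<^sup>2)) \<longlonglongrightarrow> sqrt 0" using C by (intro tendsto_real_sqrt) simp
  then show ?thesis by (simp add: tendsto_rabs_zero_iff)
qed

context fokker_planck
begin

text \<open>Multiplication by \<open>w\<close> is an isometry from \<open>L2 M\<close> to the space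
  with weight \<open>exp (E / D)\<close>, since \<open>exp (E z / D) * w z = 1\<close>.
  \<open>F\<close> is prescribed on \<open>mis \<times> TJ\<close> only, just as
  \<open>associated_solution\<close> prescribes \<open>f\<close>.\<close>

lemma weight_L2:
  assumes k: "k \<in> L2 M" and F: "\<And>z. z \<in> mis \<times> TJ \<Longrightarrow> F z = k z * w z"
  shows "F \<in> L2 (expvol TJ (\<lambda>z. E z / D))" "L2norm (expvol TJ (\<lambda>z. E z / D)) F = L2norm M k"
    and "(\<integral>z. (F z)\<^sup>2 * exp (E z / D) \<partial>vol TJ) = (\<integral>z. (k z)\<^sup>2 \<partial>M)"
proof -
  let ?M' = "expvol TJ (\<lambda>z. E z / D)"
  have km: "k \<in> borel_measurable (vol TJ)" and ki: "integrable M (\<lambda>z. (k z)\<^sup>2)" using k by (auto simp: L2_def measurable_M)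
  have kw: "(\<lambda>z. k z * w z) \<in> borel_measurable (vol TJ)" using km w_meas by simp
  have Fm: "F \<in> borel_measurable (vol TJ)"
    using measurable_cong[of "vol TJ" F "\<lambda>z. k z * w z" borel] F kw by (simp add: space_vol)
  have Em: "(\<lambda>z. exp (E z / D)) \<in> borel_measurable (vol TJ)"
    using pos by (intro continuous_measurable_vol TJ continuous_intros E_cont) auto
  have dens: "?M' = density (vol TJ) (\<lambda>z. ennreal (exp (E z / D)))" by (simp add: expvol_def)
  have ew: "exp (E z / D) * w z = 1" for z by (simp add: w_def W_def flip: exp_add)
  have e: "exp (E z / D) * (F z)\<^sup>2 = w z * (k z)\<^sup>2" if "z \<in> mis \<times> TJ" for z
  proof -
    have "exp (E z / D) * (F z)\<^sup>2 = (exp (E z / D) * w z) * (w z * (k z)\<^sup>2)"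
      by (simp add: F[OF that] power2_eq_square)
    then show ?thesis by (simp add: ew)
  qed
  have k2: "(\<lambda>z. (k z)\<^sup>2) \<in> borel_measurable (vol TJ)" and F2: "(\<lambda>z. (F z)\<^sup>2) \<in> borel_measurable (vol TJ)" using km Fm by auto
  have "integrable (vol TJ) (\<lambda>z. w z * (k z)\<^sup>2)" using ki integrable_M[OF k2] by simp
  then have "integrable (vol TJ) (\<lambda>z. exp (E z / D) * (F z)\<^sup>2)"
    using Bochner_Integration.integrable_cong[of "vol TJ" "vol TJ" "\<lambda>z. exp (E z / D) * (F z)\<^sup>2" "\<lambda>z. w z * (k z)\<^sup>2"] e by (simp add: space_vol)
  then have "integrable ?M' (\<lambda>z. (F z)\<^sup>2)"
    unfolding dens using F2 Em by (subst integrable_density) auto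
  then show "F \<in> L2 ?M'" using Fm by (simp add: L2_def cong: measurable_cong_sets)
  have int: "(\<integral>z. exp (E z / D) * (F z)\<^sup>2 \<partial>vol TJ) = (\<integral>z. (k z)\<^sup>2 \<partial>M)"
    unfolding integral_M[OF k2] by (rule Bochner_Integration.integral_cong) (use e in \<open>auto simp: space_vol\<close>)
  then show "(\<integral>z. (F z)\<^sup>2 * exp (E z / D) \<partial>vol TJ) = (\<integral>z. (k z)\<^sup>2 \<partial>M)" by (simp add: mult.commute)
  have "(\<integral>z. (F z)\<^sup>2 \<partial>?M') = (\<integral>z. exp (E z / D) * (F z)\<^sup>2 \<partial>vol TJ)"
    unfolding dens using F2 Em by (subst integral_density) auto
  then show "L2norm ?M' F = L2norm M k" using int by (simp add: L2norm_def)
qed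

text \<open>Off the null set of the points \<open>x j\<close> the classical gradient of
  \<open>E\<close> has the components \<open>gE\<close>; the scalar products in
  \<open>generator\<close> then become sums over directions that match the fluxes.\<close>

lemma generator_AE:
  "AE z in vol TJ. generator \<gamma> \<eta> D E TJ g z =
     3 * \<gamma> * (\<Sum>k\<in>UNIV. D * weak_deriv TJ (dir_th k) (weak_deriv TJ (dir_th k) g) z - gE (dir_th k) z * weak_deriv TJ (dir_th k) g z)
     + \<eta> * (\<Sum>i\<in>UNIV. D * weak_deriv TJ (dir_a i) (weak_deriv TJ (dir_a i) g) z - gE (dir_a i) z * weak_deriv TJ (dir_a i) g z)"
  using AE_regular
proof eventually_elim
  case (elim z)
  have dE: "ddir v E z = gE v z" for v by (rule ddir_eq[OF E_deriv[OF elim]])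
  have th: "grad_th E z $ k = gE (dir_th k) z" for k
    using grad_th_nth_linear[of E z k] gE_linear[of z] by (simp add: dE)
  have a: "grad_a E z $ i = gE (dir_a i) z" for i by (simp add: grad_a_nth dE)
  show ?case
    unfolding generator_def wlap_th_def wlap_a_def wgrad_th_def wgrad_a_def inner_vec_def
    by (simp add: th a sum_subtractf sum_distrib_left algebra_simps)
qed

text \<open>The integrated flux depends continuously in \<open>L2\<close> on the first and second
  derivatives of \<open>\<phi>\<close>; \<open>G\<close> and \<open>H\<close> are going to be the
  weak derivatives of a function in \<open>H2\<close>.\<close>

lemma flux_tendsto:
  fixes v :: "'k::finite \<Rightarrow> state"
  assumes \<phi>: "\<And>n. smooth_on UNIV (\<phi> n)" and \<psi>: "smooth_on UNIV \<psi>"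
    and G: "\<And>k. G k \<in> L2 M" "\<And>k. (\<lambda>n. L2norm M (\<lambda>z. ddir (v k) (\<phi> n) z - G k z)) \<longlonglongrightarrow> 0"
    and H: "\<And>k. H k \<in> L2 M" "\<And>k. (\<lambda>n. L2norm M (\<lambda>z. ddir (v k) (ddir (v k) (\<phi> n)) z - H k z)) \<longlonglongrightarrow> 0"
  shows "(\<lambda>n. \<integral>z. flux v (\<phi> n) \<psi> z \<partial>M) \<longlonglongrightarrow>
     (\<Sum>k\<in>UNIV. (\<integral>z. \<psi> z * H k z \<partial>M) + (\<integral>z. G k z * (ddir (v k) \<psi> z - \<psi> z * gE (v k) z / D) \<partial>M))"
proof -
  have p: "(\<lambda>z. ddir (v k) \<psi> z - \<psi> z * gE (v k) z / D) \<in> L2 M" for k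
    using L2_diff[OF smooth_L2[OF smooth_ddir[OF \<psi>]] L2_cmult[OF gE_times_L2[OF smooth_continuous[OF \<psi>]], of "1 / D"]] by simp
  have "(\<integral>z. flux v (\<phi> n) \<psi> z \<partial>M) = (\<Sum>k\<in>UNIV. (\<integral>z. \<psi> z * ddir (v k) (ddir (v k) (\<phi> n)) z \<partial>M) +
      (\<integral>z. ddir (v k) (\<phi> n) z * (ddir (v k) \<psi> z - \<psi> z * gE (v k) z / D) \<partial>M))" for n
  proof -
    have "integrable M (\<lambda>z. \<psi> z * ddir (v k) (ddir (v k) (\<phi> n)) z)"
      "integrable M (\<lambda>z. ddir (v k) (\<phi> n) z * (ddir (v k) \<psi> z - \<psi> z * gE (v k) z / D))" for k
      by (intro L2_mult_integrable smooth_L2 smooth_ddir \<phi> \<psi> p)+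
    then show ?thesis unfolding flux_def by (simp add: sum_distrib_left sum.distrib)
  qed
  moreover have "(\<lambda>n. \<Sum>k\<in>UNIV. (\<integral>z. \<psi> z * ddir (v k) (ddir (v k) (\<phi> n)) z \<partial>M) +
      (\<integral>z. ddir (v k) (\<phi> n) z * (ddir (v k) \<psi> z - \<psi> z * gE (v k) z / D) \<partial>M)) \<longlonglongrightarrow>
     (\<Sum>k\<in>UNIV. (\<integral>z. \<psi> z * H k z \<partial>M) + (\<integral>z. G k z * (ddir (v k) \<psi> z - \<psi> z * gE (v k) z / D) \<partial>M))"
    by (intro tendsto_sum tendsto_add L2_inner_tendsto)
      (use G H p smooth_L2[OF \<psi>] smooth_L2[OF smooth_ddir[OF \<phi>]] smooth_L2[OF smooth_ddir[OF smooth_ddir[OF \<phi>]]] in \<open>auto simp: L2norm_def\<close>)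
  ultimately show ?thesis by simp
qed

lemma smooth_approximation:
  assumes g: "g \<in> H2 M TJ" and \<phi>: "\<And>n. smooth_on UNIV (\<phi> n)" and lim: "(\<lambda>n. H2norm M TJ (\<lambda>z. \<phi> n z - g z)) \<longlonglongrightarrow> 0"
  shows "(\<lambda>n. L2norm M (\<lambda>z. \<phi> n z - g z)) \<longlonglongrightarrow> 0"
    and "v \<in> dirs \<Longrightarrow> (\<lambda>n. L2norm M (\<lambda>z. ddir v (\<phi> n) z - weak_deriv TJ v g z)) \<longlonglongrightarrow> 0"
    and "v \<in> dirs \<Longrightarrow> (\<lambda>n. L2norm M (\<lambda>z. ddir v (ddir v (\<phi> n)) z - weak_deriv TJ v (weak_deriv TJ v g) z)) \<longlonglongrightarrow> 0"
proof -
  note n = H2norm_smooth_diff[OF TJ(1,2) W_meas g[unfolded M_def] \<phi>, folded M_def]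
  have *: "f \<longlonglongrightarrow> 0" if "\<And>n. 0 \<le> f n" "\<And>n. f n \<le> H2norm M TJ (\<lambda>z. \<phi> n z - g z)" for f
    by (rule tendsto_sandwich[OF _ _ tendsto_const lim]) (use that in auto)
  show "(\<lambda>n. L2norm M (\<lambda>z. \<phi> n z - g z)) \<longlonglongrightarrow> 0" by (intro * L2norm_nonneg n)
  show "(\<lambda>n. L2norm M (\<lambda>z. ddir v (\<phi> n) z - weak_deriv TJ v g z)) \<longlonglongrightarrow> 0" if "v \<in> dirs"
    by (intro * L2norm_nonneg n that)
  show "(\<lambda>n. L2norm M (\<lambda>z. ddir v (ddir v (\<phi> n)) z - weak_deriv TJ v (weak_deriv TJ v g) z)) \<longlonglongrightarrow> 0" if "v \<in> dirs"
    by (intro * L2norm_nonneg n that)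
qed

lemma H2_L2:
  assumes g: "g \<in> H2 M TJ"
  shows "g \<in> L2 M" "v \<in> dirs \<Longrightarrow> weak_deriv TJ v g \<in> L2 M"
    "v \<in> dirs \<Longrightarrow> weak_deriv TJ v (weak_deriv TJ v g) \<in> L2 M"
  using g H2_weak_derivs[OF TJ(1) W_meas g[unfolded M_def], folded M_def] by (auto simp: H2_def)

text \<open>The flux of the approximants tends to zero by the boundary estimate and to the left-hand
  side by \<open>L2\<close> convergence. Each identity uses the sequence that its own trace
  condition provides.\<close>

lemma flux_balance:
  assumes g: "g \<in> generator_dom M TJ" and \<psi>: "smooth_on UNIV \<psi>"
  shows "(\<Sum>k\<in>UNIV. (\<integral>z. \<psi> z * weak_deriv TJ (dir_th k) (weak_deriv TJ (dir_th k) g) z \<partial>M)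
      + (\<integral>z. weak_deriv TJ (dir_th k) g z * (ddir (dir_th k) \<psi> z - \<psi> z * gE (dir_th k) z / D) \<partial>M)) = 0"
    and "(\<Sum>i\<in>UNIV. (\<integral>z. \<psi> z * weak_deriv TJ (dir_a i) (weak_deriv TJ (dir_a i) g) z \<partial>M)
      + (\<integral>z. weak_deriv TJ (dir_a i) g z * (ddir (dir_a i) \<psi> z - \<psi> z * gE (dir_a i) z / D) \<partial>M)) = 0"
proof -
  have gH: "g \<in> H2 M TJ" using g by (simp add: generator_dom_def)
  show "(\<Sum>k\<in>UNIV. (\<integral>z. \<psi> z * weak_deriv TJ (dir_th k) (weak_deriv TJ (dir_th k) g) z \<partial>M)
      + (\<integral>z. weak_deriv TJ (dir_th k) g z * (ddir (dir_th k) \<psi> z - \<psi> z * gE (dir_th k) z / D) \<partial>M)) = 0"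
  proof -
    obtain \<phi> where \<phi>: "\<And>n. smooth_on UNIV (\<phi> n)" "(\<lambda>n. H2norm M TJ (\<lambda>z. \<phi> n z - g z)) \<longlonglongrightarrow> 0"
      and b: "(\<lambda>n. \<integral>\<^sup>+a\<in>TJ. (\<integral>\<^sup>+\<theta>\<in>rel_frontier mis. ennreal ((grad_th (\<phi> n) (\<theta>, a) \<bullet> outer_normal mis_plane mis \<theta> - 0)\<^sup>2) \<partial>hausdorff1) \<partial>lborel) \<longlonglongrightarrow> 0"
      using g unfolding generator_dom_def has_normal_trace_th_def by auto
    obtain C where C: "C > 0" "\<And>\<phi>. smooth_on UNIV \<phi> \<Longrightarrow>
      ennreal (C * (\<integral>z. flux dir_th \<phi> \<psi> z \<partial>M)\<^sup>2) \<le>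
      (\<integral>\<^sup>+a\<in>TJ. (\<integral>\<^sup>+\<theta>\<in>rel_frontier mis. ennreal ((grad_th \<phi> (\<theta>, a) \<bullet> outer_normal mis_plane mis \<theta> - 0)\<^sup>2) \<partial>hausdorff1) \<partial>lborel)"
      using flux_th_bound[OF \<psi>] by blast
    have "(\<lambda>n. \<integral>z. flux dir_th (\<phi> n) \<psi> z \<partial>M) \<longlonglongrightarrow> 0"
      by (rule tendsto_zero_if_square_le[OF C(1) C(2)[OF \<phi>(1)] b])
    moreover note flux_tendsto[of \<phi> \<psi> "\<lambda>k. weak_deriv TJ (dir_th k) g" dir_th "\<lambda>k. weak_deriv TJ (dir_th k) (weak_deriv TJ (dir_th k) g)",
        OF \<phi>(1) \<psi> H2_L2(2)[OF gH] smooth_approximation(2)[OF gH \<phi>] H2_L2(3)[OF gH] smooth_approximation(3)[OF gH \<phi>]]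
    ultimately show ?thesis using LIMSEQ_unique by simp
  qed
  show "(\<Sum>i\<in>UNIV. (\<integral>z. \<psi> z * weak_deriv TJ (dir_a i) (weak_deriv TJ (dir_a i) g) z \<partial>M)
      + (\<integral>z. weak_deriv TJ (dir_a i) g z * (ddir (dir_a i) \<psi> z - \<psi> z * gE (dir_a i) z / D) \<partial>M)) = 0"
  proof -
    obtain \<phi> where \<phi>: "\<And>n. smooth_on UNIV (\<phi> n)" "(\<lambda>n. H2norm M TJ (\<lambda>z. \<phi> n z - g z)) \<longlonglongrightarrow> 0"
      and b: "(\<lambda>n. \<integral>\<^sup>+\<theta>\<in>mis. (\<integral>\<^sup>+a\<in>frontier TJ. ennreal ((grad_a (\<phi> n) (\<theta>, a) \<bullet> outer_normal UNIV TJ a - 0)\<^sup>2) \<partial>hausdorff1) \<partial>plane_measure) \<longlonglongrightarrow> 0"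
      using g unfolding generator_dom_def has_normal_trace_a_def by auto
    obtain C where C: "C > 0" "\<And>\<phi>. smooth_on UNIV \<phi> \<Longrightarrow>
      ennreal (C * (\<integral>z. flux dir_a \<phi> \<psi> z \<partial>M)\<^sup>2) \<le>
      (\<integral>\<^sup>+\<theta>\<in>mis. (\<integral>\<^sup>+a\<in>frontier TJ. ennreal ((grad_a \<phi> (\<theta>, a) \<bullet> outer_normal UNIV TJ a - 0)\<^sup>2) \<partial>hausdorff1) \<partial>plane_measure)"
      using flux_a_bound[OF \<psi>] by blast
    have "(\<lambda>n. \<integral>z. flux dir_a (\<phi> n) \<psi> z \<partial>M) \<longlonglongrightarrow> 0"
      by (rule tendsto_zero_if_square_le[OF C(1) C(2)[OF \<phi>(1)] b])
    moreover note flux_tendsto[of \<phi> \<psi> "\<lambda>k. weak_deriv TJ (dir_a k) g" dir_a "\<lambda>k. weak_deriv TJ (dir_a k) (weak_deriv TJ (dir_a k) g)",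
        OF \<phi>(1) \<psi> H2_L2(2)[OF gH] smooth_approximation(2)[OF gH \<phi>] H2_L2(3)[OF gH] smooth_approximation(3)[OF gH \<phi>]]
    ultimately show ?thesis using LIMSEQ_unique by simp
  qed
qed

text \<open>\<open>D\<close> times a flux balance contains \<open>D H - gE G\<close>, exactly the
  summand of the generator in that direction, tested with \<open>\<psi>\<close>. What remains is the
  Dirichlet form of \<open>g\<close> and \<open>\<psi>\<close>, with the coefficients
  \<open>3 * \<gamma>\<close> and \<open>\<eta>\<close> of the two groups of directions.\<close>

lemma generator_weak_form:
  assumes g: "g \<in> generator_dom M TJ" and \<psi>: "smooth_on UNIV \<psi>"
    and L: "L \<in> borel_measurable M" "AE z in M. L z = generator \<gamma> \<eta> D E TJ g z"
  shows "(\<integral>z. \<psi> z * L z \<partial>M) =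
    - D * (3 * \<gamma> * (\<Sum>k\<in>UNIV. \<integral>z. weak_deriv TJ (dir_th k) g z * ddir (dir_th k) \<psi> z \<partial>M)
         + \<eta> * (\<Sum>i\<in>UNIV. \<integral>z. weak_deriv TJ (dir_a i) g z * ddir (dir_a i) \<psi> z \<partial>M))"
proof -
  have gH: "g \<in> H2 M TJ" using g by (simp add: generator_dom_def)
  let ?G = "\<lambda>v. weak_deriv TJ v g" and ?H = "\<lambda>v. weak_deriv TJ v (weak_deriv TJ v g)"
  note \<psi>c = smooth_continuous[OF \<psi>]
  have i1: "integrable M (\<lambda>z. \<psi> z * ?H v z)" if "v \<in> dirs" for v
    by (intro L2_mult_integrable smooth_L2 \<psi> H2_L2[OF gH] that)
  have i2: "integrable M (\<lambda>z. ?G v z * (\<psi> z * gE v z))" if "v \<in> dirs" for v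
    by (intro L2_mult_integrable gE_times_L2 \<psi>c H2_L2[OF gH] that)
  have i3: "integrable M (\<lambda>z. ?G v z * ddir v \<psi> z)" if "v \<in> dirs" for v
    by (intro L2_mult_integrable smooth_L2 smooth_ddir \<psi> H2_L2[OF gH] that)
  have i4: "integrable M (\<lambda>z. D * (\<psi> z * ?H v z) - ?G v z * (\<psi> z * gE v z))" if "v \<in> dirs" for v
    using i1[OF that] i2[OF that] by simp
  have dir: "D * ((\<integral>z. \<psi> z * ?H v z \<partial>M) + (\<integral>z. ?G v z * (ddir v \<psi> z - \<psi> z * gE v z / D) \<partial>M)) =
      (\<integral>z. D * (\<psi> z * ?H v z) - ?G v z * (\<psi> z * gE v z) \<partial>M) + D * (\<integral>z. ?G v z * ddir v \<psi> z \<partial>M)" if "v \<in> dirs" for v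
  proof -
    have "(\<integral>z. ?G v z * (ddir v \<psi> z - \<psi> z * gE v z / D) \<partial>M) = (\<integral>z. ?G v z * ddir v \<psi> z - (1 / D) * (?G v z * (\<psi> z * gE v z)) \<partial>M)"
      by (simp add: right_diff_distrib)
    also have "\<dots> = (\<integral>z. ?G v z * ddir v \<psi> z \<partial>M) - (1 / D) * (\<integral>z. ?G v z * (\<psi> z * gE v z) \<partial>M)"
      using i2[OF that] i3[OF that] by simp
    finally have e: "(\<integral>z. ?G v z * (ddir v \<psi> z - \<psi> z * gE v z / D) \<partial>M) = (\<integral>z. ?G v z * ddir v \<psi> z \<partial>M) - (1 / D) * (\<integral>z. ?G v z * (\<psi> z * gE v z) \<partial>M)" .
    have "(\<integral>z. D * (\<psi> z * ?H v z) - ?G v z * (\<psi> z * gE v z) \<partial>M) = D * (\<integral>z. \<psi> z * ?H v z \<partial>M) - (\<integral>z. ?G v z * (\<psi> z * gE v z) \<partial>M)"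
      using i1[OF that] i2[OF that] by simp
    then show ?thesis unfolding e using pos by (simp add: distrib_left right_diff_distrib)
  qed
  have th: "(\<Sum>k\<in>UNIV. \<integral>z. D * (\<psi> z * ?H (dir_th k) z) - ?G (dir_th k) z * (\<psi> z * gE (dir_th k) z) \<partial>M) =
      - D * (\<Sum>k\<in>UNIV. \<integral>z. ?G (dir_th k) z * ddir (dir_th k) \<psi> z \<partial>M)"
    using arg_cong[OF flux_balance(1)[OF g \<psi>], of "\<lambda>s. D * s"]
    unfolding sum_distrib_left dir[OF dir_in_dirs(1)] by (simp add: sum.distrib sum_negf flip: sum_distrib_left)
  have a: "(\<Sum>i\<in>UNIV. \<integral>z. D * (\<psi> z * ?H (dir_a i) z) - ?G (dir_a i) z * (\<psi> z * gE (dir_a i) z) \<partial>M) =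
      - D * (\<Sum>i\<in>UNIV. \<integral>z. ?G (dir_a i) z * ddir (dir_a i) \<psi> z \<partial>M)"
    using arg_cong[OF flux_balance(2)[OF g \<psi>], of "\<lambda>s. D * s"]
    unfolding sum_distrib_left dir[OF dir_in_dirs(2)] by (simp add: sum.distrib sum_negf flip: sum_distrib_left)
  let ?R = "\<lambda>z. 3 * \<gamma> * (\<Sum>k\<in>UNIV. D * (\<psi> z * ?H (dir_th k) z) - ?G (dir_th k) z * (\<psi> z * gE (dir_th k) z))
      + \<eta> * (\<Sum>i\<in>UNIV. D * (\<psi> z * ?H (dir_a i) z) - ?G (dir_a i) z * (\<psi> z * gE (dir_a i) z))"
  have "(\<integral>z. \<psi> z * L z \<partial>M) = (\<integral>z. ?R z \<partial>M)"
  proof (rule integral_cong_AE)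
    show "(\<lambda>z. \<psi> z * L z) \<in> borel_measurable M"
      using borel_measurable_times[OF _ L(1), of \<psi>] smooth_L2[OF \<psi>] by (simp add: L2_def)
    show "?R \<in> borel_measurable M"
      by (intro borel_measurable_add borel_measurable_times borel_measurable_const borel_measurable_sum borel_measurable_integrable i4 dir_in_dirs)
    show "AE z in M. \<psi> z * L z = ?R z"
      using L(2) generator_AE[of g, folded AE_M]
    proof eventually_elim
      case (elim z)
      show ?case unfolding elim(1) elim(2)
        by (simp add: distrib_left sum_distrib_left right_diff_distrib mult_ac)
    qed
  qed
  also have "\<dots> = 3 * \<gamma> * (\<Sum>k\<in>UNIV. \<integral>z. D * (\<psi> z * ?H (dir_th k) z) - ?G (dir_th k) z * (\<psi> z * gE (dir_th k) z) \<partial>M)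
      + \<eta> * (\<Sum>i\<in>UNIV. \<integral>z. D * (\<psi> z * ?H (dir_a i) z) - ?G (dir_a i) z * (\<psi> z * gE (dir_a i) z) \<partial>M)"
    using i4 by (simp only: Bochner_Integration.integral_add Bochner_Integration.integral_sum integral_mult_right_zero
        integrable_mult_right Bochner_Integration.integrable_sum dir_in_dirs)
  finally show ?thesis unfolding th a by (simp add: algebra_simps)
qed

lemma generator_mean_zero:
  assumes g: "g \<in> generator_dom M TJ" and L: "L \<in> borel_measurable M" "AE z in M. L z = generator \<gamma> \<eta> D E TJ g z"
  shows "(\<integral>z. L z \<partial>M) = 0"
proof -
  have "ddir v (\<lambda>_::state. 1 :: real) z = 0" for v z by (simp add: frechet_derivative_const)
  then show ?thesis using generator_weak_form[OF g smooth_const[of 1] L] by simp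
qed

text \<open>The argument is a family of derivatives, so the same expression serves the classical
  derivatives of approximants and the weak derivatives of the limit.\<close>

definition grad_energy :: "(state \<Rightarrow> state \<Rightarrow> real) \<Rightarrow> real" where
  "grad_energy G = (\<Sum>k\<in>UNIV. \<integral>z. (G (dir_th k) z)\<^sup>2 \<partial>M) + (\<Sum>i\<in>UNIV. \<integral>z. (G (dir_a i) z)\<^sup>2 \<partial>M)"

text \<open>The Poincare-Wirtinger inequality is available for smooth functions only, and the
  approximants need not have mean zero for \<open>M\<close>; the subtracted square of the mean will
  vanish in the limit. The factor \<open>ws / wi\<close> arises from passing from \<open>M\<close>
  to \<open>vol TJ\<close> on the left and back to \<open>M\<close> on the right.\<close>

lemma weighted_poincare_smooth:
  assumes \<phi>: "smooth_on UNIV \<phi>"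
  shows "(\<integral>z. (\<phi> z)\<^sup>2 \<partial>M) - (\<integral>z. \<phi> z \<partial>M)\<^sup>2 / measure M (space M) \<le> ws / wi * C\<^sub>P * grad_energy (\<lambda>v. ddir v \<phi>)"
proof -
  interpret fM: finite_measure M by (rule finite_M)
  have cint: "integrable (vol TJ) f" if c: "continuous_on UNIV f" for f :: "state \<Rightarrow> real"
  proof -
    obtain B where "\<And>z. z \<in> mis \<times> TJ \<Longrightarrow> norm (f z) \<le> B" using continuous_bounded_on_state[OF TJ(2) c] by metis
    then show ?thesis by (intro integrable_vol_bounded[of _ _ B] TJ continuous_measurable_vol c) auto
  qed
  have cM: "integrable M f" if c: "continuous_on UNIV f" for f :: "state \<Rightarrow> real"
    using cint[of "\<lambda>z. w z * f z"] integrable_M[OF continuous_measurable_vol[OF TJ(1) c]] c w_cont by (simp add: continuous_intros)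
  note c = smooth_continuous[OF \<phi>] smooth_continuous[OF smooth_ddir[OF \<phi>]]
  define m where "m = mean TJ \<phi>"
  define S where "S z = (\<Sum>k\<in>UNIV. (ddir (dir_th k) \<phi> z)\<^sup>2) + (\<Sum>i\<in>UNIV. (ddir (dir_a i) \<phi> z)\<^sup>2)" for z
  have Sc: "continuous_on UNIV S" unfolding S_def by (intro continuous_intros c)
  have S0: "S z \<ge> 0" for z unfolding S_def by (intro add_nonneg_nonneg sum_nonneg) auto
  have mc: "continuous_on UNIV (\<lambda>z. (\<phi> z - m)\<^sup>2)" by (intro continuous_intros c)
  have "(\<integral>\<^sup>+z. ennreal ((\<phi> z - mean TJ \<phi>)\<^sup>2) \<partial>vol TJ) \<le> ennreal C\<^sub>P * (\<integral>\<^sup>+z. ennreal ((norm (grad_th \<phi> z))\<^sup>2 + (norm (grad_a \<phi> z))\<^sup>2) \<partial>vol TJ)"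
    using pw[unfolded poincare_wirtinger_def, rule_format, of UNIV \<phi>] \<phi> cint[OF c(1)] by simp
  also have "(\<lambda>z. (norm (grad_th \<phi> z))\<^sup>2 + (norm (grad_a \<phi> z))\<^sup>2) = S"
    by (simp add: fun_eq_iff S_def power2_norm_eq_inner inner_vec_def grad_th_nth[OF \<phi>] grad_a_nth) (simp add: power2_eq_square)
  finally have "(\<integral>\<^sup>+z. ennreal ((\<phi> z - m)\<^sup>2) \<partial>vol TJ) \<le> ennreal C\<^sub>P * (\<integral>\<^sup>+z. ennreal (S z) \<partial>vol TJ)"
    by (simp add: m_def)
  then have "ennreal (\<integral>z. (\<phi> z - m)\<^sup>2 \<partial>vol TJ) \<le> ennreal C\<^sub>P * ennreal (\<integral>z. S z \<partial>vol TJ)"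
    using S0 by (subst (asm) (1 2) nn_integral_eq_integral) (auto intro: cint mc Sc)
  then have "ennreal (\<integral>z. (\<phi> z - m)\<^sup>2 \<partial>vol TJ) \<le> ennreal (C\<^sub>P * (\<integral>z. S z \<partial>vol TJ))"
    using pos by (simp add: ennreal_mult' less_imp_le)
  then have P: "(\<integral>z. (\<phi> z - m)\<^sup>2 \<partial>vol TJ) \<le> C\<^sub>P * (\<integral>z. S z \<partial>vol TJ)"
    using S0 pos by (subst (asm) ennreal_le_iff) (auto intro!: mult_nonneg_nonneg integral_nonneg_AE)
  have "(\<integral>z. (\<phi> z - m)\<^sup>2 \<partial>M) = (\<integral>z. w z * (\<phi> z - m)\<^sup>2 \<partial>vol TJ)"
    by (intro integral_M continuous_measurable_vol TJ mc)
  also have "\<dots> \<le> (\<integral>z. ws * (\<phi> z - m)\<^sup>2 \<partial>vol TJ)"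
    by (intro integral_mono cint continuous_intros w_cont mc) (auto simp: space_vol intro!: mult_right_mono w_bounds)
  also have "\<dots> \<le> ws * (C\<^sub>P * (\<integral>z. S z \<partial>vol TJ))"
    using P w_bounds(4) by (simp add: mult_left_mono)
  also have "(\<integral>z. S z \<partial>vol TJ) \<le> (\<integral>z. (1 / wi) * (w z * S z) \<partial>vol TJ)"
  proof (intro integral_mono cint continuous_intros w_cont Sc)
    fix z assume "z \<in> space (vol TJ)"
    then have "wi * S z \<le> w z * S z" using w_bounds(2) S0 by (intro mult_right_mono) (auto simp: space_vol)
    then show "S z \<le> 1 / wi * (w z * S z)" using w_bounds(1) by (simp add: field_simps)
  qed
  also have "(\<integral>z. (1 / wi) * (w z * S z) \<partial>vol TJ) = (1 / wi) * (\<integral>z. S z \<partial>M)"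
    by (simp add: integral_M[OF continuous_measurable_vol[OF TJ(1) Sc]])
  also have "(\<integral>z. S z \<partial>M) = grad_energy (\<lambda>v. ddir v \<phi>)"
    unfolding S_def grad_energy_def
    by (simp add: cM continuous_intros c)
  finally have le: "(\<integral>z. (\<phi> z - m)\<^sup>2 \<partial>M) \<le> ws / wi * C\<^sub>P * grad_energy (\<lambda>v. ddir v \<phi>)"
    using pos w_bounds by (simp add: mult_left_mono less_imp_le)
  define \<mu> where "\<mu> = measure M (space M)"
  have i: "integrable M (\<lambda>z. (\<phi> z)\<^sup>2)" "integrable M \<phi>" by (intro cM continuous_intros c)+
  have "(\<integral>z. (\<phi> z - m)\<^sup>2 \<partial>M) = (\<integral>z. (\<phi> z)\<^sup>2 - 2 * m * \<phi> z + m\<^sup>2 \<partial>M)"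
    by (simp add: power2_eq_square algebra_simps)
  also have "\<dots> = (\<integral>z. (\<phi> z)\<^sup>2 \<partial>M) - 2 * m * (\<integral>z. \<phi> z \<partial>M) + m\<^sup>2 * \<mu>"
    using i by (simp add: \<mu>_def)
  finally have e: "(\<integral>z. (\<phi> z - m)\<^sup>2 \<partial>M) = (\<integral>z. (\<phi> z)\<^sup>2 \<partial>M) - 2 * m * (\<integral>z. \<phi> z \<partial>M) + m\<^sup>2 * \<mu>" .
  \<comment> \<open>The \<open>M\<close>-mean minimises the integral of
    \<open>(\<phi> - m)^2\<close> over constants \<open>m\<close>, so the value at the unweighted
    mean bounds the variance for \<open>M\<close> from above.\<close>
  have "- (\<integral>z. \<phi> z \<partial>M)\<^sup>2 / \<mu> \<le> - 2 * m * (\<integral>z. \<phi> z \<partial>M) + m\<^sup>2 * \<mu>"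
  proof (cases "\<mu> = 0")
    case True
    then have "emeasure M (space M) = 0" by (simp add: \<mu>_def fM.emeasure_eq_measure)
    then have "(\<integral>z. \<phi> z \<partial>M) = 0" by (intro integral_eq_zero_AE AE_I[where N = "space M"]) (auto simp del: sets_M)
    then show ?thesis using True by simp
  next
    case False
    then have "\<mu> > 0" by (simp add: \<mu>_def zero_less_measure_iff)
    have "0 \<le> (m * \<mu> - (\<integral>z. \<phi> z \<partial>M))\<^sup>2 / \<mu>" using \<open>\<mu> > 0\<close> by simp
    also have "\<dots> = m\<^sup>2 * \<mu> - 2 * m * (\<integral>z. \<phi> z \<partial>M) + (\<integral>z. \<phi> z \<partial>M)\<^sup>2 / \<mu>"
      using \<open>\<mu> > 0\<close> by (simp add: power2_eq_square field_simps)
    finally show ?thesis by simp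
  qed
  then show ?thesis using le e by (simp add: \<mu>_def)
qed

text \<open>The difference \<open>u\<close> is not placed in the generator domain. Both weak forms
  are tested with the smooth \<open>\<psi> n = \<phi>1 n - \<phi>2 n\<close>, and the limit yields
  the energy identity \<open>E1\<close> and the Poincare inequality \<open>E2\<close> for
  \<open>u\<close>. The zero mean removes the correction term of
  \<open>weighted_poincare_smooth\<close>.\<close>

lemma generator_dissipative:
  assumes g1: "g1 \<in> generator_dom M TJ" and L1: "L1 \<in> L2 M" "AE z in M. L1 z = generator \<gamma> \<eta> D E TJ g1 z"
    and g2: "g2 \<in> generator_dom M TJ" and L2: "L2' \<in> L2 M" "AE z in M. L2' z = generator \<gamma> \<eta> D E TJ g2 z"
    and mean0: "(\<integral>z. g1 z - g2 z \<partial>M) = 0"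
  shows "(\<integral>z. (g1 z - g2 z) * (L1 z - L2' z) \<partial>M) \<le> - (min (3 * \<gamma>) \<eta> * D / (ws / wi * C\<^sub>P)) * (\<integral>z. (g1 z - g2 z)\<^sup>2 \<partial>M)"
proof -
  have H: "g1 \<in> H2 M TJ" "g2 \<in> H2 M TJ" using g1 g2 by (auto simp: generator_dom_def)
  \<comment> \<open>The sequences of the angular trace condition are taken for their convergence in
    \<open>H2\<close>; both boundary conditions have already entered through
    \<open>generator_weak_form\<close>.\<close>
  obtain \<phi>1 where \<phi>1: "\<And>n. smooth_on UNIV (\<phi>1 n)" "(\<lambda>n. H2norm M TJ (\<lambda>z. \<phi>1 n z - g1 z)) \<longlonglongrightarrow> 0"
    using g1 unfolding generator_dom_def has_normal_trace_th_def by auto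
  obtain \<phi>2 where \<phi>2: "\<And>n. smooth_on UNIV (\<phi>2 n)" "(\<lambda>n. H2norm M TJ (\<lambda>z. \<phi>2 n z - g2 z)) \<longlonglongrightarrow> 0"
    using g2 unfolding generator_dom_def has_normal_trace_th_def by auto
  note a1 = smooth_approximation[OF H(1) \<phi>1] and a2 = smooth_approximation[OF H(2) \<phi>2]
  define \<psi> where "\<psi> n z = \<phi>1 n z - \<phi>2 n z" for n z
  define u where "u z = g1 z - g2 z" for z
  define G where "G v z = weak_deriv TJ v g1 z - weak_deriv TJ v g2 z" for v z
  define L where "L z = L1 z - L2' z" for z
  have \<psi>s: "smooth_on UNIV (\<psi> n)" for n unfolding \<psi>_def by (intro smooth_diff \<phi>1 \<phi>2)
  have d\<psi>: "ddir v (\<psi> n) z = ddir v (\<phi>1 n) z - ddir v (\<phi>2 n) z" for v n z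
    unfolding \<psi>_def by (intro ddir_eq has_derivative_diff smooth_has_derivative \<phi>1 \<phi>2)
  have uL: "u \<in> L2 M" unfolding u_def by (intro L2_diff H2_L2 H)
  have GL: "G v \<in> L2 M" if "v \<in> dirs" for v unfolding G_def by (intro L2_diff H2_L2 H that)
  have LL: "L \<in> L2 M" unfolding L_def by (intro L2_diff L1 L2)
  have lu: "(\<lambda>n. L2norm M (\<lambda>z. \<psi> n z - u z)) \<longlonglongrightarrow> 0"
    unfolding \<psi>_def u_def
    by (intro L2norm_diff_tendsto a1 a2 H2_L2 H always_eventually allI smooth_L2 \<phi>1 \<phi>2)
  have lG: "(\<lambda>n. L2norm M (\<lambda>z. ddir v (\<psi> n) z - G v z)) \<longlonglongrightarrow> 0" if "v \<in> dirs" for v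
    unfolding d\<psi> G_def
    by (intro L2norm_diff_tendsto a1 a2 H2_L2 H always_eventually allI smooth_L2 smooth_ddir \<phi>1 \<phi>2 that)
  have lim_const: "(\<lambda>n::nat. L2norm M (\<lambda>z. f z - f z)) \<longlonglongrightarrow> 0" for f by (simp add: L2norm_def)
  have ev: "\<forall>\<^sub>F n in sequentially. \<psi> n \<in> L2 M" "\<forall>\<^sub>F n in sequentially. ddir v (\<psi> n) \<in> L2 M" for v
    by (intro always_eventually allI smooth_L2 smooth_ddir \<psi>s)+
  have weak: "(\<integral>z. \<psi> n z * L z \<partial>M) =
    - D * (3 * \<gamma> * (\<Sum>k\<in>UNIV. \<integral>z. G (dir_th k) z * ddir (dir_th k) (\<psi> n) z \<partial>M)
         + \<eta> * (\<Sum>i\<in>UNIV. \<integral>z. G (dir_a i) z * ddir (dir_a i) (\<psi> n) z \<partial>M))" for n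
  proof -
    have Lm: "L1 \<in> borel_measurable M" "L2' \<in> borel_measurable M" using L1 L2 by (auto simp: L2_def)
    have eL: "(\<integral>z. \<psi> n z * L z \<partial>M) = (\<integral>z. \<psi> n z * L1 z \<partial>M) - (\<integral>z. \<psi> n z * L2' z \<partial>M)"
      using L2_mult_integrable[OF smooth_L2[OF \<psi>s] L1(1), of n] L2_mult_integrable[OF smooth_L2[OF \<psi>s] L2(1), of n]
      by (simp add: L_def right_diff_distrib)
    have "(\<integral>z. G v z * ddir v (\<psi> n) z \<partial>M) = (\<integral>z. weak_deriv TJ v g1 z * ddir v (\<psi> n) z \<partial>M) - (\<integral>z. weak_deriv TJ v g2 z * ddir v (\<psi> n) z \<partial>M)"
      if "v \<in> dirs" for v
      using L2_mult_integrable[OF H2_L2(2)[OF H(1) that] smooth_L2[OF smooth_ddir[OF \<psi>s]], of n v]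
        L2_mult_integrable[OF H2_L2(2)[OF H(2) that] smooth_L2[OF smooth_ddir[OF \<psi>s]], of n v]
      by (simp add: G_def left_diff_distrib)
    note dG = this
    show ?thesis
      unfolding eL generator_weak_form[OF g1 \<psi>s Lm(1) L1(2)] generator_weak_form[OF g2 \<psi>s Lm(2) L2(2)]
        dG[OF dir_in_dirs(1)] dG[OF dir_in_dirs(2)] sum_subtractf
      by (simp add: algebra_simps)
  qed
  have E1: "(\<integral>z. u z * L z \<partial>M) = - D * (3 * \<gamma> * (\<Sum>k\<in>UNIV. \<integral>z. (G (dir_th k) z)\<^sup>2 \<partial>M) + \<eta> * (\<Sum>i\<in>UNIV. \<integral>z. (G (dir_a i) z)\<^sup>2 \<partial>M))"
  proof (rule LIMSEQ_unique)
    show "(\<lambda>n. \<integral>z. \<psi> n z * L z \<partial>M) \<longlonglongrightarrow> (\<integral>z. u z * L z \<partial>M)"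
      by (rule L2_inner_tendsto[OF ev(1) uL lu _ LL lim_const]) (use LL in simp)
    show "(\<lambda>n. \<integral>z. \<psi> n z * L z \<partial>M) \<longlonglongrightarrow> - D * (3 * \<gamma> * (\<Sum>k\<in>UNIV. \<integral>z. (G (dir_th k) z)\<^sup>2 \<partial>M) + \<eta> * (\<Sum>i\<in>UNIV. \<integral>z. (G (dir_a i) z)\<^sup>2 \<partial>M))"
      unfolding weak power2_eq_square
      by (intro tendsto_intros L2_inner_tendsto[OF _ GL lim_const ev(2) GL lG]) (simp_all add: GL)
  qed
  have E2: "(\<integral>z. (u z)\<^sup>2 \<partial>M) \<le> ws / wi * C\<^sub>P * grad_energy G"
  proof (rule LIMSEQ_le)
    have one: "(\<lambda>_. 1) \<in> L2 M" by (rule smooth_L2[OF smooth_const])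
    have "(\<lambda>n. \<integral>z. \<psi> n z * 1 \<partial>M) \<longlonglongrightarrow> (\<integral>z. u z * 1 \<partial>M)"
      by (rule L2_inner_tendsto[OF ev(1) uL lu _ one lim_const]) (use one in simp)
    then have m: "(\<lambda>n. \<integral>z. \<psi> n z \<partial>M) \<longlonglongrightarrow> 0" using mean0 by (simp add: u_def)
    have "(\<lambda>n. (\<integral>z. \<psi> n z * \<psi> n z \<partial>M) - (\<integral>z. \<psi> n z \<partial>M)\<^sup>2 * (1 / measure M (space M))) \<longlonglongrightarrow> (\<integral>z. u z * u z \<partial>M) - 0\<^sup>2 * (1 / measure M (space M))"
      by (intro tendsto_intros m L2_inner_tendsto[OF ev(1) uL lu ev(1) uL lu])
    then show "(\<lambda>n. (\<integral>z. (\<psi> n z)\<^sup>2 \<partial>M) - (\<integral>z. \<psi> n z \<partial>M)\<^sup>2 / measure M (space M)) \<longlonglongrightarrow> (\<integral>z. (u z)\<^sup>2 \<partial>M)"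
      by (simp add: power2_eq_square)
    show "(\<lambda>n. ws / wi * C\<^sub>P * grad_energy (\<lambda>v. ddir v (\<psi> n))) \<longlonglongrightarrow> ws / wi * C\<^sub>P * grad_energy G"
      unfolding grad_energy_def power2_eq_square
      by (intro tendsto_intros L2_inner_tendsto[OF ev(2) GL lG ev(2) GL lG]) (simp_all add: dir_in_dirs)
    show "\<exists>N. \<forall>n\<ge>N. (\<integral>z. (\<psi> n z)\<^sup>2 \<partial>M) - (\<integral>z. \<psi> n z \<partial>M)\<^sup>2 / measure M (space M) \<le> ws / wi * C\<^sub>P * grad_energy (\<lambda>v. ddir v (\<psi> n))"
      using weighted_poincare_smooth[OF \<psi>s] by blast
  qed
  define CW where "CW = ws / wi * C\<^sub>P"
  have CW: "CW > 0" using w_bounds pos by (simp add: CW_def)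
  define A B where "A = (\<Sum>k\<in>UNIV. \<integral>z. (G (dir_th k) z)\<^sup>2 \<partial>M)" and "B = (\<Sum>i\<in>UNIV. \<integral>z. (G (dir_a i) z)\<^sup>2 \<partial>M)"
  have AB: "A \<ge> 0" "B \<ge> 0" by (auto simp: A_def B_def intro!: sum_nonneg)
  have mn: "min (3 * \<gamma>) \<eta> \<ge> 0" using pos by simp
  \<comment> \<open>Replacing both diffusion coefficients by the smaller one lets the Poincare
    inequality for the full gradient be compared with the anisotropic Dirichlet form.\<close>
  have "min (3 * \<gamma>) \<eta> * D / CW * (\<integral>z. (u z)\<^sup>2 \<partial>M) \<le> min (3 * \<gamma>) \<eta> * D / CW * (CW * (A + B))"
    using E2[folded CW_def] mult_nonneg_nonneg[OF mn, of D] CW pos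
    by (intro mult_left_mono) (auto simp: A_def B_def grad_energy_def intro: divide_nonneg_pos)
  also have "\<dots> = D * (min (3 * \<gamma>) \<eta> * A + min (3 * \<gamma>) \<eta> * B)" using CW by (simp add: field_simps)
  also have "\<dots> \<le> D * (3 * \<gamma> * A + \<eta> * B)"
    using pos AB by (intro mult_left_mono add_mono mult_right_mono) auto
  finally show ?thesis using E1 by (simp add: u_def L_def CW_def A_def B_def)
qed

end

section \<open>Decay of the time derivative of the solution\<close>

theorem theorem3p10:
  fixes \<gamma> \<eta> \<beta>\<^sub>\<theta> \<beta>\<^sub>a D C\<^sub>P C\<^sub>W t\<^sub>0 :: real
    and \<sigma> :: "real \<Rightarrow> real" and x :: "3 \<Rightarrow> real^2" and E :: "state \<Rightarrow> real"
    and \<Omega>\<^sub>T\<^sub>J :: "(real^2) set"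
    and f\<^sub>0 :: "state \<Rightarrow> real" and f :: "real \<Rightarrow> state \<Rightarrow> real"
  assumes "\<gamma> > 0" "\<eta> > 0" "\<beta>\<^sub>\<theta> > 0" "\<beta>\<^sub>a > 0"
    and "6 * \<gamma> / \<beta>\<^sub>\<theta>\<^sup>2 = 2 * \<eta> / \<beta>\<^sub>a\<^sup>2"
    and "D = \<beta>\<^sub>\<theta>\<^sup>2 / (6 * \<gamma>)"
    and "open \<Omega>\<^sub>T\<^sub>J" "connected \<Omega>\<^sub>T\<^sub>J" "bounded \<Omega>\<^sub>T\<^sub>J" "\<Omega>\<^sub>T\<^sub>J \<noteq> {}" "C2_boundary \<Omega>\<^sub>T\<^sub>J"
    and "\<sigma> C1_differentiable_on UNIV"
    and "E = energy \<sigma> x"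
    and "C\<^sub>P > 0" "poincare_wirtinger \<Omega>\<^sub>T\<^sub>J C\<^sub>P"
    and "C\<^sub>W = (SUP z\<in>mis \<times> \<Omega>\<^sub>T\<^sub>J. exp (- E z / D)) / (INF z\<in>mis \<times> \<Omega>\<^sub>T\<^sub>J. exp (- E z / D)) * C\<^sub>P"
    and "f\<^sub>0 \<in> L2 (expvol \<Omega>\<^sub>T\<^sub>J (\<lambda>z. E z / D))"
    and "AE z in vol \<Omega>\<^sub>T\<^sub>J. f\<^sub>0 z > 0" "(\<integral>z. f\<^sub>0 z \<partial>vol \<Omega>\<^sub>T\<^sub>J) = 1"
    and "associated_solution \<gamma> \<eta> D E \<Omega>\<^sub>T\<^sub>J f\<^sub>0 f"
    and "t\<^sub>0 > 0"
  shows "\<exists>C>0. \<forall>t>t\<^sub>0. \<exists>f\<^sub>t. has_L2_deriv (expvol \<Omega>\<^sub>T\<^sub>J (\<lambda>z. E z / D)) f f\<^sub>t t \<and>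
           (\<integral>z. (f\<^sub>t z)\<^sup>2 * exp (E z / D) \<partial>vol \<Omega>\<^sub>T\<^sub>J) \<le> C * exp (- (2 * min (3 * \<gamma>) \<eta> * D / C\<^sub>W) * t)"
proof -
  obtain \<sigma>' where \<sigma>': "\<And>t. (\<sigma> has_real_derivative \<sigma>' t) (at t)" "continuous_on UNIV \<sigma>'"
    using assms(12) unfolding C1_differentiable_on_def has_real_derivative_iff_has_vector_derivative by auto
  have D: "D > 0" using assms(1,3,6) by simp
  interpret F: fokker_planck \<gamma> \<eta> D C\<^sub>P \<sigma> \<sigma>' x \<Omega>\<^sub>T\<^sub>J
    by standard (use assms \<sigma>' D in auto)
  have E: "E = F.E" using assms(13) by (simp add: F.E_def)
  have W: "F.W = (\<lambda>z. - E z / D)" by (simp add: F.W_def E fun_eq_iff)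
  have w: "F.w = (\<lambda>z. exp (- E z / D))" by (simp add: F.w_def W fun_eq_iff)
  have CW: "C\<^sub>W = F.ws / F.wi * C\<^sub>P" using assms(16) by (simp add: F.ws_def F.wi_def w)
  obtain g g' where d: "\<And>t. t > 0 \<Longrightarrow> has_L2_deriv F.M g (g' t) t"
    and dom: "\<And>t. t > 0 \<Longrightarrow> g t \<in> generator_dom F.M \<Omega>\<^sub>T\<^sub>J"
    and gen: "\<And>t. t > 0 \<Longrightarrow> AE z in F.M. g' t z = generator \<gamma> \<eta> D F.E \<Omega>\<^sub>T\<^sub>J (g t) z"
    and f: "\<And>t z. t \<ge> 0 \<Longrightarrow> z \<in> mis \<times> \<Omega>\<^sub>T\<^sub>J \<Longrightarrow> f t z = g t z * F.w z"
    using assms(20) unfolding associated_solution_def Let_def F.M_def W w E by blast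
  have gL: "g t \<in> L2 F.M" "g' t \<in> L2 F.M" if "t > 0" for t
    using d[OF that] by (auto simp: has_L2_deriv_def)
  have g'm: "g' t \<in> borel_measurable F.M" if "t > 0" for t using gL(2)[OF that] by (simp add: L2_def)
  have m0: "(\<integral>z. g' t z \<partial>F.M) = 0" if "t > 0" for t
    by (rule F.generator_mean_zero[OF dom[OF that] g'm[OF that] gen[OF that]])
  have mean: "(\<integral>z. g s z \<partial>F.M) = (\<integral>z. g t z \<partial>F.M)" if "s > 0" "t > 0" for s t
    by (rule L2_mean_constant[OF F.finite_M d m0 that])
  \<comment> \<open>Half the decay exponent: squared norms decay at the rate
    \<open>2 * r\<close>.\<close>
  define r where "r = min (3 * \<gamma>) \<eta> * D / C\<^sub>W"
  have decay: "(\<integral>z. (g' t z)\<^sup>2 \<partial>F.M) * exp (2 * r * t) \<le> (\<integral>z. (g' t\<^sub>0 z)\<^sup>2 \<partial>F.M) * exp (2 * r * t\<^sub>0)" if "t > t\<^sub>0" for t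
  proof (rule L2_decay_of_derivative[OF d])
    fix s t :: real assume st: "s > 0" "t > 0"
    have one: "(\<lambda>_. 1) \<in> L2 F.M" by (rule F.smooth_L2[OF smooth_const])
    have "integrable F.M (g s)" "integrable F.M (g t)"
      using L2_mult_integrable[OF gL(1)[OF st(1)] one] L2_mult_integrable[OF gL(1)[OF st(2)] one] by auto
    then have "(\<integral>z. g s z - g t z \<partial>F.M) = 0" using mean[OF st] by simp
    then show "(\<integral>z. (g s z - g t z) * (g' s z - g' t z) \<partial>F.M) \<le> - r * (\<integral>z. (g s z - g t z)\<^sup>2 \<partial>F.M)"
      unfolding r_def CW
      by (intro F.generator_dissipative dom gL gen st)
  qed (use assms(21) that in auto)
  \<comment> \<open>The summand 1 keeps \<open>C\<close> positive when \<open>g'\<close> vanishes at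
    \<open>t\<^sub>0\<close>.\<close>
  define C where "C = (\<integral>z. (g' t\<^sub>0 z)\<^sup>2 \<partial>F.M) * exp (2 * r * t\<^sub>0) + 1"
  have C: "C > 0" unfolding C_def by (intro add_nonneg_pos mult_nonneg_nonneg) auto
  show ?thesis
  proof (intro exI[of _ C] conjI allI impI C)
    fix t assume t: "t > t\<^sub>0"
    then have t0: "t > 0" using assms(21) by simp
    let ?M' = "expvol \<Omega>\<^sub>T\<^sub>J (\<lambda>z. F.E z / D)"
    \<comment> \<open>Multiplication by \<open>F.w\<close> carries the \<open>L2\<close> derivative
      of \<open>g\<close> to that of \<open>f\<close>, by the isometry \<open>weight_L2\<close>
      applied to difference quotients.\<close>
    have deriv: "has_L2_deriv ?M' f (\<lambda>z. g' t z * F.w z) t"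
      unfolding has_L2_deriv_def
    proof (intro conjI)
      \<comment> \<open>\<open>f\<close> is tied to \<open>g\<close> at nonnegative times only, so
        the quotients are compared close to \<open>t > 0\<close>.\<close>
      have ev: "\<forall>\<^sub>F s in at t. s > 0"
        using t0 eventually_at_in_open'[of "{0<..}" t] by (auto simp: eventually_mono)
      show "(\<lambda>z. g' t z * F.w z) \<in> L2 ?M'" by (rule F.weight_L2(1)[OF gL(2)[OF t0]]) simp
      show "f t \<in> L2 ?M'" by (rule F.weight_L2(1)[OF gL(1)[OF t0]]) (use f t0 in simp)
      show "\<forall>\<^sub>F s in at t. f s \<in> L2 ?M'"
        using ev by eventually_elim (rule F.weight_L2(1)[OF gL(1)], use f in auto)
      have "\<forall>\<^sub>F s in at t. L2norm F.M (\<lambda>z. (g s z - g t z) / (s - t) - g' t z) =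
          L2norm ?M' (\<lambda>z. (f s z - f t z) / (s - t) - g' t z * F.w z)"
        using ev
      proof eventually_elim
        case (elim s)
        have k: "(\<lambda>z. (1 / (s - t)) * (g s z - g t z) - g' t z) \<in> L2 F.M"
          by (intro L2_diff L2_cmult gL elim t0)
        show ?case
          by (rule F.weight_L2(2)[symmetric]) (use k f elim t0 in \<open>auto simp: left_diff_distrib diff_divide_distrib\<close>)
      qed
      then show "((\<lambda>s. L2norm ?M' (\<lambda>z. (f s z - f t z) / (s - t) - g' t z * F.w z)) \<longlongrightarrow> 0) (at t)"
        using d[OF t0] unfolding has_L2_deriv_def by (blast intro: Lim_transform_eventually)
    qed
    have "(\<integral>z. (g' t z * F.w z)\<^sup>2 * exp (F.E z / D) \<partial>vol \<Omega>\<^sub>T\<^sub>J) = (\<integral>z. (g' t z)\<^sup>2 \<partial>F.M)"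
      by (rule F.weight_L2(3)[OF gL(2)[OF t0]]) simp
    also have "\<dots> = (\<integral>z. (g' t z)\<^sup>2 \<partial>F.M) * exp (2 * r * t) * exp (- (2 * r) * t)"
      by (simp add: mult.assoc flip: exp_add)
    also have "\<dots> \<le> C * exp (- (2 * r) * t)"
      using decay[OF t] by (intro mult_right_mono) (auto simp: C_def)
    also have "2 * r = 2 * min (3 * \<gamma>) \<eta> * D / C\<^sub>W" by (simp add: r_def)
    finally show "\<exists>f\<^sub>t. has_L2_deriv (expvol \<Omega>\<^sub>T\<^sub>J (\<lambda>z. E z / D)) f f\<^sub>t t \<and>
           (\<integral>z. (f\<^sub>t z)\<^sup>2 * exp (E z / D) \<partial>vol \<Omega>\<^sub>T\<^sub>J) \<le> C * exp (- (2 * min (3 * \<gamma>) \<eta> * D / C\<^sub>W) * t)"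
      using deriv unfolding E by blast
  qed
qed

end
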